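(* Let $m\ge3$ and suppose that: the regularity condition of order $m$ holds; $q_\lambda+hp_\lambda\ge0$ on $\mathbb R^d$ for all $h\in(0,h_0]$, $\lambda\in\Lambda_1$; $\sum_{\lambda\in\Lambda_1}\lambda q_\lambda=0$ on $\mathbb R^d$; $c\ge c_0$ for a constant $c_0>0$; and the first and the second structural inequalities of order $m$ hold. Let $k\ge0$ and $l\in[0,m]$ be integers, and suppose one of the following conditions is met: (i) $m-l\ge3k+3$; (ii) $m-l\ge2k+3$, $\Lambda_1=-\Lambda_1$ and $q_\lambda=q_{-\lambda}$ for all $\lambda\in\Lambda_1$; (iii) $k$ is odd, $m-l\ge2k+2$, $\Lambda_1=-\Lambda_1$, and $q_\lambda=q_{-\lambda}$, $p_{-\lambda}=-p_\lambda$ for all $\lambda\in\Lambda_1$. Let $v_h$ be the unique bounded solution of $L_hv_h+f=0$ on $\mathbb R^d$ and $v^{(0)}$ the unique $\mathfrak B^m$ solution of $\mathcal Lv+f=0$ on $\mathbb R^d$. Then for every multi-index $\alpha$ with $|\alpha|\le l$ and every $h\in(0,h_0]$, $$\sup_{\mathbb R^d}|D^\alpha\bar v_h-D^\alpha v^{(0)}|\le N\|f\|_mh^{k+1},$$ and if condition (iii) is met then $$\sup_{\mathbb R^d}|D^\alpha\tilde v_h-D^\alpha v^{(0)}|\le N\|f\|_mh^{k+1},$$ where $N$ depends only on $d$, $m$, $\delta$, $K$, $\tau_0$, $c_0$, $|\Lambda_1|$, $\|\Lambda_1\|$, $M_0,\dots,M_m$. Here $\bar v_h=\sum_{j=0}^kb_jv_{2^{-j}h}$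 with $(b_0,\dots,b_k)=(1,0,\dots,0)V^{-1}$, $V^{ij}=2^{-(i-1)(j-1)}$, $i,j=1,\dots,k+1$; and, for odd $k$, $\tilde v_h=\sum_{j=0}^{\tilde k}\tilde b_jv_{2^{-j}h}$ with $\tilde k=\frac{k-1}2$, $(\tilde b_0,\dots,\tilde b_{\tilde k})=(1,0,\dots,0)\tilde V^{-1}$, $\tilde V^{ij}=4^{-(i-1)(j-1)}$, $i,j=1,\dots,\tilde k+1$.
   Context: Setting. Fix $d\ge1$, $h_0\in(0,\infty)$. $\Lambda_1\subset\mathbb R^d$ is a finite set with $0\notin\Lambda_1$, and $|\Lambda_1|^2:=\sum_{\lambda\in\Lambda_1}|\lambda|^2$. For $\lambda\in\Lambda_1$, $q_\lambda\ge0$, $p_\lambda$, and also $c$, $f$, are real Borel functions on $\mathbb R^d$ (no time dependence). Spaces. $D^k\varphi$ is the collection of all $x$-partial derivatives of order $k$, $|D^k\varphi|^2=\sum_{|\alpha|=k}|D^\alpha\varphi|^2$. A bounded function $\psi$ on $\mathbb R^d$ belongs to $\mathfrak B^m$ if it is continuous and for all $|\alpha|\le m$ the generalized derivatives $D^\alpha\psi$ are bounded; $\|\psi\|_m^2:=\sup_{\mathbb R^d}\sum_{|\alpha|\le m}|D^\alpha\psi|^2$. Regularity condition of order $m$ (with constants $M_0,\dots,M_m$): $p_\lambda,q_\lambda,c,f\in\mathfrak B^m$ for all $\lambda\in\Lambda_1$ and, for $k=0,\dots,m$, $\sup_{\mathbb R^d}\big(\sum_{\lambda\in\Lambda_1}(|D^kq_\lambda|^2+|D^kp_\lambda|^2)+|D^kc|^2\big)\le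 M_k^2$. Operators. $\delta_{h,\lambda}\varphi(x)=h^{-1}(\varphi(x+h\lambda)-\varphi(x))$, $L_h\varphi=\frac1h\sum_{\lambda\in\Lambda_1}q_\lambda\delta_{h,\lambda}\varphi+\sum_{\lambda\in\Lambda_1}p_\lambda\delta_{h,\lambda}\varphi-c\varphi$; $\mathcal L=\tfrac12\sum_{\lambda\in\Lambda_1}\sum_{i,j}q_\lambda\lambda_i\lambda_jD_iD_j+\sum_{\lambda\in\Lambda_1}\sum_ip_\lambda\lambda_iD_i-c$. Under the hypotheses both equations are uniquely solvable as stated. A solution of $\mathcal Lv+f=0$ is a function $v\in\mathfrak B^2$ satisfying the equation almost everywhere. Structural notation. Fix $\tau_0>0$, numbers $\tau_\lambda\in[0,\infty)$ ($\lambda\in\Lambda_1$), $\delta\in(0,1]$, $K\in[1,\infty)$; $\|\Lambda_1\|^2:=\sum_{\lambda\in\Lambda_1}|\tau_\lambda\lambda|^2$. Let $\Lambda_2=\{\ell^1,\dots,\ell^d\}$ consist of distinct vectors not in $\Lambda_1$ and $\Lambda=\Lambda_1\cup\Lambda_2$. For $\lambda\in\Lambda_1$: $T_{h,\lambda}\varphi(x)=\varphi(x+h\lambda)$, $\bar\delta_{h,\lambda}=\tau_\lambda h^{-1}(T_{h,\lambda}-1)$; for $\ell^i\in\Lambda_2$: $T_{h,\ell^i}=1$ (identity), $\bar\delta_{h,\ell^i}=\tau_0D_i$. For $\lambda=(\lambda^1,\lambda^2)\in\Lambda^2$: $T_{h,\lambda}=T_{h,\lambda^1}T_{h,\lambda^2}$,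 $\bar\delta_{h,\lambda}=\bar\delta_{h,\lambda^1}\bar\delta_{h,\lambda^2}$. For $\mu\in\Lambda^k$, $k=1,2$: $Q_{h,\mu}\varphi=h^{-1}\sum_{\lambda\in\Lambda_1}(\bar\delta_{h,\mu}q_\lambda)\delta_{h,\lambda}\varphi$, $L^0_{h,\mu}\varphi=Q_{h,\mu}\varphi+\sum_{\lambda\in\Lambda_1}(\bar\delta_{h,\mu}p_\lambda)\delta_{h,\lambda}\varphi$. Further $A_h(\varphi)=2\sum_{\lambda\in\Lambda}(\bar\delta_{h,\lambda}\varphi)L^0_{h,\lambda}T_{h,\lambda}\varphi$, $\mathcal Q_h(\varphi)=\sum_{\lambda\in\Lambda_1}(q_\lambda+hp_\lambda)(\delta_{h,\lambda}\varphi)^2$. $\mathfrak K$ is the set of bounded operators $\mathcal K_h$ mapping the space of bounded Borel functions on $\mathbb R^d$ into itself, preserving nonnegativity, with $\mathcal K_h1\le1$. First structural inequality of order $m$ ($m\ge1$): for any $h\in(0,h_0]$ there is $\mathcal K_h=\mathcal K_{h,m}\in\mathfrak K$ such that on $\mathbb R^d$, for all smooth $\varphi$, $$mA_h(\varphi)\le(1-\delta)\sum_{\lambda\in\Lambda}\mathcal Q_h(\bar\delta_{h,\lambda}\varphi)+K\mathcal Q_h(\varphi)+2(1-\delta)c\,\mathcal K_h\Big(\sum_{\lambda\in\Lambda}|\bar\delta_{h,\lambda}\varphi|^2\Big).$$ Second structural inequality of order $m$ ($m\ge2$): for any $h\in(0,h_0]$ and $n=1,\dots,m$ there is $\mathcal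 K_h=\mathcal K_{h,n}\in\mathfrak K$ such that on $\mathbb R^d$, for all smooth $\varphi$, $$n\sum_{\nu\in\Lambda}A_h(\bar\delta_{h,\nu}\varphi)+n(n-1)\sum_{\lambda\in\Lambda^2}(\bar\delta_{h,\lambda}\varphi)Q_{h,\lambda}T_{h,\lambda}\varphi\le(1-\delta)\sum_{\lambda\in\Lambda^2}\mathcal Q_h(\bar\delta_{h,\lambda}\varphi)+K\sum_{\lambda\in\Lambda}\mathcal Q_h(\bar\delta_{h,\lambda}\varphi)$$ $$+2(1-\delta)c\,\mathcal K_h\Big(\sum_{\lambda\in\Lambda^2}|\bar\delta_{h,\lambda}\varphi|^2\Big)+K\mathcal K_h\Big(\sum_{\lambda\in\Lambda}|\bar\delta_{h,\lambda}\varphi|^2\Big).$$ *)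

theory Defs
  imports "HOL-Analysis.Analysis" "HOL-Probability.Essential_Supremum"
begin

section \<open>Partial and generalized derivatives\<close>

definition partial :: "'d::finite \<Rightarrow> (real^'d \<Rightarrow> real) \<Rightarrow> real^'d \<Rightarrow> real" where
  "partial i \<phi> x = deriv (\<lambda>t. \<phi> (x + t *\<^sub>R axis i 1)) 0"

definition smooth :: "(real^'d::finite \<Rightarrow> real) \<Rightarrow> bool" where
  "smooth \<phi> \<longleftrightarrow> (\<forall>is. foldr partial is \<phi> differentiable_on UNIV)"

text \<open>A multi-index is a function from coordinates to exponents.\<close>

definition mi_order :: "('d::finite \<Rightarrow> nat) \<Rightarrow> nat" where
  "mi_order \<alpha> = (\<Sum>i\<in>UNIV. \<alpha> i)"

definition mi_unit :: "'d \<Rightarrow> 'd \<Rightarrow> nat" where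
  "mi_unit i = (\<lambda>j. if j = i then 1 else 0)"

text \<open>Only applied to smooth functions, for which the order of differentiation, left open by
  the choice of the list, is immaterial.\<close>

definition classical_deriv ::
    "('d::finite \<Rightarrow> nat) \<Rightarrow> (real^'d \<Rightarrow> real) \<Rightarrow> real^'d \<Rightarrow> real" where
  "classical_deriv \<alpha> \<phi> = foldr partial (SOME is. \<forall>i. count_list is i = \<alpha> i) \<phi>"

definition test_function :: "(real^'d::finite \<Rightarrow> real) \<Rightarrow> bool" where
  "test_function \<phi> \<longleftrightarrow> smooth \<phi> \<and> compact (closure {x. \<phi> x \<noteq> 0})"

definition locally_integrable :: "(real^'d::finite \<Rightarrow> real) \<Rightarrow> bool" where
  "locally_integrable g \<longleftrightarrow> (\<forall>S. compact S \<longrightarrow> set_integrable lborel S g)"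

definition has_gen_deriv ::
    "('d::finite \<Rightarrow> nat) \<Rightarrow> (real^'d \<Rightarrow> real) \<Rightarrow> (real^'d \<Rightarrow> real) \<Rightarrow> bool" where
  "has_gen_deriv \<alpha> \<psi> g \<longleftrightarrow> locally_integrable \<psi> \<and> locally_integrable g \<and>
     (\<forall>\<phi>. test_function \<phi> \<longrightarrow>
        (LINT x|lborel. g x * \<phi> x)
          = (- 1) ^ mi_order \<alpha> * (LINT x|lborel. \<psi> x * classical_deriv \<alpha> \<phi> x))"

text \<open>Generalized derivatives are determined up to null sets. The continuous representative
  (which is unique) is taken whenever there is one, so that in this case \<open>gen_deriv\<close> is
  meaningful at every point; otherwise it is used only up to null sets.\<close>

definition gen_deriv ::
    "('d::finite \<Rightarrow> nat) \<Rightarrow> (real^'d \<Rightarrow> real) \<Rightarrow> real^'d \<Rightarrow> real" where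
  "gen_deriv \<alpha> \<psi> = (SOME g. has_gen_deriv \<alpha> \<psi> g \<and>
     ((\<exists>g'. has_gen_deriv \<alpha> \<psi> g' \<and> continuous_on UNIV g') \<longrightarrow> continuous_on UNIV g))"

definition deriv_sq :: "nat \<Rightarrow> (real^'d::finite \<Rightarrow> real) \<Rightarrow> real^'d \<Rightarrow> real" where
  "deriv_sq k \<psi> x = (\<Sum>\<alpha> | mi_order \<alpha> = k. (gen_deriv \<alpha> \<psi> x)\<^sup>2)"

definition Bspace :: "nat \<Rightarrow> (real^'d::finite \<Rightarrow> real) set" where
  "Bspace m = {\<psi>. bounded (range \<psi>) \<and> continuous_on UNIV \<psi> \<and>
     (\<forall>\<alpha>. mi_order \<alpha> \<le> m \<longrightarrow> (\<exists>g. has_gen_deriv \<alpha> \<psi> g \<and> bounded (range g)))}"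

text \<open>Suprema involving generalized derivatives of top order are essential suprema.\<close>

definition Bnorm :: "nat \<Rightarrow> (real^'d::finite \<Rightarrow> real) \<Rightarrow> real" where
  "Bnorm m \<psi> = sqrt (real_of_ereal (esssup lborel
     (\<lambda>x. ereal (\<Sum>\<alpha> | mi_order \<alpha> \<le> m. (gen_deriv \<alpha> \<psi> x)\<^sup>2))))"


section \<open>The equations\<close>

definition regularity_condition ::
    "(real^'d::finite) set \<Rightarrow> (real^'d \<Rightarrow> real^'d \<Rightarrow> real) \<Rightarrow> (real^'d \<Rightarrow> real^'d \<Rightarrow> real) \<Rightarrow>
     (real^'d \<Rightarrow> real) \<Rightarrow> (real^'d \<Rightarrow> real) \<Rightarrow> nat \<Rightarrow> (nat \<Rightarrow> real) \<Rightarrow> bool" where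
  "regularity_condition \<Lambda>\<^sub>1 q p c f m M \<longleftrightarrow>
     (\<forall>\<xi>\<in>\<Lambda>\<^sub>1. p \<xi> \<in> Bspace m \<and> q \<xi> \<in> Bspace m) \<and> c \<in> Bspace m \<and> f \<in> Bspace m \<and>
     (\<forall>k\<le>m. AE x in lborel.
        (\<Sum>\<xi>\<in>\<Lambda>\<^sub>1. deriv_sq k (q \<xi>) x + deriv_sq k (p \<xi>) x) + deriv_sq k c x \<le> (M k)\<^sup>2)"

definition fdiff :: "real \<Rightarrow> real^'d::finite \<Rightarrow> (real^'d \<Rightarrow> real) \<Rightarrow> real^'d \<Rightarrow> real" where
  "fdiff h \<xi> \<phi> x = (\<phi> (x + h *\<^sub>R \<xi>) - \<phi> x) / h"

definition Lh ::
    "(real^'d::finite) set \<Rightarrow> (real^'d \<Rightarrow> real^'d \<Rightarrow> real) \<Rightarrow> (real^'d \<Rightarrow> real^'d \<Rightarrow> real) \<Rightarrow>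
     (real^'d \<Rightarrow> real) \<Rightarrow> real \<Rightarrow> (real^'d \<Rightarrow> real) \<Rightarrow> real^'d \<Rightarrow> real" where
  "Lh \<Lambda>\<^sub>1 q p c h \<phi> x =
     (1 / h) * (\<Sum>\<xi>\<in>\<Lambda>\<^sub>1. q \<xi> x * fdiff h \<xi> \<phi> x) + (\<Sum>\<xi>\<in>\<Lambda>\<^sub>1. p \<xi> x * fdiff h \<xi> \<phi> x) - c x * \<phi> x"

definition Lcal ::
    "(real^'d::finite) set \<Rightarrow> (real^'d \<Rightarrow> real^'d \<Rightarrow> real) \<Rightarrow> (real^'d \<Rightarrow> real^'d \<Rightarrow> real) \<Rightarrow>
     (real^'d \<Rightarrow> real) \<Rightarrow> (real^'d \<Rightarrow> real) \<Rightarrow> real^'d \<Rightarrow> real" where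
  "Lcal \<Lambda>\<^sub>1 q p c \<phi> x =
     (1 / 2) * (\<Sum>\<xi>\<in>\<Lambda>\<^sub>1. \<Sum>i\<in>UNIV. \<Sum>j\<in>UNIV.
        q \<xi> x * \<xi> $ i * \<xi> $ j * gen_deriv (\<lambda>r. mi_unit i r + mi_unit j r) \<phi> x)
     + (\<Sum>\<xi>\<in>\<Lambda>\<^sub>1. \<Sum>i\<in>UNIV. p \<xi> x * \<xi> $ i * gen_deriv (mi_unit i) \<phi> x) - c x * \<phi> x"

definition bounded_solution_h ::
    "(real^'d::finite) set \<Rightarrow> (real^'d \<Rightarrow> real^'d \<Rightarrow> real) \<Rightarrow> (real^'d \<Rightarrow> real^'d \<Rightarrow> real) \<Rightarrow>
     (real^'d \<Rightarrow> real) \<Rightarrow> (real^'d \<Rightarrow> real) \<Rightarrow> real \<Rightarrow> (real^'d \<Rightarrow> real) \<Rightarrow> bool" where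
  "bounded_solution_h \<Lambda>\<^sub>1 q p c f h w \<longleftrightarrow>
     bounded (range w) \<and> (\<forall>x. Lh \<Lambda>\<^sub>1 q p c h w x + f x = 0)"

definition solution_Lcal ::
    "(real^'d::finite) set \<Rightarrow> (real^'d \<Rightarrow> real^'d \<Rightarrow> real) \<Rightarrow> (real^'d \<Rightarrow> real^'d \<Rightarrow> real) \<Rightarrow>
     (real^'d \<Rightarrow> real) \<Rightarrow> (real^'d \<Rightarrow> real) \<Rightarrow> (real^'d \<Rightarrow> real) \<Rightarrow> bool" where
  "solution_Lcal \<Lambda>\<^sub>1 q p c f w \<longleftrightarrow>
     w \<in> Bspace 2 \<and> (AE x in lborel. Lcal \<Lambda>\<^sub>1 q p c w x + f x = 0)"


section \<open>The structural inequalities\<close>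

definition bounded_borel :: "(real^'d::finite \<Rightarrow> real) set" where
  "bounded_borel = {g. g \<in> borel_measurable borel \<and> bounded (range g)}"

text \<open>Operators are represented by total maps on functions; only their restriction to
  \<open>bounded_borel\<close> matters.\<close>

definition Kops :: "((real^'d::finite \<Rightarrow> real) \<Rightarrow> real^'d \<Rightarrow> real) set" where
  "Kops = {\<K>.
     (\<forall>g\<in>bounded_borel. \<K> g \<in> bounded_borel) \<and>
     (\<forall>g\<in>bounded_borel. \<forall>g'\<in>bounded_borel. \<forall>a b.
        \<K> (\<lambda>x. a * g x + b * g' x) = (\<lambda>x. a * \<K> g x + b * \<K> g' x)) \<and>
     (\<exists>C. \<forall>g\<in>bounded_borel. \<forall>B. (\<forall>x. \<bar>g x\<bar> \<le> B) \<longrightarrow> (\<forall>x. \<bar>\<K> g x\<bar> \<le> C * B)) \<and>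
     (\<forall>g\<in>bounded_borel. (\<forall>x. 0 \<le> g x) \<longrightarrow> (\<forall>x. 0 \<le> \<K> g x)) \<and>
     (\<forall>x. \<K> (\<lambda>_. 1) x \<le> 1)}"

context
  fixes \<Lambda>\<^sub>1 :: "(real^'d::finite) set"
    and \<l> :: "'d \<Rightarrow> real^'d" \<comment> \<open>the labels of the coordinate directions\<close>
    and \<tau>\<^sub>0 :: real
    and \<tau> :: "real^'d \<Rightarrow> real"
begin

definition Lam :: "(real^'d) set" where
  "Lam = \<Lambda>\<^sub>1 \<union> range \<l>"

definition shift :: "real \<Rightarrow> real^'d \<Rightarrow> (real^'d \<Rightarrow> real) \<Rightarrow> real^'d \<Rightarrow> real" where
  "shift h \<xi> \<phi> = (if \<xi> \<in> \<Lambda>\<^sub>1 then (\<lambda>x. \<phi> (x + h *\<^sub>R \<xi>)) else \<phi>)"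

text \<open>Classical derivatives suffice here: \<open>bdiff\<close> is applied, at most twice, to smooth functions
  and to coefficients in \<open>Bspace m\<close> with \<open>m \<ge> 3\<close>, which are twice continuously differentiable.\<close>

definition bdiff :: "real \<Rightarrow> real^'d \<Rightarrow> (real^'d \<Rightarrow> real) \<Rightarrow> real^'d \<Rightarrow> real" where
  "bdiff h \<xi> \<phi> = (if \<xi> \<in> \<Lambda>\<^sub>1 then (\<lambda>x. \<tau> \<xi> * (\<phi> (x + h *\<^sub>R \<xi>) - \<phi> x) / h)
     else (\<lambda>x. \<tau>\<^sub>0 * partial (the_inv \<l> \<xi>) \<phi> x))"

text \<open>Elements of the \<open>k\<close>-th power of \<open>Lam\<close> are lists of length \<open>k\<close>.\<close>

definition Lam_pow :: "nat \<Rightarrow> (real^'d) list set" where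
  "Lam_pow k = {\<mu>. set \<mu> \<subseteq> Lam \<and> length \<mu> = k}"

definition shifts :: "real \<Rightarrow> (real^'d) list \<Rightarrow> (real^'d \<Rightarrow> real) \<Rightarrow> real^'d \<Rightarrow> real" where
  "shifts h \<mu> \<phi> = foldr (shift h) \<mu> \<phi>"

definition bdiffs :: "real \<Rightarrow> (real^'d) list \<Rightarrow> (real^'d \<Rightarrow> real) \<Rightarrow> real^'d \<Rightarrow> real" where
  "bdiffs h \<mu> \<phi> = foldr (bdiff h) \<mu> \<phi>"

text \<open>The sum of the squares of all \<open>k\<close>-fold differences.\<close>

definition bdiff_sq :: "nat \<Rightarrow> real \<Rightarrow> (real^'d \<Rightarrow> real) \<Rightarrow> real^'d \<Rightarrow> real" where
  "bdiff_sq k h \<phi> x = (\<Sum>\<mu>\<in>Lam_pow k. \<bar>bdiffs h \<mu> \<phi> x\<bar>\<^sup>2)"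

definition Qop :: "(real^'d \<Rightarrow> real^'d \<Rightarrow> real) \<Rightarrow> real \<Rightarrow> (real^'d) list \<Rightarrow>
    (real^'d \<Rightarrow> real) \<Rightarrow> real^'d \<Rightarrow> real" where
  "Qop q h \<mu> \<phi> x = (1 / h) * (\<Sum>\<xi>\<in>\<Lambda>\<^sub>1. bdiffs h \<mu> (q \<xi>) x * fdiff h \<xi> \<phi> x)"

definition L0op :: "(real^'d \<Rightarrow> real^'d \<Rightarrow> real) \<Rightarrow> (real^'d \<Rightarrow> real^'d \<Rightarrow> real) \<Rightarrow> real \<Rightarrow>
    (real^'d) list \<Rightarrow> (real^'d \<Rightarrow> real) \<Rightarrow> real^'d \<Rightarrow> real" where
  "L0op q p h \<mu> \<phi> x = Qop q h \<mu> \<phi> x + (\<Sum>\<xi>\<in>\<Lambda>\<^sub>1. bdiffs h \<mu> (p \<xi>) x * fdiff h \<xi> \<phi> x)"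

definition Aform :: "(real^'d \<Rightarrow> real^'d \<Rightarrow> real) \<Rightarrow> (real^'d \<Rightarrow> real^'d \<Rightarrow> real) \<Rightarrow> real \<Rightarrow>
    (real^'d \<Rightarrow> real) \<Rightarrow> real^'d \<Rightarrow> real" where
  "Aform q p h \<phi> x = 2 * (\<Sum>\<xi>\<in>Lam. bdiff h \<xi> \<phi> x * L0op q p h [\<xi>] (shift h \<xi> \<phi>) x)"

definition Qform :: "(real^'d \<Rightarrow> real^'d \<Rightarrow> real) \<Rightarrow> (real^'d \<Rightarrow> real^'d \<Rightarrow> real) \<Rightarrow> real \<Rightarrow>
    (real^'d \<Rightarrow> real) \<Rightarrow> real^'d \<Rightarrow> real" where
  "Qform q p h \<phi> x = (\<Sum>\<xi>\<in>\<Lambda>\<^sub>1. (q \<xi> x + h * p \<xi> x) * (fdiff h \<xi> \<phi> x)\<^sup>2)"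

text \<open>The inequalities are required for those smooth functions for which the arguments of the
  operators in \<open>Kops\<close> are bounded, i.e. for which both sides are defined.\<close>

definition first_structural :: "(real^'d \<Rightarrow> real^'d \<Rightarrow> real) \<Rightarrow> (real^'d \<Rightarrow> real^'d \<Rightarrow> real) \<Rightarrow>
    (real^'d \<Rightarrow> real) \<Rightarrow> real \<Rightarrow> real \<Rightarrow> real \<Rightarrow> nat \<Rightarrow> bool" where
  "first_structural q p c h0 \<delta> K m \<longleftrightarrow> (\<forall>h. 0 < h \<and> h \<le> h0 \<longrightarrow> (\<exists>\<K>\<in>Kops.
     \<forall>\<phi>. smooth \<phi> \<and> bounded (range (bdiff_sq 1 h \<phi>)) \<longrightarrow> (\<forall>x.
       real m * Aform q p h \<phi> x
       \<le> (1 - \<delta>) * (\<Sum>\<xi>\<in>Lam. Qform q p h (bdiff h \<xi> \<phi>) x) + K * Qform q p h \<phi> x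
          + 2 * (1 - \<delta>) * c x * \<K> (bdiff_sq 1 h \<phi>) x)))"

definition second_structural :: "(real^'d \<Rightarrow> real^'d \<Rightarrow> real) \<Rightarrow> (real^'d \<Rightarrow> real^'d \<Rightarrow> real) \<Rightarrow>
    (real^'d \<Rightarrow> real) \<Rightarrow> real \<Rightarrow> real \<Rightarrow> real \<Rightarrow> nat \<Rightarrow> bool" where
  "second_structural q p c h0 \<delta> K m \<longleftrightarrow> (\<forall>h n. 0 < h \<and> h \<le> h0 \<and> n \<in> {1..m} \<longrightarrow> (\<exists>\<K>\<in>Kops.
     \<forall>\<phi>. smooth \<phi> \<and> bounded (range (bdiff_sq 1 h \<phi>)) \<and> bounded (range (bdiff_sq 2 h \<phi>)) \<longrightarrow> (\<forall>x.
       real n * (\<Sum>\<nu>\<in>Lam. Aform q p h (bdiff h \<nu> \<phi>) x)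
         + real n * (real n - 1) * (\<Sum>\<mu>\<in>Lam_pow 2. bdiffs h \<mu> \<phi> x * Qop q h \<mu> (shifts h \<mu> \<phi>) x)
       \<le> (1 - \<delta>) * (\<Sum>\<mu>\<in>Lam_pow 2. Qform q p h (bdiffs h \<mu> \<phi>) x)
          + K * (\<Sum>\<xi>\<in>Lam. Qform q p h (bdiff h \<xi> \<phi>) x)
          + 2 * (1 - \<delta>) * c x * \<K> (bdiff_sq 2 h \<phi>) x + K * \<K> (bdiff_sq 1 h \<phi>) x)))"

end


section \<open>Extrapolation\<close>

text \<open>Square matrices of size \<open>n\<close> are functions of two indices below \<open>n\<close>; indices start at \<open>0\<close>.
  The inverse is unique on this index range.\<close>

definition mat_inverse :: "nat \<Rightarrow> (nat \<Rightarrow> nat \<Rightarrow> real) \<Rightarrow> nat \<Rightarrow> nat \<Rightarrow> real" where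
  "mat_inverse n V = (SOME W. \<forall>i<n. \<forall>j<n.
     (\<Sum>r<n. V i r * W r j) = (if i = j then 1 else 0) \<and>
     (\<Sum>r<n. W i r * V r j) = (if i = j then 1 else 0))"

definition first_row_inverse :: "nat \<Rightarrow> (nat \<Rightarrow> nat \<Rightarrow> real) \<Rightarrow> nat \<Rightarrow> real" where
  "first_row_inverse n V j = (\<Sum>i<n. (if i = 0 then 1 else 0) * mat_inverse n V i j)"

definition vbar :: "nat \<Rightarrow> (real \<Rightarrow> real^'d::finite \<Rightarrow> real) \<Rightarrow> real \<Rightarrow> real^'d \<Rightarrow> real" where
  "vbar k v h x = (\<Sum>j\<le>k. first_row_inverse (k + 1) (\<lambda>i j. (1 / 2) ^ (i * j)) j * v ((1 / 2) ^ j * h) x)"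

definition vtilde :: "nat \<Rightarrow> (real \<Rightarrow> real^'d::finite \<Rightarrow> real) \<Rightarrow> real \<Rightarrow> real^'d \<Rightarrow> real" where
  "vtilde k v h x = (\<Sum>j\<le>(k - 1) div 2.
     first_row_inverse ((k - 1) div 2 + 1) (\<lambda>i j. (1 / 4) ^ (i * j)) j * v ((1 / 2) ^ j * h) x)"

definition condition_i :: "nat \<Rightarrow> nat \<Rightarrow> nat \<Rightarrow> bool" where
  "condition_i m k l \<longleftrightarrow> m - l \<ge> 3 * k + 3"

definition condition_ii ::
    "(real^'d::finite) set \<Rightarrow> (real^'d \<Rightarrow> real^'d \<Rightarrow> real) \<Rightarrow> nat \<Rightarrow> nat \<Rightarrow> nat \<Rightarrow> bool" where
  "condition_ii \<Lambda>\<^sub>1 q m k l \<longleftrightarrow>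
     m - l \<ge> 2 * k + 3 \<and> \<Lambda>\<^sub>1 = uminus ` \<Lambda>\<^sub>1 \<and> (\<forall>\<xi>\<in>\<Lambda>\<^sub>1. \<forall>x. q \<xi> x = q (- \<xi>) x)"

definition condition_iii ::
    "(real^'d::finite) set \<Rightarrow> (real^'d \<Rightarrow> real^'d \<Rightarrow> real) \<Rightarrow> (real^'d \<Rightarrow> real^'d \<Rightarrow> real) \<Rightarrow>
     nat \<Rightarrow> nat \<Rightarrow> nat \<Rightarrow> bool" where
  "condition_iii \<Lambda>\<^sub>1 q p m k l \<longleftrightarrow>
     odd k \<and> m - l \<ge> 2 * k + 2 \<and> \<Lambda>\<^sub>1 = uminus ` \<Lambda>\<^sub>1 \<and>
     (\<forall>\<xi>\<in>\<Lambda>\<^sub>1. \<forall>x. q \<xi> x = q (- \<xi>) x \<and> p (- \<xi>) x = - p \<xi> x)"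

text \<open>\<open>w\<close> has generalized derivatives up to order \<open>l\<close>, and these differ from those of \<open>u\<close>
  by at most \<open>B\<close> everywhere.\<close>

definition derivs_within :: "nat \<Rightarrow> (real^'d::finite \<Rightarrow> real) \<Rightarrow> (real^'d \<Rightarrow> real) \<Rightarrow> real \<Rightarrow> bool" where
  "derivs_within l w u B \<longleftrightarrow> w \<in> Bspace l \<and>
     (\<forall>\<alpha>. mi_order \<alpha> \<le> l \<longrightarrow> (\<forall>x. \<bar>gen_deriv \<alpha> w x - gen_deriv \<alpha> u x\<bar> \<le> B))"

end

theory Submission
  imports Defs "HOL-Computational_Algebra.Polynomial"
begin

text \<open>For smooth coefficients, the maximum principle applied to combinations of the sums of squares
  of all mixed differences of order at most \<open>n\<close> turns the structural inequalities into a bound of the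
  derivatives of order \<open>n \<le> m\<close> of \<open>v\<^sub>h\<close> by those of \<open>f\<close>, uniformly in \<open>h\<close>. By Taylor's formula \<open>v\<^sub>h\<close> then
  has an expansion in powers of \<open>h\<close> with remainder of order \<open>h ^ (k + 1)\<close>; instead of solving the limiting
  differential equations, its coefficients are taken to solve difference equations with a much smaller
  step \<open>\<eta>\<close>, at the price of an error of order \<open>\<eta>\<close>. The extrapolation weights cancel the powers
  \<open>h, \<dots>, h ^ k\<close>, the odd ones being absent under the symmetry of condition (iii).

  For general coefficients, the structural inequalities are linear in the coefficients and invariant
  under translations of \<open>\<phi>\<close>, so they survive mollification with the same constants. Mollification and
  \<open>\<eta>\<close> are sent to zero together; consistency and the maximum principle identify the limit with \<open>v\<^sup>(\<^sup>0\<^sup>)\<close>.\<close>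

text \<open>When the equation is differenced n + 1 times, the terms with one or two differences on
  \<open>q\<close> or one on \<open>p\<close> cost n + 1 or more derivatives of the solution, and
  only the structural inequalities control them. The centering of \<open>q\<close> makes the
  diffusion part act like a second derivative uniformly in \<open>h\<close>, so that all further
  Leibniz terms cost at most n derivatives. Two obstacles shape the induction. The inequalities
  leave behind \<open>K\<close> times sums of \<open>Qform\<close> one order lower, which contain n
  + 1 differences and are not controlled by the bounds already obtained; each order therefore also
  hands on a bounded function whose image under L_h dominates these sums. And \<K> is nonlocal, so
  it enters only through the supremum of its argument; the factor 1 - \<delta> leaves room to absorb
  that supremum. The limiting equation may be degenerate, which is why difference equations take its
  place. The derivative counts stem from the i-th Taylor coefficient of L_h: it costs i + 2
  derivatives, hence at most 3 i, and at most 2 i when symmetry removes the diffusion part for odd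
  i; a Taylor remainder costs 3 more.\<close>

lemma norm_eq_abs_sum_le:
  fixes y :: "real^'d::finite"
  assumes "\<And>i. \<bar>g i\<bar> \<le> B"
  shows "\<bar>\<Sum>i\<in>UNIV. y $ i * g i\<bar> \<le> real CARD('d) * norm y * B"
proof -
  have B: "0 \<le> B" using assms[of undefined] by linarith
  have "\<bar>\<Sum>i\<in>UNIV. y $ i * g i\<bar> \<le> (\<Sum>i\<in>UNIV. \<bar>y $ i * g i\<bar>)" by (rule sum_abs)
  also have "\<dots> \<le> (\<Sum>i\<in>(UNIV::'d set). norm y * B)"
    by (rule sum_mono) (auto simp: abs_mult B intro!: mult_mono assms component_le_norm_cart)
  finally have "\<bar>\<Sum>i\<in>UNIV. y $ i * g i\<bar> \<le> (\<Sum>i\<in>(UNIV::'d set). norm y * B)" .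
  then show ?thesis by simp
qed

subsection \<open>Partial derivatives\<close>

lemma has_derivative_partial_eq:
  assumes "(\<phi> has_derivative f') (at x)"
  shows "partial i \<phi> x = f' (axis i 1)"
proof -
  have l: "linear f'" using assms has_derivative_linear by blast
  have "((\<lambda>t. x + t *\<^sub>R axis i 1) has_derivative (\<lambda>t. t *\<^sub>R axis i (1::real))) (at 0)"
    by (auto intro!: derivative_eq_intros)
  moreover have "(\<phi> has_derivative f') (at (x + 0 *\<^sub>R axis i 1))" using assms by simp
  ultimately have "((\<lambda>t. \<phi> (x + t *\<^sub>R axis i 1)) has_derivative (\<lambda>t. f' (t *\<^sub>R axis i 1))) (at 0)"
    by (rule has_derivative_compose)
  then have "((\<lambda>t. \<phi> (x + t *\<^sub>R axis i 1)) has_field_derivative f' (axis i 1)) (at 0)"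
    unfolding has_field_derivative_def
    by (rule has_derivative_eq_rhs) (auto simp: linear_cmul[OF l] fun_eq_iff)
  then show ?thesis unfolding partial_def by (rule DERIV_imp_deriv)
qed

lemma vec_axis_sum: "(\<Sum>i\<in>UNIV. y $ i *\<^sub>R axis i (1::real)) = y"
  for y :: "real^'d::finite"
  by (simp add: vec_eq_iff axis_def if_distrib[of "\<lambda>t. _ * t"] cong: if_cong)

lemma has_derivative_partial:
  fixes \<phi> :: "real^'d::finite \<Rightarrow> real"
  assumes "\<phi> differentiable at x"
  shows "(\<phi> has_derivative (\<lambda>y. \<Sum>i\<in>UNIV. y $ i * partial i \<phi> x)) (at x)"
proof -
  obtain f' where f': "(\<phi> has_derivative f') (at x)" using assms differentiable_def by blast
  have l: "linear f'" using f' has_derivative_linear by blast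
  have "f' y = (\<Sum>i\<in>UNIV. y $ i * partial i \<phi> x)" for y
  proof -
    have "f' y = f' (\<Sum>i\<in>UNIV. y $ i *\<^sub>R axis i (1::real))" by (simp add: vec_axis_sum)
    also have "\<dots> = (\<Sum>i\<in>UNIV. y $ i * f' (axis i 1))"
      by (simp add: linear_sum[OF l] linear_cmul[OF l])
    finally show ?thesis by (simp add: has_derivative_partial_eq[OF f'])
  qed
  then have "f' = (\<lambda>y. \<Sum>i\<in>UNIV. y $ i * partial i \<phi> x)" by (rule ext)
  then show ?thesis using f' by simp
qed

text \<open>A quadratic bound on the remainder is stable under pointwise limits, integration and
  inversion of a contraction. Differentiability of uniform limits, of convolutions and of solutions
  of shift equations is therefore always proved through it. Only increments of norm at most 1 are
  tested, which is all that the support estimate for convolutions provides.\<close>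

lemma has_derivative_quadraticI:
  fixes \<phi> :: "real^'d::finite \<Rightarrow> real"
  assumes "\<And>y. norm y \<le> 1 \<Longrightarrow> \<bar>\<phi> (x + y) - \<phi> x - (\<Sum>i\<in>UNIV. y $ i * g i)\<bar> \<le> C * (norm y)\<^sup>2"
  shows "(\<phi> has_derivative (\<lambda>y. \<Sum>i\<in>UNIV. y $ i * g i)) (at x)"
  unfolding has_derivative_at
proof
  show "bounded_linear (\<lambda>y. \<Sum>i\<in>UNIV. y $ i * g i)"
    by (intro bounded_linear_sum bounded_linear_mult_const bounded_linear_vec_nth)
  show "(\<lambda>y. norm (\<phi> (x + y) - \<phi> x - (\<Sum>i\<in>UNIV. y $ i * g i)) / norm y) \<midarrow>0\<rightarrow> 0"
  proof (rule Lim_null_comparison)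
    have "eventually (\<lambda>y::real^'d. norm y < 1) (at 0)"
      unfolding eventually_at by (intro exI[of _ 1]) (auto simp: dist_norm)
    then show "eventually (\<lambda>y. norm (norm (\<phi> (x + y) - \<phi> x - (\<Sum>i\<in>UNIV. y $ i * g i)) / norm y)
        \<le> \<bar>C\<bar> * norm y) (at 0)"
    proof eventually_elim
      case (elim y)
      have "\<bar>\<phi> (x + y) - \<phi> x - (\<Sum>i\<in>UNIV. y $ i * g i)\<bar> \<le> C * (norm y)\<^sup>2"
        using assms[of y] elim by simp
      also have "\<dots> \<le> \<bar>C\<bar> * (norm y)\<^sup>2" by (simp add: mult_right_mono)
      finally show ?case
        by (cases "y = 0") (auto simp: divide_le_eq power2_eq_square mult.assoc)
    qed
    show "((\<lambda>y. \<bar>C\<bar> * norm y) \<longlongrightarrow> 0) (at (0::real^'d))"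
      by (rule tendsto_eq_intros refl tendsto_norm_zero tendsto_ident_at| simp)+
  qed
qed

lemma partial_quadratic_eq:
  fixes \<phi> :: "real^'d::finite \<Rightarrow> real"
  assumes "\<And>x y. norm y \<le> 1 \<Longrightarrow>
    \<bar>\<phi> (x + y) - \<phi> x - (\<Sum>i\<in>UNIV. y $ i * g i x)\<bar> \<le> C * (norm y)\<^sup>2"
  shows "\<phi> differentiable at x" "partial i \<phi> = g i"
proof -
  have d: "(\<phi> has_derivative (\<lambda>y. \<Sum>i\<in>UNIV. y $ i * g i x)) (at x)" for x
    by (rule has_derivative_quadraticI[of \<phi> x "\<lambda>i. g i x", OF assms])
  show "\<phi> differentiable at x" using d differentiable_def by blast
  show "partial i \<phi> = g i"
  proof
    fix x
    show "partial i \<phi> x = g i x"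
      unfolding has_derivative_partial_eq[OF d]
      by (simp add: axis_def if_distrib[of "\<lambda>t. t * _"] cong: if_cong)
  qed
qed

lemma partial_add:
  assumes "\<And>x. f differentiable at x" "\<And>x. g differentiable at x"
  shows "partial i (\<lambda>x. f x + g x) = (\<lambda>x. partial i f x + partial i g x)"
proof
  fix x
  show "partial i (\<lambda>x. f x + g x) x = partial i f x + partial i g x"
    using has_derivative_partial_eq[OF has_derivative_add[OF
        has_derivative_partial[OF assms(1)] has_derivative_partial[OF assms(2)]], of i x]
    by (simp add: axis_def if_distrib[of "\<lambda>t. t * _"] cong: if_cong)
qed

lemma partial_mult:
  assumes "\<And>x. f differentiable at x" "\<And>x. g differentiable at x"
  shows "partial i (\<lambda>x. f x * g x) = (\<lambda>x. f x * partial i g x + partial i f x * g x)"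
proof
  fix x
  show "partial i (\<lambda>x. f x * g x) x = f x * partial i g x + partial i f x * g x"
    using has_derivative_partial_eq[OF has_derivative_mult[OF
        has_derivative_partial[OF assms(1)] has_derivative_partial[OF assms(2)]], of i x]
    by (simp add: axis_def if_distrib[of "\<lambda>t. t * _"] cong: if_cong)
qed

lemma partial_const: "partial i (\<lambda>x. a) = (\<lambda>x. 0)"
  by (simp add: partial_def fun_eq_iff)

lemma partial_shift: "partial i (\<lambda>x. f (x + z)) = (\<lambda>x. partial i f (x + z))"
  by (simp add: partial_def fun_eq_iff add_ac)

lemma differentiable_shift:
  fixes f :: "real^'d::finite \<Rightarrow> real"
  assumes "\<And>x. f differentiable at x"
  shows "(\<lambda>x. f (x + z)) differentiable at x"
proof -
  have "(f \<circ> (\<lambda>x. x + z)) differentiable at x"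
    by (rule differentiable_chain_at) (auto intro!: derivative_intros assms)
  then show ?thesis by (simp add: o_def)
qed

subsection \<open>Bounded functions with bounded derivatives\<close>

definition lipb :: "('a::metric_space \<Rightarrow> real) \<Rightarrow> bool" where
  "lipb \<phi> \<longleftrightarrow> (\<exists>B. (\<forall>x. \<bar>\<phi> x\<bar> \<le> B) \<and> (\<forall>x y. \<bar>\<phi> x - \<phi> y\<bar> \<le> B * dist x y))"

lemma lipbI:
  assumes "\<And>x. \<bar>\<phi> x\<bar> \<le> B" "\<And>x y. \<bar>\<phi> x - \<phi> y\<bar> \<le> C * dist x y"
  shows "lipb \<phi>"
  unfolding lipb_def
proof (intro exI conjI allI)
  fix x y show "\<bar>\<phi> x\<bar> \<le> max B C" using assms(1)[of x] by linarith
  show "\<bar>\<phi> x - \<phi> y\<bar> \<le> max B C * dist x y"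
    by (rule order_trans[OF assms(2)]) (simp add: mult_right_mono)
qed

lemma lipbE:
  assumes "lipb \<phi>"
  obtains B where "B > 0" "\<And>x. \<bar>\<phi> x\<bar> \<le> B" "\<And>x y. \<bar>\<phi> x - \<phi> y\<bar> \<le> B * dist x y"
proof -
  obtain B where B: "\<And>x. \<bar>\<phi> x\<bar> \<le> B" "\<And>x y. \<bar>\<phi> x - \<phi> y\<bar> \<le> B * dist x y"
    using assms unfolding lipb_def by blast
  have le: "B \<le> \<bar>B\<bar> + 1" by linarith
  show thesis
  proof (rule that[of "\<bar>B\<bar> + 1"])
    show "\<bar>B\<bar> + 1 > 0" by linarith
    show "\<bar>\<phi> x\<bar> \<le> \<bar>B\<bar> + 1" for x using B(1)[of x] by linarith
    show "\<bar>\<phi> x - \<phi> y\<bar> \<le> (\<bar>B\<bar> + 1) * dist x y" for x y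
      using B(2)[of x y] mult_right_mono[OF le, of "dist x y"] by auto
  qed
qed

lemma lipb_continuous: "lipb \<phi> \<Longrightarrow> continuous_on S \<phi>"
proof (elim lipbE)
  fix B assume B: "B > 0" "\<And>x y. \<bar>\<phi> x - \<phi> y\<bar> \<le> B * dist x y"
  have "B-lipschitz_on S \<phi>"
    unfolding lipschitz_on_def using B by (auto simp: dist_real_def)
  then show ?thesis by (rule lipschitz_on_continuous_on)
qed

lemma lipb_bounded: "lipb \<phi> \<Longrightarrow> bounded (range \<phi>)"
  by (elim lipbE) (auto simp: bounded_iff)

lemma lipb_const: "lipb (\<lambda>x. a)"
  by (rule lipbI[of _ "\<bar>a\<bar>" 0]) auto

lemma lipb_add:
  assumes "lipb f" "lipb g" shows "lipb (\<lambda>x. f x + g x)"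
proof -
  obtain A where A: "\<And>x. \<bar>f x\<bar> \<le> A" "\<And>x y. \<bar>f x - f y\<bar> \<le> A * dist x y" using assms(1) by (metis lipbE)
  obtain B where B: "\<And>x. \<bar>g x\<bar> \<le> B" "\<And>x y. \<bar>g x - g y\<bar> \<le> B * dist x y" using assms(2) by (metis lipbE)
  show ?thesis
  proof (rule lipbI[of _ "A + B" "A + B"])
    fix x y
    show "\<bar>f x + g x\<bar> \<le> A + B" using A(1)[of x] B(1)[of x] by linarith
    show "\<bar>f x + g x - (f y + g y)\<bar> \<le> (A + B) * dist x y"
      using A(2)[of x y] B(2)[of x y] unfolding distrib_right by linarith
  qed
qed

lemma lipb_mult:
  assumes "lipb f" "lipb g" shows "lipb (\<lambda>x. f x * g x)"
proof -
  obtain A where A: "A > 0" "\<And>x. \<bar>f x\<bar> \<le> A" "\<And>x y. \<bar>f x - f y\<bar> \<le> A * dist x y" using assms(1) by (metis lipbE)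
  obtain B where B: "B > 0" "\<And>x. \<bar>g x\<bar> \<le> B" "\<And>x y. \<bar>g x - g y\<bar> \<le> B * dist x y" using assms(2) by (metis lipbE)
  show ?thesis
  proof (rule lipbI[of _ "A * B" "A * B + A * B"])
    fix x y
    show "\<bar>f x * g x\<bar> \<le> A * B" unfolding abs_mult using A B by (intro mult_mono) (auto intro: less_imp_le)
    have "f x * g x - f y * g y = f x * (g x - g y) + (f x - f y) * g y" by algebra
    also have "\<bar>\<dots>\<bar> \<le> \<bar>f x\<bar> * \<bar>g x - g y\<bar> + \<bar>f x - f y\<bar> * \<bar>g y\<bar>"
      by (rule order_trans[OF abs_triangle_ineq]) (simp add: abs_mult)
    also have "\<dots> \<le> A * (B * dist x y) + (A * dist x y) * B"
      using A B by (intro add_mono mult_mono) (auto intro: less_imp_le)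
    finally show "\<bar>f x * g x - f y * g y\<bar> \<le> (A * B + A * B) * dist x y" by (simp add: algebra_simps)
  qed
qed

lemma lipb_shift:
  fixes f :: "'a::real_normed_vector \<Rightarrow> real"
  assumes "lipb f" shows "lipb (\<lambda>x. f (x + z))"
  using assms
proof (rule lipbE)
  fix A assume A: "\<And>x. \<bar>f x\<bar> \<le> A" "\<And>x y. \<bar>f x - f y\<bar> \<le> A * dist x y"
  show ?thesis
    by (rule lipbI[of _ A A]) (use A(1) A(2)[of "_ + z" "_ + z"] in \<open>auto simp: dist_norm\<close>)
qed

text \<open>The Lipschitz condition makes \<open>Cb n\<close> the classical counterpart of \<open>Bspace (Suc n)\<close>.\<close>

primrec Cb :: "nat \<Rightarrow> (real^'d::finite \<Rightarrow> real) \<Rightarrow> bool" where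
  "Cb 0 \<phi> = lipb \<phi>"
| "Cb (Suc n) \<phi> = (lipb \<phi> \<and> (\<forall>x. \<phi> differentiable at x) \<and> (\<forall>i. Cb n (partial i \<phi>)))"

text \<open>The class in which all computations with smooth coefficients take place. Unlike
  \<open>smooth\<close>, it guarantees that every sum of squares of differences is bounded, as both
  the maximum principle and the structural inequalities require.\<close>

definition smb :: "(real^'d::finite \<Rightarrow> real) \<Rightarrow> bool" where
  "smb \<phi> \<longleftrightarrow> (\<forall>n. Cb n \<phi>)"

lemma Cb_lipb: "Cb n \<phi> \<Longrightarrow> lipb \<phi>"
  by (cases n) auto

lemma Cb_Suc: "Cb (Suc n) \<phi> \<Longrightarrow> Cb n \<phi>"
  by (induction n arbitrary: \<phi>) auto

lemma Cb_mono: "n \<le> m \<Longrightarrow> Cb m \<phi> \<Longrightarrow> Cb n \<phi>"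
  by (induction rule: dec_induct) (use Cb_Suc in blast)+

lemma Cb_diff: "Cb (Suc n) \<phi> \<Longrightarrow> \<phi> differentiable at x"
  by auto

lemma Cb_partial: "Cb (Suc n) \<phi> \<Longrightarrow> Cb n (partial i \<phi>)"
  by auto

lemma Cb_add: "Cb n f \<Longrightarrow> Cb n g \<Longrightarrow> Cb n (\<lambda>x. f x + g x)"
proof (induction n arbitrary: f g)
  case (Suc n)
  then show ?case by (auto simp: partial_add intro!: lipb_add derivative_intros)
qed (auto intro: lipb_add)

lemma Cb_mult: "Cb n f \<Longrightarrow> Cb n g \<Longrightarrow> Cb n (\<lambda>x. f x * g x)"
proof (induction n arbitrary: f g)
  case (Suc n)
  have "Cb n f" "Cb n g" using Suc.prems Cb_Suc by auto
  then show ?case using Suc by (auto simp: partial_mult intro!: lipb_mult derivative_intros Cb_add)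
qed (auto intro: lipb_mult)

lemma Cb_const: "Cb n (\<lambda>x. a)"
  by (induction n arbitrary: a) (auto simp: lipb_const partial_const)

lemma Cb_shift: "Cb n f \<Longrightarrow> Cb n (\<lambda>x. f (x + z))"
  by (induction n arbitrary: f) (auto simp: lipb_shift partial_shift intro!: differentiable_shift)

lemma Cb_cmult: "Cb n f \<Longrightarrow> Cb n (\<lambda>x. a * f x)"
  by (intro Cb_mult Cb_const)

lemma Cb_minus: "Cb n f \<Longrightarrow> Cb n (\<lambda>x. - f x)"
  using Cb_cmult[of n f "-1"] by simp

lemma Cb_diff2: "Cb n f \<Longrightarrow> Cb n g \<Longrightarrow> Cb n (\<lambda>x. f x - g x)"
  using Cb_add[of n f "\<lambda>x. - g x"] Cb_minus[of n g] by simp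

lemma Cb_divide: "Cb n f \<Longrightarrow> Cb n (\<lambda>x. f x / a)"
  using Cb_cmult[of n f "1 / a"] by simp

lemma Cb_sum: "(\<And>i. i \<in> I \<Longrightarrow> Cb n (f i)) \<Longrightarrow> Cb n (\<lambda>x. \<Sum>i\<in>I. f i x)"
  by (induction I rule: infinite_finite_induct) (auto intro: Cb_const Cb_add)

lemmas Cb_intros = Cb_const Cb_add Cb_mult Cb_minus Cb_diff2 Cb_divide Cb_sum Cb_shift

lemma smb_const: "smb (\<lambda>x. a)" by (simp add: smb_def Cb_intros)
lemma smb_add: "smb f \<Longrightarrow> smb g \<Longrightarrow> smb (\<lambda>x. f x + g x)" by (simp add: smb_def Cb_intros)
lemma smb_mult: "smb f \<Longrightarrow> smb g \<Longrightarrow> smb (\<lambda>x. f x * g x)" by (simp add: smb_def Cb_intros)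
lemma smb_minus: "smb f \<Longrightarrow> smb (\<lambda>x. - f x)" by (simp add: smb_def Cb_intros)
lemma smb_diff: "smb f \<Longrightarrow> smb g \<Longrightarrow> smb (\<lambda>x. f x - g x)" by (simp add: smb_def Cb_intros)
lemma smb_divide: "smb f \<Longrightarrow> smb (\<lambda>x. f x / a)" by (simp add: smb_def Cb_intros)
lemma smb_sum: "(\<And>i. i \<in> I \<Longrightarrow> smb (f i)) \<Longrightarrow> smb (\<lambda>x. \<Sum>i\<in>I. f i x)" by (simp add: smb_def Cb_intros)
lemma smb_shift: "smb f \<Longrightarrow> smb (\<lambda>x. f (x + z))" by (simp add: smb_def Cb_intros)
lemma smb_partial: "smb f \<Longrightarrow> smb (partial i f)" unfolding smb_def using Cb_partial by blast
lemma smb_power: "smb f \<Longrightarrow> smb (\<lambda>x. f x ^ n)" by (induction n) (auto intro: smb_const smb_mult)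

lemmas smb_intros = smb_const smb_add smb_mult smb_minus smb_diff smb_divide smb_sum smb_shift
  smb_partial smb_power

lemma smb_differentiable: "smb f \<Longrightarrow> f differentiable at x"
  unfolding smb_def using Cb_diff by blast

lemma smb_Cb: "smb f \<Longrightarrow> Cb n f" by (simp add: smb_def)

lemma smb_lipb: "smb f \<Longrightarrow> lipb f" using smb_Cb[of f 0] by simp

lemma smb_pderivs: "smb f \<Longrightarrow> smb (foldr partial is f)"
  by (induction "is") (auto intro: smb_partial)

lemma Cb_pderivs: "Cb (n + length is) f \<Longrightarrow> Cb n (foldr partial is f)"
proof (induction "is" arbitrary: n)
  case (Cons i "is")
  then have "Cb (Suc n + length is) f" by (simp del: Cb.simps)
  from Cons.IH[OF this] show ?case by (simp add: Cb_partial)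
qed simp

lemma Cb_differentiable_pderivs: "Cb n f \<Longrightarrow> length is < n \<Longrightarrow> foldr partial is f differentiable at x"
proof -
  assume "Cb n f" "length is < n"
  then have "Cb (1 + length is) f" by (intro Cb_mono[OF _ \<open>Cb n f\<close>]) simp
  then have "Cb 1 (foldr partial is f)" by (rule Cb_pderivs)
  then show ?thesis by auto
qed

lemma pderivs_add:
  assumes "Cb n f" "Cb n g" "length is \<le> n"
  shows "foldr partial is (\<lambda>x. f x + g x) = (\<lambda>x. foldr partial is f x + foldr partial is g x)"
  using assms(3)
proof (induction "is")
  case (Cons i "is")
  have "foldr partial is f differentiable at x" "foldr partial is g differentiable at x" for x
    using Cb_differentiable_pderivs assms Cons.prems by (metis Suc_le_eq length_Cons)+
  then show ?case using Cons by (simp add: partial_add)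
qed simp

lemma pderivs_cmult:
  assumes "Cb n f" "length is \<le> n"
  shows "foldr partial is (\<lambda>x. a * f x) = (\<lambda>x. a * foldr partial is f x)"
  using assms(2)
proof (induction "is")
  case (Cons i "is")
  have "foldr partial is f differentiable at x" for x
    using Cb_differentiable_pderivs assms Cons.prems by (metis Suc_le_eq length_Cons)
  then show ?case using Cons by (simp add: partial_mult partial_const)
qed simp

lemma pderivs_const: "foldr partial is (\<lambda>x. a) = (\<lambda>x. if is = [] then a else 0)"
  by (induction "is") (auto simp: partial_const)

lemma pderivs_diff:
  assumes "Cb n f" "Cb n g" "length is \<le> n"
  shows "foldr partial is (\<lambda>x. f x - g x) = (\<lambda>x. foldr partial is f x - foldr partial is g x)"
  using pderivs_add[OF assms(1) Cb_minus[OF assms(2)] assms(3)] pderivs_cmult[OF assms(2,3), of "-1"]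
  by simp

lemma pderivs_sum:
  assumes "\<And>j. j \<in> I \<Longrightarrow> Cb n (f j)" "length is \<le> n"
  shows "foldr partial is (\<lambda>x. \<Sum>j\<in>I. f j x) = (\<lambda>x. \<Sum>j\<in>I. foldr partial is (f j) x)"
  using assms(1)
proof (induction I rule: infinite_finite_induct)
  case (insert j I)
  have "foldr partial is (\<lambda>x. f j x + (\<Sum>j\<in>I. f j x)) =
      (\<lambda>x. foldr partial is (f j) x + foldr partial is (\<lambda>x. \<Sum>j\<in>I. f j x) x)"
    by (rule pderivs_add[of n]) (use insert.prems assms(2) in \<open>auto intro!: Cb_sum\<close>)
  then show ?case using insert by simp
qed (simp_all add: pderivs_const)

lemma pderivs_shift: "foldr partial is (\<lambda>x. f (x + z)) = (\<lambda>x. foldr partial is f (x + z))"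
  by (induction "is") (auto simp: partial_shift)

subsection \<open>Uniform bounds on derivatives\<close>

text \<open>A single constant serves all iterated partial derivatives, in every order of
  differentiation; multi-indices enter only when generalized derivatives are compared.\<close>

definition bd :: "nat \<Rightarrow> real \<Rightarrow> (real^'d::finite \<Rightarrow> real) \<Rightarrow> bool" where
  "bd n B \<phi> \<longleftrightarrow> (\<forall>is x. length is \<le> n \<longrightarrow> \<bar>foldr partial is \<phi> x\<bar> \<le> B)"

lemma bdD: "bd n B \<phi> \<Longrightarrow> length is \<le> n \<Longrightarrow> \<bar>foldr partial is \<phi> x\<bar> \<le> B"
  by (simp add: bd_def)

lemma bd0: "bd n B \<phi> \<Longrightarrow> \<bar>\<phi> x\<bar> \<le> B"
  using bdD[of n B \<phi> "[]"] by simp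

lemma bd_0_iff: "bd 0 B \<phi> \<longleftrightarrow> (\<forall>x. \<bar>\<phi> x\<bar> \<le> B)"
  by (simp add: bd_def)

lemma bd1: "bd (Suc n) B \<phi> \<Longrightarrow> \<bar>partial i \<phi> x\<bar> \<le> B"
  using bdD[of "Suc n" B \<phi> "[i]"] by simp

lemma bd_nonneg: "bd n B \<phi> \<Longrightarrow> 0 \<le> B"
  using bd0[of n B \<phi> 0] by linarith

lemma bd_partial: "bd (Suc n) B \<phi> \<Longrightarrow> bd n B (partial i \<phi>)"
  unfolding bd_def
proof (intro allI impI)
  fix "is" :: "'a list" and x assume "\<forall>is x. length is \<le> Suc n \<longrightarrow> \<bar>foldr partial is \<phi> x\<bar> \<le> B" "length is \<le> n"
  then show "\<bar>foldr partial is (partial i \<phi>) x\<bar> \<le> B"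
    by (auto dest!: spec[of _ "is @ [i]"])
qed

lemma bd_Suc_iff: "bd (Suc n) B \<phi> \<longleftrightarrow> (\<forall>x. \<bar>\<phi> x\<bar> \<le> B) \<and> (\<forall>i. bd n B (partial i \<phi>))"
proof (intro iffI conjI allI)
  assume *: "(\<forall>x. \<bar>\<phi> x\<bar> \<le> B) \<and> (\<forall>i. bd n B (partial i \<phi>))"
  show "bd (Suc n) B \<phi>"
    unfolding bd_def
  proof (intro allI impI)
    fix "is" :: "'a list" and x assume l: "length is \<le> Suc n"
    show "\<bar>foldr partial is \<phi> x\<bar> \<le> B"
    proof (cases "is" rule: rev_cases)
      case (snoc js i)
      then show ?thesis using * l by (auto simp: bd_def)
    qed (use * in auto)
  qed
qed (auto simp: bd0 bd_partial)

lemma bd_mono: "bd n A \<phi> \<Longrightarrow> m \<le> n \<Longrightarrow> A \<le> B \<Longrightarrow> bd m B \<phi>"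
  unfolding bd_def by (meson order_trans)

lemma bd_add: "Cb n f \<Longrightarrow> Cb n g \<Longrightarrow> bd n A f \<Longrightarrow> bd n B g \<Longrightarrow> bd n (A + B) (\<lambda>x. f x + g x)"
  unfolding bd_def by (auto simp: pderivs_add intro!: order_trans[OF abs_triangle_ineq] add_mono)

lemma bd_cmult: "Cb n f \<Longrightarrow> bd n A f \<Longrightarrow> bd n (\<bar>a\<bar> * A) (\<lambda>x. a * f x)"
  unfolding bd_def by (auto simp: pderivs_cmult abs_mult intro!: mult_left_mono)

lemma bd_diff: "Cb n f \<Longrightarrow> Cb n g \<Longrightarrow> bd n A f \<Longrightarrow> bd n B g \<Longrightarrow> bd n (A + B) (\<lambda>x. f x - g x)"
  using bd_add[of n f "\<lambda>x. -1 * g x" A B] bd_cmult[of n g B "-1"] Cb_cmult[of n g "-1"] by simp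

lemma bd_sum:
  "(\<And>j. j \<in> I \<Longrightarrow> Cb n (f j)) \<Longrightarrow> (\<And>j. j \<in> I \<Longrightarrow> bd n (A j) (f j)) \<Longrightarrow>
    bd n (\<Sum>j\<in>I. A j) (\<lambda>x. \<Sum>j\<in>I. f j x)"
proof (unfold bd_def, intro allI impI)
  fix "is" :: "'b list" and x
  assume cb: "\<And>j. j \<in> I \<Longrightarrow> Cb n (f j)" and l: "length is \<le> n"
    and b: "\<And>j. j \<in> I \<Longrightarrow> \<forall>is x. length is \<le> n \<longrightarrow> \<bar>foldr partial is (f j) x\<bar> \<le> A j"
  have "\<bar>\<Sum>j\<in>I. foldr partial is (f j) x\<bar> \<le> (\<Sum>j\<in>I. \<bar>foldr partial is (f j) x\<bar>)" by (rule sum_abs)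
  also have "\<dots> \<le> (\<Sum>j\<in>I. A j)" by (rule sum_mono) (use b l in blast)
  finally show "\<bar>foldr partial is (\<lambda>x. \<Sum>j\<in>I. f j x) x\<bar> \<le> (\<Sum>j\<in>I. A j)"
    by (simp add: pderivs_sum[OF cb l])
qed

lemma bd_shift: "bd n A f \<Longrightarrow> bd n A (\<lambda>x. f (x + z))"
  unfolding bd_def by (auto simp: pderivs_shift)

lemma Cb_bd_ex: "Cb n f \<Longrightarrow> \<exists>B. bd n B f"
proof (induction n arbitrary: f)
  case 0
  then show ?case unfolding bd_0_iff by (metis Cb.simps(1) lipbE)
next
  case (Suc n)
  then have "\<forall>i. \<exists>B. bd n B (partial i f)" by auto
  then obtain B where B: "\<And>i. bd n (B i) (partial i f)" by metis
  obtain A where A: "A > 0" "\<And>x. \<bar>f x\<bar> \<le> A" using Suc.prems by (metis Cb_lipb lipbE)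
  have nn: "0 \<le> B i" for i using bd_nonneg[OF B] .
  have "B i \<le> (\<Sum>i\<in>UNIV. B i)" for i
    by (rule member_le_sum) (auto simp: nn)
  moreover have "0 \<le> (\<Sum>i\<in>UNIV. B i)" by (simp add: nn sum_nonneg)
  ultimately have "bd n (A + (\<Sum>i\<in>UNIV. B i)) (partial i f)" "\<bar>f x\<bar> \<le> A + (\<Sum>i\<in>UNIV. B i)" for i x
    using A(1) A(2)[of x] by (auto intro!: bd_mono[OF B] add_increasing)
  then show ?case unfolding bd_Suc_iff by blast
qed

lemma smb_bd_ex: "smb f \<Longrightarrow> \<exists>B. bd n B f"
  using Cb_bd_ex smb_Cb by blast

subsection \<open>Directional derivatives and Taylor expansion\<close>

definition dir :: "real^'d::finite \<Rightarrow> (real^'d \<Rightarrow> real) \<Rightarrow> real^'d \<Rightarrow> real" where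
  "dir \<xi> \<phi> x = (\<Sum>i\<in>UNIV. \<xi> $ i * partial i \<phi> x)"

lemma line_has_derivative:
  fixes \<phi> :: "real^'d::finite \<Rightarrow> real"
  assumes "\<And>x. \<phi> differentiable at x"
  shows "((\<lambda>t. \<phi> (x + t *\<^sub>R y)) has_real_derivative dir y \<phi> (x + t *\<^sub>R y)) (at t)"
proof -
  have "((\<lambda>t. x + t *\<^sub>R y) has_derivative (\<lambda>t. t *\<^sub>R y)) (at t)"
    by (auto intro!: derivative_eq_intros)
  from has_derivative_compose[OF this has_derivative_partial[OF assms]]
  show ?thesis
    unfolding has_field_derivative_def
    by (rule has_derivative_eq_rhs)
      (auto simp: fun_eq_iff dir_def sum_distrib_left sum_distrib_right mult_ac)
qed

lemma mean_value:
  fixes \<phi> :: "real^'d::finite \<Rightarrow> real"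
  assumes "\<And>x. \<phi> differentiable at x"
  shows "\<exists>s. 0 \<le> s \<and> s \<le> 1 \<and> \<phi> (x + y) - \<phi> x = dir y \<phi> (x + s *\<^sub>R y)"
proof -
  have "\<exists>s. 0 < s \<and> s < 1 \<and> \<phi> (x + 1 *\<^sub>R y) - \<phi> (x + 0 *\<^sub>R y) = (1 - 0) * dir y \<phi> (x + s *\<^sub>R y)"
    by (rule MVT2) (auto intro!: line_has_derivative assms)
  then obtain s where "0 < s" "s < 1" "\<phi> (x + y) - \<phi> x = dir y \<phi> (x + s *\<^sub>R y)" by auto
  then show ?thesis by (intro exI[of _ s]) auto
qed

lemma dir_bound: "(\<And>i. \<bar>partial i \<phi> x\<bar> \<le> B) \<Longrightarrow> \<bar>dir y \<phi> x\<bar> \<le> real CARD('d) * norm y * B"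
  for y :: "real^'d::finite"
  unfolding dir_def by (rule norm_eq_abs_sum_le)

lemma dir_scale: "dir (t *\<^sub>R y) \<phi> x = t * dir y \<phi> x"
  by (simp add: dir_def sum_distrib_left mult_ac)

lemma dir_axis: "dir (axis i 1) \<phi> x = partial i \<phi> x"
  by (simp add: dir_def axis_def if_distrib[of "\<lambda>t. t * _"] cong: if_cong)

lemma increment_bound:
  fixes \<phi> :: "real^'d::finite \<Rightarrow> real"
  assumes "\<And>x. \<phi> differentiable at x" "\<And>i x. \<bar>partial i \<phi> x\<bar> \<le> B"
  shows "\<bar>\<phi> (x + y) - \<phi> x\<bar> \<le> real CARD('d) * norm y * B"
  using mean_value[of \<phi> x y, OF assms(1)] dir_bound[of \<phi> _ B y, OF assms(2)] by metis

lemma Cb_dir: "Cb (Suc n) \<phi> \<Longrightarrow> Cb n (dir \<xi> \<phi>)"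
  unfolding dir_def[abs_def] by (intro Cb_sum Cb_mult Cb_const Cb_partial)

lemma smb_dir: "smb \<phi> \<Longrightarrow> smb (dir \<xi> \<phi>)"
  unfolding smb_def using Cb_dir by blast

lemma smb_dirpow: "smb \<phi> \<Longrightarrow> smb ((dir \<xi> ^^ n) \<phi>)"
  by (induction n) (auto intro: smb_dir)

lemma pderivs_dir:
  assumes "Cb (Suc n) \<phi>" "length is \<le> n"
  shows "foldr partial is (dir \<xi> \<phi>) x = (\<Sum>i\<in>UNIV. \<xi> $ i * foldr partial is (partial i \<phi>) x)"
proof -
  have c: "Cb n (partial i \<phi>)" for i using assms(1) by (rule Cb_partial)
  have "foldr partial is (dir \<xi> \<phi>) = foldr partial is (\<lambda>x. \<Sum>i\<in>UNIV. \<xi> $ i * partial i \<phi> x)"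
    by (simp add: dir_def[abs_def])
  also have "\<dots> = (\<lambda>x. \<Sum>i\<in>UNIV. foldr partial is (\<lambda>x. \<xi> $ i * partial i \<phi> x) x)"
    by (rule pderivs_sum) (use assms c in \<open>auto intro: Cb_cmult\<close>)
  finally show ?thesis by (simp add: pderivs_cmult[OF c assms(2)])
qed

lemma bd_dir:
  fixes \<xi> :: "real^'d::finite"
  assumes "Cb (Suc n) \<phi>" "bd (Suc n) B \<phi>"
  shows "bd n (real CARD('d) * norm \<xi> * B) (dir \<xi> \<phi>)"
  unfolding bd_def
proof (intro allI impI)
  fix "is" :: "'d list" and x assume l: "length is \<le> n"
  show "\<bar>foldr partial is (dir \<xi> \<phi>) x\<bar> \<le> real CARD('d) * norm \<xi> * B"
    unfolding pderivs_dir[OF assms(1) l]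
    by (rule norm_eq_abs_sum_le) (rule bdD[OF bd_partial[OF assms(2)] l])
qed

lemma bd_dirpow:
  fixes \<xi> :: "real^'d::finite"
  assumes "smb \<phi>" "bd (n + k) B \<phi>"
  shows "bd n ((real CARD('d) * norm \<xi>) ^ k * B) ((dir \<xi> ^^ k) \<phi>)"
  using assms(2)
proof (induction k arbitrary: n)
  case (Suc k)
  then have "bd (Suc n) ((real CARD('d) * norm \<xi>) ^ k * B) ((dir \<xi> ^^ k) \<phi>)"
    by simp
  from bd_dir[OF smb_Cb[OF smb_dirpow[OF assms(1)]] this]
  show ?case by (simp add: mult_ac)
qed simp

text \<open>One-dimensional Taylor formula along the line through \<open>x\<close>. Each directional
  derivative costs a factor \<open>CARD('d) * norm \<xi>\<close>, and the factor 1/n! of the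
  remainder is bounded by 1.\<close>

lemma taylor_line:
  fixes \<phi> :: "real^'d::finite \<Rightarrow> real"
  assumes "smb \<phi>" "bd n B \<phi>"
  shows "\<bar>\<phi> (x + h *\<^sub>R \<xi>) - (\<Sum>i<n. (dir \<xi> ^^ i) \<phi> x / fact i * h ^ i)\<bar>
    \<le> (real CARD('d) * norm \<xi>) ^ n * B * \<bar>h\<bar> ^ n"
proof -
  have d: "DERIV (\<lambda>t. (dir \<xi> ^^ k) \<phi> (x + t *\<^sub>R \<xi>)) t :> (dir \<xi> ^^ Suc k) \<phi> (x + t *\<^sub>R \<xi>)" for k t
    using line_has_derivative[of "(dir \<xi> ^^ k) \<phi>" x \<xi> t] smb_differentiable[OF smb_dirpow[OF assms(1)]] by auto
  obtain t where t: "\<phi> (x + h *\<^sub>R \<xi>) = (\<Sum>i<n. (dir \<xi> ^^ i) \<phi> (x + 0 *\<^sub>R \<xi>) / fact i * h ^ i)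
      + (dir \<xi> ^^ n) \<phi> (x + t *\<^sub>R \<xi>) / fact n * h ^ n"
    using Maclaurin_bi_le[of "\<lambda>k t. (dir \<xi> ^^ k) \<phi> (x + t *\<^sub>R \<xi>)" "\<lambda>t. \<phi> (x + t *\<^sub>R \<xi>)" n h] d
    by auto
  have "bd 0 ((real CARD('d) * norm \<xi>) ^ n * B) ((dir \<xi> ^^ n) \<phi>)"
    using bd_dirpow[of \<phi> 0 n B \<xi>] assms by simp
  then have b: "\<bar>(dir \<xi> ^^ n) \<phi> (x + t *\<^sub>R \<xi>)\<bar> \<le> (real CARD('d) * norm \<xi>) ^ n * B"
    by (simp add: bd_0_iff)
  have "\<bar>(dir \<xi> ^^ n) \<phi> (x + t *\<^sub>R \<xi>) / fact n\<bar> \<le> \<bar>(dir \<xi> ^^ n) \<phi> (x + t *\<^sub>R \<xi>)\<bar> / 1"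
    unfolding abs_divide by (rule divide_left_mono) auto
  then have "\<bar>(dir \<xi> ^^ n) \<phi> (x + t *\<^sub>R \<xi>) / fact n\<bar> \<le> (real CARD('d) * norm \<xi>) ^ n * B"
    using b by simp
  then have "\<bar>(dir \<xi> ^^ n) \<phi> (x + t *\<^sub>R \<xi>) / fact n * h ^ n\<bar> \<le> (real CARD('d) * norm \<xi>) ^ n * B * \<bar>h\<bar> ^ n"
    unfolding abs_mult using bd_nonneg[OF assms(2)] by (intro mult_mono) (auto simp: power_abs)
  then show ?thesis using t by simp
qed

lemma quadratic_remainder:
  fixes \<phi> :: "real^'d::finite \<Rightarrow> real"
  assumes "smb \<phi>" "bd 2 B \<phi>"
  shows "\<bar>\<phi> (x + y) - \<phi> x - (\<Sum>i\<in>UNIV. y $ i * partial i \<phi> x)\<bar> \<le> (real CARD('d))\<^sup>2 * B * (norm y)\<^sup>2"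
  using taylor_line[OF assms, of x 1 y]
  by (simp add: numeral_2_eq_2 dir_def power_mult_distrib mult_ac diff_diff_eq)

text \<open>The mean value theorem and a Lipschitz gradient replace second derivatives. This matters
  where only one derivative is available at the stage of an induction at which the remainder is
  needed.\<close>

lemma Cb1_quadratic_remainder:
  fixes \<phi> :: "real^'d::finite \<Rightarrow> real"
  assumes "Cb (Suc 0) \<phi>"
  shows "\<exists>C\<ge>0. \<forall>x y. \<bar>\<phi> (x + y) - \<phi> x - (\<Sum>i\<in>UNIV. y $ i * partial i \<phi> x)\<bar> \<le> C * (norm y)\<^sup>2"
proof -
  have "\<forall>i. \<exists>B>0. \<forall>x y. \<bar>partial i \<phi> x - partial i \<phi> y\<bar> \<le> B * dist x y"
    using assms by (auto) (metis lipbE)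
  then obtain L where L: "\<And>i. L i > 0" "\<And>i x y. \<bar>partial i \<phi> x - partial i \<phi> y\<bar> \<le> L i * dist x y"
    by metis
  define C where "C = (\<Sum>i\<in>UNIV. L i)"
  have LC: "L i \<le> C" for i unfolding C_def by (rule member_le_sum) (auto intro: less_imp_le L)
  have C0: "0 \<le> C" using LC[of undefined] L(1)[of undefined] by linarith
  have "\<bar>\<phi> (x + y) - \<phi> x - (\<Sum>i\<in>UNIV. y $ i * partial i \<phi> x)\<bar> \<le> (real CARD('d) * C) * (norm y)\<^sup>2" for x y
  proof -
    obtain s where s: "0 \<le> s" "s \<le> 1" "\<phi> (x + y) - \<phi> x = dir y \<phi> (x + s *\<^sub>R y)"
      using mean_value[of \<phi> x y] assms by auto
    have "\<bar>partial i \<phi> (x + s *\<^sub>R y) - partial i \<phi> x\<bar> \<le> C * norm y" for i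
    proof -
      have "\<bar>partial i \<phi> (x + s *\<^sub>R y) - partial i \<phi> x\<bar> \<le> L i * norm (s *\<^sub>R y)"
        using L(2)[of i "x + s *\<^sub>R y" x] by (simp add: dist_norm)
      also have "\<dots> \<le> C * norm y"
        using s LC[of i] C0 L(1)[of i]
        by (intro mult_mono) (auto simp: mult_left_le_one_le)
      finally show ?thesis .
    qed
    from norm_eq_abs_sum_le[of "\<lambda>i. partial i \<phi> (x + s *\<^sub>R y) - partial i \<phi> x", OF this, of y]
    show ?thesis using s(3)
      by (simp add: dir_def right_diff_distrib sum_subtractf power2_eq_square mult_ac)
  qed
  then show ?thesis using C0 by (intro exI[of _ "real CARD('d) * C"]) auto
qed

lemma nonpos_if_le_mult:
  fixes a c :: real
  assumes "\<And>t. 0 < t \<Longrightarrow> t \<le> 1 \<Longrightarrow> a \<le> c * t"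
  shows "a \<le> 0"
proof (rule tendsto_lowerbound)
  show "((\<lambda>t. c * t) \<longlongrightarrow> 0) (at_right (0::real))"
    by (rule tendsto_eq_intros refl | simp)+
  show "\<forall>\<^sub>F t in at_right 0. a \<le> c * t"
    unfolding eventually_at_right_field using assms by (intro exI[of _ 1]) auto
qed simp

subsection \<open>Symmetry of higher derivatives\<close>

text \<open>The mean value theorem is applied to the increment in direction \<open>j\<close> along
  direction \<open>i\<close>, then to \<open>partial i \<phi>\<close> along direction
  \<open>j\<close>. The mixed second difference itself is symmetric in \<open>i\<close> and
  \<open>j\<close>, which yields the symmetry of second derivatives as \<open>t\<close> tends to
  0.\<close>

lemma second_difference:
  fixes \<phi> :: "real^'d::finite \<Rightarrow> real"
  assumes "smb \<phi>" "bd 3 B \<phi>" "t > 0"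
  shows "\<bar>(\<phi> (x + t *\<^sub>R axis i 1 + t *\<^sub>R axis j 1) - \<phi> (x + t *\<^sub>R axis i 1) - \<phi> (x + t *\<^sub>R axis j 1) + \<phi> x)
    - t\<^sup>2 * partial j (partial i \<phi>) x\<bar> \<le> t\<^sup>2 * (real CARD('d) * (2 * t) * B)"
proof -
  define g where "g = (\<lambda>z. \<phi> (z + t *\<^sub>R axis j 1) - \<phi> z)"
  have g: "smb g" unfolding g_def by (intro smb_intros assms)
  have pg: "partial i g z = partial i \<phi> (z + t *\<^sub>R axis j 1) - partial i \<phi> z" for z
    using pderivs_diff[OF smb_Cb[OF smb_shift[OF assms(1)]] smb_Cb[OF assms(1)], of "[i]" 1 "t *\<^sub>R axis j 1"]
    by (auto simp: g_def partial_shift)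
  obtain s where s: "0 \<le> s" "s \<le> 1"
    "g (x + t *\<^sub>R axis i 1) - g x = dir (t *\<^sub>R axis i 1) g (x + s *\<^sub>R (t *\<^sub>R axis i 1))"
    using mean_value[of g x "t *\<^sub>R axis i 1"] smb_differentiable[OF g] by blast
  define z where "z = x + s *\<^sub>R (t *\<^sub>R axis i 1)"
  obtain r where r: "0 \<le> r" "r \<le> 1"
    "partial i \<phi> (z + t *\<^sub>R axis j 1) - partial i \<phi> z = dir (t *\<^sub>R axis j 1) (partial i \<phi>) (z + r *\<^sub>R (t *\<^sub>R axis j 1))"
    using mean_value[of "partial i \<phi>" z "t *\<^sub>R axis j 1"] smb_differentiable[OF smb_partial[OF assms(1)]] by blast
  define w where "w = s *\<^sub>R (t *\<^sub>R axis i (1::real)) + r *\<^sub>R (t *\<^sub>R axis j 1)"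
  have E: "g (x + t *\<^sub>R axis i 1) - g x = t\<^sup>2 * partial j (partial i \<phi>) (x + w)"
    unfolding s(3) using r(3)
    by (simp add: dir_scale dir_axis pg power2_eq_square z_def w_def add.assoc)
  have nw: "norm w \<le> 2 * t"
  proof -
    have "norm w \<le> norm (s *\<^sub>R (t *\<^sub>R axis i (1::real)) :: real^'d) + norm (r *\<^sub>R (t *\<^sub>R axis j (1::real)) :: real^'d)"
      unfolding w_def by (rule norm_triangle_ineq)
    also have "\<dots> = s * t + r * t" using s r assms(3) by simp
    also have "\<dots> \<le> 1 * t + 1 * t" using s r assms(3) by (intro add_mono mult_right_mono) auto
    finally show ?thesis by simp
  qed
  have "\<bar>partial j (partial i \<phi>) (x + w) - partial j (partial i \<phi>) x\<bar> \<le> real CARD('d) * norm w * B"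
  proof (rule increment_bound)
    show "partial j (partial i \<phi>) differentiable at x" for x
      by (intro smb_differentiable smb_partial assms)
    have "bd (Suc 0) B (partial j (partial i \<phi>))"
      using assms(2) by (intro bd_partial) (simp add: numeral_3_eq_3)
    then show "\<bar>partial k (partial j (partial i \<phi>)) x\<bar> \<le> B" for k x by (rule bd1)
  qed
  also have "\<dots> \<le> real CARD('d) * (2 * t) * B"
    using nw assms(3) bd_nonneg[OF assms(2)] by (intro mult_mono) auto
  finally have "\<bar>t\<^sup>2 * (partial j (partial i \<phi>) (x + w) - partial j (partial i \<phi>) x)\<bar> \<le> t\<^sup>2 * (real CARD('d) * (2 * t) * B)"
    unfolding abs_mult by (simp add: mult_left_mono)
  then show ?thesis using E by (simp add: g_def right_diff_distrib algebra_simps)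
qed

lemma partial_commute:
  fixes \<phi> :: "real^'d::finite \<Rightarrow> real"
  assumes "smb \<phi>"
  shows "partial i (partial j \<phi>) = partial j (partial i \<phi>)"
proof
  fix x
  obtain B where B: "bd 3 B \<phi>" using smb_bd_ex[OF assms] by blast
  define a where "a = \<bar>partial i (partial j \<phi>) x - partial j (partial i \<phi>) x\<bar>"
  have le: "a \<le> (4 * real CARD('d) * B) * t" if t: "t > 0" for t
  proof -
    have "\<bar>t\<^sup>2 * partial i (partial j \<phi>) x - t\<^sup>2 * partial j (partial i \<phi>) x\<bar> \<le> 2 * (t\<^sup>2 * (real CARD('d) * (2 * t) * B))"
      using second_difference[OF assms B t, of x i j] second_difference[OF assms B t, of x j i]
      by (simp add: add_ac)
    also have "t\<^sup>2 * partial i (partial j \<phi>) x - t\<^sup>2 * partial j (partial i \<phi>) x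
        = t\<^sup>2 * (partial i (partial j \<phi>) x - partial j (partial i \<phi>) x)"
      by (rule right_diff_distrib[symmetric])
    also have "\<bar>\<dots>\<bar> = t\<^sup>2 * a" by (simp add: a_def abs_mult)
    finally have "t\<^sup>2 * a \<le> t\<^sup>2 * (4 * real CARD('d) * B * t)"
      by (simp add: mult_ac)
    then show ?thesis using t by simp
  qed
  have "a \<le> 0" by (rule nonpos_if_le_mult[of _ "4 * real CARD('d) * B", OF le])
  then show "partial i (partial j \<phi>) x = partial j (partial i \<phi>) x" by (simp add: a_def)
qed

lemma pderivs_partial_commute:
  "smb \<phi> \<Longrightarrow> foldr partial is (partial i \<phi>) = partial i (foldr partial is \<phi>)"
  by (induction "is") (auto simp: partial_commute smb_pderivs)

lemma pderivs_remove1: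
  assumes "smb \<phi>" "i \<in> set is"
  shows "foldr partial is \<phi> = partial i (foldr partial (remove1 i is) \<phi>)"
  using assms(2)
proof (induction "is")
  case (Cons j "is")
  then show ?case
    by (cases "j = i") (auto simp: partial_commute smb_pderivs assms(1))
qed simp

lemma pderivs_mset_cong:
  assumes "smb \<phi>" "mset is = mset js"
  shows "foldr partial is \<phi> = foldr partial js \<phi>"
  using assms(2)
proof (induction "is" arbitrary: js)
  case (Cons i "is")
  then have "i \<in> set js" by (metis list.set_intros(1) mset_eq_setD)
  moreover have "mset is = mset (remove1 i js)" using Cons.prems by (metis add_mset_remove_trivial mset.simps(2) mset_remove1)
  ultimately show ?case using Cons.IH[of "remove1 i js"] by (simp add: pderivs_remove1[OF assms(1) \<open>i \<in> set js\<close>])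
qed simp

subsection \<open>Uniform limits\<close>

text \<open>A Landau type inequality: smallness of a function together with a bound on its second
  derivatives forces smallness of the gradient, with \<open>t\<close> free for optimisation.\<close>

lemma interpolation:
  fixes \<psi> :: "real^'d::finite \<Rightarrow> real"
  assumes "smb \<psi>" "bd 2 B \<psi>" "\<And>x. \<bar>\<psi> x\<bar> \<le> A" "t > 0"
  shows "\<bar>partial i \<psi> x\<bar> \<le> 2 * A / t + (real CARD('d))\<^sup>2 * B * t"
proof -
  have "\<bar>\<psi> (x + t *\<^sub>R axis i 1) - \<psi> x - t * partial i \<psi> x\<bar> \<le> (real CARD('d))\<^sup>2 * B * t\<^sup>2"
    using quadratic_remainder[OF assms(1,2), of x "t *\<^sub>R axis i 1"] assms(4)
      dir_scale[of t "axis i 1" \<psi> x, unfolded dir_axis]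
    by (simp add: dir_def)
  then have "\<bar>t * partial i \<psi> x\<bar> \<le> 2 * A + (real CARD('d))\<^sup>2 * B * t\<^sup>2"
    using assms(3)[of "x + t *\<^sub>R axis i 1"] assms(3)[of x] by linarith
  then have "\<bar>partial i \<psi> x\<bar> * t \<le> (2 * A / t + (real CARD('d))\<^sup>2 * B * t) * t"
  proof -
    have "(2 * A / t + (real CARD('d))\<^sup>2 * B * t) * t = 2 * A + (real CARD('d))\<^sup>2 * B * t\<^sup>2"
      using assms(4) by (simp add: field_simps power2_eq_square)
    moreover have "\<bar>t * partial i \<psi> x\<bar> = \<bar>partial i \<psi> x\<bar> * t" using assms(4) by (simp add: abs_mult)
    ultimately show ?thesis using \<open>\<bar>t * partial i \<psi> x\<bar> \<le> _\<close> by linarith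
  qed
  then show ?thesis using assms(4) mult_le_cancel_right_pos by blast
qed

lemma uniform_limit_abs_le:
  assumes "uniform_limit UNIV f g sequentially" "\<And>j x. \<bar>f j x\<bar> \<le> (B::real)"
  shows "\<bar>g x\<bar> \<le> B"
proof (rule tendsto_upperbound)
  show "(\<lambda>j. \<bar>f j x\<bar>) \<longlonglongrightarrow> \<bar>g x\<bar>"
    using assms(1) by (intro tendsto_rabs tendsto_uniform_limitI[where S = UNIV]) auto
qed (use assms in auto)

lemma uniformly_Cauchy_partial:
  fixes \<phi> :: "nat \<Rightarrow> real^'d::finite \<Rightarrow> real"
  assumes sm: "\<And>j. smb (\<phi> j)" and b: "\<And>j. bd 2 C (\<phi> j)"
    and lim: "uniform_limit UNIV \<phi> \<psi> sequentially"
  shows "uniformly_Cauchy_on UNIV (\<lambda>j. partial i (\<phi> j))"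
proof (rule uniformly_Cauchy_onI)
  fix e :: real assume e: "e > 0"
  have C: "C \<ge> 0" using bd_nonneg[OF b] .
  define k where "k = (real CARD('d))\<^sup>2 * (C + C)"
  have k: "k \<ge> 0" using C by (simp add: k_def)
  \<comment> \<open>\<open>t\<close> makes the curvature term at most e/4; then \<open>A\<close>
    makes \<open>2 * A / t\<close> equal to e/4.\<close>
  define t where "t = e / (4 * (k + 1))"
  have t: "t > 0" using e k by (simp add: t_def)
  have kt: "k * t \<le> e / 4" using e k by (simp add: t_def field_simps)
  define A where "A = e * t / 8"
  have A: "A > 0" using e t by (simp add: A_def)
  have "uniformly_Cauchy_on UNIV \<phi>"
    using lim uniformly_convergent_Cauchy uniformly_convergent_on_def by blast
  then obtain M where M: "\<And>x m n. m \<ge> M \<Longrightarrow> n \<ge> M \<Longrightarrow> dist (\<phi> m x) (\<phi> n x) < A"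
    using A unfolding uniformly_Cauchy_on_def by blast
  show "\<exists>M. \<forall>x\<in>UNIV. \<forall>m\<ge>M. \<forall>n\<ge>M. dist (partial i (\<phi> m) x) (partial i (\<phi> n) x) < e"
  proof (intro exI ballI allI impI)
    fix x m n assume mn: "M \<le> m" "M \<le> n"
    have "\<bar>partial i (\<lambda>x. \<phi> m x - \<phi> n x) x\<bar> \<le> 2 * A / t + (real CARD('d))\<^sup>2 * (C + C) * t"
    proof (rule interpolation)
      show "smb (\<lambda>x. \<phi> m x - \<phi> n x)" by (intro smb_intros sm)
      show "bd 2 (C + C) (\<lambda>x. \<phi> m x - \<phi> n x)" by (intro bd_diff smb_Cb sm b)
      show "\<bar>\<phi> m x - \<phi> n x\<bar> \<le> A" for x using M[OF mn, of x] by (simp add: dist_real_def)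
    qed (rule t)
    also have "\<dots> < e" using kt t e by (simp add: A_def k_def)
    finally show "dist (partial i (\<phi> m) x) (partial i (\<phi> n) x) < e"
      using pderivs_diff[OF smb_Cb[OF sm] smb_Cb[OF sm], of "[i]" 1 m n]
      by (simp add: dist_real_def)
  qed
qed

text \<open>By interpolation, uniform convergence of functions with a common bound on second
  derivatives implies uniform convergence of the gradients; this is iterated one order at a time. It
  serves both for mollifications and for the final diagonal sequence.\<close>

lemma smooth_limit:
  fixes \<phi> :: "nat \<Rightarrow> real^'d::finite \<Rightarrow> real"
  assumes "\<And>j. smb (\<phi> j)" "\<And>j. bd (Suc n) C (\<phi> j)" "uniform_limit UNIV \<phi> \<psi> sequentially"
  shows "Cb n \<psi> \<and> (\<forall>is. length is \<le> n \<longrightarrow>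
    uniform_limit UNIV (\<lambda>j. foldr partial is (\<phi> j)) (foldr partial is \<psi>) sequentially)"
  using assms
proof (induction n arbitrary: \<phi> \<psi>)
  case (0 \<phi> \<psi>)
  have pt: "(\<lambda>j. \<phi> j x) \<longlonglongrightarrow> \<psi> x" for x
    using 0(3) by (rule tendsto_uniform_limitI) auto
  have C: "C \<ge> 0" using bd_nonneg[OF 0(2)] .
  have "lipb \<psi>"
  proof (rule lipbI)
    show "\<bar>\<psi> x\<bar> \<le> C" for x
      by (rule uniform_limit_abs_le[OF 0(3)]) (rule bd0[OF 0(2)])
    fix x y
    have "\<bar>\<phi> j x - \<phi> j y\<bar> \<le> real CARD('d) * norm (x - y) * C" for j
      using increment_bound[of "\<phi> j" C y "x - y"] smb_differentiable[OF 0(1)] bd1[OF 0(2)] by auto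
    moreover have "(\<lambda>j. \<bar>\<phi> j x - \<phi> j y\<bar>) \<longlonglongrightarrow> \<bar>\<psi> x - \<psi> y\<bar>" by (intro tendsto_intros pt)
    ultimately have "\<bar>\<psi> x - \<psi> y\<bar> \<le> real CARD('d) * norm (x - y) * C"
      by (intro tendsto_upperbound) auto
    then show "\<bar>\<psi> x - \<psi> y\<bar> \<le> (real CARD('d) * C) * dist x y" by (simp add: dist_norm mult_ac)
  qed
  then show ?case using 0(3) by simp
next
  case (Suc n \<phi> \<psi>)
  have sm: "\<And>j. smb (\<phi> j)" by fact
  have b: "\<And>j. bd (Suc (Suc n)) C (\<phi> j)" by fact
  have b2: "bd 2 C (\<phi> j)" for j using b bd_mono[of "Suc (Suc n)" C "\<phi> j" 2 C] by auto
  have lim: "uniform_limit UNIV \<phi> \<psi> sequentially" by fact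
  have "\<exists>g. uniform_limit UNIV (\<lambda>j. partial i (\<phi> j)) g sequentially" for i
    using Cauchy_uniformly_convergent[OF uniformly_Cauchy_partial[OF sm b2 lim]] uniformly_convergent_on_def
    by blast
  then obtain g where g: "\<And>i. uniform_limit UNIV (\<lambda>j. partial i (\<phi> j)) (g i) sequentially" by metis
  have pt: "(\<lambda>j. \<phi> j x) \<longlonglongrightarrow> \<psi> x" for x
    using lim by (rule tendsto_uniform_limitI) auto
  have ptg: "(\<lambda>j. partial i (\<phi> j) x) \<longlonglongrightarrow> g i x" for x i
    using g by (rule tendsto_uniform_limitI) auto
  have quad: "\<bar>\<psi> (x + y) - \<psi> x - (\<Sum>i\<in>UNIV. y $ i * g i x)\<bar> \<le> (real CARD('d))\<^sup>2 * C * (norm y)\<^sup>2" for x y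
  proof (rule tendsto_upperbound)
    show "(\<lambda>j. \<bar>\<phi> j (x + y) - \<phi> j x - (\<Sum>i\<in>UNIV. y $ i * partial i (\<phi> j) x)\<bar>) \<longlonglongrightarrow>
        \<bar>\<psi> (x + y) - \<psi> x - (\<Sum>i\<in>UNIV. y $ i * g i x)\<bar>"
      by (intro tendsto_intros pt ptg)
    show "\<forall>\<^sub>F j in sequentially. \<bar>\<phi> j (x + y) - \<phi> j x - (\<Sum>i\<in>UNIV. y $ i * partial i (\<phi> j) x)\<bar> \<le> (real CARD('d))\<^sup>2 * C * (norm y)\<^sup>2"
      by (intro always_eventually allI quadratic_remainder sm b2)
  qed simp
  have d: "\<psi> differentiable at x" and p: "partial i \<psi> = g i" for x i
    by (rule partial_quadratic_eq[of \<psi> g, OF quad])+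
  have IH: "Cb n (g i)" "\<And>is. length is \<le> n \<Longrightarrow>
      uniform_limit UNIV (\<lambda>j. foldr partial is (partial i (\<phi> j))) (foldr partial is (g i)) sequentially" for i
    using Suc.IH[of "\<lambda>j. partial i (\<phi> j)" "g i"] smb_partial[OF sm] bd_partial[OF b] g by blast+
  have "lipb \<psi>"
  proof (rule lipbI)
    show "\<bar>\<psi> x\<bar> \<le> C" for x
      by (rule uniform_limit_abs_le[OF lim]) (rule bd0[OF b])
    have gb: "\<bar>partial i \<psi> x\<bar> \<le> C" for i x unfolding p
      by (rule uniform_limit_abs_le[OF g]) (rule bd1[OF b])
    show "\<bar>\<psi> x - \<psi> y\<bar> \<le> (real CARD('d) * C) * dist x y" for x y
      using increment_bound[of \<psi> C y "x - y"] d gb by (simp add: dist_norm mult_ac)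
  qed
  then have "Cb (Suc n) \<psi>" using d p IH by simp
  moreover have "uniform_limit UNIV (\<lambda>j. foldr partial is (\<phi> j)) (foldr partial is \<psi>) sequentially"
    if "length is \<le> Suc n" for "is"
  proof (cases "is" rule: rev_cases)
    case Nil
    then show ?thesis using lim by simp
  next
    case (snoc js i)
    then show ?thesis using IH(2)[of js i] that p by simp
  qed
  ultimately show ?case by blast
qed

lemma uniform_limit_seq_iff:
  "uniform_limit UNIV \<phi> \<psi> sequentially \<longleftrightarrow> (\<forall>e>0. \<exists>N. \<forall>n\<ge>N. \<forall>x. \<bar>\<phi> n x - \<psi> x\<bar> < (e::real))"
  by (simp add: uniform_limit_iff eventually_sequentially dist_real_def)

subsection \<open>Test functions\<close>

lemma smooth_iff: "smooth \<phi> \<longleftrightarrow> (\<forall>is x. foldr partial is \<phi> differentiable at x)"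
  by (simp add: smooth_def differentiable_on_def)

text \<open>The derivatives of a member never leave the class, so no formula for iterated
  derivatives is needed.\<close>

lemma smooth_coinduct:
  assumes "P f" "\<And>f x. P f \<Longrightarrow> f differentiable at x" "\<And>f i. P f \<Longrightarrow> P (partial i f)"
  shows "smooth f"
proof -
  have "P (foldr partial is f)" for "is"
    by (induction "is") (auto intro: assms)
  then show ?thesis unfolding smooth_iff using assms(2) by blast
qed

lemma smb_smooth: "smb f \<Longrightarrow> smooth f"
  by (rule smooth_coinduct[of smb]) (auto intro: smb_differentiable smb_partial)

lemma smbI:
  fixes f :: "real^'d::finite \<Rightarrow> real"
  assumes "smooth f" "\<And>is. \<exists>B. \<forall>x. \<bar>foldr partial is f x\<bar> \<le> B"
  shows "smb f"
proof -
  have lip: "lipb (foldr partial is f)" for "is"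
  proof -
    obtain B where B: "\<And>x. \<bar>foldr partial is f x\<bar> \<le> B" using assms(2) by metis
    have "\<exists>C. \<forall>i x. \<bar>partial i (foldr partial is f) x\<bar> \<le> C"
    proof -
      have "\<forall>i. \<exists>C. \<forall>x. \<bar>partial i (foldr partial is f) x\<bar> \<le> C"
        using assms(2)[of "_ # is"] by simp
      then obtain C where C: "\<And>i x. \<bar>partial i (foldr partial is f) x\<bar> \<le> C i" by metis
      have "C i \<le> (\<Sum>i\<in>UNIV. C i)" for i
        by (rule member_le_sum) (use order_trans[OF abs_ge_zero C] in auto)
      then show ?thesis using C order_trans by metis
    qed
    then obtain C where C: "\<And>i x. \<bar>partial i (foldr partial is f) x\<bar> \<le> C" by blast
    have d: "foldr partial is f differentiable at x" for x using assms(1) smooth_iff by blast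
    show ?thesis
    proof (rule lipbI[OF B])
      show "\<bar>foldr partial is f x - foldr partial is f y\<bar> \<le> (real CARD('d) * C) * dist x y" for x y
        using increment_bound[OF d C, of y "x - y"] by (simp add: dist_norm mult_ac)
    qed
  qed
  have "Cb n (foldr partial is f)" for n "is"
  proof (induction n arbitrary: "is")
    case (Suc n)
    have "Cb n (partial i (foldr partial is f))" for i using Suc[of "i # is"] by simp
    then show ?case using lip assms(1)[unfolded smooth_iff] by simp
  qed (simp add: lip)
  from this[of _ "[]"] show ?thesis by (simp add: smb_def)
qed

lemma pderivs_outside:
  fixes f :: "real^'d::finite \<Rightarrow> real"
  assumes "closed K" "\<And>x. x \<notin> K \<Longrightarrow> f x = 0" "x \<notin> K"
  shows "foldr partial is f x = 0"
  using assms(3)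
proof (induction "is" arbitrary: x)
  case (Cons i "is")
  have "((\<lambda>y. 0) has_derivative (\<lambda>y. 0)) (at x)" by (rule has_derivative_const)
  then have "(foldr partial is f has_derivative (\<lambda>y. 0)) (at x)"
    by (rule has_derivative_transform_within_open[of _ _ _ _ "- K"])
      (use assms(1) Cons in auto)
  then show ?case using has_derivative_partial_eq by fastforce
qed (use assms in auto)

lemma test_functionE:
  assumes "test_function (\<phi> :: real^'d::finite \<Rightarrow> real)"
  obtains R where "R > 0" "\<And>x is. R < norm x \<Longrightarrow> foldr partial is \<phi> x = 0"
proof -
  have "bounded (closure {x. \<phi> x \<noteq> 0})" using assms compact_imp_bounded test_function_def by blast
  then obtain R where R: "R > 0" "\<And>x. x \<in> closure {x. \<phi> x \<noteq> 0} \<Longrightarrow> norm x \<le> R"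
    unfolding bounded_pos by blast
  show thesis
  proof (rule that[OF R(1)])
    fix x :: "real^'d" and "is" :: "'d list" assume "R < norm x"
    then have "x \<notin> closure {x. \<phi> x \<noteq> 0}" using R(2) by force
    then show "foldr partial is \<phi> x = 0"
      by (rule pderivs_outside[rotated 2]) (use closure_subset[of "{x. \<phi> x \<noteq> 0}"] in auto)
  qed
qed

lemma compact_support_bounded:
  fixes f :: "'a::euclidean_space \<Rightarrow> real"
  assumes "continuous_on UNIV f" "\<And>x. R < norm x \<Longrightarrow> f x = 0"
  shows "\<exists>B. \<forall>x. \<bar>f x\<bar> \<le> B"
proof -
  have "bounded (f ` cball 0 R)"
    by (intro compact_imp_bounded compact_continuous_image continuous_on_subset[OF assms(1)]) auto
  then obtain B where "\<And>x. x \<in> cball 0 R \<Longrightarrow> \<bar>f x\<bar> \<le> B" unfolding bounded_iff by (metis image_eqI real_norm_def)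
  then have "\<bar>f x\<bar> \<le> \<bar>B\<bar>" for x
    using assms(2)[of x] by (cases "norm x \<le> R") (force simp: mem_cball_0)+
  then show ?thesis by blast
qed

lemma test_smb:
  assumes "test_function \<phi>" shows "smb \<phi>"
proof (rule smbI)
  show sm: "smooth \<phi>" using assms by (simp add: test_function_def)
  obtain R where R: "\<And>x is. R < norm x \<Longrightarrow> foldr partial is \<phi> x = 0" using assms by (rule test_functionE) blast
  show "\<exists>B. \<forall>x. \<bar>foldr partial is \<phi> x\<bar> \<le> B" for "is"
  proof (rule compact_support_bounded)
    show "continuous_on UNIV (foldr partial is \<phi>)"
      using sm unfolding smooth_def by (meson differentiable_imp_continuous_on)
  qed (rule R)
qed

lemma test_functionI:
  fixes \<phi> :: "real^'d::finite \<Rightarrow> real"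
  assumes "smooth \<phi>" "\<And>x. R < norm x \<Longrightarrow> \<phi> x = 0"
  shows "test_function \<phi>"
proof -
  have "{x. \<phi> x \<noteq> 0} \<subseteq> cball 0 R" using assms(2) by force
  then have "closure {x. \<phi> x \<noteq> 0} \<subseteq> cball 0 R" by (simp add: closure_minimal)
  then have "compact (closure {x. \<phi> x \<noteq> 0})"
    by (meson bounded_cball bounded_subset closed_closure compact_eq_bounded_closed)
  then show ?thesis using assms(1) by (simp add: test_function_def)
qed

lemma test_pderivs: "test_function \<phi> \<Longrightarrow> test_function (foldr partial is \<phi>)"
proof -
  assume a: "test_function \<phi>"
  then obtain R where R: "\<And>x is. R < norm x \<Longrightarrow> foldr partial is \<phi> x = 0" by (rule test_functionE) blast
  show ?thesis
    by (rule test_functionI[of _ R, OF smb_smooth[OF smb_pderivs[OF test_smb[OF a]]] R])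
qed

lemma ex_list_count: "\<exists>is. \<forall>i. count_list is i = \<alpha> i" for \<alpha> :: "'d::finite \<Rightarrow> nat"
proof -
  obtain "is" where "mset is = Abs_multiset \<alpha>" using ex_mset by blast
  then have "count (mset is) i = \<alpha> i" for i by (simp add: Abs_multiset_inverse)
  then show ?thesis by (metis count_mset)
qed

lemma mi_order_count: "\<forall>i. count_list is i = \<alpha> i \<Longrightarrow> mi_order \<alpha> = length is"
proof -
  assume a: "\<forall>i. count_list is i = \<alpha> i"
  have "mi_order \<alpha> = (\<Sum>i\<in>UNIV. count_list is i)" using a by (simp add: mi_order_def)
  also have "\<dots> = (\<Sum>i\<in>set is. count_list is i)"
    by (rule sum.mono_neutral_right) (auto simp: count_list_0_iff)
  also have "\<dots> = length is" by (rule sum_count_set) auto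
  finally show ?thesis .
qed

lemma classical_deriv_eq:
  assumes "smb \<phi>" "\<forall>i. count_list is i = \<alpha> i"
  shows "classical_deriv \<alpha> \<phi> = foldr partial is \<phi>"
  unfolding classical_deriv_def
proof (rule pderivs_mset_cong[OF assms(1)])
  have "\<forall>i. count_list (SOME is. \<forall>i. count_list is i = \<alpha> i) i = \<alpha> i"
    using ex_list_count by (rule someI_ex)
  then show "mset (SOME is. \<forall>i. count_list is i = \<alpha> i) = mset is"
    using assms(2) by (intro multiset_eqI) (simp add: count_mset)
qed

subsection \<open>Bump functions\<close>

text \<open>Carrying a polynomial as parameter makes the family closed under differentiation: the
  derivative of p(1/t) exp(-1/t) has the same form with p(s) replaced by s^2 (p(s) - p'(s)).\<close>

definition expf :: "real poly \<Rightarrow> real \<Rightarrow> real" where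
  "expf p t = (if t > 0 then poly p (1 / t) * exp (- (1 / t)) else 0)"

lemma poly_div_exp_tendsto: "((\<lambda>s. poly p s * exp (- s)) \<longlongrightarrow> (0::real)) at_top"
proof -
  have "((\<lambda>s. \<Sum>i\<le>degree p. coeff p i * (s ^ i / exp s)) \<longlongrightarrow> (\<Sum>i\<le>degree p. coeff p i * 0)) at_top"
    by (intro tendsto_intros tendsto_power_div_exp_0)
  then show ?thesis
    by (simp add: poly_altdef sum_distrib_right exp_minus divide_inverse mult.assoc)
qed

lemma expf_has_derivative:
  "(expf p has_real_derivative expf (monom 1 2 * (p - pderiv p)) t) (at t)"
proof -
  consider "t > 0" | "t < 0" | "t = 0" by linarith
  then show ?thesis
  proof cases
    case 1
    have "((\<lambda>t. poly p (1 / t) * exp (- (1 / t))) has_real_derivative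
        expf (monom 1 2 * (p - pderiv p)) t) (at t)"
      using 1 by (auto intro!: derivative_eq_intros DERIV_chain2[OF poly_DERIV]
          simp: expf_def poly_monom field_simps power2_eq_square)
    then show ?thesis
      by (rule has_field_derivative_transform_within_open[of _ _ _ "{0<..}"]) (use 1 in \<open>auto simp: expf_def\<close>)
  next
    case 2
    have "((\<lambda>t. 0) has_real_derivative expf (monom 1 2 * (p - pderiv p)) t) (at t)"
      using 2 by (simp add: expf_def)
    then show ?thesis
      by (rule has_field_derivative_transform_within_open[of _ _ _ "{..<0}"]) (use 2 in \<open>auto simp: expf_def\<close>)
  next
    case 3
    have "((\<lambda>h. expf p h / h) \<longlongrightarrow> 0) (at_left 0)"
      by (rule tendsto_eventually) (auto simp: eventually_at_filter expf_def)
    moreover have "((\<lambda>h. expf p h / h) \<longlongrightarrow> 0) (at_right 0)"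
    proof -
      have "((\<lambda>s. expf p (inverse s) / inverse s) \<longlongrightarrow> 0) at_top"
      proof (rule tendsto_cong[THEN iffD1])
        \<comment> \<open>With h = 1/s, division by h becomes multiplication by s, that is,
          \<open>pCons 0 p\<close> in place of \<open>p\<close>.\<close>
        show "((\<lambda>s. poly (pCons 0 p) s * exp (- s)) \<longlongrightarrow> (0::real)) at_top" by (rule poly_div_exp_tendsto)
        show "\<forall>\<^sub>F s in at_top. poly (pCons 0 p) s * exp (- s) = expf p (inverse s) / inverse s"
          using eventually_gt_at_top[of 0]
          by eventually_elim (auto simp: expf_def divide_simps)
      qed
      then show ?thesis by (simp add: filterlim_at_right_to_top)
    qed
    ultimately have "((\<lambda>h. expf p h / h) \<longlongrightarrow> 0) (at 0)"
      by (simp add: filterlim_split_at)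
    then show ?thesis using 3 by (simp add: has_field_derivative_iff expf_def)
  qed
qed

text \<open>An algebra stable under all partial derivatives: products of one-dimensional profiles
  are smooth by closure, without a formula for their derivatives.\<close>

inductive_set bumpalg :: "(real^'d::finite \<Rightarrow> real) set" where
  gen: "(\<lambda>x. expf p (a + b * x $ i)) \<in> bumpalg"
| const: "(\<lambda>x. a) \<in> bumpalg"
| add: "f \<in> bumpalg \<Longrightarrow> g \<in> bumpalg \<Longrightarrow> (\<lambda>x. f x + g x) \<in> bumpalg"
| mult: "f \<in> bumpalg \<Longrightarrow> g \<in> bumpalg \<Longrightarrow> (\<lambda>x. f x * g x) \<in> bumpalg"

lemma bumpalg_closed:
  assumes "f \<in> bumpalg"
  shows "(\<forall>x. f differentiable at x) \<and> (\<forall>j. partial j f \<in> bumpalg)"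
  using assms
proof induction
  case (gen p a b i)
  define p' where "p' = monom 1 2 * (p - pderiv p)"
  have d: "((\<lambda>x::real^'a. expf p (a + b * x $ i)) has_derivative (\<lambda>y. b * y $ i * expf p' (a + b * x $ i))) (at x)" for x
  proof -
    have "((\<lambda>x::real^'a. a + b * x $ i) has_derivative (\<lambda>y. b * y $ i)) (at x)"
      by (auto intro!: derivative_eq_intros bounded_linear.has_derivative[OF bounded_linear_vec_nth])
    from has_derivative_compose[OF this expf_has_derivative[unfolded has_field_derivative_def]]
    show ?thesis by (rule has_derivative_eq_rhs) (auto simp: p'_def mult_ac)
  qed
  have "partial j (\<lambda>x::real^'a. expf p (a + b * x $ i)) = (\<lambda>x. (if i = j then b else 0) * expf p' (a + b * x $ i))" for j
    unfolding has_derivative_partial_eq[OF d] fun_eq_iff by (auto simp: axis_def)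
  moreover have "(\<lambda>x::real^'a. (if i = j then b else 0) * expf p' (a + b * x $ i)) \<in> bumpalg" for j
    by (intro bumpalg.mult bumpalg.const bumpalg.gen)
  ultimately show ?case using d unfolding differentiable_def by auto
next
  case (mult f g)
  then show ?case
    by (auto simp: partial_mult intro!: derivative_intros bumpalg.add bumpalg.mult)
qed (auto simp: partial_add partial_const intro: bumpalg.intros intro!: derivative_intros)

lemma bumpalg_smooth: "f \<in> bumpalg \<Longrightarrow> smooth f"
  by (rule smooth_coinduct[of "\<lambda>f. f \<in> bumpalg"]) (use bumpalg_closed in blast)+

lemma bumpalg_prod: "(\<And>i. i \<in> I \<Longrightarrow> f i \<in> bumpalg) \<Longrightarrow> (\<lambda>x. \<Prod>i\<in>I. f i x) \<in> bumpalg"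
  by (induction I rule: infinite_finite_induct) (auto intro: bumpalg.intros)

text \<open>Nonzero exactly on the open cube of half-width 1/(n+1) around 0: for each coordinate one
  factor cuts off from below, the other from above.\<close>

definition bump0 :: "nat \<Rightarrow> real^'d::finite \<Rightarrow> real" where
  "bump0 n x = (\<Prod>i\<in>UNIV. expf 1 (1 + real (Suc n) * x $ i) * expf 1 (1 + (- real (Suc n)) * x $ i))"

definition bump :: "nat \<Rightarrow> real^'d::finite \<Rightarrow> real" where
  "bump n x = inverse (LINT x|lborel. bump0 n (x :: real^'d)) * bump0 n x"

lemma expf_nonneg: "0 \<le> expf 1 t" by (simp add: expf_def)

lemma bump0_nonneg: "0 \<le> bump0 n x"
  unfolding bump0_def by (intro prod_nonneg ballI mult_nonneg_nonneg expf_nonneg)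

lemma bump0_pos: "0 < bump0 n 0"
  unfolding bump0_def by (intro prod_pos) (auto simp: expf_def)

lemma bump0_support:
  fixes x :: "real^'d::finite"
  assumes "real CARD('d) / real (Suc n) < norm x"
  shows "bump0 n x = 0"
proof (rule ccontr)
  assume "bump0 n x \<noteq> 0"
  then have "expf 1 (1 + real (Suc n) * x $ i) \<noteq> 0 \<and> expf 1 (1 + (- real (Suc n)) * x $ i) \<noteq> 0" for i
    unfolding bump0_def by auto
  then have "0 < 1 + real (Suc n) * x $ i \<and> 0 < 1 + (- real (Suc n)) * x $ i" for i
    unfolding expf_def by metis
  then have "\<bar>x $ i\<bar> \<le> 1 / real (Suc n)" for i
    by (auto simp: abs_le_iff field_simps) (smt (verit))+
  then have "(\<Sum>i\<in>UNIV. \<bar>x $ i\<bar>) \<le> (\<Sum>i\<in>(UNIV::'d set). 1 / real (Suc n))" by (intro sum_mono) auto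
  then show False using assms norm_le_l1_cart[of x] by simp
qed

lemma bump0_test: "test_function (bump0 n :: real^'d::finite \<Rightarrow> real)"
proof (rule test_functionI[OF _ bump0_support])
  have "(bump0 n :: real^'d \<Rightarrow> real) \<in> bumpalg"
    unfolding bump0_def[abs_def] by (intro bumpalg_prod bumpalg.mult bumpalg.gen)
  then show "smooth (bump0 n :: real^'d \<Rightarrow> real)" by (rule bumpalg_smooth)
qed

lemma test_continuous: "test_function \<phi> \<Longrightarrow> continuous_on S \<phi>"
  by (simp add: lipb_continuous smb_lipb test_smb)

lemma test_measurable: "test_function \<phi> \<Longrightarrow> \<phi> \<in> borel_measurable borel"
  by (simp add: borel_measurable_continuous_onI test_continuous)

lemma locally_integrable_test_mult:
  fixes f \<phi> :: "real^'d::finite \<Rightarrow> real"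
  assumes "locally_integrable f" "continuous_on UNIV \<phi>" "\<And>x. R < norm x \<Longrightarrow> \<phi> x = 0"
  shows "integrable lborel (\<lambda>x. f x * \<phi> x)"
proof -
  obtain B where B: "\<And>x. \<bar>\<phi> x\<bar> \<le> B" using compact_support_bounded[OF assms(2,3)] by blast
  have i: "integrable lborel (\<lambda>x. indicat_real (cball 0 R) x * f x)"
    using assms(1) compact_cball unfolding locally_integrable_def set_integrable_def by auto
  have eq: "(\<lambda>x. f x * \<phi> x) = (\<lambda>x. (indicat_real (cball 0 R) x * f x) * \<phi> x)"
    using assms(3) by (force simp: indicator_def fun_eq_iff)
  have [measurable]: "\<phi> \<in> borel_measurable borel" using assms(2) by (rule borel_measurable_continuous_onI)
  have [measurable]: "(\<lambda>x. indicat_real (cball 0 R) x * f x) \<in> borel_measurable lborel"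
    using i by (rule borel_measurable_integrable)
  show ?thesis unfolding eq
  proof (rule Bochner_Integration.integrable_bound[OF integrable_mult_right[OF i, of B]])
    show "AE x in lborel. norm (indicat_real (cball 0 R) x * f x * \<phi> x) \<le> norm (B * (indicat_real (cball 0 R) x * f x))"
    proof (intro AE_I2)
      fix x
      have "\<bar>\<phi> x\<bar> \<le> \<bar>B\<bar>" using B[of x] by linarith
      then have "\<bar>indicat_real (cball 0 R) x * f x\<bar> * \<bar>\<phi> x\<bar> \<le> \<bar>indicat_real (cball 0 R) x * f x\<bar> * \<bar>B\<bar>"
        by (intro mult_left_mono) auto
      then show "norm (indicat_real (cball 0 R) x * f x * \<phi> x) \<le> norm (B * (indicat_real (cball 0 R) x * f x))"
        by (simp add: abs_mult mult_ac)
    qed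
  qed simp
qed

lemma continuous_locally_integrable:
  fixes f :: "real^'d::finite \<Rightarrow> real"
  assumes "continuous_on UNIV f" shows "locally_integrable f"
  unfolding locally_integrable_def set_integrable_def
proof (intro allI impI)
  fix S :: "(real^'d) set" assume "compact S"
  then show "integrable lborel (\<lambda>x. indicator S x *\<^sub>R f x)"
    using borel_integrable_compact[of S f] continuous_on_subset[OF assms] by auto
qed

lemma integrable_continuous_compact_support:
  fixes \<phi> :: "real^'d::finite \<Rightarrow> real"
  assumes "continuous_on UNIV \<phi>" "\<And>x. R < norm x \<Longrightarrow> \<phi> x = 0"
  shows "integrable lborel \<phi>"
  using locally_integrable_test_mult[OF continuous_locally_integrable, of "\<lambda>_. 1" \<phi> R] assms by simp

lemma test_integrable: "test_function (\<phi> :: real^'d::finite \<Rightarrow> real) \<Longrightarrow> integrable lborel \<phi>"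
  by (metis foldr.simps(1) id_apply integrable_continuous_compact_support test_continuous test_functionE)

lemma locally_integrable_test: "locally_integrable f \<Longrightarrow> test_function \<phi> \<Longrightarrow> integrable lborel (\<lambda>x. f x * \<phi> x)"
  by (metis foldr.simps(1) id_apply locally_integrable_test_mult test_continuous test_functionE)

lemma continuous_AE_eq_0:
  fixes f :: "'a::euclidean_space \<Rightarrow> real"
  assumes "continuous_on UNIV f" "AE x in lborel. f x = 0"
  shows "f x = 0"
proof (rule ccontr)
  assume "f x \<noteq> 0"
  have o: "open {x. f x \<noteq> 0}" by (intro open_Collect_neq assms continuous_intros)
  have "{x. f x \<noteq> 0} \<in> null_sets lborel"
    using assms(2) AE_iff_null_sets[of "{x. f x \<noteq> 0}" lborel] o by auto
  then have "negligible {x. f x \<noteq> 0}" by (simp add: negligible_iff_null_sets null_sets_completionI)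
  then show False using open_not_negligible[OF o] \<open>f x \<noteq> 0\<close> by blast
qed

lemma bump0_integral_pos: "0 < (LINT x|lborel. bump0 n (x :: real^'d::finite))"
proof -
  have i: "integrable lborel (bump0 n :: real^'d \<Rightarrow> real)" by (intro test_integrable bump0_test)
  have "0 \<le> (LINT x|lborel. bump0 n (x :: real^'d))" by (intro integral_nonneg_AE) (simp add: bump0_nonneg)
  moreover have "(LINT x|lborel. bump0 n (x :: real^'d)) \<noteq> 0"
  proof
    assume "(LINT x|lborel. bump0 n (x :: real^'d)) = 0"
    then have "AE x in lborel. bump0 n (x :: real^'d) = 0"
      using integral_nonneg_eq_0_iff_AE[OF i] bump0_nonneg by auto
    then have "bump0 n (0::real^'d) = 0"
      by (rule continuous_AE_eq_0[OF test_continuous[OF bump0_test]])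
    then show False using bump0_pos[of n, where 'a='d] by simp
  qed
  ultimately show ?thesis by simp
qed

lemma bump_nonneg: "0 \<le> bump n (x :: real^'d::finite)"
  using bump0_integral_pos[of n, where 'd='d] by (simp add: bump_def bump0_nonneg)

lemma bump_support:
  fixes x :: "real^'d::finite"
  shows "real CARD('d) / real (Suc n) < norm x \<Longrightarrow> bump n x = 0"
  by (simp add: bump_def bump0_support del: of_nat_Suc)

lemma bump_test: "test_function (bump n :: real^'d::finite \<Rightarrow> real)"
  by (rule test_functionI[OF _ bump_support])
    (unfold bump_def[abs_def], intro smb_smooth smb_intros test_smb bump0_test)

lemma bump_integral: "(LINT x|lborel. bump n (x :: real^'d::finite)) = 1"
  using bump0_integral_pos[of n, where 'd='d] by (simp add: bump_def)

subsection \<open>Convolution\<close>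

definition conv :: "(real^'d::finite \<Rightarrow> real) \<Rightarrow> (real^'d \<Rightarrow> real) \<Rightarrow> real^'d \<Rightarrow> real" where
  "conv \<phi> \<kappa> x = (LINT z|lborel. \<phi> z * \<kappa> (x - z))"

lemma lborel_reflect: "distr lborel borel (\<lambda>z. x - z) = (lborel :: ('a::euclidean_space) measure)"
  using lborel_affine[of "-1" x] by (simp add: density_1)

lemma integral_reflect_lborel:
  fixes g :: "'a::euclidean_space \<Rightarrow> real"
  assumes [measurable]: "g \<in> borel_measurable borel"
  shows "(LINT z|lborel. g (x - z)) = (LINT z|lborel. g z)"
  by (subst (2) lborel_reflect[of x, symmetric]) (subst integral_distr; simp)

lemma integral_translate_lborel:
  fixes g :: "'a::euclidean_space \<Rightarrow> real"
  assumes [measurable]: "g \<in> borel_measurable borel"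
  shows "(LINT z|lborel. g (z + a)) = (LINT z|lborel. g z)"
  by (subst (2) lborel_distr_plus[of a, symmetric]) (subst integral_distr; simp add: add.commute)

lemma smb_reflect:
  assumes "smb \<kappa>"
  shows "smooth (\<lambda>z. \<kappa> (x - z))"
    "foldr partial is (\<lambda>z. \<kappa> (x - z)) = (\<lambda>z. (-1) ^ length is * foldr partial is \<kappa> (x - z))"
proof -
  have d: "((\<lambda>z. \<kappa> (x - z)) has_derivative (\<lambda>y. \<Sum>i\<in>UNIV. (- y) $ i * partial i \<kappa> (x - z))) (at z)"
    if "smb \<kappa>" for \<kappa> :: "real^'a \<Rightarrow> real" and z
  proof -
    have "((\<lambda>z. x - z) has_derivative (\<lambda>y. - y)) (at z)" by (auto intro!: derivative_eq_intros)
    from has_derivative_compose[OF this has_derivative_partial[OF smb_differentiable[OF that]]]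
    show ?thesis .
  qed
  have p: "partial i (\<lambda>z. a * \<kappa> (x - z)) = (\<lambda>z. (- a) * partial i \<kappa> (x - z))"
    if "smb \<kappa>" for \<kappa> :: "real^'a \<Rightarrow> real" and i a
  proof
    fix z
    show "partial i (\<lambda>z. a * \<kappa> (x - z)) z = (- a) * partial i \<kappa> (x - z)"
      unfolding has_derivative_partial_eq[OF has_derivative_mult_right[OF d[OF that]]]
      by (simp add: axis_def if_distrib[of "\<lambda>t. t * _"] sum_negf cong: if_cong)
  qed
  show *: "foldr partial is (\<lambda>z. \<kappa> (x - z)) = (\<lambda>z. (-1) ^ length is * foldr partial is \<kappa> (x - z))" for "is"
  proof (induction "is")
    case (Cons i "is")
    then show ?case by (simp only: foldr.simps o_apply p[OF smb_pderivs[OF assms]]) simp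
  qed simp
  show "smooth (\<lambda>z. \<kappa> (x - z))"
    unfolding smooth_iff *
    using has_derivative_mult_right[OF d[OF smb_pderivs[OF assms]]] differentiable_def by blast
qed

lemma test_reflect:
  fixes \<kappa> :: "real^'d::finite \<Rightarrow> real"
  assumes "test_function \<kappa>"
  shows "test_function (\<lambda>z. \<kappa> (x - z))"
proof -
  obtain R where R: "R > 0" "\<And>x is. R < norm x \<Longrightarrow> foldr partial is \<kappa> x = 0" using assms by (rule test_functionE) blast
  show ?thesis
  proof (rule test_functionI[of _ "R + norm x", OF smb_reflect(1)[OF test_smb[OF assms]]])
    fix z :: "real^'d" assume "R + norm x < norm z"
    then have "R < norm (x - z)" using norm_triangle_ineq2[of z x] by (simp add: norm_minus_commute)
    then show "\<kappa> (x - z) = 0" using R(2)[of "x - z" "[]"] by simp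
  qed
qed

lemma conv_integrable: "locally_integrable \<phi> \<Longrightarrow> test_function \<kappa> \<Longrightarrow> integrable lborel (\<lambda>z. \<phi> z * \<kappa> (x - z))"
  by (intro locally_integrable_test test_reflect)

definition bmeas :: "(real^'d::finite \<Rightarrow> real) \<Rightarrow> bool" where
  "bmeas \<phi> \<longleftrightarrow> \<phi> \<in> borel_measurable borel \<and> bounded (range \<phi>)"

lemma bmeas_locally_integrable:
  assumes "bmeas \<phi>" shows "locally_integrable \<phi>"
  unfolding locally_integrable_def
proof (intro allI impI)
  fix S :: "(real^'a) set" assume S: "compact S"
  have [measurable]: "\<phi> \<in> borel_measurable borel" using assms by (simp add: bmeas_def)
  have [measurable]: "S \<in> sets borel" using S by (simp add: compact_imp_closed borel_closed)
  obtain B where B: "\<And>x. \<bar>\<phi> x\<bar> \<le> B" using assms unfolding bmeas_def bounded_iff by auto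
  have "integrable lborel (\<lambda>x. B * indicat_real S x)"
    using emeasure_bounded_finite[OF compact_imp_bounded[OF S]]
    by (intro integrable_mult_right integrable_real_indicator) auto
  then show "set_integrable lborel S \<phi>" unfolding set_integrable_def
  proof (rule Bochner_Integration.integrable_bound)
    show "AE x in lborel. norm (indicat_real S x *\<^sub>R \<phi> x) \<le> norm (B * indicat_real S x)"
      using B order_trans[OF B abs_ge_self] by (intro AE_I2) (auto simp: indicator_def)
  qed simp
qed

lemma lipb_bmeas: "lipb \<phi> \<Longrightarrow> bmeas \<phi>"
  unfolding bmeas_def by (intro conjI borel_measurable_continuous_onI lipb_continuous lipb_bounded)

lemma conv_abs_le:
  fixes \<kappa> :: "real^'d::finite \<Rightarrow> real"
  assumes "AE z in lborel. \<bar>g z\<bar> \<le> B" "locally_integrable g" "test_function \<kappa>"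
  shows "\<bar>conv g \<kappa> x\<bar> \<le> B * (LINT z|lborel. \<bar>\<kappa> z\<bar>)"
proof -
  have m[measurable]: "\<kappa> \<in> borel_measurable borel" by (rule test_measurable[OF assms(3)])
  have i: "integrable lborel (\<lambda>z. \<bar>\<kappa> (x - z)\<bar>)"
    by (intro integrable_abs test_integrable test_reflect assms)
  have "\<bar>conv g \<kappa> x\<bar> \<le> (LINT z|lborel. \<bar>g z * \<kappa> (x - z)\<bar>)"
    unfolding conv_def by (rule integral_abs_bound)
  also have "\<dots> \<le> (LINT z|lborel. B * \<bar>\<kappa> (x - z)\<bar>)"
  proof (rule integral_mono_AE)
    show "AE z in lborel. \<bar>g z * \<kappa> (x - z)\<bar> \<le> B * \<bar>\<kappa> (x - z)\<bar>"
      using assms(1) by eventually_elim (simp add: abs_mult mult_right_mono)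
  qed (intro integrable_abs conv_integrable assms integrable_mult_right i)+
  also have "\<dots> = B * (LINT z|lborel. \<bar>\<kappa> (x - z)\<bar>)" by simp
  also have "(LINT z|lborel. \<bar>\<kappa> (x - z)\<bar>) = (LINT z|lborel. \<bar>\<kappa> z\<bar>)"
    by (rule integral_reflect_lborel) simp
  finally show ?thesis .
qed

lemma conv_bump_abs_le:
  assumes "AE z in lborel. \<bar>g z\<bar> \<le> B" "locally_integrable g"
  shows "\<bar>conv g (bump n) x\<bar> \<le> B"
  using conv_abs_le[OF assms bump_test[of n], of x] by (simp add: bump_nonneg bump_integral)

text \<open>All derivatives fall on the kernel. Its Taylor remainder is quadratic in
  \<open>y\<close> and, for \<open>norm y \<le> 1\<close>, vanishes outside the ball of radius
  \<open>R + 1\<close>; integrating it costs only the volume \<open>V\<close> of that ball.\<close>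

lemma conv_differentiable:
  fixes \<kappa> :: "real^'d::finite \<Rightarrow> real"
  assumes "bmeas \<phi>" "test_function \<kappa>"
  shows "conv \<phi> \<kappa> differentiable at x" "partial i (conv \<phi> \<kappa>) = conv \<phi> (partial i \<kappa>)"
proof -
  obtain A where A: "\<And>x. \<bar>\<phi> x\<bar> \<le> A" using assms unfolding bmeas_def bounded_iff by auto
  have A0: "A \<ge> 0" using A[of 0] by linarith
  have li: "locally_integrable \<phi>" by (rule bmeas_locally_integrable[OF assms(1)])
  obtain R where R: "R > 0" "\<And>x is. R < norm x \<Longrightarrow> foldr partial is \<kappa> x = 0"
    using assms(2) by (rule test_functionE) blast
  obtain B where B: "bd 2 B \<kappa>" using smb_bd_ex test_smb[OF assms(2)] by blast
  have tp: "test_function (partial i \<kappa>)" for i using test_pderivs[OF assms(2), of "[i]"] by simp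
  have [measurable]: "\<kappa> \<in> borel_measurable borel" "partial i \<kappa> \<in> borel_measurable borel" "\<phi> \<in> borel_measurable borel" for i
    using test_measurable assms(2) tp assms(1) by (auto simp: bmeas_def)
  define V where "V = unit_ball_vol (real CARD('d)) * (R + 1) ^ CARD('d)"
  define C where "C = A * ((real CARD('d))\<^sup>2 * B)"
  have B0: "B \<ge> 0" using bd_nonneg[OF B] .
  have main: "\<bar>conv \<phi> \<kappa> (x + y) - conv \<phi> \<kappa> x - (\<Sum>i\<in>UNIV. y $ i * conv \<phi> (partial i \<kappa>) x)\<bar> \<le> (C * V) * (norm y)\<^sup>2"
    if y: "norm y \<le> 1" for x y
  proof -
    define E where "E = (\<lambda>w. \<kappa> (w + y) - \<kappa> w - (\<Sum>i\<in>UNIV. y $ i * partial i \<kappa> w))"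
    have E1: "\<bar>E w\<bar> \<le> (real CARD('d))\<^sup>2 * B * (norm y)\<^sup>2" for w
      unfolding E_def by (rule quadratic_remainder[OF test_smb[OF assms(2)] B])
    have E2: "E w = 0" if "R + 1 < norm w" for w
    proof -
      have "R < norm (w + y)" using norm_diff_ineq[of w y] that y by linarith
      then show ?thesis using R(2)[of w "[]"] R(2)[of "w + y" "[]"] R(2)[of w "[_]"] that by (simp add: E_def)
    qed
    have i0: "integrable lborel (\<lambda>z. \<phi> z * \<kappa> (x - z))" for x by (intro conv_integrable li assms)
    have ii: "integrable lborel (\<lambda>z. \<phi> z * partial i \<kappa> (x - z))" for x i by (intro conv_integrable li tp)
    have is': "integrable lborel (\<lambda>z. \<Sum>i\<in>UNIV. y $ i * (\<phi> z * partial i \<kappa> (x - z)))" for x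
      by (intro Bochner_Integration.integrable_sum integrable_mult_right ii)
    have "conv \<phi> \<kappa> (x + y) - conv \<phi> \<kappa> x - (\<Sum>i\<in>UNIV. y $ i * conv \<phi> (partial i \<kappa>) x)
        = (LINT z|lborel. \<phi> z * \<kappa> (x + y - z) - \<phi> z * \<kappa> (x - z) - (\<Sum>i\<in>UNIV. y $ i * (\<phi> z * partial i \<kappa> (x - z))))"
      unfolding conv_def using i0[of "x + y"] i0[of x] is'[of x] ii[of _ x]
      by (simp add: Bochner_Integration.integral_sum)
    also have "\<dots> = (LINT z|lborel. \<phi> z * E (x - z))"
      by (rule Bochner_Integration.integral_cong) (auto simp: E_def algebra_simps sum_distrib_left)
    finally have eq: "conv \<phi> \<kappa> (x + y) - conv \<phi> \<kappa> x - (\<Sum>i\<in>UNIV. y $ i * conv \<phi> (partial i \<kappa>) x) = (LINT z|lborel. \<phi> z * E (x - z))" .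
    have ind: "integrable lborel (\<lambda>z. C * (norm y)\<^sup>2 * indicat_real (cball x (R + 1)) z)"
      using emeasure_lborel_cball_finite[of x "R + 1"]
      by (intro integrable_mult_right integrable_real_indicator) auto
    have le: "\<bar>\<phi> z * E (x - z)\<bar> \<le> C * (norm y)\<^sup>2 * indicat_real (cball x (R + 1)) z" for z
    proof (cases "z \<in> cball x (R + 1)")
      case True
      have "\<bar>\<phi> z\<bar> * \<bar>E (x - z)\<bar> \<le> A * ((real CARD('d))\<^sup>2 * B * (norm y)\<^sup>2)"
        using A E1 A0 by (intro mult_mono) auto
      then show ?thesis using True by (simp add: abs_mult C_def mult_ac)
    next
      case False
      then have "R + 1 < norm (x - z)" by (simp add: dist_norm)
      then show ?thesis using E2[of "x - z"] False by simp
    qed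
    have [measurable]: "E \<in> borel_measurable borel" unfolding E_def by measurable
    have iE: "integrable lborel (\<lambda>z. \<phi> z * E (x - z))"
    proof (rule Bochner_Integration.integrable_bound[OF ind])
      show "AE z in lborel. norm (\<phi> z * E (x - z)) \<le> norm (C * (norm y)\<^sup>2 * indicat_real (cball x (R + 1)) z)"
      proof (rule AE_I2)
        fix z
        show "norm (\<phi> z * E (x - z)) \<le> norm (C * (norm y)\<^sup>2 * indicat_real (cball x (R + 1)) z)"
          using order_trans[OF le[of z] abs_ge_self] by (simp only: real_norm_def)
      qed
    qed simp
    have "\<bar>LINT z|lborel. \<phi> z * E (x - z)\<bar> \<le> (LINT z|lborel. \<bar>\<phi> z * E (x - z)\<bar>)" by (rule integral_abs_bound)
    also have "\<dots> \<le> (LINT z|lborel. C * (norm y)\<^sup>2 * indicat_real (cball x (R + 1)) z)"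
      by (intro integral_mono integrable_abs iE ind le)
    also have "\<dots> = C * (norm y)\<^sup>2 * measure lborel (cball x (R + 1))" by simp
    also have "measure lborel (cball x (R + 1)) = V"
      using R(1) content_cball[of "R + 1" x] by (simp add: V_def)
    finally show ?thesis unfolding eq by (simp add: mult_ac)
  qed
  show "conv \<phi> \<kappa> differentiable at x" "partial i (conv \<phi> \<kappa>) = conv \<phi> (partial i \<kappa>)"
    by (rule partial_quadratic_eq[of "conv \<phi> \<kappa>" "\<lambda>i. conv \<phi> (partial i \<kappa>)", OF main], assumption)+
qed

lemma conv_pderivs:
  assumes "bmeas \<phi>" "test_function \<kappa>"
  shows "foldr partial is (conv \<phi> \<kappa>) = conv \<phi> (foldr partial is \<kappa>)"
  by (induction "is") (simp_all add: conv_differentiable(2)[OF assms(1) test_pderivs[OF assms(2)]])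

lemma conv_smb:
  assumes "bmeas \<phi>" "test_function \<kappa>"
  shows "smb (conv \<phi> \<kappa>)"
proof (rule smbI)
  show "smooth (conv \<phi> \<kappa>)"
    unfolding smooth_iff conv_pderivs[OF assms]
    by (intro allI conv_differentiable(1) assms test_pderivs)
  obtain A where "\<And>x. \<bar>\<phi> x\<bar> \<le> A" using assms unfolding bmeas_def bounded_iff by auto
  then show "\<exists>B. \<forall>x. \<bar>foldr partial is (conv \<phi> \<kappa>) x\<bar> \<le> B" for "is"
    unfolding conv_pderivs[OF assms]
    using conv_abs_le[OF _ bmeas_locally_integrable[OF assms(1)] test_pderivs[OF assms(2)]] by (meson AE_I2)
qed

subsection \<open>Generalized derivatives\<close>

text \<open>The reflected kernel serves as test function: the sign from the reflection and the sign
  in the definition of a generalized derivative cancel.\<close>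

lemma conv_gen_deriv:
  assumes "has_gen_deriv \<alpha> \<phi> g" "\<forall>i. count_list is i = \<alpha> i" "test_function \<kappa>"
  shows "conv \<phi> (foldr partial is \<kappa>) x = conv g \<kappa> x"
proof -
  have "conv g \<kappa> x = (- 1) ^ mi_order \<alpha> * (LINT z|lborel. \<phi> z * classical_deriv \<alpha> (\<lambda>z. \<kappa> (x - z)) z)"
    unfolding conv_def using assms(1) test_reflect[OF assms(3), of x] unfolding has_gen_deriv_def by blast
  also have "classical_deriv \<alpha> (\<lambda>z. \<kappa> (x - z)) = (\<lambda>z. (-1) ^ length is * foldr partial is \<kappa> (x - z))"
    by (simp add: classical_deriv_eq[OF test_smb[OF test_reflect[OF assms(3)]] assms(2)] smb_reflect(2)[OF test_smb[OF assms(3)]])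
  also have "(LINT z|lborel. \<phi> z * ((-1) ^ length is * foldr partial is \<kappa> (x - z)))
      = (LINT z|lborel. (-1) ^ length is * (\<phi> z * foldr partial is \<kappa> (x - z)))"
    by (simp add: mult_ac)
  also have "\<dots> = (-1) ^ length is * conv \<phi> (foldr partial is \<kappa>) x"
    unfolding conv_def by simp
  finally show ?thesis
    using mi_order_count[OF assms(2)] by (simp flip: power_mult_distrib mult.assoc)
qed

text \<open>Translation invariance of Lebesgue measure: the integral of the increment
  \<open>\<Phi> (x + y) - \<Phi> x\<close> vanishes, and divided by \<open>t = norm y\<close> it
  equals the integral of the derivative up to O(t).\<close>

lemma integral_partial_eq_0:
  fixes \<Phi> :: "real^'d::finite \<Rightarrow> real"
  assumes "Cb (Suc 0) \<Phi>" "\<And>x. R < norm x \<Longrightarrow> \<Phi> x = 0"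
  shows "(LINT x|lborel. partial i \<Phi> x) = 0"
proof -
  obtain C where C: "C \<ge> 0" "\<And>x y. \<bar>\<Phi> (x + y) - \<Phi> x - (\<Sum>i\<in>UNIV. y $ i * partial i \<Phi> x)\<bar> \<le> C * (norm y)\<^sup>2"
    using Cb1_quadratic_remainder[OF assms(1)] by blast
  have cont: "continuous_on UNIV \<Phi>" "continuous_on UNIV (partial i \<Phi>)"
    using assms(1) by (auto intro!: lipb_continuous)
  have sup: "partial i \<Phi> x = 0" if "R < norm x" for x
    using pderivs_outside[of "cball 0 R" \<Phi> x "[i]"] assms(2) that by (auto simp: not_le)
  have iP: "integrable lborel \<Phi>" by (rule integrable_continuous_compact_support[OF cont(1) assms(2)])
  have ip: "integrable lborel (partial i \<Phi>)" by (rule integrable_continuous_compact_support[OF cont(2) sup])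
  have [measurable]: "\<Phi> \<in> borel_measurable borel" using cont by (intro borel_measurable_continuous_onI)
  define V where "V = measure lborel (cball (0::real^'d) (R + 1))"
  have bnd: "\<bar>LINT x|lborel. partial i \<Phi> x\<bar> \<le> (C * V) * t" if t: "0 < t" "t \<le> 1" for t
  proof -
    define y where "y = (t *\<^sub>R axis i (1::real) :: real^'d)"
    have ny: "norm y = t" using t by (simp add: y_def)
    have s: "(\<Sum>i\<in>UNIV. y $ i * partial i \<Phi> x) = t * partial i \<Phi> x" for x
      using dir_scale[of t "axis i 1" \<Phi> x, unfolded dir_axis] by (simp add: dir_def y_def)
    have iy: "integrable lborel (\<lambda>x. \<Phi> (x + y))"
    proof (rule integrable_continuous_compact_support[where R = "R + 1"])
      show "continuous_on UNIV (\<lambda>x. \<Phi> (x + y))"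
        using Cb_lipb[OF Cb_shift[OF assms(1)]] by (rule lipb_continuous)
      fix x :: "real^'d" assume "R + 1 < norm x"
      then have "R < norm (x + y)" using norm_diff_ineq[of x y] ny t by linarith
      then show "\<Phi> (x + y) = 0" by (rule assms(2))
    qed
    have "(LINT x|lborel. \<Phi> (x + y) - \<Phi> x - t * partial i \<Phi> x) = - t * (LINT x|lborel. partial i \<Phi> x)"
      using iy iP ip by (simp add: integral_translate_lborel)
    moreover have "\<bar>LINT x|lborel. \<Phi> (x + y) - \<Phi> x - t * partial i \<Phi> x\<bar> \<le>
        (LINT x|lborel. C * t\<^sup>2 * indicat_real (cball 0 (R + 1)) (x::real^'d))"
    proof (rule order_trans[OF integral_abs_bound], rule integral_mono)
      show "integrable lborel (\<lambda>x. \<bar>\<Phi> (x + y) - \<Phi> x - t * partial i \<Phi> x\<bar>)"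
        by (intro integrable_abs Bochner_Integration.integrable_diff integrable_mult_right iy iP ip)
      show "integrable lborel (\<lambda>x. C * t\<^sup>2 * indicat_real (cball 0 (R + 1)) (x::real^'d))"
        using emeasure_lborel_cball_finite[of "0::real^'d" "R + 1"]
        by (intro integrable_mult_right integrable_real_indicator) auto
      fix x
      show "\<bar>\<Phi> (x + y) - \<Phi> x - t * partial i \<Phi> x\<bar> \<le> C * t\<^sup>2 * indicat_real (cball 0 (R + 1)) x"
      proof (cases "norm x \<le> R + 1")
        case True
        then show ?thesis using C(2)[of x y] by (simp add: s ny)
      next
        case False
        then have "R < norm (x + y)" "R < norm x" using norm_diff_ineq[of x y] ny t by linarith+
        then show ?thesis using assms(2) sup False by simp
      qed
    qed
    ultimately have "t * \<bar>LINT x|lborel. partial i \<Phi> x\<bar> \<le> C * t\<^sup>2 * V"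
      using t by (simp add: V_def abs_mult)
    also have "\<dots> = t * (C * V * t)" by (simp add: power2_eq_square mult_ac)
    finally show ?thesis using t mult_le_cancel_left_pos by blast
  qed
  have "\<bar>LINT x|lborel. partial i \<Phi> x\<bar> \<le> 0" by (rule nonpos_if_le_mult[OF bnd])
  then show ?thesis by simp
qed

lemma integration_by_parts:
  fixes \<phi> \<psi> :: "real^'d::finite \<Rightarrow> real"
  assumes "Cb (Suc 0) \<phi>" "test_function \<psi>"
  shows "(LINT x|lborel. partial i \<phi> x * \<psi> x) = - (LINT x|lborel. \<phi> x * partial i \<psi> x)"
proof -
  obtain R where R: "R > 0" "\<And>x is. R < norm x \<Longrightarrow> foldr partial is \<psi> x = 0"
    using assms(2) by (rule test_functionE) blast
  have tp: "test_function (partial i \<psi>)" using test_pderivs[OF assms(2), of "[i]"] by simp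
  have d: "\<phi> differentiable at x" "\<psi> differentiable at x" for x
    using assms smb_differentiable test_smb by auto
  have "(LINT x|lborel. partial i (\<lambda>x. \<phi> x * \<psi> x) x) = 0"
    using R(2)[of _ "[]"] by (intro integral_partial_eq_0[of _ R] Cb_mult assms smb_Cb test_smb) auto
  moreover have "(LINT x|lborel. partial i (\<lambda>x. \<phi> x * \<psi> x) x)
      = (LINT x|lborel. \<phi> x * partial i \<psi> x) + (LINT x|lborel. partial i \<phi> x * \<psi> x)"
    unfolding partial_mult[OF d]
    using assms by (intro Bochner_Integration.integral_add locally_integrable_test tp continuous_locally_integrable lipb_continuous) auto
  ultimately show ?thesis by linarith
qed

lemma integration_by_parts_iterated:
  fixes \<phi> \<psi> :: "real^'d::finite \<Rightarrow> real"
  assumes "Cb n \<phi>" "test_function \<psi>" "length is \<le> n"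
  shows "(LINT x|lborel. foldr partial is \<phi> x * \<psi> x) = (-1) ^ length is * (LINT x|lborel. \<phi> x * foldr partial is \<psi> x)"
  using assms(2,3)
proof (induction "is" arbitrary: \<psi>)
  case (Cons i "is")
  have c: "Cb (Suc 0) (foldr partial is \<phi>)"
    by (rule Cb_pderivs, rule Cb_mono[OF _ assms(1)]) (use Cons.prems(2) in simp)
  have tp: "test_function (partial i \<psi>)" using test_pderivs[OF Cons.prems(1), of "[i]"] by simp
  show ?case
    using integration_by_parts[OF c Cons.prems(1), of i] Cons.IH[OF tp] Cons.prems(2)
    by (simp add: pderivs_partial_commute[OF test_smb[OF Cons.prems(1)]])
qed simp

lemma Cb_has_gen_deriv:
  fixes \<phi> :: "real^'d::finite \<Rightarrow> real"
  assumes "Cb n \<phi>" "length is \<le> n" "\<forall>i. count_list is i = \<alpha> i"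
  shows "has_gen_deriv \<alpha> \<phi> (foldr partial is \<phi>)"
  unfolding has_gen_deriv_def
proof (intro conjI allI impI)
  have "Cb 0 (foldr partial is \<phi>)" by (rule Cb_pderivs) (use Cb_mono[OF _ assms(1)] assms(2) in simp)
  then show "locally_integrable (foldr partial is \<phi>)"
    by (intro continuous_locally_integrable lipb_continuous) simp
  show "locally_integrable \<phi>"
    by (intro continuous_locally_integrable lipb_continuous Cb_lipb[OF assms(1)])
  fix \<psi> :: "real^'d \<Rightarrow> real" assume t: "test_function \<psi>"
  show "(LINT x|lborel. foldr partial is \<phi> x * \<psi> x) = (-1) ^ mi_order \<alpha> * (LINT x|lborel. \<phi> x * classical_deriv \<alpha> \<psi> x)"
    by (simp add: integration_by_parts_iterated[OF assms(1) t assms(2)] mi_order_count[OF assms(3)]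
        classical_deriv_eq[OF test_smb[OF t] assms(3)])
qed

lemma conv_bump_minus:
  fixes g :: "real^'d::finite \<Rightarrow> real"
  assumes "continuous_on UNIV g" "\<And>z. dist z x \<le> real CARD('d) / real (Suc n) \<Longrightarrow> \<bar>g z - g x\<bar> \<le> e"
  shows "\<bar>conv g (bump n) x - g x\<bar> \<le> e"
proof -
  have t: "test_function (bump n :: real^'d \<Rightarrow> real)" by (rule bump_test)
  have [measurable]: "(bump n :: real^'d \<Rightarrow> real) \<in> borel_measurable borel" by (rule test_measurable[OF t])
  have i1: "integrable lborel (\<lambda>z. g z * bump n (x - z))"
    by (intro conv_integrable continuous_locally_integrable assms t)
  have i2: "integrable lborel (\<lambda>z. bump n (x - z))" by (intro test_integrable test_reflect t)
  have one: "(LINT z|lborel. bump n (x - z)) = 1"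
    by (subst integral_reflect_lborel) (simp_all add: bump_integral)
  have "conv g (bump n) x - g x = (LINT z|lborel. (g z - g x) * bump n (x - z))"
    unfolding conv_def left_diff_distrib using i1 i2 one by simp
  also have "\<bar>\<dots>\<bar> \<le> (LINT z|lborel. e * bump n (x - z))"
  proof (rule order_trans[OF integral_abs_bound], rule integral_mono)
    show "integrable lborel (\<lambda>z. \<bar>(g z - g x) * bump n (x - z)\<bar>)"
      unfolding left_diff_distrib by (intro integrable_abs Bochner_Integration.integrable_diff i1 integrable_mult_right i2)
    show "integrable lborel (\<lambda>z. e * bump n (x - z))" by (intro integrable_mult_right i2)
    fix z
    show "\<bar>(g z - g x) * bump n (x - z)\<bar> \<le> e * bump n (x - z)"
    proof (cases "dist z x \<le> real CARD('d) / real (Suc n)")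
      case True
      then show ?thesis using assms(2) by (simp add: abs_mult bump_nonneg mult_right_mono)
    next
      case False
      then have "bump n (x - z) = 0" by (intro bump_support) (simp add: dist_norm norm_minus_commute)
      then show ?thesis by simp
    qed
  qed
  finally show ?thesis using one by simp
qed

lemma conv_bump_tendsto:
  fixes g :: "real^'d::finite \<Rightarrow> real"
  assumes "continuous_on UNIV g"
  shows "(\<lambda>n. conv g (bump n) x) \<longlonglongrightarrow> g x"
proof (rule LIMSEQ_I)
  fix e :: real assume e: "e > 0"
  have "isCont g x" using assms continuous_on_eq_continuous_at open_UNIV by blast
  then obtain d where d: "d > 0" "\<And>z. dist z x < d \<Longrightarrow> \<bar>g z - g x\<bar> < e / 2"
    using e unfolding continuous_at_eps_delta dist_real_def by (meson half_gt_zero)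
  obtain N where N: "real CARD('d) / d < real N" using reals_Archimedean2 by blast
  show "\<exists>N. \<forall>n\<ge>N. norm (conv g (bump n) x - g x) < e"
  proof (intro exI allI impI)
    fix n assume "N \<le> n"
    then have "real CARD('d) / d < real (Suc n)" using N by linarith
    then have "real CARD('d) / real (Suc n) < d" using d(1) by (simp add: field_simps)
    then have "\<bar>conv g (bump n) x - g x\<bar> \<le> e / 2"
      by (intro conv_bump_minus assms) (use d(2) in \<open>force intro: less_imp_le\<close>)
    then show "norm (conv g (bump n) x - g x) < e" using e by simp
  qed
qed

lemma conv_bump_lipschitz:
  fixes g :: "real^'d::finite \<Rightarrow> real"
  assumes "continuous_on UNIV g" "C \<ge> 0" "\<And>x y. \<bar>g x - g y\<bar> \<le> C * dist x y"
  shows "\<bar>conv g (bump n) x - g x\<bar> \<le> C * (real CARD('d) / real (Suc n))"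
proof (rule conv_bump_minus[OF assms(1)])
  fix z assume "dist z x \<le> real CARD('d) / real (Suc n)"
  then have "C * dist z x \<le> C * (real CARD('d) / real (Suc n))" using assms(2) by (rule mult_left_mono)
  then show "\<bar>g z - g x\<bar> \<le> C * (real CARD('d) / real (Suc n))" using assms(3)[of z x] by linarith
qed

lemma conv_bump_uniform_limit:
  fixes g :: "real^'d::finite \<Rightarrow> real"
  assumes "lipb g"
  shows "uniform_limit UNIV (\<lambda>n. conv g (bump n)) g sequentially"
proof -
  obtain C where C: "C > 0" "\<And>x y. \<bar>g x - g y\<bar> \<le> C * dist x y" using assms by (metis lipbE)
  show ?thesis
    unfolding uniform_limit_seq_iff
  proof (intro allI impI)
    fix e :: real assume e: "e > 0"
    have "(\<lambda>n. C * (real CARD('d) / real (Suc n))) \<longlonglongrightarrow> C * 0"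
      by (intro tendsto_mult tendsto_const LIMSEQ_Suc lim_const_over_n)
    then have "eventually (\<lambda>n. C * (real CARD('d) / real (Suc n)) < e) sequentially"
      using e by (intro order_tendstoD(2)) auto
    then obtain N where N: "\<And>n. n \<ge> N \<Longrightarrow> C * (real CARD('d) / real (Suc n)) < e"
      unfolding eventually_sequentially by blast
    show "\<exists>N. \<forall>n\<ge>N. \<forall>x. \<bar>conv g (bump n) x - g x\<bar> < e"
      using N conv_bump_lipschitz[OF lipb_continuous[OF assms] less_imp_le[OF C(1)] C(2)] order_le_less_trans by blast
  qed
qed

text \<open>Both candidates have the same mollifications by \<open>conv_gen_deriv\<close>, and a
  continuous function is the pointwise limit of its mollifications.\<close>

lemma continuous_gen_deriv_unique:
  assumes "has_gen_deriv \<alpha> \<phi> g" "has_gen_deriv \<alpha> \<phi> g'" "continuous_on UNIV g" "continuous_on UNIV g'"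
  shows "g = g'"
proof
  fix x
  obtain "is" where c: "\<forall>i. count_list is i = \<alpha> i" using ex_list_count by blast
  have "conv g (bump n) x = conv g' (bump n) x" for n
    using conv_gen_deriv[OF assms(1) c bump_test, of n x] conv_gen_deriv[OF assms(2) c bump_test, of n x] by simp
  then show "g x = g' x"
    using conv_bump_tendsto[OF assms(3), of x] conv_bump_tendsto[OF assms(4), of x] LIMSEQ_unique by simp
qed

text \<open>The choice in \<open>gen_deriv\<close> falls on a continuous function because a
  continuous generalized derivative exists, and that one is unique.\<close>

lemma gen_deriv_eq:
  assumes "Cb n \<phi>" "length is \<le> n" "\<forall>i. count_list is i = \<alpha> i"
  shows "gen_deriv \<alpha> \<phi> = foldr partial is \<phi>"
proof -
  let ?P = "\<lambda>g. has_gen_deriv \<alpha> \<phi> g \<and>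
     ((\<exists>g'. has_gen_deriv \<alpha> \<phi> g' \<and> continuous_on UNIV g') \<longrightarrow> continuous_on UNIV g)"
  have h: "has_gen_deriv \<alpha> \<phi> (foldr partial is \<phi>)" by (rule Cb_has_gen_deriv[OF assms])
  have "Cb 0 (foldr partial is \<phi>)" by (rule Cb_pderivs) (use Cb_mono[OF _ assms(1)] assms(2) in simp)
  then have c: "continuous_on UNIV (foldr partial is \<phi>)" by (simp add: lipb_continuous)
  have "?P (gen_deriv \<alpha> \<phi>)" unfolding gen_deriv_def by (rule someI[of ?P "foldr partial is \<phi>"]) (use h c in blast)
  then show ?thesis using continuous_gen_deriv_unique h c by blast
qed

lemma Bspace_has_gen_deriv:
  assumes "\<phi> \<in> Bspace m" "mi_order \<alpha> \<le> m"
  shows "has_gen_deriv \<alpha> \<phi> (gen_deriv \<alpha> \<phi>)"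
proof -
  let ?P = "\<lambda>g. has_gen_deriv \<alpha> \<phi> g \<and>
     ((\<exists>g'. has_gen_deriv \<alpha> \<phi> g' \<and> continuous_on UNIV g') \<longrightarrow> continuous_on UNIV g)"
  have "\<exists>g. ?P g" using assms unfolding Bspace_def by (cases "\<exists>g'. has_gen_deriv \<alpha> \<phi> g' \<and> continuous_on UNIV g'") blast+
  then have "?P (gen_deriv \<alpha> \<phi>)" unfolding gen_deriv_def by (rule someI_ex)
  then show ?thesis by blast
qed

lemma Cb_Bspace: "Cb n \<phi> \<Longrightarrow> \<phi> \<in> Bspace n"
  unfolding Bspace_def
proof (intro CollectI conjI allI impI)
  assume c: "Cb n \<phi>"
  show "bounded (range \<phi>)" "continuous_on UNIV \<phi>" using Cb_lipb[OF c] by (auto intro: lipb_bounded lipb_continuous)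
  fix \<alpha> :: "'a \<Rightarrow> nat" assume m: "mi_order \<alpha> \<le> n"
  obtain "is" where is': "\<forall>i. count_list is i = \<alpha> i" using ex_list_count by blast
  have l: "length is \<le> n" using m mi_order_count[OF is'] by simp
  have "Cb 0 (foldr partial is \<phi>)" by (rule Cb_pderivs) (use Cb_mono[OF _ c] l in simp)
  then show "\<exists>g. has_gen_deriv \<alpha> \<phi> g \<and> bounded (range g)"
    using Cb_has_gen_deriv[OF c l is'] lipb_bounded by auto
qed

lemma Bspace_bmeas: "\<phi> \<in> Bspace m \<Longrightarrow> bmeas \<phi>"
  by (simp add: Bspace_def bmeas_def borel_measurable_continuous_onI)

text \<open>A derivative of the mollification is an average of the generalized derivative, so the
  bounds do not depend on \<open>n\<close>.\<close>

lemma Bspace_conv_bd: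
  fixes \<phi> :: "real^'d::finite \<Rightarrow> real"
  assumes "\<phi> \<in> Bspace m"
  shows "\<exists>C. \<forall>n. bd m C (conv \<phi> (bump n))"
proof -
  have "\<exists>C\<ge>0. \<forall>n x. \<bar>foldr partial is (conv \<phi> (bump n)) x\<bar> \<le> C" if l: "length is \<le> m" for "is"
  proof -
    define \<alpha> where "\<alpha> = (\<lambda>i. count_list is i)"
    have c: "\<forall>i. count_list is i = \<alpha> i" by (simp add: \<alpha>_def)
    have "mi_order \<alpha> \<le> m" using l mi_order_count[OF c] by simp
    then obtain g where g: "has_gen_deriv \<alpha> \<phi> g" "bounded (range g)"
      using assms unfolding Bspace_def by blast
    obtain C where C: "\<And>x. \<bar>g x\<bar> \<le> C" using g(2) unfolding bounded_iff by auto
    have "\<bar>foldr partial is (conv \<phi> (bump n)) x\<bar> \<le> C" for n x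
      unfolding conv_pderivs[OF Bspace_bmeas[OF assms] bump_test] conv_gen_deriv[OF g(1) c bump_test]
      using g(1) C by (intro conv_bump_abs_le) (auto simp: has_gen_deriv_def)
    moreover have "C \<ge> 0" using C[of 0] by linarith
    ultimately show ?thesis by blast
  qed
  then obtain C where C: "\<And>is. length is \<le> m \<Longrightarrow> C is \<ge> 0"
    "\<And>is n x. length is \<le> m \<Longrightarrow> \<bar>foldr partial is (conv \<phi> (bump n)) x\<bar> \<le> C is" by metis
  have fin: "finite {is :: 'd list. length is \<le> m}" using finite_lists_length_le[of "UNIV :: 'd set" m] by simp
  have "C is \<le> (\<Sum>is | length is \<le> m. C is)" if "length is \<le> m" for "is"
    by (rule member_le_sum) (use that C(1) fin in auto)
  then show ?thesis unfolding bd_def using C(2) order_trans by (metis (no_types, lifting))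
qed

lemma Bspace_conv_uniform_limit:
  fixes \<phi> :: "real^'d::finite \<Rightarrow> real"
  assumes "\<phi> \<in> Bspace (Suc n)"
  shows "uniform_limit UNIV (\<lambda>j. conv \<phi> (bump j)) \<phi> sequentially"
proof -
  obtain C where C: "\<And>j. bd (Suc n) C (conv \<phi> (bump j))" using Bspace_conv_bd[OF assms] by blast
  have sm: "smb (conv \<phi> (bump j))" for j by (intro conv_smb Bspace_bmeas[OF assms] bump_test)
  have cont: "continuous_on UNIV \<phi>" using assms by (simp add: Bspace_def)
  have "lipb \<phi>"
  proof (rule lipbI)
    show "\<bar>\<phi> x\<bar> \<le> C" for x
      using tendsto_rabs[OF conv_bump_tendsto[OF cont]] by (rule tendsto_upperbound) (use bd0[OF C] in auto)
    show "\<bar>\<phi> x - \<phi> y\<bar> \<le> (real CARD('d) * C) * dist x y" for x y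
    proof (rule tendsto_upperbound)
      show "(\<lambda>j. \<bar>conv \<phi> (bump j) x - conv \<phi> (bump j) y\<bar>) \<longlonglongrightarrow> \<bar>\<phi> x - \<phi> y\<bar>"
        by (intro tendsto_intros conv_bump_tendsto cont)
      show "\<forall>\<^sub>F j in sequentially. \<bar>conv \<phi> (bump j) x - conv \<phi> (bump j) y\<bar> \<le> (real CARD('d) * C) * dist x y"
        using increment_bound[OF smb_differentiable[OF sm] bd1[OF C], of _ y "x - y"]
        by (intro always_eventually allI) (simp add: dist_norm mult_ac)
    qed simp
  qed
  then show ?thesis by (rule conv_bump_uniform_limit)
qed

text \<open>The embedding of W^{n+1,\<infinity>} into C^{n,1}: the mollifications have uniformly
  bounded derivatives of order \<open>Suc n\<close> and converge uniformly, so
  \<open>smooth_limit\<close> gives \<open>n\<close> classical derivatives of the limit.\<close>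

lemma Bspace_Cb:
  assumes "\<phi> \<in> Bspace (Suc n)"
  shows "Cb n \<phi>" "length is \<le> n \<Longrightarrow>
    uniform_limit UNIV (\<lambda>j. foldr partial is (conv \<phi> (bump j))) (foldr partial is \<phi>) sequentially"
proof -
  obtain C where C: "\<And>j. bd (Suc n) C (conv \<phi> (bump j))" using Bspace_conv_bd[OF assms] by blast
  have sm: "smb (conv \<phi> (bump j))" for j by (intro conv_smb Bspace_bmeas[OF assms] bump_test)
  show "Cb n \<phi>" "length is \<le> n \<Longrightarrow>
    uniform_limit UNIV (\<lambda>j. foldr partial is (conv \<phi> (bump j))) (foldr partial is \<phi>) sequentially"
    using smooth_limit[OF sm C Bspace_conv_uniform_limit[OF assms]] by blast+
qed

subsection \<open>Almost everywhere uniqueness of generalized derivatives\<close>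

lemma locally_integrable_measurable:
  fixes r :: "real^'d::finite \<Rightarrow> real"
  assumes "locally_integrable r" shows "r \<in> borel_measurable borel"
proof (rule borel_measurable_LIMSEQ_real)
  fix n
  have "integrable lborel (\<lambda>x. indicat_real (cball 0 (real n)) x * r x)"
    using assms compact_cball unfolding locally_integrable_def set_integrable_def by auto
  then show "(\<lambda>x. indicat_real (cball 0 (real n)) x * r x) \<in> borel_measurable borel"
    using borel_measurable_integrable by fastforce
next
  fix x :: "real^'d"
  obtain N where N: "norm x \<le> real N" using real_arch_simple by blast
  show "(\<lambda>n. indicat_real (cball 0 (real n)) x * r x) \<longlonglongrightarrow> r x"
  proof (rule tendsto_eventually)
    show "\<forall>\<^sub>F n in sequentially. indicat_real (cball 0 (real n)) x * r x = r x"
      unfolding eventually_sequentially by (intro exI[of _ N]) (use N in auto)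
  qed
qed

text \<open>A compactly supported Lipschitz function is the uniform limit of its mollifications,
  which are test functions with supports in a common ball. This is a step towards uniqueness of
  generalized derivatives almost everywhere.\<close>

lemma test_orthogonal_lipschitz:
  fixes r :: "real^'d::finite \<Rightarrow> real"
  assumes "locally_integrable r" "\<And>\<psi>. test_function \<psi> \<Longrightarrow> (LINT x|lborel. r x * \<psi> x) = 0"
    and "lipb \<psi>" "\<And>x. R < norm x \<Longrightarrow> \<psi> x = 0"
  shows "(LINT x|lborel. r x * \<psi> x) = 0"
proof -
  define d where "d = real CARD('d)"
  have [measurable]: "r \<in> borel_measurable borel" by (rule locally_integrable_measurable[OF assms(1)])
  have supp: "conv \<psi> (bump n) x = 0" if "R + d < norm x" for n x
  proof -
    have "\<psi> z * bump n (x - z) = 0" for z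
    proof (cases "norm z \<le> R")
      case True
      then have "d < norm (x - z)" using that norm_triangle_ineq2[of x z] by linarith
      moreover have "d / real (Suc n) \<le> d" unfolding d_def by (simp add: divide_le_eq)
      ultimately have "bump n (x - z) = 0" unfolding d_def by (intro bump_support) linarith
      then show ?thesis by simp
    qed (use assms(4) in auto)
    then have "(\<lambda>z. \<psi> z * bump n (x - z)) = (\<lambda>z. 0)" by (rule ext)
    then show ?thesis by (simp add: conv_def)
  qed
  have sm: "smb (conv \<psi> (bump n))" for n by (intro conv_smb lipb_bmeas assms bump_test)
  have test: "test_function (conv \<psi> (bump n))" for n
    by (rule test_functionI[OF smb_smooth[OF sm] supp])
  define I where "I = (LINT x|lborel. \<bar>r x * indicat_real (cball 0 (R + d)) x\<bar>)"
  have iI: "integrable lborel (\<lambda>x. r x * indicat_real (cball 0 (R + d)) x)"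
    using assms(1) compact_cball[of 0 "R + d"] unfolding locally_integrable_def set_integrable_def by (auto simp: mult.commute)
  have i0: "integrable lborel (\<lambda>x. r x * \<psi> x)"
    by (rule locally_integrable_test_mult[OF assms(1) lipb_continuous[OF assms(3)] assms(4)])
  have "\<bar>LINT x|lborel. r x * \<psi> x\<bar> \<le> I * t" if t: "0 < t" for t
  proof -
    obtain n where n: "\<And>x. \<bar>conv \<psi> (bump n) x - \<psi> x\<bar> < t"
      using conv_bump_uniform_limit[OF assms(3)] t unfolding uniform_limit_seq_iff by blast
    have i1: "integrable lborel (\<lambda>x. r x * conv \<psi> (bump n) x)"
      by (intro locally_integrable_test assms(1) test)
    have "(LINT x|lborel. r x * \<psi> x) = (LINT x|lborel. r x * \<psi> x - r x * conv \<psi> (bump n) x)"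
      using i0 i1 assms(2)[OF test] by simp
    also have "\<bar>\<dots>\<bar> \<le> (LINT x|lborel. \<bar>r x * indicat_real (cball 0 (R + d)) x\<bar> * t)"
    proof (rule order_trans[OF integral_abs_bound], rule integral_mono)
      fix x
      show "\<bar>r x * \<psi> x - r x * conv \<psi> (bump n) x\<bar> \<le> \<bar>r x * indicat_real (cball 0 (R + d)) x\<bar> * t"
      proof (cases "norm x \<le> R + d")
        case True
        have "\<bar>r x\<bar> * \<bar>\<psi> x - conv \<psi> (bump n) x\<bar> \<le> \<bar>r x\<bar> * t"
          using n[of x] by (intro mult_left_mono) auto
        moreover have "r x * \<psi> x - r x * conv \<psi> (bump n) x = r x * (\<psi> x - conv \<psi> (bump n) x)"
          by (rule right_diff_distrib[symmetric])
        ultimately show ?thesis using True by (simp only: abs_mult) simp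
      next
        case False
        then have "R < norm x" "R + d < norm x" by (auto simp: d_def)
        then show ?thesis using supp[of x n] assms(4)[of x] False by simp
      qed
    qed (intro integrable_abs Bochner_Integration.integrable_diff i0 i1 integrable_mult_left iI)+
    also have "\<dots> = I * t" by (simp add: I_def)
    finally show ?thesis .
  qed
  then have "\<bar>LINT x|lborel. r x * \<psi> x\<bar> \<le> 0" by (rule nonpos_if_le_mult)
  then show ?thesis by simp
qed

text \<open>The Lipschitz functions \<open>\<psi> n\<close> decrease to the indicator of
  \<open>K\<close> and live in a common ball, on which \<open>r\<close> is integrable; dominated
  convergence applies.\<close>

lemma test_orthogonal_compact:
  fixes r :: "real^'d::finite \<Rightarrow> real"
  assumes "locally_integrable r" "\<And>\<psi>. test_function \<psi> \<Longrightarrow> (LINT x|lborel. r x * \<psi> x) = 0"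
    and K: "compact K" "K \<noteq> {}"
  shows "(LINT x|lborel. r x * indicat_real K x) = 0"
proof -
  have [measurable]: "r \<in> borel_measurable borel" by (rule locally_integrable_measurable[OF assms(1)])
  have [measurable]: "K \<in> sets borel" using K by (simp add: compact_imp_closed borel_closed)
  obtain R where R: "\<And>x. x \<in> K \<Longrightarrow> norm x \<le> R" using compact_imp_bounded[OF K(1)] bounded_iff by metis
  define \<psi> where "\<psi> = (\<lambda>n x. max 0 (1 - real (Suc n) * infdist x K))"
  have lip: "lipb (\<psi> n)" for n
  proof (rule lipbI)
    show "\<bar>\<psi> n x\<bar> \<le> 1" for x by (auto simp: \<psi>_def infdist_nonneg)
    fix x y
    have "real (Suc n) * \<bar>infdist x K - infdist y K\<bar> \<le> real (Suc n) * dist x y"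
      by (intro mult_left_mono infdist_triangle_abs) simp
    then have "\<bar>real (Suc n) * infdist x K - real (Suc n) * infdist y K\<bar> \<le> real (Suc n) * dist x y"
      by (metis abs_mult abs_of_nat right_diff_distrib)
    then show "\<bar>\<psi> n x - \<psi> n y\<bar> \<le> real (Suc n) * dist x y"
      unfolding \<psi>_def by linarith
  qed
  have supp: "\<psi> n x = 0" if "R + 1 < norm x" for n x
  proof -
    obtain y where y: "y \<in> K" "infdist x K = dist x y"
      using infdist_attains_inf[OF compact_imp_closed[OF K(1)] K(2)] by metis
    have "1 \<le> dist x y" using that R[OF y(1)] norm_triangle_ineq2[of x y] by (simp add: dist_norm)
    then have "1 * 1 \<le> real (Suc n) * infdist x K" unfolding y(2) by (intro mult_mono) auto
    then show ?thesis by (simp add: \<psi>_def)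
  qed
  have [measurable]: "\<psi> n \<in> borel_measurable borel" for n
    using lip lipb_bmeas bmeas_def by blast
  have "(\<lambda>n. LINT x|lborel. r x * \<psi> n x) \<longlonglongrightarrow> (LINT x|lborel. r x * indicat_real K x)"
  proof (rule integral_dominated_convergence)
    show "integrable lborel (\<lambda>x. \<bar>r x * indicat_real (cball 0 (R + 1)) x\<bar>)"
      using assms(1) compact_cball[of 0 "R + 1"] unfolding locally_integrable_def set_integrable_def
      by (intro integrable_abs) (auto simp: mult.commute)
    show "AE x in lborel. (\<lambda>n. r x * \<psi> n x) \<longlonglongrightarrow> r x * indicat_real K x"
    proof (intro AE_I2 tendsto_mult tendsto_const)
      fix x
      show "(\<lambda>n. \<psi> n x) \<longlonglongrightarrow> indicat_real K x"
      proof (cases "x \<in> K")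
        case True
        then show ?thesis by (simp add: \<psi>_def)
      next
        case False
        then have pos: "0 < infdist x K"
          using in_closed_iff_infdist_zero[OF compact_imp_closed[OF K(1)] K(2), of x] infdist_nonneg[of x K] by linarith
        obtain N where N: "1 / infdist x K < real N" using reals_Archimedean2 by blast
        have "\<psi> n x = 0" if "n \<ge> N" for n
        proof -
          have "1 / infdist x K \<le> real (Suc n)" using N that by linarith
          then have "1 \<le> real (Suc n) * infdist x K" using pos by (simp add: divide_le_eq)
          then show ?thesis by (simp add: \<psi>_def)
        qed
        then show ?thesis using False
          by (intro tendsto_eventually) (auto simp: eventually_sequentially)
      qed
    qed
    show "AE x in lborel. norm (r x * \<psi> n x) \<le> \<bar>r x * indicat_real (cball 0 (R + 1)) x\<bar>" for n
    proof (rule AE_I2)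
      fix x
      have "\<bar>\<psi> n x\<bar> \<le> 1" by (auto simp: \<psi>_def infdist_nonneg)
      then have "\<bar>r x\<bar> * \<bar>\<psi> n x\<bar> \<le> \<bar>r x\<bar> * 1" by (intro mult_left_mono) auto
      then show "norm (r x * \<psi> n x) \<le> \<bar>r x * indicat_real (cball 0 (R + 1)) x\<bar>"
        using supp[of x n] by (cases "norm x \<le> R + 1") (auto simp: abs_mult)
    qed
  qed simp_all
  moreover have "(LINT x|lborel. r x * \<psi> n x) = 0" for n
    by (rule test_orthogonal_lipschitz[OF assms(1,2) lip supp])
  ultimately show ?thesis by (simp add: LIMSEQ_const_iff)
qed

text \<open>Inner regularity: for a compact subset \<open>T\<close> of the set where
  \<open>r\<close> exceeds \<open>c > 0\<close>, the measure of \<open>T\<close> times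
  \<open>c\<close> is at most the integral of \<open>r\<close> over \<open>T\<close>, which is 0.
  Hence that set is null.\<close>

lemma test_orthogonal_AE_le:
  fixes r :: "real^'d::finite \<Rightarrow> real"
  assumes "locally_integrable r" "\<And>\<psi>. test_function \<psi> \<Longrightarrow> (LINT x|lborel. r x * \<psi> x) = 0"
  shows "AE x in lborel. r x \<le> 0"
proof -
  have [measurable]: "r \<in> borel_measurable borel" by (rule locally_integrable_measurable[OF assms(1)])
  have null: "{x \<in> cball 0 N. c < r x} \<in> null_sets lborel" if c: "c > 0" for N c :: real
  proof -
    define S where "S = {x \<in> cball 0 N. c < r x}"
    have [measurable]: "S \<in> sets borel" unfolding S_def by measurable
    have Sl: "S \<in> sets lebesgue" by simp
    have "emeasure lborel S \<le> ennreal e" if e: "e > 0" for e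
    proof -
      obtain T where T: "closed T" "T \<subseteq> S" "emeasure lebesgue (S - T) < ennreal e"
        by (rule sets_lebesgue_inner_closed[OF Sl e])
      have "bounded T" by (rule bounded_subset[OF bounded_cball[of 0 N]]) (use T(2) in \<open>auto simp: S_def\<close>)
      then have Tc: "compact T" using T(1) by (simp add: compact_eq_bounded_closed)
      have [measurable]: "T \<in> sets borel" using T by (simp add: borel_closed)
      have fin: "emeasure lborel T < \<infinity>" using emeasure_bounded_finite[OF compact_imp_bounded[OF Tc]] .
      have "emeasure lborel T = 0"
      proof (cases "T = {}")
        case False
        have "c * measure lborel T = (LINT x|lborel. c * indicat_real T x)" by simp
        also have "\<dots> \<le> (LINT x|lborel. r x * indicat_real T x)"
        proof (rule integral_mono)
          show "integrable lborel (\<lambda>x. c * indicat_real T x)"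
            using fin by (intro integrable_mult_right integrable_real_indicator) auto
          show "integrable lborel (\<lambda>x. r x * indicat_real T x)"
            using assms(1) Tc unfolding locally_integrable_def set_integrable_def by (auto simp: mult.commute)
          show "c * indicat_real T x \<le> r x * indicat_real T x" for x
            using T(2) by (auto simp: indicator_def S_def)
        qed
        also have "\<dots> = 0" by (rule test_orthogonal_compact[OF assms Tc False])
        finally have "measure lborel T = 0" using c by (simp add: mult_le_0_iff measure_le_0_iff)
        then show ?thesis using fin by (auto simp: measure_def enn2real_eq_0_iff)
      qed simp
      moreover have "emeasure lborel (S - T) \<le> ennreal e"
        using T(3) by (simp add: less_imp_le)
      moreover have "emeasure lborel S \<le> emeasure lborel T + emeasure lborel (S - T)"
        using emeasure_subadditive[of T lborel "S - T"] T(2) by (simp add: Un_absorb1)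
      ultimately show ?thesis by simp
    qed
    then have "emeasure lborel S \<le> 0"
      using ennreal_le_epsilon[of 0 "emeasure lborel S"] by simp
    then show ?thesis unfolding S_def[symmetric] by (intro null_setsI) auto
  qed
  have "AE x in lborel. \<forall>N k. x \<notin> {x \<in> cball 0 (real N). 1 / real (Suc k) < r x}"
    unfolding AE_all_countable by (intro allI AE_not_in null) simp
  then show ?thesis
  proof eventually_elim
    case (elim x)
    show "r x \<le> 0"
    proof (rule ccontr)
      assume "\<not> r x \<le> 0"
      then obtain k where "1 / real (Suc k) < r x" by (metis nat_approx_posE not_le)
      moreover obtain N where "norm x \<le> real N" using real_arch_simple by blast
      ultimately show False using elim by auto
    qed
  qed
qed

lemma locally_integrable_diff:
  "locally_integrable f \<Longrightarrow> locally_integrable g \<Longrightarrow> locally_integrable (\<lambda>x. f x - g x)"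
  by (simp add: locally_integrable_def)

text \<open>The difference is orthogonal to all test functions. At top order
  \<open>gen_deriv\<close> may be an arbitrary choice among generalized derivatives, whereas
  \<open>Bspace\<close> only provides some bounded one; this comparison makes the chosen one
  essentially bounded.\<close>

lemma gen_deriv_AE_le:
  fixes \<phi> :: "real^'d::finite \<Rightarrow> real"
  assumes "has_gen_deriv \<alpha> \<phi> g" "has_gen_deriv \<alpha> \<phi> g'"
  shows "AE x in lborel. g x \<le> g' x"
proof -
  have "AE x in lborel. g x - g' x \<le> 0"
  proof (rule test_orthogonal_AE_le)
    show "locally_integrable (\<lambda>x. g x - g' x)"
      using assms unfolding has_gen_deriv_def by (blast intro: locally_integrable_diff)
    fix \<psi> :: "real^'d \<Rightarrow> real" assume "test_function \<psi>"
    then have "integrable lborel (\<lambda>x. g x * \<psi> x)" "integrable lborel (\<lambda>x. g' x * \<psi> x)"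
      "(LINT x|lborel. g x * \<psi> x) = (LINT x|lborel. g' x * \<psi> x)"
      using assms unfolding has_gen_deriv_def by (auto intro!: locally_integrable_test)
    then show "(LINT x|lborel. (g x - g' x) * \<psi> x) = 0"
      unfolding left_diff_distrib by simp
  qed
  then show ?thesis by simp
qed

lemma finite_mi_order: "finite {\<alpha> :: 'd::finite \<Rightarrow> nat. mi_order \<alpha> \<le> m}"
proof (rule finite_subset)
  show "{\<alpha> :: 'd \<Rightarrow> nat. mi_order \<alpha> \<le> m} \<subseteq> (UNIV \<rightarrow>\<^sub>E {..m})"
  proof safe
    fix \<alpha> :: "'d \<Rightarrow> nat" and i assume "mi_order \<alpha> \<le> m"
    moreover have "\<alpha> i \<le> mi_order \<alpha>" unfolding mi_order_def by (rule member_le_sum) auto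
    ultimately show "\<alpha> i \<le> m" by simp
  qed auto
qed (simp add: finite_PiE)

lemma Bnorm_bound:
  fixes f :: "real^'d::finite \<Rightarrow> real"
  assumes "f \<in> Bspace m"
  shows "0 \<le> Bnorm m f" "mi_order \<alpha> \<le> m \<Longrightarrow> AE x in lborel. \<bar>gen_deriv \<alpha> f x\<bar> \<le> Bnorm m f"
proof -
  define s where "s = (\<lambda>x. \<Sum>\<alpha> | mi_order \<alpha> \<le> m. (gen_deriv \<alpha> f x)\<^sup>2)"
  define E where "E = esssup lborel (\<lambda>x. ereal (s x))"
  have meas: "gen_deriv \<alpha> f \<in> borel_measurable borel" if "mi_order \<alpha> \<le> m" for \<alpha>
    using Bspace_has_gen_deriv[OF assms that] locally_integrable_measurable unfolding has_gen_deriv_def by blast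
  have [measurable]: "s \<in> borel_measurable borel"
    unfolding s_def by (intro borel_measurable_sum borel_measurable_power meas) auto
  have "\<exists>C. AE x in lborel. (gen_deriv \<alpha> f x)\<^sup>2 \<le> C" if m: "mi_order \<alpha> \<le> m" for \<alpha>
  proof -
    obtain g where g: "has_gen_deriv \<alpha> f g" "bounded (range g)" using assms m unfolding Bspace_def by blast
    obtain C where C: "\<And>x. \<bar>g x\<bar> \<le> C" using g(2) unfolding bounded_iff by auto
    note h = Bspace_has_gen_deriv[OF assms m]
    have "AE x in lborel. (gen_deriv \<alpha> f x)\<^sup>2 \<le> C\<^sup>2"
      using gen_deriv_AE_le[OF h g(1)] gen_deriv_AE_le[OF g(1) h]
    proof eventually_elim
      case (elim x)
      then have "\<bar>gen_deriv \<alpha> f x\<bar> \<le> \<bar>C\<bar>" using C[of x] by linarith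
      then show ?case by (simp only: abs_le_square_iff)
    qed
    then show ?thesis by blast
  qed
  then obtain C where C: "\<And>\<alpha>. mi_order \<alpha> \<le> m \<Longrightarrow> AE x in lborel. (gen_deriv \<alpha> f x)\<^sup>2 \<le> C \<alpha>" by metis
  have "AE x in lborel. \<forall>\<alpha>\<in>{\<alpha>. mi_order \<alpha> \<le> m}. (gen_deriv \<alpha> f x)\<^sup>2 \<le> C \<alpha>"
    by (rule AE_finite_allI[OF finite_mi_order]) (use C in blast)
  then have "AE x in lborel. s x \<le> (\<Sum>\<alpha> | mi_order \<alpha> \<le> m. C \<alpha>)"
    by eventually_elim (auto simp: s_def intro!: sum_mono)
  then have E1: "E \<le> ereal (\<Sum>\<alpha> | mi_order \<alpha> \<le> m. C \<alpha>)"
    unfolding E_def by (intro esssup_I) auto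
  have snn: "0 \<le> s x" for x unfolding s_def by (intro sum_nonneg) auto
  have "esssup lborel (\<lambda>x::real^'d. 0::ereal) \<le> E" unfolding E_def by (rule esssup_mono) (auto simp: snn)
  then have E0: "0 \<le> E" by (subst (asm) esssup_const) auto
  \<comment> \<open>Finiteness matters here: \<open>real_of_ereal\<close> would send an infinite
    essential supremum to 0.\<close>
  have Er: "ereal (real_of_ereal E) = E" using E0 E1 by (intro ereal_real') auto
  have BE: "Bnorm m f = sqrt (real_of_ereal E)" by (simp add: Bnorm_def E_def s_def)
  show "0 \<le> Bnorm m f" using E0 by (simp add: BE real_of_ereal_pos)
  assume m: "mi_order \<alpha> \<le> m"
  have "AE x in lborel. ereal (s x) \<le> E" unfolding E_def by (rule esssup_AE)
  then show "AE x in lborel. \<bar>gen_deriv \<alpha> f x\<bar> \<le> Bnorm m f"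
  proof eventually_elim
    case (elim x)
    then have "s x \<le> real_of_ereal E" using Er by (metis ereal_less_eq(3))
    moreover have "(gen_deriv \<alpha> f x)\<^sup>2 \<le> s x"
      unfolding s_def by (rule member_le_sum) (use m finite_mi_order in auto)
    ultimately show ?case unfolding BE by (intro real_le_rsqrt) simp
  qed
qed

text \<open>The source of the factor \<open>Bnorm m f\<close> in the final estimate: averaging does
  not increase the essential bounds of the derivatives of \<open>f\<close>.\<close>

lemma Bspace_conv_bd_Bnorm:
  assumes "f \<in> Bspace m"
  shows "bd m (Bnorm m f) (conv f (bump n))"
  unfolding bd_def
proof (intro allI impI)
  fix "is" :: "'a list" and x assume l: "length is \<le> m"
  have c: "\<forall>i. count_list is i = (\<lambda>i. count_list is i) i" by simp
  have m: "mi_order (\<lambda>i. count_list is i) \<le> m" using l mi_order_count[OF c] by simp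
  note h = Bspace_has_gen_deriv[OF assms m]
  show "\<bar>foldr partial is (conv f (bump n)) x\<bar> \<le> Bnorm m f"
    unfolding conv_pderivs[OF Bspace_bmeas[OF assms] bump_test] conv_gen_deriv[OF h c bump_test]
    by (intro conv_bump_abs_le Bnorm_bound(2) assms m) (use h in \<open>simp add: has_gen_deriv_def\<close>)
qed

subsection \<open>Equations with shifts\<close>

lemma shift_contraction_bound:
  fixes b :: "'i \<Rightarrow> 'a \<Rightarrow> real" and w :: "'a \<Rightarrow> real"
  assumes "finite S" "\<And>\<xi> x. \<xi> \<in> S \<Longrightarrow> 0 \<le> b \<xi> x" "\<And>x. (\<Sum>\<xi>\<in>S. b \<xi> x) \<le> \<theta>" "\<theta> < 1"
    and "\<And>x. \<bar>w x\<bar> \<le> A" "\<And>x. \<bar>w x - (\<Sum>\<xi>\<in>S. b \<xi> x * w (\<sigma> \<xi> x))\<bar> \<le> G"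
  shows "\<bar>w x\<bar> \<le> G / (1 - \<theta>)"
proof -
  define B where "B = (SUP x. \<bar>w x\<bar>)"
  have bdd: "bdd_above (range (\<lambda>x. \<bar>w x\<bar>))" using assms(5) by (intro bdd_aboveI2)
  have wB: "\<bar>w x\<bar> \<le> B" for x unfolding B_def by (rule cSUP_upper[OF _ bdd]) simp
  have B0: "0 \<le> B" using wB[of x] by linarith
  have "\<bar>w x\<bar> \<le> \<theta> * B + G" for x
  proof -
    have "\<bar>\<Sum>\<xi>\<in>S. b \<xi> x * w (\<sigma> \<xi> x)\<bar> \<le> (\<Sum>\<xi>\<in>S. \<bar>b \<xi> x * w (\<sigma> \<xi> x)\<bar>)" by (rule sum_abs)
    also have "\<dots> \<le> (\<Sum>\<xi>\<in>S. b \<xi> x * B)"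
      using assms(2) wB by (intro sum_mono) (auto simp: abs_mult intro!: mult_left_mono)
    also have "\<dots> = (\<Sum>\<xi>\<in>S. b \<xi> x) * B" by (simp add: sum_distrib_right)
    also have "\<dots> \<le> \<theta> * B" by (intro mult_right_mono assms(3) B0)
    finally show ?thesis using assms(6)[of x] by linarith
  qed
  then have "B \<le> \<theta> * B + G" unfolding B_def by (intro cSUP_least) (auto simp: B_def[symmetric])
  then have "B * (1 - \<theta>) \<le> G" by (simp add: algebra_simps)
  then have "B \<le> G / (1 - \<theta>)" using assms(4) by (simp add: pos_le_divide_eq)
  then show ?thesis using wB[of x] by linarith
qed

text \<open>The Neumann series of the averaging operator, whose norm on bounded functions is at most
  \<open>\<theta> < 1\<close>.\<close>

lemma shift_equation_ex_bounded:
  fixes b :: "'i \<Rightarrow> 'a \<Rightarrow> real" and g :: "'a \<Rightarrow> real"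
  assumes "finite S" "\<And>\<xi> x. \<xi> \<in> S \<Longrightarrow> 0 \<le> b \<xi> x" "\<And>x. (\<Sum>\<xi>\<in>S. b \<xi> x) \<le> \<theta>" "\<theta> < 1"
    and "\<And>x. \<bar>g x\<bar> \<le> A"
  shows "\<exists>v B. (\<forall>x. \<bar>v x\<bar> \<le> B) \<and> (\<forall>x. v x = (\<Sum>\<xi>\<in>S. b \<xi> x * v (\<sigma> \<xi> x)) + g x)"
proof -
  define a where "a = rec_nat g (\<lambda>n u x. \<Sum>\<xi>\<in>S. b \<xi> x * u (\<sigma> \<xi> x))"
  have a0: "a 0 = g" and aS: "\<And>n. a (Suc n) = (\<lambda>x. \<Sum>\<xi>\<in>S. b \<xi> x * a n (\<sigma> \<xi> x))" by (simp_all add: a_def)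
  have th0: "0 \<le> \<theta>" by (rule order_trans[OF sum_nonneg assms(3)]) (use assms(2) in auto)
  have A0: "0 \<le> A" using order_trans[OF abs_ge_zero assms(5)] by blast
  have bnd: "\<bar>a n x\<bar> \<le> \<theta> ^ n * A" for n x
  proof (induction n arbitrary: x)
    case (Suc n)
    have "\<bar>a (Suc n) x\<bar> \<le> (\<Sum>\<xi>\<in>S. \<bar>b \<xi> x * a n (\<sigma> \<xi> x)\<bar>)" unfolding aS by (rule sum_abs)
    also have "\<dots> \<le> (\<Sum>\<xi>\<in>S. b \<xi> x * (\<theta> ^ n * A))"
      using assms(2) Suc by (intro sum_mono) (auto simp: abs_mult intro!: mult_left_mono)
    also have "\<dots> = (\<Sum>\<xi>\<in>S. b \<xi> x) * (\<theta> ^ n * A)" by (simp add: sum_distrib_right)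
    also have "\<dots> \<le> \<theta> * (\<theta> ^ n * A)" using th0 A0 by (intro mult_right_mono assms(3)) auto
    finally show ?case by (simp add: mult_ac)
  qed (simp add: a0 assms)
  have sg: "summable (\<lambda>n. \<theta> ^ n * A)" using th0 assms(4) by (intro summable_mult2 summable_geometric) auto
  have sa: "summable (\<lambda>n. \<bar>a n x\<bar>)" for x
    by (rule summable_comparison_test'[OF sg, of 0]) (use bnd in auto)
  have s: "summable (\<lambda>n. a n x)" for x using sa[of x] by (rule summable_rabs_cancel)
  define v where "v = (\<lambda>x. \<Sum>n. a n x)"
  have "v x = (\<Sum>\<xi>\<in>S. b \<xi> x * v (\<sigma> \<xi> x)) + g x" for x
  proof -
    have "v x = (\<Sum>n. a (Suc n) x) + a 0 x" unfolding v_def by (subst suminf_split_head[OF s]) simp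
    also have "(\<Sum>n. a (Suc n) x) = (\<Sum>\<xi>\<in>S. \<Sum>n. b \<xi> x * a n (\<sigma> \<xi> x))"
      unfolding aS by (rule suminf_sum) (intro summable_mult s)
    also have "\<dots> = (\<Sum>\<xi>\<in>S. b \<xi> x * v (\<sigma> \<xi> x))" unfolding v_def by (simp add: suminf_mult s)
    finally show ?thesis by (simp add: a0)
  qed
  moreover have "\<bar>v x\<bar> \<le> (\<Sum>n. \<theta> ^ n * A)" for x
    unfolding v_def by (rule order_trans[OF summable_rabs[OF sa] suminf_le[OF bnd sa sg]])
  ultimately show ?thesis by blast
qed

text \<open>Shifts commute with derivatives, so the differentiated equation has the same averaging
  operator and the same contraction constant \<open>\<theta>\<close>, with the derivatives of
  \<open>b\<close> moved into the right-hand side. This is why solutions are as smooth as the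
  data.\<close>

locale shift_equation =
  fixes S :: "(real^'d::finite) set" and b :: "real^'d \<Rightarrow> real^'d \<Rightarrow> real" and \<theta> h :: real
  assumes fin: "finite S" and bnn: "\<And>\<xi> x. \<xi> \<in> S \<Longrightarrow> 0 \<le> b \<xi> x"
    and bsum: "\<And>x. (\<Sum>\<xi>\<in>S. b \<xi> x) \<le> \<theta>" and th: "\<theta> < 1"
    and bsm: "\<And>\<xi>. \<xi> \<in> S \<Longrightarrow> smb (b \<xi>)"
begin

definition sol :: "(real^'d \<Rightarrow> real) \<Rightarrow> (real^'d \<Rightarrow> real) \<Rightarrow> bool" where
  "sol g v \<longleftrightarrow> (\<exists>B. \<forall>x. \<bar>v x\<bar> \<le> B) \<and> (\<forall>x. v x = (\<Sum>\<xi>\<in>S. b \<xi> x * v (x + h *\<^sub>R \<xi>)) + g x)"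

lemma sol_ex: "lipb g \<Longrightarrow> \<exists>v. sol g v"
  using shift_equation_ex_bounded[where S = S and b = b and g = g and \<sigma> = "\<lambda>\<xi> x. x + h *\<^sub>R \<xi>", OF fin bnn bsum th] unfolding sol_def
  by (metis lipbE)

lemma bound: "(\<And>x. \<bar>w x\<bar> \<le> A) \<Longrightarrow> (\<And>x. \<bar>w x - (\<Sum>\<xi>\<in>S. b \<xi> x * w (x + h *\<^sub>R \<xi>))\<bar> \<le> G) \<Longrightarrow> \<bar>w x\<bar> \<le> G / (1 - \<theta>)"
  by (rule shift_contraction_bound[where S = S and b = b and w = w and \<sigma> = "\<lambda>\<xi> x. x + h *\<^sub>R \<xi>", OF fin bnn bsum th])

text \<open>The increment of \<open>v\<close> by a fixed \<open>y\<close> solves the same equation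
  with a right-hand side of size O(norm y), so \<open>bound\<close> applies to it.\<close>

lemma sol_lipb:
  assumes "lipb g" "sol g v"
  shows "lipb v"
proof -
  obtain A where A: "\<And>x. \<bar>v x\<bar> \<le> A" using assms(2) sol_def by blast
  have veq: "v x = (\<Sum>\<xi>\<in>S. b \<xi> x * v (x + h *\<^sub>R \<xi>)) + g x" for x using assms(2) sol_def by blast
  have A0: "0 \<le> A" using A[of 0] by linarith
  obtain L where L: "L > 0" "\<And>x y. \<bar>g x - g y\<bar> \<le> L * dist x y" using assms(1) by (metis lipbE)
  have "\<exists>M>0. \<forall>x y. \<bar>b \<xi> x - b \<xi> y\<bar> \<le> M * dist x y" if "\<xi> \<in> S" for \<xi>
    using smb_lipb[OF bsm[OF that]] by (metis lipbE)
  then obtain M where M: "\<And>\<xi>. \<xi> \<in> S \<Longrightarrow> M \<xi> > 0" "\<And>\<xi> x y. \<xi> \<in> S \<Longrightarrow> \<bar>b \<xi> x - b \<xi> y\<bar> \<le> M \<xi> * dist x y" by metis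
  define C where "C = (\<Sum>\<xi>\<in>S. M \<xi> * A) + L"
  have "\<bar>v (x + y) - v x\<bar> \<le> (C * norm y) / (1 - \<theta>)" for x y
  proof (rule bound[of "\<lambda>x. v (x + y) - v x"])
    show "\<bar>v (x + y) - v x\<bar> \<le> A + A" for x using A[of x] A[of "x + y"] by linarith
    fix x
    have "v (x + y) - v x - (\<Sum>\<xi>\<in>S. b \<xi> x * (v (x + h *\<^sub>R \<xi> + y) - v (x + h *\<^sub>R \<xi>)))
      = (\<Sum>\<xi>\<in>S. (b \<xi> (x + y) - b \<xi> x) * v (x + y + h *\<^sub>R \<xi>)) + (g (x + y) - g x)"
      using veq[of "x + y"] veq[of x]
      by (simp add: left_diff_distrib right_diff_distrib sum_subtractf add_ac)
    also have "\<bar>\<dots>\<bar> \<le> (\<Sum>\<xi>\<in>S. \<bar>(b \<xi> (x + y) - b \<xi> x) * v (x + y + h *\<^sub>R \<xi>)\<bar>) + \<bar>g (x + y) - g x\<bar>"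
      by (rule order_trans[OF abs_triangle_ineq]) (simp add: sum_abs)
    also have "\<dots> \<le> (\<Sum>\<xi>\<in>S. M \<xi> * A * norm y) + L * norm y"
    proof (intro add_mono sum_mono)
      fix \<xi> assume "\<xi> \<in> S"
      have "\<bar>b \<xi> (x + y) - b \<xi> x\<bar> * \<bar>v (x + y + h *\<^sub>R \<xi>)\<bar> \<le> (M \<xi> * norm y) * A"
        using M(2)[OF \<open>\<xi> \<in> S\<close>, of "x + y" x] M(1)[OF \<open>\<xi> \<in> S\<close>] A A0
        by (intro mult_mono) (auto simp: dist_norm)
      then show "\<bar>(b \<xi> (x + y) - b \<xi> x) * v (x + y + h *\<^sub>R \<xi>)\<bar> \<le> M \<xi> * A * norm y"
        by (simp add: abs_mult mult_ac)
    next
      show "\<bar>g (x + y) - g x\<bar> \<le> L * norm y" using L(2)[of "x + y" x] by (simp add: dist_norm)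
    qed
    also have "\<dots> = C * norm y" by (simp add: C_def sum_distrib_right distrib_right)
    finally show "\<bar>v (x + y) - v x - (\<Sum>\<xi>\<in>S. b \<xi> x * (v (x + h *\<^sub>R \<xi> + y) - v (x + h *\<^sub>R \<xi>)))\<bar> \<le> C * norm y" .
  qed
  from this[of _ "_ - _"] have "\<bar>v x - v y\<bar> \<le> (C / (1 - \<theta>)) * dist x y" for x y
    by (metis add.commute diff_add_cancel dist_norm times_divide_eq_left)
  then show ?thesis using A lipbI by blast
qed

text \<open>Candidates \<open>w i\<close> for the partial derivatives are obtained by solving the
  formally differentiated equation, whose right-hand side \<open>gi i\<close> contains only
  \<open>v\<close> and the data. The Taylor remainder of \<open>v\<close> formed with them solves
  the original equation with a quadratically small right-hand side, and \<open>bound\<close> makes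
  it quadratically small itself.\<close>

lemma sol_Cb: "Cb n g \<Longrightarrow> sol g v \<Longrightarrow> Cb n v"
proof (induction n arbitrary: g v)
  case 0
  then show ?case by (simp add: sol_lipb)
next
  case (Suc n)
  have vn: "Cb n v" using Suc Cb_Suc by blast
  have lg: "lipb g" using Cb_lipb[OF Suc.prems(1)] .
  have lv: "lipb v" using Cb_lipb[OF vn] .
  obtain A where A: "A > 0" "\<And>x. \<bar>v x\<bar> \<le> A" "\<And>x y. \<bar>v x - v y\<bar> \<le> A * dist x y" using lv by (metis lipbE)
  have veq: "v x = (\<Sum>\<xi>\<in>S. b \<xi> x * v (x + h *\<^sub>R \<xi>)) + g x" for x using Suc.prems(2) sol_def by blast
  define gi where "gi = (\<lambda>i x. (\<Sum>\<xi>\<in>S. partial i (b \<xi>) x * v (x + h *\<^sub>R \<xi>)) + partial i g x)"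
  have pg: "Cb n (partial i g)" for i by (rule Cb_partial[OF Suc.prems(1)])
  have gin: "Cb n (gi i)" for i
    unfolding gi_def by (intro Cb_add Cb_sum Cb_mult Cb_shift vn pg smb_Cb[OF smb_partial[OF bsm]])
  obtain w where w: "\<And>i. sol (gi i) (w i)" using sol_ex[OF Cb_lipb[OF gin]] by metis
  have wn: "Cb n (w i)" for i by (rule Suc.IH[OF gin w])
  have weq: "w i x = (\<Sum>\<xi>\<in>S. b \<xi> x * w i (x + h *\<^sub>R \<xi>)) + gi i x" for i x using w sol_def by blast
  obtain W where W: "\<And>i x. \<bar>w i x\<bar> \<le> W i" using w unfolding sol_def by metis
  obtain Cg where Cg: "Cg \<ge> 0" "\<And>x y. \<bar>g (x + y) - g x - (\<Sum>i\<in>UNIV. y $ i * partial i g x)\<bar> \<le> Cg * (norm y)\<^sup>2"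
    using Cb1_quadratic_remainder[of g] Cb_mono[OF _ Suc.prems(1), of "Suc 0"] by auto
  have "\<exists>C\<ge>0. \<forall>x y. \<bar>b \<xi> (x + y) - b \<xi> x - (\<Sum>i\<in>UNIV. y $ i * partial i (b \<xi>) x)\<bar> \<le> C * (norm y)\<^sup>2" if "\<xi> \<in> S" for \<xi>
    using Cb1_quadratic_remainder[OF smb_Cb[OF bsm[OF that]]] .
  then obtain Cb' where Cb': "\<And>\<xi>. \<xi> \<in> S \<Longrightarrow> Cb' \<xi> \<ge> 0"
    "\<And>\<xi> x y. \<xi> \<in> S \<Longrightarrow> \<bar>b \<xi> (x + y) - b \<xi> x - (\<Sum>i\<in>UNIV. y $ i * partial i (b \<xi>) x)\<bar> \<le> Cb' \<xi> * (norm y)\<^sup>2"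
    by metis
  have "\<exists>B. bd 1 B (b \<xi>)" if "\<xi> \<in> S" for \<xi> using smb_bd_ex[OF bsm[OF that]] .
  then obtain B where B: "\<And>\<xi>. \<xi> \<in> S \<Longrightarrow> bd 1 (B \<xi>) (b \<xi>)" by metis
  define C where "C = (\<Sum>\<xi>\<in>S. Cb' \<xi> * A + real CARD('d) * B \<xi> * A) + Cg"
  have quad: "\<bar>v (x + y) - v x - (\<Sum>i\<in>UNIV. y $ i * w i x)\<bar> \<le> C * (norm y)\<^sup>2 / (1 - \<theta>)" for x y
  proof (rule bound[of "\<lambda>x. v (x + y) - v x - (\<Sum>i\<in>UNIV. y $ i * w i x)"])
    fix x
    have "\<bar>\<Sum>i\<in>UNIV. y $ i * w i x\<bar> \<le> (\<Sum>i\<in>UNIV. \<bar>y $ i * w i x\<bar>)" by (rule sum_abs)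
    also have "\<dots> \<le> (\<Sum>i\<in>UNIV. \<bar>y $ i\<bar> * W i)"
      by (intro sum_mono) (auto simp: abs_mult W intro!: mult_left_mono)
    finally show "\<bar>v (x + y) - v x - (\<Sum>i\<in>UNIV. y $ i * w i x)\<bar> \<le> A + A + (\<Sum>i\<in>UNIV. \<bar>y $ i\<bar> * W i)"
      using A(2)[of x] A(2)[of "x + y"] by linarith
  next
    fix x
    define D where "D = (\<lambda>\<xi>. \<Sum>i\<in>UNIV. y $ i * partial i (b \<xi>) x)"
    have swap: "(\<Sum>i\<in>UNIV. y $ i * w i x) = (\<Sum>\<xi>\<in>S. b \<xi> x * (\<Sum>i\<in>UNIV. y $ i * w i (x + h *\<^sub>R \<xi>)))
        + (\<Sum>\<xi>\<in>S. D \<xi> * v (x + h *\<^sub>R \<xi>)) + (\<Sum>i\<in>UNIV. y $ i * partial i g x)"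
    proof -
      have "(\<Sum>i\<in>UNIV. y $ i * w i x) = (\<Sum>i\<in>UNIV. (\<Sum>\<xi>\<in>S. b \<xi> x * (y $ i * w i (x + h *\<^sub>R \<xi>)))
          + (\<Sum>\<xi>\<in>S. y $ i * partial i (b \<xi>) x * v (x + h *\<^sub>R \<xi>)) + y $ i * partial i g x)"
        by (subst weq) (simp add: gi_def distrib_left sum_distrib_left mult_ac add.assoc)
      also have "\<dots> = (\<Sum>i\<in>UNIV. \<Sum>\<xi>\<in>S. b \<xi> x * (y $ i * w i (x + h *\<^sub>R \<xi>)))
          + (\<Sum>i\<in>UNIV. \<Sum>\<xi>\<in>S. y $ i * partial i (b \<xi>) x * v (x + h *\<^sub>R \<xi>)) + (\<Sum>i\<in>UNIV. y $ i * partial i g x)"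
        by (simp add: sum.distrib)
      also have "(\<Sum>i\<in>UNIV. \<Sum>\<xi>\<in>S. b \<xi> x * (y $ i * w i (x + h *\<^sub>R \<xi>))) = (\<Sum>\<xi>\<in>S. b \<xi> x * (\<Sum>i\<in>UNIV. y $ i * w i (x + h *\<^sub>R \<xi>)))"
        by (subst sum.swap) (simp add: sum_distrib_left)
      also have "(\<Sum>i\<in>UNIV. \<Sum>\<xi>\<in>S. y $ i * partial i (b \<xi>) x * v (x + h *\<^sub>R \<xi>)) = (\<Sum>\<xi>\<in>S. D \<xi> * v (x + h *\<^sub>R \<xi>))"
        by (subst sum.swap) (simp add: D_def sum_distrib_right)
      finally show ?thesis .
    qed
    \<comment> \<open>What is left after inserting the equations of \<open>v\<close> and of all
      \<open>w i\<close>: the Taylor remainders of \<open>b\<close> and \<open>g\<close>, and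
      products of two first-order increments.\<close>
    define Y where "Y = (\<Sum>\<xi>\<in>S. (b \<xi> (x + y) - b \<xi> x - D \<xi>) * v (x + y + h *\<^sub>R \<xi>) + D \<xi> * (v (x + y + h *\<^sub>R \<xi>) - v (x + h *\<^sub>R \<xi>)))
        + (g (x + y) - g x - (\<Sum>i\<in>UNIV. y $ i * partial i g x))"
    have eq: "v (x + y) - v x - (\<Sum>i\<in>UNIV. y $ i * w i x)
        - (\<Sum>\<xi>\<in>S. b \<xi> x * (v (x + h *\<^sub>R \<xi> + y) - v (x + h *\<^sub>R \<xi>) - (\<Sum>i\<in>UNIV. y $ i * w i (x + h *\<^sub>R \<xi>))))
      = Y"
    proof -
      have 1: "(\<Sum>\<xi>\<in>S. (b \<xi> (x + y) - b \<xi> x - D \<xi>) * v (x + y + h *\<^sub>R \<xi>) + D \<xi> * (v (x + y + h *\<^sub>R \<xi>) - v (x + h *\<^sub>R \<xi>)))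
        = (\<Sum>\<xi>\<in>S. b \<xi> (x + y) * v (x + y + h *\<^sub>R \<xi>)) - (\<Sum>\<xi>\<in>S. b \<xi> x * v (x + y + h *\<^sub>R \<xi>)) - (\<Sum>\<xi>\<in>S. D \<xi> * v (x + h *\<^sub>R \<xi>))"
        unfolding sum_subtractf[symmetric] by (rule sum.cong) (auto simp: algebra_simps)
      have 2: "(\<Sum>\<xi>\<in>S. b \<xi> x * (v (x + h *\<^sub>R \<xi> + y) - v (x + h *\<^sub>R \<xi>) - (\<Sum>i\<in>UNIV. y $ i * w i (x + h *\<^sub>R \<xi>))))
        = (\<Sum>\<xi>\<in>S. b \<xi> x * v (x + y + h *\<^sub>R \<xi>)) - (\<Sum>\<xi>\<in>S. b \<xi> x * v (x + h *\<^sub>R \<xi>))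
          - (\<Sum>\<xi>\<in>S. b \<xi> x * (\<Sum>i\<in>UNIV. y $ i * w i (x + h *\<^sub>R \<xi>)))"
        unfolding sum_subtractf[symmetric] by (rule sum.cong) (auto simp: right_diff_distrib add_ac)
      show ?thesis unfolding Y_def using 1 2 swap veq[of "x + y"] veq[of x] by linarith
    qed
    have "\<bar>Y\<bar> \<le> (\<Sum>\<xi>\<in>S. \<bar>(b \<xi> (x + y) - b \<xi> x - D \<xi>) * v (x + y + h *\<^sub>R \<xi>) + D \<xi> * (v (x + y + h *\<^sub>R \<xi>) - v (x + h *\<^sub>R \<xi>))\<bar>)
        + \<bar>g (x + y) - g x - (\<Sum>i\<in>UNIV. y $ i * partial i g x)\<bar>"
      unfolding Y_def by (rule order_trans[OF abs_triangle_ineq]) (simp add: sum_abs)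
    also have "\<dots> \<le> (\<Sum>\<xi>\<in>S. (Cb' \<xi> * A + real CARD('d) * B \<xi> * A) * (norm y)\<^sup>2) + Cg * (norm y)\<^sup>2"
    proof (rule add_mono[OF sum_mono Cg(2)])
      fix \<xi> assume s: "\<xi> \<in> S"
      have "\<bar>b \<xi> (x + y) - b \<xi> x - D \<xi>\<bar> * \<bar>v (x + y + h *\<^sub>R \<xi>)\<bar> \<le> (Cb' \<xi> * (norm y)\<^sup>2) * A"
        unfolding D_def using Cb'(2)[OF s, of x y] Cb'(1)[OF s] A(1) A(2)[of "x + y + h *\<^sub>R \<xi>"]
        by (intro mult_mono) simp_all
      moreover have "\<bar>D \<xi>\<bar> * \<bar>v (x + y + h *\<^sub>R \<xi>) - v (x + h *\<^sub>R \<xi>)\<bar> \<le> (real CARD('d) * norm y * B \<xi>) * (A * norm y)"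
      proof (intro mult_mono)
        show "\<bar>D \<xi>\<bar> \<le> real CARD('d) * norm y * B \<xi>"
          unfolding D_def by (rule norm_eq_abs_sum_le) (use bd1 B[OF s] in force)
        show "\<bar>v (x + y + h *\<^sub>R \<xi>) - v (x + h *\<^sub>R \<xi>)\<bar> \<le> A * norm y"
          using A(3)[of "x + y + h *\<^sub>R \<xi>" "x + h *\<^sub>R \<xi>"] by (simp add: dist_norm)
      qed (use bd_nonneg[OF B[OF s]] in auto)
      then have "\<bar>(b \<xi> (x + y) - b \<xi> x - D \<xi>) * v (x + y + h *\<^sub>R \<xi>)\<bar> + \<bar>D \<xi> * (v (x + y + h *\<^sub>R \<xi>) - v (x + h *\<^sub>R \<xi>))\<bar>
          \<le> (Cb' \<xi> * A + real CARD('d) * B \<xi> * A) * (norm y)\<^sup>2"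
      proof -
        have "(Cb' \<xi> * A + real CARD('d) * B \<xi> * A) * (norm y)\<^sup>2
            = (Cb' \<xi> * (norm y)\<^sup>2) * A + (real CARD('d) * norm y * B \<xi>) * (A * norm y)"
          by (simp add: power2_eq_square algebra_simps)
        then show ?thesis unfolding abs_mult
          using \<open>\<bar>b \<xi> (x + y) - b \<xi> x - D \<xi>\<bar> * _ \<le> _\<close> \<open>\<bar>D \<xi>\<bar> * _ \<le> _\<close> by linarith
      qed
      then show "\<bar>(b \<xi> (x + y) - b \<xi> x - D \<xi>) * v (x + y + h *\<^sub>R \<xi>) + D \<xi> * (v (x + y + h *\<^sub>R \<xi>) - v (x + h *\<^sub>R \<xi>))\<bar>
          \<le> (Cb' \<xi> * A + real CARD('d) * B \<xi> * A) * (norm y)\<^sup>2"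
        using abs_triangle_ineq order_trans by blast
    qed
    also have "\<dots> = C * (norm y)\<^sup>2" by (simp add: C_def sum_distrib_right distrib_right)
    finally have "\<bar>Y\<bar> \<le> C * (norm y)\<^sup>2" .
    then show "\<bar>v (x + y) - v x - (\<Sum>i\<in>UNIV. y $ i * w i x)
        - (\<Sum>\<xi>\<in>S. b \<xi> x * (v (x + h *\<^sub>R \<xi> + y) - v (x + h *\<^sub>R \<xi>) - (\<Sum>i\<in>UNIV. y $ i * w i (x + h *\<^sub>R \<xi>))))\<bar>
      \<le> C * (norm y)\<^sup>2" unfolding eq .
  qed
  have "\<And>x. v differentiable at x" "\<And>i. partial i v = w i"
    using partial_quadratic_eq[of v w "C / (1 - \<theta>)"] quad by auto
  then show ?case using lv wn by simp
qed

lemma sol_smb_ex: "smb g \<Longrightarrow> \<exists>v. smb v \<and> (\<forall>x. v x = (\<Sum>\<xi>\<in>S. b \<xi> x * v (x + h *\<^sub>R \<xi>)) + g x)"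
  using sol_ex[OF smb_lipb] sol_Cb unfolding smb_def sol_def by metis

end

subsection \<open>Solvability of the difference equation and the maximum principle\<close>

lemma Lh_alt:
  assumes "h \<noteq> 0"
  shows "Lh \<Lambda> q p c h \<phi> x = (\<Sum>\<xi>\<in>\<Lambda>. (q \<xi> x + h * p \<xi> x) / h\<^sup>2 * (\<phi> (x + h *\<^sub>R \<xi>) - \<phi> x)) - c x * \<phi> x"
proof -
  have "(1 / h) * (q \<xi> x * fdiff h \<xi> \<phi> x) + p \<xi> x * fdiff h \<xi> \<phi> x
      = (q \<xi> x + h * p \<xi> x) / h\<^sup>2 * (\<phi> (x + h *\<^sub>R \<xi>) - \<phi> x)" for \<xi>
    using assms by (simp add: fdiff_def field_simps power2_eq_square)
  then show ?thesis
    by (simp add: Lh_def sum_distrib_left flip: sum.distrib)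
qed

text \<open>Adding a multiple of \<open>v\<close> to both sides turns the difference equation into a
  shift equation with the additional shift 0, for which the index \<open>0\<close> is free because
  \<open>0 \<notin> \<Lambda>\<close>. The positivity of \<open>c\<close> makes the total weight
  smaller than 1.\<close>

lemma Lh_ex_solution:
  fixes \<Lambda> :: "(real^'d::finite) set"
  assumes fin: "finite \<Lambda>" and n0: "0 \<notin> \<Lambda>" and h: "0 < h"
    and sm: "\<And>\<xi>. \<xi> \<in> \<Lambda> \<Longrightarrow> smb (q \<xi>)" "\<And>\<xi>. \<xi> \<in> \<Lambda> \<Longrightarrow> smb (p \<xi>)" "smb c" "smb f"
    and nn: "\<And>\<xi> x. \<xi> \<in> \<Lambda> \<Longrightarrow> 0 \<le> q \<xi> x + h * p \<xi> x" and c: "0 < c0" "\<And>x. c0 \<le> c x"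
  shows "\<exists>v. smb v \<and> (\<forall>x. Lh \<Lambda> q p c h v x + f x = 0)"
proof -
  define a where "a = (\<lambda>\<xi> x. (q \<xi> x + h * p \<xi> x) / h\<^sup>2)"
  have asm: "smb (a \<xi>)" if "\<xi> \<in> \<Lambda>" for \<xi> unfolding a_def by (intro smb_intros sm that)
  have ann: "0 \<le> a \<xi> x" if "\<xi> \<in> \<Lambda>" for \<xi> x using nn[OF that] h by (simp add: a_def)
  define s where "s = (\<lambda>x. c x + (\<Sum>\<xi>\<in>\<Lambda>. a \<xi> x))"
  have ssm: "smb s" unfolding s_def by (intro smb_intros sm asm)
  obtain R where R: "R > 0" "\<And>x. \<bar>s x\<bar> \<le> R" using smb_lipb[OF ssm] by (metis lipbE)
  \<comment> \<open>The relaxation parameter is small enough for the weight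
    \<open>1 - \<rho> * s x\<close> of the zero shift to stay nonnegative.\<close>
  define \<rho> where "\<rho> = 1 / R"
  have rho: "\<rho> > 0" using R by (simp add: \<rho>_def)
  define b where "b = (\<lambda>\<xi> x. if \<xi> = 0 then 1 - \<rho> * s x else \<rho> * a \<xi> x)"
  have bL: "(\<Sum>\<xi>\<in>\<Lambda>. b \<xi> x * F \<xi>) = \<rho> * (\<Sum>\<xi>\<in>\<Lambda>. a \<xi> x * F \<xi>)" for x F
    unfolding sum_distrib_left by (rule sum.cong) (use n0 in \<open>auto simp: b_def mult.assoc\<close>)
  interpret shift_equation "insert 0 \<Lambda>" b "1 - \<rho> * c0" h
  proof
    show "finite (insert 0 \<Lambda>)" using fin by simp
    show "0 \<le> b \<xi> x" if "\<xi> \<in> insert 0 \<Lambda>" for \<xi> x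
    proof (cases "\<xi> = 0")
      case True
      have "\<rho> * s x \<le> \<rho> * R" using R(2)[of x] rho by (intro mult_left_mono) auto
      then show ?thesis using True R(1) by (simp add: b_def \<rho>_def)
    next
      case False
      then show ?thesis using ann[of \<xi> x] that rho by (simp add: b_def)
    qed
    show "(\<Sum>\<xi>\<in>insert 0 \<Lambda>. b \<xi> x) \<le> 1 - \<rho> * c0" for x
    proof -
      have "(\<Sum>\<xi>\<in>insert 0 \<Lambda>. b \<xi> x) = 1 - \<rho> * c x"
        using fin n0 bL[of x "\<lambda>_. 1"] by (simp add: b_def s_def algebra_simps)
      then show ?thesis using c(2)[of x] rho by simp
    qed
    show "1 - \<rho> * c0 < 1" using rho c by simp
    show "smb (b \<xi>)" if "\<xi> \<in> insert 0 \<Lambda>" for \<xi>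
    proof (cases "\<xi> = 0")
      case True
      then have "b \<xi> = (\<lambda>x. 1 - \<rho> * s x)" by (simp add: b_def)
      then show ?thesis by (simp add: smb_intros ssm)
    next
      case False
      then have "b \<xi> = (\<lambda>x. \<rho> * a \<xi> x)" by (simp add: b_def)
      then show ?thesis using False that by (simp add: smb_intros asm)
    qed
  qed
  obtain v where v: "smb v" "\<And>x. v x = (\<Sum>\<xi>\<in>insert 0 \<Lambda>. b \<xi> x * v (x + h *\<^sub>R \<xi>)) + \<rho> * f x"
    using sol_smb_ex[of "\<lambda>x. \<rho> * f x"] sm(4) smb_intros by blast
  have "Lh \<Lambda> q p c h v x + f x = 0" for x
  proof -
    have "v x = (1 - \<rho> * s x) * v x + \<rho> * (\<Sum>\<xi>\<in>\<Lambda>. a \<xi> x * v (x + h *\<^sub>R \<xi>)) + \<rho> * f x"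
      using v(2)[of x] fin n0 bL[of x "\<lambda>\<xi>. v (x + h *\<^sub>R \<xi>)"] by (simp add: b_def)
    then have "\<rho> * ((\<Sum>\<xi>\<in>\<Lambda>. a \<xi> x * v (x + h *\<^sub>R \<xi>)) - s x * v x + f x) = 0"
      by (simp add: algebra_simps)
    then have "(\<Sum>\<xi>\<in>\<Lambda>. a \<xi> x * v (x + h *\<^sub>R \<xi>)) - s x * v x + f x = 0" using rho by simp
    moreover have "Lh \<Lambda> q p c h v x = (\<Sum>\<xi>\<in>\<Lambda>. a \<xi> x * v (x + h *\<^sub>R \<xi>)) - s x * v x"
    proof -
      have "Lh \<Lambda> q p c h v x = (\<Sum>\<xi>\<in>\<Lambda>. a \<xi> x * (v (x + h *\<^sub>R \<xi>) - v x)) - c x * v x"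
        using h by (simp add: Lh_alt a_def)
      then show ?thesis
        by (simp add: s_def right_diff_distrib sum_subtractf distrib_right sum_distrib_right)
    qed
    ultimately show ?thesis by simp
  qed
  then show ?thesis using v(1) by blast
qed

text \<open>The supremum need not be attained, so the inequality is evaluated where \<open>W\<close>
  is within \<open>e\<close> of it. There the difference part is at most \<open>A * e\<close>, and
  \<open>e\<close> tends to 0.\<close>

lemma max_principle:
  fixes W :: "'a \<Rightarrow> real" and a :: "'i \<Rightarrow> 'a \<Rightarrow> real" and \<sigma> :: "'i \<Rightarrow> 'a \<Rightarrow> 'a"
  assumes "finite \<Lambda>" "\<And>\<xi> x. \<xi> \<in> \<Lambda> \<Longrightarrow> 0 \<le> a \<xi> x" "\<And>x. (\<Sum>\<xi>\<in>\<Lambda>. a \<xi> x) \<le> A"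
    and c: "0 < c0" "\<And>x. c0 \<le> c x" and W: "\<And>x. W x \<le> B0"
    and le: "\<And>x. c x * W x \<le> (\<Sum>\<xi>\<in>\<Lambda>. a \<xi> x * (W (\<sigma> \<xi> x) - W x)) + c x * B"
  shows "W x \<le> B"
proof -
  define S where "S = (SUP x. W x)"
  have bdd: "bdd_above (range W)" using W by (intro bdd_aboveI2)
  have WS: "W x \<le> S" for x unfolding S_def by (rule cSUP_upper[OF _ bdd]) simp
  have A0: "0 \<le> A" by (rule order_trans[OF sum_nonneg assms(3)]) (use assms(2) in auto)
  have "S - B \<le> (A / c0 + 1) * e" if e: "0 < e" for e
  proof -
    have "\<exists>x\<in>UNIV. S - e < W x" unfolding S_def
      using less_cSUP_iff[OF _ bdd, of "S - e"] e by (simp add: S_def)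
    then obtain x where x: "S - e < W x" by blast
    have cx: "0 < c x" using c(1) c(2)[of x] by linarith
    have "(\<Sum>\<xi>\<in>\<Lambda>. a \<xi> x * (W (\<sigma> \<xi> x) - W x)) \<le> (\<Sum>\<xi>\<in>\<Lambda>. a \<xi> x * e)"
    proof (intro sum_mono mult_left_mono assms(2))
      fix \<xi> show "W (\<sigma> \<xi> x) - W x \<le> e" using WS[of "\<sigma> \<xi> x"] x by linarith
    qed
    also have "\<dots> \<le> A * e" using assms(3)[of x] e by (simp add: sum_distrib_right[symmetric] mult_right_mono)
    finally have "c x * (W x - B) \<le> A * e" using le[of x] by (simp add: right_diff_distrib)
    then have "W x - B \<le> A * e / c x" using cx by (simp add: pos_le_divide_eq mult.commute)
    also have "\<dots> \<le> A * e / c0" using c(1) c(2)[of x] cx A0 e by (intro divide_left_mono) auto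
    finally show ?thesis using x by (simp add: distrib_right)
  qed
  then have "S - B \<le> 0" by (rule nonpos_if_le_mult)
  then show ?thesis using WS[of x] by linarith
qed

lemma Lh_bound:
  fixes \<Lambda> :: "(real^'d::finite) set"
  assumes "finite \<Lambda>" "0 < h"
    and bq: "\<And>\<xi>. \<xi> \<in> \<Lambda> \<Longrightarrow> bounded (range (q \<xi>))" "\<And>\<xi>. \<xi> \<in> \<Lambda> \<Longrightarrow> bounded (range (p \<xi>))"
    and nn: "\<And>\<xi> x. \<xi> \<in> \<Lambda> \<Longrightarrow> 0 \<le> q \<xi> x + h * p \<xi> x" and c: "0 < c0" "\<And>x. c0 \<le> c x"
    and W: "bounded (range W)" and G: "\<And>x. \<bar>Lh \<Lambda> q p c h W x\<bar> \<le> G"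
  shows "\<bar>W x\<bar> \<le> G / c0"
proof -
  define a where "a = (\<lambda>\<xi> x. (q \<xi> x + h * p \<xi> x) / h\<^sup>2)"
  have ann: "0 \<le> a \<xi> x" if "\<xi> \<in> \<Lambda>" for \<xi> x using nn[OF that] assms(2) by (simp add: a_def)
  have "\<exists>A. \<forall>x. a \<xi> x \<le> A" if x: "\<xi> \<in> \<Lambda>" for \<xi>
  proof -
    obtain Q where Q: "\<And>x. \<bar>q \<xi> x\<bar> \<le> Q" using bq(1)[OF x] unfolding bounded_iff by auto
    obtain P where P: "\<And>x. \<bar>p \<xi> x\<bar> \<le> P" using bq(2)[OF x] unfolding bounded_iff by auto
    have "a \<xi> x \<le> (Q + h * P) / h\<^sup>2" for x
      unfolding a_def using Q[of x] P[of x] assms(2)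
      by (intro divide_right_mono add_mono mult_left_mono) (auto simp: abs_le_iff)
    then show ?thesis by blast
  qed
  then obtain A where A: "\<And>\<xi> x. \<xi> \<in> \<Lambda> \<Longrightarrow> a \<xi> x \<le> A \<xi>" by metis
  have As: "(\<Sum>\<xi>\<in>\<Lambda>. a \<xi> x) \<le> (\<Sum>\<xi>\<in>\<Lambda>. A \<xi>)" for x by (intro sum_mono A)
  obtain B0 where B0: "\<And>x. \<bar>W x\<bar> \<le> B0" using W unfolding bounded_iff by auto
  have G0: "0 \<le> G" using order_trans[OF abs_ge_zero G] by blast
  have cG: "G \<le> c x * (G / c0)" for x
  proof -
    have "c0 * (G / c0) \<le> c x * (G / c0)" using c G0 by (intro mult_right_mono) auto
    then show ?thesis using c(1) by simp
  qed
  have L: "Lh \<Lambda> q p c h W x = (\<Sum>\<xi>\<in>\<Lambda>. a \<xi> x * (W (x + h *\<^sub>R \<xi>) - W x)) - c x * W x" for x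
    using assms(2) by (simp add: Lh_alt a_def)
  have "W x \<le> G / c0"
  proof (rule max_principle[where a = a and W = W and \<sigma> = "\<lambda>\<xi> x. x + h *\<^sub>R \<xi>", OF assms(1) ann As c])
    show "W x \<le> B0" for x using B0[of x] by linarith
    show "c x * W x \<le> (\<Sum>\<xi>\<in>\<Lambda>. a \<xi> x * (W (x + h *\<^sub>R \<xi>) - W x)) + c x * (G / c0)" for x
      using L[of x] G[of x] cG[of x] by linarith
  qed
  moreover have "- W x \<le> G / c0"
  proof (rule max_principle[where a = a and W = "\<lambda>x. - W x" and \<sigma> = "\<lambda>\<xi> x. x + h *\<^sub>R \<xi>", OF assms(1) ann As c])
    show "- W x \<le> B0" for x using B0[of x] by linarith
    show "c x * (- W x) \<le> (\<Sum>\<xi>\<in>\<Lambda>. a \<xi> x * (- W (x + h *\<^sub>R \<xi>) - (- W x))) + c x * (G / c0)" for x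
    proof -
      have "(\<Sum>\<xi>\<in>\<Lambda>. a \<xi> x * (- W (x + h *\<^sub>R \<xi>) - (- W x))) = - (\<Sum>\<xi>\<in>\<Lambda>. a \<xi> x * (W (x + h *\<^sub>R \<xi>) - W x))"
        by (simp add: sum_negf[symmetric] algebra_simps)
      then show ?thesis using L[of x] G[of x] cG[of x] by simp
    qed
  qed
  ultimately show ?thesis by linarith
qed

subsection \<open>Difference operators\<close>

locale scheme_data =
  fixes \<Lambda>\<^sub>1 :: "(real^'d::finite) set" and \<l> :: "'d \<Rightarrow> real^'d" and \<tau>\<^sub>0 :: real and \<tau> :: "real^'d \<Rightarrow> real"
  assumes fin: "finite \<Lambda>\<^sub>1" and zero_notin: "0 \<notin> \<Lambda>\<^sub>1" and inj_l: "inj \<l>"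
    and disj: "range \<l> \<inter> \<Lambda>\<^sub>1 = {}" and tau0: "0 < \<tau>\<^sub>0" and tau: "\<And>\<xi>. \<xi> \<in> \<Lambda>\<^sub>1 \<Longrightarrow> 0 \<le> \<tau> \<xi>"
begin

abbreviation "LM \<equiv> Lam \<Lambda>\<^sub>1 \<l>"
abbreviation "bD \<equiv> bdiff \<Lambda>\<^sub>1 \<l> \<tau>\<^sub>0 \<tau>"
abbreviation "bDs \<equiv> bdiffs \<Lambda>\<^sub>1 \<l> \<tau>\<^sub>0 \<tau>"
abbreviation "sh \<equiv> shift \<Lambda>\<^sub>1"
abbreviation "pw \<equiv> Lam_pow \<Lambda>\<^sub>1 \<l>"

text \<open>The size of \<open>bD h \<xi>\<close> measured against one derivative, uniformly in
  \<open>h\<close> and up to the dimension. Through the sum of its squares, evaluated in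
  \<open>wt_sum\<close>, the constants depend on \<open>\<tau>\<close> only via
  \<open>\<parallel>\<Lambda>\<^sub>1\<parallel>\<close>.\<close>

definition wt :: "real^'d \<Rightarrow> real" where
  "wt \<xi> = (if \<xi> \<in> \<Lambda>\<^sub>1 then \<tau> \<xi> * norm \<xi> else \<tau>\<^sub>0)"

definition wl :: "(real^'d) list \<Rightarrow> real" where
  "wl \<mu> = prod_list (map wt \<mu>)"

lemma wt_nonneg: "0 \<le> wt \<xi>"
  using tau0 tau by (auto simp: wt_def)

lemma wl_nonneg: "0 \<le> wl \<mu>"
  by (induction \<mu>) (auto simp: wl_def wt_nonneg)

lemma wl_simps [simp]: "wl [] = 1" "wl (\<xi> # \<mu>) = wt \<xi> * wl \<mu>"
  by (auto simp: wl_def)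

lemma finite_LM: "finite LM"
  by (simp add: Lam_def fin)

lemma wt_sum: "(\<Sum>\<xi>\<in>LM. (wt \<xi>)\<^sup>2) = (\<Sum>\<xi>\<in>\<Lambda>\<^sub>1. (norm (\<tau> \<xi> *\<^sub>R \<xi>))\<^sup>2) + real CARD('d) * \<tau>\<^sub>0\<^sup>2"
proof -
  have "(\<Sum>\<xi>\<in>LM. (wt \<xi>)\<^sup>2) = (\<Sum>\<xi>\<in>\<Lambda>\<^sub>1. (wt \<xi>)\<^sup>2) + (\<Sum>\<xi>\<in>range \<l>. (wt \<xi>)\<^sup>2)"
    unfolding Lam_def by (rule sum.union_disjoint) (use fin disj in auto)
  also have "(\<Sum>\<xi>\<in>range \<l>. (wt \<xi>)\<^sup>2) = (\<Sum>\<xi>\<in>range \<l>. \<tau>\<^sub>0\<^sup>2)"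
    using disj by (intro sum.cong) (auto simp: wt_def)
  also have "\<dots> = real CARD('d) * \<tau>\<^sub>0\<^sup>2" by (simp add: card_image inj_l)
  also have "(\<Sum>\<xi>\<in>\<Lambda>\<^sub>1. (wt \<xi>)\<^sup>2) = (\<Sum>\<xi>\<in>\<Lambda>\<^sub>1. (norm (\<tau> \<xi> *\<^sub>R \<xi>))\<^sup>2)"
    using tau by (intro sum.cong) (auto simp: wt_def)
  finally show ?thesis .
qed

lemma pw_0: "pw 0 = {[]}"
  by (auto simp: Lam_pow_def)

lemma pw_Suc: "pw (Suc n) = (\<lambda>(\<xi>, \<mu>). \<xi> # \<mu>) ` (LM \<times> pw n)"
  by (auto simp: Lam_pow_def image_iff length_Suc_conv)

lemma finite_pw: "finite (pw n)"
  by (induction n) (auto simp: pw_0 pw_Suc finite_LM)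

lemma sum_pw_Suc: "(\<Sum>\<mu>\<in>pw (Suc n). F \<mu>) = (\<Sum>\<xi>\<in>LM. \<Sum>\<mu>\<in>pw n. F (\<xi> # \<mu>))"
  unfolding pw_Suc sum.cartesian_product
  by (subst sum.reindex) (auto simp: inj_on_def intro!: sum.cong)

lemma sum_pw_1: "(\<Sum>\<mu>\<in>pw (Suc 0). F \<mu>) = (\<Sum>\<xi>\<in>LM. F [\<xi>])"
  by (simp add: sum_pw_Suc pw_0)

lemma sum_pw_2: "(\<Sum>\<mu>\<in>pw 2. F \<mu>) = (\<Sum>\<xi>\<in>LM. \<Sum>\<zeta>\<in>LM. F [\<xi>, \<zeta>])"
  by (simp add: numeral_2_eq_2 sum_pw_Suc pw_0)

lemma wl_sum: "(\<Sum>\<mu>\<in>pw n. (wl \<mu>)\<^sup>2) = (\<Sum>\<xi>\<in>LM. (wt \<xi>)\<^sup>2) ^ n"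
  by (induction n) (simp_all add: pw_0 sum_pw_Suc power_mult_distrib sum_distrib_left[symmetric] sum_distrib_right[symmetric])

lemma bDs_simps [simp]: "bDs h [] \<phi> = \<phi>" "bDs h (\<xi> # \<mu>) \<phi> = bD h \<xi> (bDs h \<mu> \<phi>)"
  by (simp_all add: bdiffs_def)

lemma pw_subset: "\<mu> \<in> pw n \<Longrightarrow> set \<mu> \<subseteq> LM" by (simp add: Lam_pow_def)
lemma pw_length: "\<mu> \<in> pw n \<Longrightarrow> length \<mu> = n" by (simp add: Lam_pow_def)

lemma LM_cases:
  assumes "\<xi> \<in> LM"
  obtains "\<xi> \<in> \<Lambda>\<^sub>1" | i where "\<xi> = \<l> i" "\<xi> \<notin> \<Lambda>\<^sub>1"
  using assms disj unfolding Lam_def by blast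

lemma bD_in: "\<xi> \<in> \<Lambda>\<^sub>1 \<Longrightarrow> bD h \<xi> \<phi> = (\<lambda>x. \<tau> \<xi> * (\<phi> (x + h *\<^sub>R \<xi>) - \<phi> x) / h)"
  by (simp add: bdiff_def)

lemma bD_dir: "bD h (\<l> i) \<phi> = (\<lambda>x. \<tau>\<^sub>0 * partial i \<phi> x)"
  using disj inj_l by (auto simp: bdiff_def the_inv_f_f)

lemma sh_in: "\<xi> \<in> \<Lambda>\<^sub>1 \<Longrightarrow> sh h \<xi> \<phi> = (\<lambda>x. \<phi> (x + h *\<^sub>R \<xi>))"
  by (simp add: shift_def)

lemma sh_dir: "sh h (\<l> i) \<phi> = \<phi>"
  using disj by (auto simp: shift_def)

lemma sh_ex: "\<exists>z. \<forall>\<phi>. sh h \<xi> \<phi> = (\<lambda>x. \<phi> (x + z))"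
  by (cases "\<xi> \<in> \<Lambda>\<^sub>1") (auto simp: shift_def intro: exI[of _ 0])

lemma sh_smb: "smb \<phi> \<Longrightarrow> smb (sh h \<xi> \<phi>)"
  using sh_ex[of h \<xi>] smb_shift by metis

lemma sh_bd: "bd n B \<phi> \<Longrightarrow> bd n B (sh h \<xi> \<phi>)"
  using sh_ex[of h \<xi>] bd_shift by metis

lemma bD_Cb:
  assumes "\<xi> \<in> LM" "Cb (Suc n) \<phi>" shows "Cb n (bD h \<xi> \<phi>)"
  using assms(1)
proof (cases rule: LM_cases)
  case 1
  then show ?thesis using Cb_Suc[OF assms(2)] by (simp add: bD_in Cb_intros)
next
  case (2 i)
  then show ?thesis using Cb_partial[OF assms(2)] by (simp add: bD_dir Cb_intros)
qed

lemma bD_smb: "\<xi> \<in> LM \<Longrightarrow> smb \<phi> \<Longrightarrow> smb (bD h \<xi> \<phi>)"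
  unfolding smb_def using bD_Cb by blast

lemma bDs_smb: "set \<mu> \<subseteq> LM \<Longrightarrow> smb \<phi> \<Longrightarrow> smb (bDs h \<mu> \<phi>)"
  by (induction \<mu>) (auto intro: bD_smb)

lemma partial_sub: "smb f \<Longrightarrow> smb g \<Longrightarrow> partial i (\<lambda>x. f x - g x) = (\<lambda>x. partial i f x - partial i g x)"
  using pderivs_diff[OF smb_Cb smb_Cb, of f g "[i]" 1] by auto

lemma partial_plus: "smb f \<Longrightarrow> smb g \<Longrightarrow> partial i (\<lambda>x. f x + g x) = (\<lambda>x. partial i f x + partial i g x)"
  using partial_add smb_differentiable by blast

lemma partial_cmult: "smb f \<Longrightarrow> partial i (\<lambda>x. a * f x) = (\<lambda>x. a * partial i f x)"
  using pderivs_cmult[OF smb_Cb, of f "[i]" 1 a] by auto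

lemma partial_multc: "smb f \<Longrightarrow> partial i (\<lambda>x. f x * a) = (\<lambda>x. a * partial i f x)"
  using partial_cmult[of f i a] by (simp add: mult.commute)

lemma partial_cdivide: "smb f \<Longrightarrow> partial i (\<lambda>x. f x / a) = (\<lambda>x. partial i f x / a)"
  using partial_cmult[of f i "1 / a"] by simp

lemma partial_sum: "(\<And>j. j \<in> I \<Longrightarrow> smb (f j)) \<Longrightarrow> partial i (\<lambda>x. \<Sum>j\<in>I. f j x) = (\<lambda>x. \<Sum>j\<in>I. partial i (f j) x)"
  using pderivs_sum[of I 1 f "[i]"] smb_Cb by fastforce

lemma bD_commute:
  assumes "\<xi> \<in> LM" "\<zeta> \<in> LM" "smb \<phi>"
  shows "bD h \<xi> (bD h \<zeta> \<phi>) = bD h \<zeta> (bD h \<xi> \<phi>)"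
  using assms(1)
proof (cases rule: LM_cases)
  case 1
  note x = 1
  show ?thesis using assms(2)
  proof (cases rule: LM_cases)
    case 1
    then show ?thesis using x by (auto simp: bD_in fun_eq_iff algebra_simps diff_divide_distrib add_divide_distrib)
  next
    case (2 i)
    then show ?thesis using x assms(3)
      by (simp add: bD_in bD_dir partial_cdivide partial_cmult partial_multc partial_sub partial_shift smb_intros fun_eq_iff algebra_simps)
  qed
next
  case (2 j)
  note x = 2
  show ?thesis using assms(2)
  proof (cases rule: LM_cases)
    case 1
    then show ?thesis using x assms(3)
      by (simp add: bD_in bD_dir partial_cdivide partial_cmult partial_multc partial_sub partial_shift smb_intros fun_eq_iff algebra_simps)
  next
    case (2 i)
    then show ?thesis using x assms(3)
      by (simp add: bD_dir partial_cmult smb_intros partial_commute[of \<phi> i j])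
  qed
qed

lemma bD_bDs: "\<xi> \<in> LM \<Longrightarrow> set \<mu> \<subseteq> LM \<Longrightarrow> smb \<phi> \<Longrightarrow> bD h \<xi> (bDs h \<mu> \<phi>) = bDs h \<mu> (bD h \<xi> \<phi>)"
  by (induction \<mu>) (auto simp: bD_commute bDs_smb)

lemma bD_sh:
  assumes "\<xi> \<in> LM" shows "bD h \<xi> (sh h \<zeta> \<phi>) = sh h \<zeta> (bD h \<xi> \<phi>)"
proof -
  obtain z where z: "\<And>\<phi>. sh h \<zeta> \<phi> = (\<lambda>x. \<phi> (x + z))" using sh_ex by blast
  show ?thesis unfolding z using assms by (cases rule: LM_cases) (auto simp: bD_in bD_dir partial_shift add_ac)
qed

lemma bDs_sh: "set \<mu> \<subseteq> LM \<Longrightarrow> bDs h \<mu> (sh h \<zeta> \<phi>) = sh h \<zeta> (bDs h \<mu> \<phi>)"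
  by (induction \<mu>) (auto simp: bD_sh)

lemma bD_add: "\<xi> \<in> LM \<Longrightarrow> smb f \<Longrightarrow> smb g \<Longrightarrow> bD h \<xi> (\<lambda>x. f x + g x) = (\<lambda>x. bD h \<xi> f x + bD h \<xi> g x)"
  by (erule LM_cases) (auto simp: bD_in bD_dir partial_plus algebra_simps add_divide_distrib diff_divide_distrib fun_eq_iff)

lemma bD_cmult: "\<xi> \<in> LM \<Longrightarrow> smb f \<Longrightarrow> bD h \<xi> (\<lambda>x. a * f x) = (\<lambda>x. a * bD h \<xi> f x)"
  by (erule LM_cases) (auto simp: bD_in bD_dir partial_cmult algebra_simps fun_eq_iff)

lemma bD_sum: "\<xi> \<in> LM \<Longrightarrow> (\<And>j. j \<in> I \<Longrightarrow> smb (f j)) \<Longrightarrow> bD h \<xi> (\<lambda>x. \<Sum>j\<in>I. f j x) = (\<lambda>x. \<Sum>j\<in>I. bD h \<xi> (f j) x)"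
  by (erule LM_cases) (auto simp: bD_in bD_dir partial_sum sum_distrib_left sum_subtractf sum_divide_distrib right_diff_distrib diff_divide_distrib fun_eq_iff)

text \<open>For a finite difference the second factor is evaluated at the shifted point, for a
  derivative it is not; \<open>shift\<close> is defined so that one formula covers both. This is
  where the operators T_h in the structural inequalities come from.\<close>

lemma bD_mult:
  assumes "\<xi> \<in> LM" "smb a" "smb \<phi>"
  shows "bD h \<xi> (\<lambda>x. a x * \<phi> x) = (\<lambda>x. a x * bD h \<xi> \<phi> x + bD h \<xi> a x * sh h \<xi> \<phi> x)"
  using assms(1)
proof (cases rule: LM_cases)
  case 1
  then show ?thesis by (auto simp: bD_in sh_in fun_eq_iff algebra_simps add_divide_distrib diff_divide_distrib)
next
  case (2 i)
  have "partial i (\<lambda>x. a x * \<phi> x) = (\<lambda>x. a x * partial i \<phi> x + partial i a x * \<phi> x)"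
    by (intro partial_mult smb_differentiable assms)
  then show ?thesis unfolding 2(1) bD_dir sh_dir by (simp add: fun_eq_iff algebra_simps)
qed

lemma smb_fdiff: "smb \<phi> \<Longrightarrow> smb (fdiff h \<zeta> \<phi>)"
  unfolding fdiff_def[abs_def] by (intro smb_intros)

lemma bD_fdiff:
  assumes "\<xi> \<in> LM" "smb \<phi>" shows "bD h \<xi> (fdiff h \<zeta> \<phi>) = fdiff h \<zeta> (bD h \<xi> \<phi>)"
  using assms(1)
proof (cases rule: LM_cases)
  case 1
  then show ?thesis by (auto simp: bD_in fdiff_def fun_eq_iff algebra_simps diff_divide_distrib)
next
  case (2 i)
  then show ?thesis using assms(2)
    by (simp add: bD_dir fdiff_def[abs_def] partial_cdivide partial_sub partial_shift smb_intros fun_eq_iff algebra_simps)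
qed

lemma bDs_add: "set \<mu> \<subseteq> LM \<Longrightarrow> smb f \<Longrightarrow> smb g \<Longrightarrow> bDs h \<mu> (\<lambda>x. f x + g x) = (\<lambda>x. bDs h \<mu> f x + bDs h \<mu> g x)"
  by (induction \<mu>) (auto simp: bD_add bDs_smb)

lemma bDs_cmult: "set \<mu> \<subseteq> LM \<Longrightarrow> smb f \<Longrightarrow> bDs h \<mu> (\<lambda>x. a * f x) = (\<lambda>x. a * bDs h \<mu> f x)"
  by (induction \<mu>) (auto simp: bD_cmult bDs_smb)

lemma card_ge_1: "1 \<le> real CARD('d)"
  by (simp add: Suc_leI)

text \<open>By the mean value theorem the factor 1/h of the difference is compensated by the length
  of the shift, so the bound is uniform in \<open>h\<close>.\<close>

lemma bd_bD:
  assumes "\<xi> \<in> LM" "h > 0" "smb \<phi>" "bd (Suc n) B \<phi>"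
  shows "bd n (real CARD('d) * wt \<xi> * B) (bD h \<xi> \<phi>)"
  using assms(1)
proof (cases rule: LM_cases)
  case 1
  show ?thesis unfolding bd_def
  proof (intro allI impI)
    fix "is" :: "'d list" and x assume l: "length is \<le> n"
    have bd': "\<And>i x. \<bar>partial i (foldr partial is \<phi>) x\<bar> \<le> B"
      using bdD[OF assms(4), of "_ # is"] l by simp
    have "bD h \<xi> \<phi> = (\<lambda>x. (\<tau> \<xi> / h) * (\<phi> (x + h *\<^sub>R \<xi>) - \<phi> x))" using 1 by (auto simp: bD_in)
    then have "foldr partial is (bD h \<xi> \<phi>) x = (\<tau> \<xi> / h) * (foldr partial is \<phi> (x + h *\<^sub>R \<xi>) - foldr partial is \<phi> x)"
      using pderivs_cmult[OF smb_Cb, of "\<lambda>x. \<phi> (x + h *\<^sub>R \<xi>) - \<phi> x" "is" "length is" "\<tau> \<xi> / h"]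
        pderivs_diff[OF smb_Cb smb_Cb, of "\<lambda>x. \<phi> (x + h *\<^sub>R \<xi>)" \<phi> "is" "length is"] assms(3)
      by (simp add: smb_intros pderivs_shift)
    also have "\<bar>\<dots>\<bar> \<le> (\<tau> \<xi> / h) * (real CARD('d) * norm (h *\<^sub>R \<xi>) * B)"
      unfolding abs_mult using tau[OF 1] assms(2)
      by (intro mult_mono increment_bound bd' smb_differentiable smb_pderivs assms) auto
    also have "\<dots> = real CARD('d) * wt \<xi> * B" using 1 assms(2) by (simp add: wt_def)
    finally show "\<bar>foldr partial is (bD h \<xi> \<phi>) x\<bar> \<le> real CARD('d) * wt \<xi> * B" .
  qed
next
  case (2 i)
  have B: "0 \<le> B" using bd_nonneg[OF assms(4)] .
  have "bd n (\<bar>\<tau>\<^sub>0\<bar> * B) (bD h \<xi> \<phi>)"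
    using bd_cmult[OF smb_Cb[OF smb_partial[OF assms(3)]] bd_partial[OF assms(4)], where a = \<tau>\<^sub>0] 2 by (simp add: bD_dir)
  moreover have "\<bar>\<tau>\<^sub>0\<bar> * B \<le> real CARD('d) * wt \<xi> * B"
    using 2 tau0 B card_ge_1 mult_right_mono[OF card_ge_1, of "\<tau>\<^sub>0 * B"] by (simp add: wt_def mult.assoc)
  ultimately show ?thesis by (blast intro: bd_mono)
qed

lemma bd_bDs:
  assumes "set \<mu> \<subseteq> LM" "h > 0" "smb \<phi>" "bd (n + length \<mu>) B \<phi>"
  shows "bd n (real CARD('d) ^ length \<mu> * wl \<mu> * B) (bDs h \<mu> \<phi>)"
  using assms(1,4)
proof (induction \<mu> arbitrary: n)
  case (Cons \<xi> \<mu>)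
  have "bd (Suc n) (real CARD('d) ^ length \<mu> * wl \<mu> * B) (bDs h \<mu> \<phi>)" using Cons by simp
  from bd_bD[OF _ assms(2) bDs_smb[OF _ assms(3)] this, of \<xi>] Cons.prems(1)
  show ?case by (simp add: mult_ac)
qed simp

text \<open>The \<open>j\<close>-th term of the discrete Leibniz formula for \<open>bDs h \<mu> (Op b \<phi>)\<close>: it collects
  the contributions in which exactly \<open>j\<close> of the differences fall on the coefficients \<open>b\<close>.\<close>

fun leib :: "((real^'d \<Rightarrow> real^'d \<Rightarrow> real) \<Rightarrow> (real^'d \<Rightarrow> real) \<Rightarrow> real^'d \<Rightarrow> real) \<Rightarrow> real \<Rightarrow> nat \<Rightarrow>
    (real^'d) list \<Rightarrow> (real^'d \<Rightarrow> real^'d \<Rightarrow> real) \<Rightarrow> (real^'d \<Rightarrow> real) \<Rightarrow> real^'d \<Rightarrow> real" where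
  "leib Op h 0 [] b \<phi> = Op b \<phi>"
| "leib Op h (Suc j) [] b \<phi> = (\<lambda>x. 0)"
| "leib Op h 0 (\<xi> # \<mu>) b \<phi> = leib Op h 0 \<mu> b (bD h \<xi> \<phi>)"
| "leib Op h (Suc j) (\<xi> # \<mu>) b \<phi> = (\<lambda>x. leib Op h (Suc j) \<mu> b (bD h \<xi> \<phi>) x
      + leib Op h j \<mu> (\<lambda>\<zeta>. bD h \<xi> (b \<zeta>)) (sh h \<xi> \<phi>) x)"

text \<open>The one-step product rule for an operator that is formally a product of coefficients and
  \<open>\<phi>\<close>. Isolating it lets the iterated formula be proved once for the diffusion,
  drift and zeroth-order parts.\<close>

definition leibniz_op :: "((real^'d \<Rightarrow> real^'d \<Rightarrow> real) \<Rightarrow> (real^'d \<Rightarrow> real) \<Rightarrow> real^'d \<Rightarrow> real) \<Rightarrow> real \<Rightarrow> bool" where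
  "leibniz_op Op h \<longleftrightarrow> (\<forall>b \<phi>. (\<forall>\<zeta>. smb (b \<zeta>)) \<longrightarrow> smb \<phi> \<longrightarrow> smb (Op b \<phi>) \<and>
     (\<forall>\<xi>\<in>LM. bD h \<xi> (Op b \<phi>) = (\<lambda>x. Op b (bD h \<xi> \<phi>) x + Op (\<lambda>\<zeta>. bD h \<xi> (b \<zeta>)) (sh h \<xi> \<phi>) x)))"

lemma leib_zero: "length \<mu> < j \<Longrightarrow> leib Op h j \<mu> b \<phi> = (\<lambda>x. 0)"
proof (induction \<mu> arbitrary: j b \<phi>)
  case Nil
  then show ?case by (cases j) auto
next
  case (Cons \<xi> \<mu>)
  then show ?case by (cases j) auto
qed

lemma leib_0: "set \<mu> \<subseteq> LM \<Longrightarrow> smb \<phi> \<Longrightarrow> leib Op h 0 \<mu> b \<phi> = Op b (bDs h \<mu> \<phi>)"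
  by (induction \<mu> arbitrary: \<phi>) (auto simp: bD_smb bD_bDs)

lemma leibniz_formula:
  assumes "leibniz_op Op h" "set \<mu> \<subseteq> LM" "smb \<phi>" "\<And>\<zeta>. smb (b \<zeta>)"
  shows "bDs h \<mu> (Op b \<phi>) = (\<lambda>x. \<Sum>j\<le>length \<mu>. leib Op h j \<mu> b \<phi> x)"
  using assms(2-)
proof (induction \<mu> arbitrary: b \<phi>)
  case (Cons \<xi> \<mu>)
  have x: "\<xi> \<in> LM" and m: "set \<mu> \<subseteq> LM" using Cons.prems by auto
  have sb: "smb (bD h \<xi> (b \<zeta>))" for \<zeta> using Cons.prems x by (auto intro: bD_smb)
  have sp: "smb (bD h \<xi> \<phi>)" "smb (sh h \<xi> \<phi>)" using Cons.prems x by (auto intro: bD_smb sh_smb)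
  have so: "smb (Op b \<phi>)" if "\<And>\<zeta>. smb (b \<zeta>)" "smb \<phi>" for b \<phi> using assms(1) that unfolding leibniz_op_def by blast
  have "bDs h (\<xi> # \<mu>) (Op b \<phi>) = bDs h \<mu> (bD h \<xi> (Op b \<phi>))"
    using bD_bDs[OF x m so[OF Cons.prems(3,2)]] by simp
  also have "bD h \<xi> (Op b \<phi>) = (\<lambda>x. Op b (bD h \<xi> \<phi>) x + Op (\<lambda>\<zeta>. bD h \<xi> (b \<zeta>)) (sh h \<xi> \<phi>) x)"
    using assms(1) Cons.prems(2,3) x unfolding leibniz_op_def by blast
  also have "bDs h \<mu> \<dots> = (\<lambda>x. bDs h \<mu> (Op b (bD h \<xi> \<phi>)) x + bDs h \<mu> (Op (\<lambda>\<zeta>. bD h \<xi> (b \<zeta>)) (sh h \<xi> \<phi>)) x)"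
    by (intro bDs_add m so sb sp Cons.prems)
  also have "\<dots> = (\<lambda>x. (\<Sum>j\<le>length \<mu>. leib Op h j \<mu> b (bD h \<xi> \<phi>) x)
      + (\<Sum>j\<le>length \<mu>. leib Op h j \<mu> (\<lambda>\<zeta>. bD h \<xi> (b \<zeta>)) (sh h \<xi> \<phi>) x))"
    by (simp add: Cons.IH[OF m sp(1) Cons.prems(3)] Cons.IH[OF m sp(2) sb])
  also have "\<dots> = (\<lambda>x. \<Sum>j\<le>length (\<xi> # \<mu>). leib Op h j (\<xi> # \<mu>) b \<phi> x)"
  proof
    fix x
    have "(\<Sum>j\<le>length \<mu>. leib Op h j \<mu> b (bD h \<xi> \<phi>) x) = (\<Sum>j\<le>Suc (length \<mu>). leib Op h j \<mu> b (bD h \<xi> \<phi>) x)"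
      by (simp add: leib_zero)
    also have "\<dots> = leib Op h 0 \<mu> b (bD h \<xi> \<phi>) x + (\<Sum>j\<le>length \<mu>. leib Op h (Suc j) \<mu> b (bD h \<xi> \<phi>) x)"
      by (rule sum.atMost_Suc_shift)
    finally show "(\<Sum>j\<le>length \<mu>. leib Op h j \<mu> b (bD h \<xi> \<phi>) x)
      + (\<Sum>j\<le>length \<mu>. leib Op h j \<mu> (\<lambda>\<zeta>. bD h \<xi> (b \<zeta>)) (sh h \<xi> \<phi>) x) = (\<Sum>j\<le>length (\<xi> # \<mu>). leib Op h j (\<xi> # \<mu>) b \<phi> x)"
      by (simp add: sum.distrib sum.atMost_Suc_shift del: sum.atMost_Suc)
  qed
  finally show ?case .
qed simp

text \<open>\<open>\<beta> n B b\<close> abstracts a bound by \<open>B\<close> for the derivatives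
  of the coefficients up to order \<open>n\<close>, and \<open>r\<close> is the number of
  derivatives of \<open>\<phi>\<close> that \<open>Op\<close> consumes. With \<open>j\<close>
  differences on the coefficients, \<open>length \<mu> - j + r\<close> derivatives of
  \<open>\<phi>\<close> are needed; each difference has two places to fall, whence the powers of
  2.\<close>

lemma leib_bound:
  assumes step: "\<And>n B b \<xi>. \<beta> (Suc n) B b \<Longrightarrow> \<xi> \<in> LM \<Longrightarrow> \<beta> n (real CARD('d) * wt \<xi> * B) (\<lambda>\<zeta>. bD h \<xi> (b \<zeta>))"
    and bnd: "\<And>B G b \<phi> x. \<beta> 0 B b \<Longrightarrow> 0 \<le> B \<Longrightarrow> smb \<phi> \<Longrightarrow> bd r G \<phi> \<Longrightarrow> \<bar>Op b \<phi> x\<bar> \<le> C0 * B * G"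
    and "0 \<le> C0" "0 < h"
    and "set \<mu> \<subseteq> LM" "j \<le> length \<mu>" "smb \<phi>" "\<beta> j B b" "0 \<le> B" "bd (length \<mu> - j + r) G \<phi>"
  shows "\<bar>leib Op h j \<mu> b \<phi> x\<bar> \<le> C0 * (2 * real CARD('d)) ^ length \<mu> * wl \<mu> * B * G"
  using assms(5-)
proof (induction \<mu> arbitrary: j b \<phi> B G)
  case Nil
  then show ?case using bnd by simp
next
  case (Cons \<xi> \<mu>)
  have x: "\<xi> \<in> LM" and m: "set \<mu> \<subseteq> LM" using Cons.prems by auto
  have G: "0 \<le> G" using bd_nonneg Cons.prems by blast
  define Y where "Y = C0 * (2 * real CARD('d)) ^ length \<mu> * wl \<mu> * (real CARD('d) * wt \<xi>) * B * G"
  have Y0: "0 \<le> Y" unfolding Y_def using assms(3) G Cons.prems(5) by (simp add: wl_nonneg wt_nonneg)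
  have first: "\<bar>leib Op h i \<mu> b (bD h \<xi> \<phi>) x\<bar> \<le> Y" if "i \<le> length \<mu>" "\<beta> i B b" "bd (Suc (length \<mu> - i + r)) G \<phi>" for i
    using Cons.IH[OF m that(1) bD_smb[OF x Cons.prems(3)] that(2) Cons.prems(5)
        bd_bD[OF x assms(4) Cons.prems(3) that(3)]]
    by (simp add: Y_def mult_ac)
  have YY: "C0 * (2 * real CARD('d)) ^ length (\<xi> # \<mu>) * wl (\<xi> # \<mu>) * B * G = Y + Y"
    by (simp add: Y_def algebra_simps)
  show ?case
  proof (cases j)
    case 0
    then have "\<bar>leib Op h 0 \<mu> b (bD h \<xi> \<phi>) x\<bar> \<le> Y" using Cons.prems by (intro first) auto
    then show ?thesis unfolding YY using Y0 0 by simp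
  next
    case (Suc i)
    have "\<bar>leib Op h (Suc i) \<mu> b (bD h \<xi> \<phi>) x\<bar> \<le> Y"
    proof (cases "Suc i \<le> length \<mu>")
      case True
      then have "Suc (length \<mu> - Suc i + r) = length (\<xi> # \<mu>) - j + r" using Suc by simp
      then show ?thesis using True Cons.prems Suc by (intro first) auto
    next
      case False
      then show ?thesis using Y0 by (simp add: leib_zero)
    qed
    moreover have "\<bar>leib Op h i \<mu> (\<lambda>\<zeta>. bD h \<xi> (b \<zeta>)) (sh h \<xi> \<phi>) x\<bar> \<le> Y"
    proof -
      have "\<beta> i (real CARD('d) * wt \<xi> * B) (\<lambda>\<zeta>. bD h \<xi> (b \<zeta>))" using step x Cons.prems(4) Suc by blast
      moreover have "0 \<le> real CARD('d) * wt \<xi> * B" using Cons.prems(5) by (simp add: wt_nonneg)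
      moreover have "bd (length \<mu> - i + r) G (sh h \<xi> \<phi>)" using Cons.prems(6) Suc by (intro sh_bd) simp
      ultimately show ?thesis
        using Cons.IH[OF m _ sh_smb[OF Cons.prems(3)]] Cons.prems(2) Suc by (force simp: Y_def mult_ac)
    qed
    ultimately show ?thesis unfolding YY Suc leib.simps using abs_triangle_ineq order_trans by (smt (verit))
  qed
qed

text \<open>Differences commute, so in the sum over all words each of the \<open>Suc n\<close>
  positions of the difference that falls on the coefficients contributes the same; hence the factor
  in front of A_h in the structural inequalities. \<open>u\<close> and \<open>w\<close> are kept
  apart because \<open>leib_sum_2\<close> needs the formula with only \<open>w\<close>
  shifted.\<close>

lemma leib_sum_1:
  assumes "\<And>\<zeta>. smb (b \<zeta>)" "smb u" "smb w"
  shows "(\<Sum>\<mu>\<in>pw (Suc n). bDs h \<mu> u x * leib Op h 1 \<mu> b w x)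
    = real (Suc n) * (\<Sum>\<nu>\<in>LM. \<Sum>\<mu>\<in>pw n. bDs h \<mu> (bD h \<nu> u) x * Op (\<lambda>\<zeta>. bD h \<nu> (b \<zeta>)) (bDs h \<mu> (sh h \<nu> w)) x)"
  using assms(2,3)
proof (induction n arbitrary: u w)
  case 0
  then show ?case by (simp add: sum_pw_1 pw_0)
next
  case (Suc n)
  let ?T = "\<lambda>u w \<nu> \<mu>. bDs h \<mu> (bD h \<nu> u) x * Op (\<lambda>\<zeta>. bD h \<nu> (b \<zeta>)) (bDs h \<mu> (sh h \<nu> w)) x"
  have "(\<Sum>\<mu>\<in>pw (Suc (Suc n)). bDs h \<mu> u x * leib Op h 1 \<mu> b w x)
    = (\<Sum>\<xi>\<in>LM. \<Sum>\<mu>\<in>pw (Suc n). bDs h \<mu> (bD h \<xi> u) x * leib Op h 1 \<mu> b (bD h \<xi> w) x + ?T u w \<xi> \<mu>)"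
    unfolding sum_pw_Suc[of _ "Suc n"]
    by (intro sum.cong refl) (auto simp: distrib_left bD_bDs[symmetric] Suc.prems leib_0 sh_smb pw_subset dest!: pw_subset)
  also have "\<dots> = (\<Sum>\<xi>\<in>LM. \<Sum>\<mu>\<in>pw (Suc n). bDs h \<mu> (bD h \<xi> u) x * leib Op h 1 \<mu> b (bD h \<xi> w) x)
      + (\<Sum>\<xi>\<in>LM. \<Sum>\<mu>\<in>pw (Suc n). ?T u w \<xi> \<mu>)" by (simp add: sum.distrib)
  also have "(\<Sum>\<xi>\<in>LM. \<Sum>\<mu>\<in>pw (Suc n). bDs h \<mu> (bD h \<xi> u) x * leib Op h 1 \<mu> b (bD h \<xi> w) x)
      = (\<Sum>\<xi>\<in>LM. real (Suc n) * (\<Sum>\<nu>\<in>LM. \<Sum>\<mu>\<in>pw n. ?T (bD h \<xi> u) (bD h \<xi> w) \<nu> \<mu>))"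
    by (intro sum.cong refl Suc.IH bD_smb Suc.prems)
  also have "\<dots> = real (Suc n) * (\<Sum>\<nu>\<in>LM. \<Sum>\<xi>\<in>LM. \<Sum>\<mu>\<in>pw n. ?T (bD h \<xi> u) (bD h \<xi> w) \<nu> \<mu>)"
    unfolding sum_distrib_left[symmetric] by (subst sum.swap) simp
  also have "(\<Sum>\<nu>\<in>LM. \<Sum>\<xi>\<in>LM. \<Sum>\<mu>\<in>pw n. ?T (bD h \<xi> u) (bD h \<xi> w) \<nu> \<mu>)
      = (\<Sum>\<nu>\<in>LM. \<Sum>\<mu>\<in>pw (Suc n). ?T u w \<nu> \<mu>)"
    unfolding sum_pw_Suc[of _ n]
  proof (intro sum.cong refl)
    fix \<nu> \<xi> \<mu> assume m: "\<nu> \<in> LM" "\<xi> \<in> LM" "\<mu> \<in> pw n"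
    then have "set \<mu> \<subseteq> LM" by (simp add: pw_subset)
    then show "?T (bD h \<xi> u) (bD h \<xi> w) \<nu> \<mu> = ?T u w \<nu> (\<xi> # \<mu>)"
      using m Suc.prems by (simp add: bD_bDs bD_smb sh_smb bD_commute[of \<nu> \<xi> u] bD_sh)
  qed
  finally show ?case by (simp add: algebra_simps)
qed

text \<open>An unordered pair of positions is chosen for the two differences on the coefficients.
  This accounts for the 2 on the left and for the factor n (n - 1) of the second structural
  inequality.\<close>

lemma leib_sum_2:
  assumes "\<And>\<zeta>. smb (b \<zeta>)" "smb u" "smb w"
  shows "2 * (\<Sum>\<mu>\<in>pw (Suc (Suc n)). bDs h \<mu> u x * leib Op h 2 \<mu> b w x)
    = real (Suc (Suc n)) * real (Suc n) * (\<Sum>\<xi>\<in>LM. \<Sum>\<nu>\<in>LM. \<Sum>\<mu>\<in>pw n. bDs h \<mu> (bD h \<nu> (bD h \<xi> u)) x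
        * Op (\<lambda>\<zeta>. bD h \<nu> (bD h \<xi> (b \<zeta>))) (bDs h \<mu> (sh h \<nu> (sh h \<xi> w))) x)"
  using assms(2,3)
proof (induction n arbitrary: u w)
  let ?T = "\<lambda>u w \<xi> \<nu> \<mu>. bDs h \<mu> (bD h \<nu> (bD h \<xi> u)) x
        * Op (\<lambda>\<zeta>. bD h \<nu> (bD h \<xi> (b \<zeta>))) (bDs h \<mu> (sh h \<nu> (sh h \<xi> w))) x"
  have split: "(\<Sum>\<mu>\<in>pw (Suc (Suc n)). bDs h \<mu> u x * leib Op h 2 \<mu> b w x)
    = (\<Sum>\<xi>\<in>LM. \<Sum>\<mu>\<in>pw (Suc n). bDs h \<mu> (bD h \<xi> u) x * leib Op h 2 \<mu> b (bD h \<xi> w) x)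
      + real (Suc n) * (\<Sum>\<xi>\<in>LM. \<Sum>\<nu>\<in>LM. \<Sum>\<mu>\<in>pw n. ?T u w \<xi> \<nu> \<mu>)" if "smb u" "smb w" for u w n
  proof -
    have "(\<Sum>\<mu>\<in>pw (Suc (Suc n)). bDs h \<mu> u x * leib Op h 2 \<mu> b w x)
      = (\<Sum>\<xi>\<in>LM. \<Sum>\<mu>\<in>pw (Suc n). bDs h \<mu> (bD h \<xi> u) x * leib Op h 2 \<mu> b (bD h \<xi> w) x
        + bDs h \<mu> (bD h \<xi> u) x * leib Op h 1 \<mu> (\<lambda>\<zeta>. bD h \<xi> (b \<zeta>)) (sh h \<xi> w) x)"
      unfolding sum_pw_Suc[of _ "Suc n"] numeral_2_eq_2
      by (intro sum.cong refl) (auto simp: distrib_left bD_bDs[symmetric] that pw_subset dest!: pw_subset)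
    also have "\<dots> = (\<Sum>\<xi>\<in>LM. \<Sum>\<mu>\<in>pw (Suc n). bDs h \<mu> (bD h \<xi> u) x * leib Op h 2 \<mu> b (bD h \<xi> w) x)
      + (\<Sum>\<xi>\<in>LM. \<Sum>\<mu>\<in>pw (Suc n). bDs h \<mu> (bD h \<xi> u) x * leib Op h 1 \<mu> (\<lambda>\<zeta>. bD h \<xi> (b \<zeta>)) (sh h \<xi> w) x)"
      by (simp add: sum.distrib)
    also have "(\<Sum>\<xi>\<in>LM. \<Sum>\<mu>\<in>pw (Suc n). bDs h \<mu> (bD h \<xi> u) x * leib Op h 1 \<mu> (\<lambda>\<zeta>. bD h \<xi> (b \<zeta>)) (sh h \<xi> w) x)
      = (\<Sum>\<xi>\<in>LM. real (Suc n) * (\<Sum>\<nu>\<in>LM. \<Sum>\<mu>\<in>pw n. ?T u w \<xi> \<nu> \<mu>))"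
      by (intro sum.cong refl leib_sum_1 bD_smb sh_smb assms(1) that)
    finally show ?thesis by (simp add: sum_distrib_left)
  qed
  {
    case 0
    have "(\<Sum>\<xi>\<in>LM. \<Sum>\<mu>\<in>pw (Suc 0). bDs h \<mu> (bD h \<xi> u) x * leib Op h 2 \<mu> b (bD h \<xi> w) x) = 0"
      by (intro sum.neutral ballI) (auto simp: leib_zero dest!: pw_length)
    then show ?case using split[OF 0, of 0] by simp
  next
    case (Suc n)
    have "2 * (\<Sum>\<xi>\<in>LM. \<Sum>\<mu>\<in>pw (Suc (Suc n)). bDs h \<mu> (bD h \<xi> u) x * leib Op h 2 \<mu> b (bD h \<xi> w) x)
      = (\<Sum>\<kappa>\<in>LM. real (Suc (Suc n)) * real (Suc n) * (\<Sum>\<xi>\<in>LM. \<Sum>\<nu>\<in>LM. \<Sum>\<mu>\<in>pw n. ?T (bD h \<kappa> u) (bD h \<kappa> w) \<xi> \<nu> \<mu>))"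
      by (subst sum_distrib_left) (intro sum.cong refl Suc.IH bD_smb Suc.prems)
    also have "\<dots> = real (Suc (Suc n)) * real (Suc n) * (\<Sum>\<xi>\<in>LM. \<Sum>\<nu>\<in>LM. \<Sum>\<kappa>\<in>LM. \<Sum>\<mu>\<in>pw n. ?T (bD h \<kappa> u) (bD h \<kappa> w) \<xi> \<nu> \<mu>)"
    proof -
      have "(\<Sum>\<kappa>\<in>LM. \<Sum>\<xi>\<in>LM. \<Sum>\<nu>\<in>LM. F \<kappa> \<xi> \<nu>) = (\<Sum>\<xi>\<in>LM. \<Sum>\<nu>\<in>LM. \<Sum>\<kappa>\<in>LM. F \<kappa> \<xi> \<nu>)" for F :: "real^'d \<Rightarrow> real^'d \<Rightarrow> real^'d \<Rightarrow> real"
        by (subst sum.swap) (intro sum.cong refl sum.swap)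
      then show ?thesis unfolding sum_distrib_left[symmetric] by simp
    qed
    also have "(\<Sum>\<xi>\<in>LM. \<Sum>\<nu>\<in>LM. \<Sum>\<kappa>\<in>LM. \<Sum>\<mu>\<in>pw n. ?T (bD h \<kappa> u) (bD h \<kappa> w) \<xi> \<nu> \<mu>)
      = (\<Sum>\<xi>\<in>LM. \<Sum>\<nu>\<in>LM. \<Sum>\<mu>\<in>pw (Suc n). ?T u w \<xi> \<nu> \<mu>)"
      unfolding sum_pw_Suc[of _ n]
    proof (intro sum.cong refl)
      fix \<xi> \<nu> \<kappa> \<mu> assume m: "\<xi> \<in> LM" "\<nu> \<in> LM" "\<kappa> \<in> LM" "\<mu> \<in> pw n"
      then have "set \<mu> \<subseteq> LM" by (simp add: pw_subset)
      then show "?T (bD h \<kappa> u) (bD h \<kappa> w) \<xi> \<nu> \<mu> = ?T u w \<xi> \<nu> (\<kappa> # \<mu>)"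
        using m Suc.prems
        by (simp add: bD_bDs bD_smb sh_smb bD_commute[of \<xi> \<kappa> u] bD_commute[of \<nu> \<kappa> "bD h \<xi> u"] bD_sh)
    qed
    finally show ?case using split[OF Suc.prems, of "Suc n"] by (simp add: algebra_simps)
  }
qed

end

section \<open>The diffusion, drift and zeroth-order operators: Leibniz rule and bounds\<close>

context scheme_data
begin

definition Qo :: "real \<Rightarrow> (real^'d \<Rightarrow> real^'d \<Rightarrow> real) \<Rightarrow> (real^'d \<Rightarrow> real) \<Rightarrow> real^'d \<Rightarrow> real" where
  "Qo h b \<phi> x = (1 / h) * (\<Sum>\<xi>\<in>\<Lambda>\<^sub>1. b \<xi> x * fdiff h \<xi> \<phi> x)"

definition Po :: "real \<Rightarrow> (real^'d \<Rightarrow> real^'d \<Rightarrow> real) \<Rightarrow> (real^'d \<Rightarrow> real) \<Rightarrow> real^'d \<Rightarrow> real" where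
  "Po h b \<phi> x = (\<Sum>\<xi>\<in>\<Lambda>\<^sub>1. b \<xi> x * fdiff h \<xi> \<phi> x)"

text \<open>The zeroth-order term is cast as an operator with a coefficient family, of which only the
  member with index \<open>0\<close> is used, so that it falls under the same Leibniz formula.\<close>

definition Co :: "(real^'d \<Rightarrow> real^'d \<Rightarrow> real) \<Rightarrow> (real^'d \<Rightarrow> real) \<Rightarrow> real^'d \<Rightarrow> real" where
  "Co b \<phi> x = b 0 x * \<phi> x"

lemma sh_fdiff: "sh h \<xi> (fdiff h \<zeta> \<phi>) = fdiff h \<zeta> (sh h \<xi> \<phi>)"
  using sh_ex[of h \<xi>] by (auto simp: fdiff_def[abs_def] add_ac)

lemma Po_smb: "(\<And>\<zeta>. smb (b \<zeta>)) \<Longrightarrow> smb \<phi> \<Longrightarrow> smb (Po h b \<phi>)"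
  unfolding Po_def[abs_def] by (intro smb_sum smb_mult smb_fdiff)

lemma Qo_eq: "Qo h b \<phi> = (\<lambda>x. (1 / h) * Po h b \<phi> x)"
  by (simp add: Qo_def Po_def fun_eq_iff)

lemma leibniz_Po: "leibniz_op (Po h) h"
  unfolding leibniz_op_def
proof (intro allI impI conjI ballI)
  fix b :: "real^'d \<Rightarrow> real^'d \<Rightarrow> real" and \<phi> :: "real^'d \<Rightarrow> real" and \<xi>
  assume b: "\<forall>\<zeta>. smb (b \<zeta>)" and p: "smb \<phi>"
  show "smb (Po h b \<phi>)" using b p by (intro Po_smb) auto
  assume x: "\<xi> \<in> LM"
  have "bD h \<xi> (Po h b \<phi>) = (\<lambda>x. \<Sum>\<zeta>\<in>\<Lambda>\<^sub>1. bD h \<xi> (\<lambda>x. b \<zeta> x * fdiff h \<zeta> \<phi> x) x)"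
    unfolding Po_def[abs_def] by (rule bD_sum[OF x]) (use b p in \<open>auto intro: smb_mult smb_fdiff\<close>)
  also have "\<dots> = (\<lambda>x. \<Sum>\<zeta>\<in>\<Lambda>\<^sub>1. b \<zeta> x * fdiff h \<zeta> (bD h \<xi> \<phi>) x + bD h \<xi> (b \<zeta>) x * fdiff h \<zeta> (sh h \<xi> \<phi>) x)"
    using b by (simp add: bD_mult[OF x] smb_fdiff[OF p] bD_fdiff[OF x p] sh_fdiff)
  finally show "bD h \<xi> (Po h b \<phi>) = (\<lambda>x. Po h b (bD h \<xi> \<phi>) x + Po h (\<lambda>\<zeta>. bD h \<xi> (b \<zeta>)) (sh h \<xi> \<phi>) x)"
    by (simp add: Po_def sum.distrib)
qed

lemma leibniz_Qo: "leibniz_op (Qo h) h"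
  unfolding leibniz_op_def Qo_eq
proof (intro allI impI conjI ballI)
  fix b :: "real^'d \<Rightarrow> real^'d \<Rightarrow> real" and \<phi> :: "real^'d \<Rightarrow> real" and \<xi>
  assume b: "\<forall>\<zeta>. smb (b \<zeta>)" and p: "smb \<phi>"
  have sm: "smb (Po h b \<phi>)" using b p by (intro Po_smb) auto
  then show "smb (\<lambda>x. 1 / h * Po h b \<phi> x)" by (intro smb_intros)
  assume x: "\<xi> \<in> LM"
  have "bD h \<xi> (Po h b \<phi>) = (\<lambda>x. Po h b (bD h \<xi> \<phi>) x + Po h (\<lambda>\<zeta>. bD h \<xi> (b \<zeta>)) (sh h \<xi> \<phi>) x)"
    using leibniz_Po b p x unfolding leibniz_op_def by blast
  then show "bD h \<xi> (\<lambda>x. 1 / h * Po h b \<phi> x) =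
      (\<lambda>x. 1 / h * Po h b (bD h \<xi> \<phi>) x + 1 / h * Po h (\<lambda>\<zeta>. bD h \<xi> (b \<zeta>)) (sh h \<xi> \<phi>) x)"
    unfolding bD_cmult[OF x sm] by (simp add: distrib_left add_divide_distrib)
qed

lemma leibniz_Co: "leibniz_op Co h"
  unfolding leibniz_op_def Co_def[abs_def] by (auto simp: smb_mult bD_mult)

lemma leibniz_smb: "leibniz_op Op h \<Longrightarrow> (\<And>\<zeta>. smb (b \<zeta>)) \<Longrightarrow> smb \<phi> \<Longrightarrow> smb (Op b \<phi>)"
  unfolding leibniz_op_def by blast

text \<open>Coefficient families are measured by duality with the Euclidean norm over
  \<open>\<Lambda>\<^sub>1\<close>. A bound on the sum of squares of derivatives gives exactly this;
  it is stable under linear operations such as mollification and differences, and it keeps the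
  number of elements of \<open>\<Lambda>\<^sub>1\<close> out of the constants.\<close>

definition cbd :: "nat \<Rightarrow> real \<Rightarrow> (real^'d \<Rightarrow> real^'d \<Rightarrow> real) \<Rightarrow> bool" where
  "cbd n B b \<longleftrightarrow> (\<forall>e. bd n (B * L2_set e \<Lambda>\<^sub>1) (\<lambda>x. \<Sum>\<xi>\<in>\<Lambda>\<^sub>1. e \<xi> * b \<xi> x))"

lemma cbd_bD:
  assumes "\<And>\<zeta>. smb (b \<zeta>)" "cbd (Suc n) B b" "\<xi> \<in> LM" "h > 0"
  shows "cbd n (real CARD('d) * wt \<xi> * B) (\<lambda>\<zeta>. bD h \<xi> (b \<zeta>))"
  unfolding cbd_def
proof
  fix e
  have sm: "smb (\<lambda>x. \<Sum>\<xi>\<in>\<Lambda>\<^sub>1. e \<xi> * b \<xi> x)" by (intro smb_intros assms)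
  have "bd n (real CARD('d) * wt \<xi> * (B * L2_set e \<Lambda>\<^sub>1)) (bD h \<xi> (\<lambda>x. \<Sum>\<xi>\<in>\<Lambda>\<^sub>1. e \<xi> * b \<xi> x))"
    using assms(2) by (intro bd_bD assms sm) (simp add: cbd_def)
  moreover have "bD h \<xi> (\<lambda>x. \<Sum>\<zeta>\<in>\<Lambda>\<^sub>1. e \<zeta> * b \<zeta> x) = (\<lambda>x. \<Sum>\<zeta>\<in>\<Lambda>\<^sub>1. e \<zeta> * bD h \<xi> (b \<zeta>) x)"
    using assms(1) by (subst bD_sum[OF assms(3)]) (auto simp: smb_intros bD_cmult[OF assms(3)])
  ultimately show "bd n (real CARD('d) * wt \<xi> * B * L2_set e \<Lambda>\<^sub>1) (\<lambda>x. \<Sum>\<zeta>\<in>\<Lambda>\<^sub>1. e \<zeta> * bD h \<xi> (b \<zeta>) x)"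
    by (simp add: mult_ac)
qed

lemma cbd_apply:
  assumes "cbd 0 B b" "0 \<le> B" "\<And>\<xi>. \<xi> \<in> \<Lambda>\<^sub>1 \<Longrightarrow> \<bar>g \<xi>\<bar> \<le> g' \<xi>"
  shows "\<bar>\<Sum>\<xi>\<in>\<Lambda>\<^sub>1. b \<xi> x * g \<xi>\<bar> \<le> B * L2_set g' \<Lambda>\<^sub>1"
proof -
  have "\<bar>\<Sum>\<xi>\<in>\<Lambda>\<^sub>1. g \<xi> * b \<xi> x\<bar> \<le> B * L2_set g \<Lambda>\<^sub>1"
    using assms(1) bd0 unfolding cbd_def by blast
  also have "L2_set g \<Lambda>\<^sub>1 = L2_set (\<lambda>\<xi>. \<bar>g \<xi>\<bar>) \<Lambda>\<^sub>1" by (simp add: L2_set_def)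
  also have "B * \<dots> \<le> B * L2_set g' \<Lambda>\<^sub>1"
    using assms by (intro mult_left_mono L2_set_mono) auto
  finally show ?thesis by (simp add: mult.commute)
qed

definition LL where "LL = L2_set norm \<Lambda>\<^sub>1"

lemma LL_nonneg: "0 \<le> LL" by (simp add: LL_def)

text \<open>No element of \<open>\<Lambda>\<^sub>1\<close> is longer than \<open>LL\<close>, so all
  powers but one can be pulled out and the cardinality does not enter.\<close>

lemma L2_norm_power: "L2_set (\<lambda>\<xi>. norm \<xi> ^ Suc k) \<Lambda>\<^sub>1 \<le> LL ^ Suc k"
proof (induction k)
  case (Suc k)
  have le: "norm \<xi> \<le> LL" if "\<xi> \<in> \<Lambda>\<^sub>1" for \<xi>
    using member_le_L2_set[OF fin that, of norm] by (simp add: LL_def)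
  have "L2_set (\<lambda>\<xi>. norm \<xi> ^ Suc (Suc k)) \<Lambda>\<^sub>1 \<le> L2_set (\<lambda>\<xi>. LL * norm \<xi> ^ Suc k) \<Lambda>\<^sub>1"
    using le by (intro L2_set_mono) (auto intro!: mult_right_mono simp: mult.assoc[symmetric])
  also have "\<dots> = LL * L2_set (\<lambda>\<xi>. norm \<xi> ^ Suc k) \<Lambda>\<^sub>1"
    by (rule L2_set_right_distrib[symmetric, OF LL_nonneg])
  also have "\<dots> \<le> LL * LL ^ Suc k" by (intro mult_left_mono Suc LL_nonneg)
  finally show ?case by simp
qed (simp add: LL_def)

text \<open>The three summands serve the diffusion, drift and zeroth-order parts respectively; their
  sum is used for all of them.\<close>

definition C0 where "C0 = (real CARD('d) * LL)\<^sup>2 + real CARD('d) * LL + 1"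

lemma C0_nonneg: "0 \<le> C0" by (simp add: C0_def LL_nonneg)

lemma Po_bound:
  assumes "cbd 0 B b" "0 \<le> B" "smb \<phi>" "bd 1 G \<phi>" "h > 0"
  shows "\<bar>Po h b \<phi> x\<bar> \<le> C0 * B * G"
proof -
  have G: "0 \<le> G" using bd_nonneg assms(4) .
  have "\<bar>Po h b \<phi> x\<bar> \<le> B * L2_set (\<lambda>\<xi>. (real CARD('d) * G) * norm \<xi> ^ Suc 0) \<Lambda>\<^sub>1"
    unfolding Po_def
  proof (rule cbd_apply[OF assms(1,2)])
    fix \<xi>
    have "\<bar>\<phi> (x + h *\<^sub>R \<xi>) - \<phi> x\<bar> \<le> real CARD('d) * norm (h *\<^sub>R \<xi>) * G"
      using bd1[of 0 G \<phi>] assms(4) by (intro increment_bound smb_differentiable assms) auto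
    then show "\<bar>fdiff h \<xi> \<phi> x\<bar> \<le> real CARD('d) * G * norm \<xi> ^ Suc 0"
      using assms(5) by (simp add: fdiff_def pos_divide_le_eq mult_ac)
  qed
  also have "\<dots> = B * (real CARD('d) * G * L2_set (\<lambda>\<xi>. norm \<xi> ^ Suc 0) \<Lambda>\<^sub>1)"
    using G by (subst L2_set_right_distrib) auto
  also have "\<dots> \<le> B * (real CARD('d) * G * LL ^ Suc 0)"
    by (intro mult_left_mono L2_norm_power) (use G assms in auto)
  also have "\<dots> = (real CARD('d) * LL) * (B * G)" by simp
  also have "\<dots> \<le> C0 * (B * G)" using G assms(2) by (intro mult_right_mono) (auto simp: C0_def)
  finally show ?thesis by (simp add: mult.assoc)
qed

text \<open>The first-order Taylor terms would be of size 1/h, but they cancel because the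
  coefficients are centered; the quadratic remainders that are left compensate the factor
  1/h^2.\<close>

lemma Qo_bound:
  assumes "cbd 0 B b" "\<And>k x. (\<Sum>\<xi>\<in>\<Lambda>\<^sub>1. b \<xi> x * \<xi> $ k) = 0" "0 \<le> B" "smb \<phi>" "bd 2 G \<phi>" "h > 0"
  shows "\<bar>Qo h b \<phi> x\<bar> \<le> C0 * B * G"
proof -
  have G: "0 \<le> G" using bd_nonneg assms(5) .
  define g where "g = (\<lambda>\<xi>. (fdiff h \<xi> \<phi> x - dir \<xi> \<phi> x) / h)"
  have z: "(\<Sum>\<xi>\<in>\<Lambda>\<^sub>1. b \<xi> x * dir \<xi> \<phi> x) = 0"
  proof -
    have "(\<Sum>\<xi>\<in>\<Lambda>\<^sub>1. b \<xi> x * dir \<xi> \<phi> x) = (\<Sum>k\<in>UNIV. \<Sum>\<xi>\<in>\<Lambda>\<^sub>1. b \<xi> x * (\<xi> $ k * partial k \<phi> x))"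
      unfolding dir_def sum_distrib_left by (rule sum.swap)
    also have "\<dots> = (\<Sum>k\<in>UNIV. (\<Sum>\<xi>\<in>\<Lambda>\<^sub>1. b \<xi> x * \<xi> $ k) * partial k \<phi> x)"
      by (simp add: sum_distrib_right mult.assoc)
    finally show ?thesis by (simp add: assms(2))
  qed
  have "Qo h b \<phi> x = (\<Sum>\<xi>\<in>\<Lambda>\<^sub>1. b \<xi> x * g \<xi>) + (1 / h) * (\<Sum>\<xi>\<in>\<Lambda>\<^sub>1. b \<xi> x * dir \<xi> \<phi> x)"
    unfolding Qo_def g_def sum_distrib_left sum.distrib[symmetric]
    by (rule sum.cong) (auto simp: right_diff_distrib diff_divide_distrib)
  then have "\<bar>Qo h b \<phi> x\<bar> = \<bar>\<Sum>\<xi>\<in>\<Lambda>\<^sub>1. b \<xi> x * g \<xi>\<bar>" using z by simp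
  also have "\<dots> \<le> B * L2_set (\<lambda>\<xi>. ((real CARD('d))\<^sup>2 * G) * norm \<xi> ^ Suc 1) \<Lambda>\<^sub>1"
  proof (rule cbd_apply[OF assms(1,3)])
    fix \<xi>
    have "\<bar>\<phi> (x + h *\<^sub>R \<xi>) - \<phi> x - (\<Sum>i\<in>UNIV. (h *\<^sub>R \<xi>) $ i * partial i \<phi> x)\<bar> \<le> (real CARD('d))\<^sup>2 * G * (norm (h *\<^sub>R \<xi>))\<^sup>2"
      by (rule quadratic_remainder[OF assms(4,5)])
    moreover have "(\<Sum>i\<in>UNIV. (h *\<^sub>R \<xi>) $ i * partial i \<phi> x) = h * dir \<xi> \<phi> x"
      using dir_scale[of h \<xi> \<phi> x] by (simp add: dir_def)
    moreover have "\<phi> (x + h *\<^sub>R \<xi>) - \<phi> x - h * dir \<xi> \<phi> x = h\<^sup>2 * g \<xi>"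
      using assms(6) by (simp add: g_def fdiff_def field_simps power2_eq_square)
    ultimately have "h\<^sup>2 * \<bar>g \<xi>\<bar> \<le> h\<^sup>2 * ((real CARD('d))\<^sup>2 * G * (norm \<xi>)\<^sup>2)"
      by (simp add: abs_mult power_mult_distrib mult_ac)
    then show "\<bar>g \<xi>\<bar> \<le> ((real CARD('d))\<^sup>2 * G) * norm \<xi> ^ Suc 1"
      using assms(6) by (simp add: power2_eq_square)
  qed
  also have "\<dots> = B * ((real CARD('d))\<^sup>2 * G * L2_set (\<lambda>\<xi>. norm \<xi> ^ Suc 1) \<Lambda>\<^sub>1)"
    using G by (subst L2_set_right_distrib) auto
  also have "\<dots> \<le> B * ((real CARD('d))\<^sup>2 * G * LL ^ Suc 1)"
    by (intro mult_left_mono L2_norm_power) (use G assms in auto)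
  also have "\<dots> = (real CARD('d) * LL)\<^sup>2 * (B * G)" by (simp add: power2_eq_square)
  also have "\<dots> \<le> C0 * (B * G)" using G assms(3) LL_nonneg by (intro mult_right_mono) (auto simp: C0_def)
  finally show ?thesis by (simp add: mult.assoc)
qed

definition betaP :: "nat \<Rightarrow> real \<Rightarrow> (real^'d \<Rightarrow> real^'d \<Rightarrow> real) \<Rightarrow> bool" where
  "betaP n B b \<longleftrightarrow> (\<forall>\<zeta>. smb (b \<zeta>)) \<and> cbd n B b"

definition betaQ :: "nat \<Rightarrow> real \<Rightarrow> (real^'d \<Rightarrow> real^'d \<Rightarrow> real) \<Rightarrow> bool" where
  "betaQ n B b \<longleftrightarrow> (\<forall>\<zeta>. smb (b \<zeta>)) \<and> cbd n B b \<and> (\<forall>k x. (\<Sum>\<xi>\<in>\<Lambda>\<^sub>1. b \<xi> x * \<xi> $ k) = 0)"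

definition betaC :: "nat \<Rightarrow> real \<Rightarrow> (real^'d \<Rightarrow> real^'d \<Rightarrow> real) \<Rightarrow> bool" where
  "betaC n B b \<longleftrightarrow> (\<forall>\<zeta>. smb (b \<zeta>)) \<and> bd n B (b 0)"

lemma betaP_step: "h > 0 \<Longrightarrow> betaP (Suc n) B b \<Longrightarrow> \<xi> \<in> LM \<Longrightarrow> betaP n (real CARD('d) * wt \<xi> * B) (\<lambda>\<zeta>. bD h \<xi> (b \<zeta>))"
  unfolding betaP_def by (auto intro: cbd_bD bD_smb)

lemma betaC_step: "h > 0 \<Longrightarrow> betaC (Suc n) B b \<Longrightarrow> \<xi> \<in> LM \<Longrightarrow> betaC n (real CARD('d) * wt \<xi> * B) (\<lambda>\<zeta>. bD h \<xi> (b \<zeta>))"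
  unfolding betaC_def by (auto intro: bd_bD bD_smb)

text \<open>Centering is a linear relation with weights independent of \<open>x\<close>, hence
  inherited by differences and derivatives of the family.\<close>

lemma betaQ_step:
  assumes "h > 0" "betaQ (Suc n) B b" "\<xi> \<in> LM"
  shows "betaQ n (real CARD('d) * wt \<xi> * B) (\<lambda>\<zeta>. bD h \<xi> (b \<zeta>))"
proof -
  have b: "\<And>\<zeta>. smb (b \<zeta>)" "cbd (Suc n) B b" "\<And>k x. (\<Sum>\<xi>\<in>\<Lambda>\<^sub>1. b \<xi> x * \<xi> $ k) = 0"
    using assms(2) by (auto simp: betaQ_def)
  have "(\<Sum>\<zeta>\<in>\<Lambda>\<^sub>1. bD h \<xi> (b \<zeta>) x * \<zeta> $ k) = 0" for k x
  proof -
    have "(\<lambda>x. \<Sum>\<zeta>\<in>\<Lambda>\<^sub>1. \<zeta> $ k * bD h \<xi> (b \<zeta>) x) = bD h \<xi> (\<lambda>x. \<Sum>\<zeta>\<in>\<Lambda>\<^sub>1. \<zeta> $ k * b \<zeta> x)"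
      using b(1) by (subst bD_sum[OF assms(3)]) (auto simp: smb_intros bD_cmult[OF assms(3)])
    also have "(\<lambda>x. \<Sum>\<zeta>\<in>\<Lambda>\<^sub>1. \<zeta> $ k * b \<zeta> x) = (\<lambda>x. 0 * 0)" using b(3)[of _ k] by (simp add: mult.commute fun_eq_iff)
    also have "bD h \<xi> (\<lambda>x. 0 * 0) = (\<lambda>x. 0)"
      using bD_cmult[OF assms(3) smb_const[of 0], of h 0] by simp
    finally show ?thesis by (simp add: fun_eq_iff mult.commute)
  qed
  then show ?thesis using b assms by (auto simp: betaQ_def intro: cbd_bD bD_smb)
qed

lemma leib_bounds:
  assumes "h > 0" "set \<mu> \<subseteq> LM" "j \<le> length \<mu>" "smb \<phi>" "0 \<le> B"
  shows "betaQ j B b \<Longrightarrow> bd (length \<mu> - j + 2) G \<phi> \<Longrightarrow>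
      \<bar>leib (Qo h) h j \<mu> b \<phi> x\<bar> \<le> C0 * (2 * real CARD('d)) ^ length \<mu> * wl \<mu> * B * G"
    "betaP j B b \<Longrightarrow> bd (length \<mu> - j + 1) G \<phi> \<Longrightarrow>
      \<bar>leib (Po h) h j \<mu> b \<phi> x\<bar> \<le> C0 * (2 * real CARD('d)) ^ length \<mu> * wl \<mu> * B * G"
    "betaC j B b \<Longrightarrow> bd (length \<mu> - j + 0) G \<phi> \<Longrightarrow>
      \<bar>leib Co h j \<mu> b \<phi> x\<bar> \<le> C0 * (2 * real CARD('d)) ^ length \<mu> * wl \<mu> * B * G"
proof -
  assume a: "betaQ j B b" "bd (length \<mu> - j + 2) G \<phi>"
  show "\<bar>leib (Qo h) h j \<mu> b \<phi> x\<bar> \<le> C0 * (2 * real CARD('d)) ^ length \<mu> * wl \<mu> * B * G"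
    by (rule leib_bound[of betaQ, OF betaQ_step[OF assms(1)] _ C0_nonneg assms(1-4) a(1) assms(5) a(2)])
      (use assms(1) in \<open>auto simp: betaQ_def intro!: Qo_bound\<close>)
next
  assume a: "betaP j B b" "bd (length \<mu> - j + 1) G \<phi>"
  show "\<bar>leib (Po h) h j \<mu> b \<phi> x\<bar> \<le> C0 * (2 * real CARD('d)) ^ length \<mu> * wl \<mu> * B * G"
    by (rule leib_bound[of betaP, OF betaP_step[OF assms(1)] _ C0_nonneg assms(1-4) a(1) assms(5) a(2)])
      (use assms(1) in \<open>auto simp: betaP_def intro!: Po_bound\<close>)
next
  assume a: "betaC j B b" "bd (length \<mu> - j + 0) G \<phi>"
  show "\<bar>leib Co h j \<mu> b \<phi> x\<bar> \<le> C0 * (2 * real CARD('d)) ^ length \<mu> * wl \<mu> * B * G"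
  proof (rule leib_bound[of betaC, OF betaC_step[OF assms(1)] _ C0_nonneg assms(1-4) a(1) assms(5) a(2)])
    fix B G :: real and b :: "real^'d \<Rightarrow> real^'d \<Rightarrow> real" and \<phi> :: "real^'d \<Rightarrow> real" and x
    assume b: "betaC 0 B b" "0 \<le> B" "bd 0 G \<phi>"
    have "\<bar>b 0 x\<bar> * \<bar>\<phi> x\<bar> \<le> B * G"
      using b bd0 unfolding betaC_def by (intro mult_mono) auto
    also have "\<dots> \<le> C0 * (B * G)"
      using b(2) bd_nonneg[OF b(3)] LL_nonneg mult_right_mono[of 1 C0 "B * G"] by (simp add: C0_def)
    finally show "\<bar>Co b \<phi> x\<bar> \<le> C0 * B * G" by (simp add: Co_def abs_mult mult.assoc)
  qed
qed

end

subsection \<open>Uniform estimates for smooth coefficients\<close>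

text \<open>The structural inequalities appear in a weakened form: the term with \<K> is replaced by
  a constant bound of its argument. Only a supremum is known where they are applied, and this form
  survives mollification of the coefficients. The second one is stated for a finite family because
  the supremum of a sum of squares may be smaller than the sum of the suprema.\<close>

locale smooth_scheme = scheme_data \<Lambda>\<^sub>1 \<l> \<tau>\<^sub>0 \<tau>
  for \<Lambda>\<^sub>1 :: "(real^'d::finite) set" and \<l> :: "'d \<Rightarrow> real^'d" and \<tau>\<^sub>0 :: real and \<tau> :: "real^'d \<Rightarrow> real" +
  fixes q p :: "real^'d \<Rightarrow> real^'d \<Rightarrow> real" and c :: "real^'d \<Rightarrow> real"
    and h0 \<delta> K c0 Mx :: real and m :: nat
  assumes delta: "0 < \<delta>" "\<delta> \<le> 1" and K1: "1 \<le> K" and c0: "0 < c0" "\<And>x. c0 \<le> c x"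
    and q_smb: "\<And>\<xi>. smb (q \<xi>)" and p_smb: "\<And>\<xi>. smb (p \<xi>)" and c_smb: "smb c"
    and nn: "\<And>h \<xi> x. 0 < h \<Longrightarrow> h \<le> h0 \<Longrightarrow> \<xi> \<in> \<Lambda>\<^sub>1 \<Longrightarrow> 0 \<le> q \<xi> x + h * p \<xi> x"
    and centered: "\<And>k x. (\<Sum>\<xi>\<in>\<Lambda>\<^sub>1. q \<xi> x * \<xi> $ k) = 0"
    and Mx: "0 \<le> Mx" and q_cbd: "cbd m Mx q" and p_cbd: "cbd m Mx p" and c_bd: "bd m Mx c"
    and str1: "\<And>h \<phi> B x. 0 < h \<Longrightarrow> h \<le> h0 \<Longrightarrow> smb \<phi> \<Longrightarrow> (\<And>y. bdiff_sq \<Lambda>\<^sub>1 \<l> \<tau>\<^sub>0 \<tau> 1 h \<phi> y \<le> B) \<Longrightarrow>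
      Aform \<Lambda>\<^sub>1 \<l> \<tau>\<^sub>0 \<tau> q p h \<phi> x
      \<le> (1 - \<delta>) * (\<Sum>\<xi>\<in>LM. Qform \<Lambda>\<^sub>1 q p h (bD h \<xi> \<phi>) x) + K * Qform \<Lambda>\<^sub>1 q p h \<phi> x + 2 * (1 - \<delta>) * c x * B"
    and str2: "\<And>h n I (\<phi> :: (real^'d) list \<Rightarrow> real^'d \<Rightarrow> real) B1 B2 x. 0 < h \<Longrightarrow> h \<le> h0 \<Longrightarrow> 2 \<le> n \<Longrightarrow> n \<le> m \<Longrightarrow> finite I \<Longrightarrow>
      (\<And>i. i \<in> I \<Longrightarrow> smb (\<phi> i)) \<Longrightarrow>
      (\<And>y. (\<Sum>i\<in>I. bdiff_sq \<Lambda>\<^sub>1 \<l> \<tau>\<^sub>0 \<tau> 1 h (\<phi> i) y) \<le> B1) \<Longrightarrow> (\<And>y. (\<Sum>i\<in>I. bdiff_sq \<Lambda>\<^sub>1 \<l> \<tau>\<^sub>0 \<tau> 2 h (\<phi> i) y) \<le> B2) \<Longrightarrow>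
      (\<Sum>i\<in>I. real n * (\<Sum>\<nu>\<in>LM. Aform \<Lambda>\<^sub>1 \<l> \<tau>\<^sub>0 \<tau> q p h (bD h \<nu> (\<phi> i)) x)
         + real n * (real n - 1) * (\<Sum>\<mu>\<in>pw 2. bDs h \<mu> (\<phi> i) x * Qop \<Lambda>\<^sub>1 \<l> \<tau>\<^sub>0 \<tau> q h \<mu> (shifts \<Lambda>\<^sub>1 h \<mu> (\<phi> i)) x))
      \<le> (\<Sum>i\<in>I. (1 - \<delta>) * (\<Sum>\<mu>\<in>pw 2. Qform \<Lambda>\<^sub>1 q p h (bDs h \<mu> (\<phi> i)) x)
          + K * (\<Sum>\<xi>\<in>LM. Qform \<Lambda>\<^sub>1 q p h (bD h \<xi> (\<phi> i)) x))
          + 2 * (1 - \<delta>) * c x * B2 + K * B1"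
begin

abbreviation "L \<equiv> Lh \<Lambda>\<^sub>1 q p c"
abbreviation "Qf \<equiv> Qform \<Lambda>\<^sub>1 q p"

definition U :: "real \<Rightarrow> nat \<Rightarrow> (real^'d \<Rightarrow> real) \<Rightarrow> real^'d \<Rightarrow> real" where
  "U h n \<phi> x = (\<Sum>\<mu>\<in>pw n. (bDs h \<mu> \<phi> x)\<^sup>2)"

lemma U_eq: "bdiff_sq \<Lambda>\<^sub>1 \<l> \<tau>\<^sub>0 \<tau> n h \<phi> x = U h n \<phi> x"
  by (simp add: bdiff_sq_def U_def)

lemma U_smb: "smb \<phi> \<Longrightarrow> smb (U h n \<phi>)"
  unfolding U_def[abs_def] by (intro smb_sum smb_power bDs_smb pw_subset)

lemma U_nonneg: "0 \<le> U h n \<phi> x" by (simp add: U_def sum_nonneg)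

lemma L_eq: "L h \<phi> x = Qo h q \<phi> x + Po h p \<phi> x - Co (\<lambda>_. c) \<phi> x"
  by (simp add: Lh_def Qo_def Po_def Co_def)

lemma L_add: "L h (\<lambda>x. f x + g x) x = L h f x + L h g x"
proof -
  have "fdiff h \<xi> (\<lambda>x. f x + g x) x = fdiff h \<xi> f x + fdiff h \<xi> g x" for \<xi>
    by (simp add: fdiff_def add_divide_distrib diff_divide_distrib)
  then show ?thesis by (simp add: Lh_def distrib_left sum.distrib)
qed

lemma L_cmult: "h \<noteq> 0 \<Longrightarrow> L h (\<lambda>x. a * f x) x = a * L h f x"
  by (simp add: Lh_alt sum_distrib_left algebra_simps)

lemma L_sum: "finite I \<Longrightarrow> L h (\<lambda>x. \<Sum>i\<in>I. f i x) x = (\<Sum>i\<in>I. L h (f i) x)"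
  by (induction I rule: finite_induct) (auto simp: L_add, simp add: Lh_def fdiff_def)

lemma L_smb: "smb \<phi> \<Longrightarrow> smb (L h \<phi>)"
  unfolding Lh_def[abs_def] by (intro smb_intros smb_fdiff q_smb p_smb c_smb)

text \<open>The discrete carre du champ identity. The zeroth-order part subtracts \<open>c\<close>
  times the square once on the left but twice in the product \<open>2 * f x * L h f x\<close>; the
  difference \<open>c x * (f x)\<^sup>2\<close> has a favourable sign and doubles the effective
  zeroth-order coefficient in the maximum principle.\<close>

lemma L_sq: "h \<noteq> 0 \<Longrightarrow> L h (\<lambda>x. (f x)\<^sup>2) x = 2 * f x * L h f x + c x * (f x)\<^sup>2 + Qf h f x"
proof -
  assume h: "h \<noteq> 0"
  have gen: "a / k * (2 * s * D + D\<^sup>2) = 2 * s * (a / k * D) + a * (D\<^sup>2 / k)" for a k s D :: real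
    by (simp add: algebra_simps)
  have "(q \<xi> x + h * p \<xi> x) / h\<^sup>2 * ((f (x + h *\<^sub>R \<xi>))\<^sup>2 - (f x)\<^sup>2) =
      2 * f x * ((q \<xi> x + h * p \<xi> x) / h\<^sup>2 * (f (x + h *\<^sub>R \<xi>) - f x)) + (q \<xi> x + h * p \<xi> x) * (fdiff h \<xi> f x)\<^sup>2" for \<xi>
  proof -
    have "(f (x + h *\<^sub>R \<xi>))\<^sup>2 - (f x)\<^sup>2 = 2 * f x * (f (x + h *\<^sub>R \<xi>) - f x) + (f (x + h *\<^sub>R \<xi>) - f x)\<^sup>2"
      by (simp add: power2_eq_square algebra_simps)
    then show ?thesis unfolding fdiff_def power_divide by (simp only: gen)
  qed
  then show ?thesis
    using h by (simp add: Lh_alt Qform_def sum.distrib sum_distrib_left power2_eq_square algebra_simps)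
qed

lemma Qf_nonneg: "0 < h \<Longrightarrow> h \<le> h0 \<Longrightarrow> 0 \<le> Qf h \<phi> x"
  unfolding Qform_def by (intro sum_nonneg mult_nonneg_nonneg nn) auto

text \<open>\<open>leib_sum_1\<close> for the diffusion and the drift part together produces A_h on
  the words of length \<open>n\<close>; the difference \<open>\<nu>\<close> summed inside
  \<open>Aform\<close> is the one that falls on the coefficients.\<close>

lemma leib_main_1:
  assumes "smb u"
  shows "(\<Sum>\<mu>\<in>pw (Suc n). 2 * bDs h \<mu> u x * (leib (Qo h) h 1 \<mu> q u x + leib (Po h) h 1 \<mu> p u x))
    = real (Suc n) * (\<Sum>\<mu>\<in>pw n. Aform \<Lambda>\<^sub>1 \<l> \<tau>\<^sub>0 \<tau> q p h (bDs h \<mu> u) x)"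
proof -
  have A: "Aform \<Lambda>\<^sub>1 \<l> \<tau>\<^sub>0 \<tau> q p h (bDs h \<mu> u) x = (\<Sum>\<nu>\<in>LM. 2 * (bDs h \<mu> (bD h \<nu> u) x *
      (Qo h (\<lambda>\<zeta>. bD h \<nu> (q \<zeta>)) (bDs h \<mu> (sh h \<nu> u)) x + Po h (\<lambda>\<zeta>. bD h \<nu> (p \<zeta>)) (bDs h \<mu> (sh h \<nu> u)) x)))"
    if "\<mu> \<in> pw n" for \<mu>
    unfolding Aform_def L0op_def Qop_def sum_distrib_left[of 2]
    using pw_subset[OF that] assms
    by (intro sum.cong) (auto simp: Qo_def Po_def bD_bDs[symmetric] bDs_sh)
  have gen: "(\<Sum>\<nu>\<in>A. \<Sum>\<mu>\<in>B. 2 * (a \<nu> \<mu> * (y \<nu> \<mu> + z \<nu> \<mu>)))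
      = 2 * ((\<Sum>\<nu>\<in>A. \<Sum>\<mu>\<in>B. a \<nu> \<mu> * y \<nu> \<mu>) + (\<Sum>\<nu>\<in>A. \<Sum>\<mu>\<in>B. a \<nu> \<mu> * z \<nu> \<mu>))"
    for A :: "(real^'d) set" and B :: "(real^'d) list set" and a y z :: "real^'d \<Rightarrow> (real^'d) list \<Rightarrow> real"
    by (simp add: distrib_left sum.distrib sum_distrib_left)
  have gen': "2 * (s * X + s * Y) = s * (2 * (X + Y))" for s X Y :: real by (simp add: algebra_simps)
  have "(\<Sum>\<mu>\<in>pw (Suc n). 2 * bDs h \<mu> u x * (leib (Qo h) h 1 \<mu> q u x + leib (Po h) h 1 \<mu> p u x))
    = 2 * ((\<Sum>\<mu>\<in>pw (Suc n). bDs h \<mu> u x * leib (Qo h) h 1 \<mu> q u x) + (\<Sum>\<mu>\<in>pw (Suc n). bDs h \<mu> u x * leib (Po h) h 1 \<mu> p u x))"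
    by (simp add: sum.distrib[symmetric] sum_distrib_left algebra_simps)
  also have "\<dots> = real (Suc n) * (\<Sum>\<nu>\<in>LM. \<Sum>\<mu>\<in>pw n. 2 * (bDs h \<mu> (bD h \<nu> u) x *
      (Qo h (\<lambda>\<zeta>. bD h \<nu> (q \<zeta>)) (bDs h \<mu> (sh h \<nu> u)) x + Po h (\<lambda>\<zeta>. bD h \<nu> (p \<zeta>)) (bDs h \<mu> (sh h \<nu> u)) x)))"
    unfolding leib_sum_1[OF q_smb assms assms] leib_sum_1[OF p_smb assms assms] gen by (rule gen')
  also have "\<dots> = real (Suc n) * (\<Sum>\<mu>\<in>pw n. Aform \<Lambda>\<^sub>1 \<l> \<tau>\<^sub>0 \<tau> q p h (bDs h \<mu> u) x)"
    by (subst sum.swap) (simp add: A)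
  finally show ?thesis .
qed

text \<open>These Leibniz terms cost \<open>Suc n\<close> or more derivatives of \<open>u\<close>.
  The diffusion part counts for two derivatives, so it contributes with one and with two differences
  on \<open>q\<close>, the drift part only with one on \<open>p\<close>. Summed over all words they
  form the left side of a structural inequality.\<close>

lemma main_ineq:
  assumes h: "0 < h" "h \<le> h0" and u: "smb u" and n: "Suc n \<le> m"
    and B2: "\<And>y. U h (Suc n) u y \<le> B2" and B1: "\<And>y. U h n u y \<le> B1"
  shows "(\<Sum>\<mu>\<in>pw (Suc n). 2 * bDs h \<mu> u x * (leib (Qo h) h 1 \<mu> q u x + leib (Po h) h 1 \<mu> p u x + leib (Qo h) h 2 \<mu> q u x))
    \<le> (1 - \<delta>) * (\<Sum>\<mu>\<in>pw (Suc n). Qf h (bDs h \<mu> u) x) + K * (\<Sum>\<mu>\<in>pw n. Qf h (bDs h \<mu> u) x)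
      + 2 * (1 - \<delta>) * c x * B2 + K * B1"
proof -
  have split: "(\<Sum>\<mu>\<in>pw (Suc n). 2 * bDs h \<mu> u x * (leib (Qo h) h 1 \<mu> q u x + leib (Po h) h 1 \<mu> p u x + leib (Qo h) h 2 \<mu> q u x))
    = real (Suc n) * (\<Sum>\<mu>\<in>pw n. Aform \<Lambda>\<^sub>1 \<l> \<tau>\<^sub>0 \<tau> q p h (bDs h \<mu> u) x)
      + 2 * (\<Sum>\<mu>\<in>pw (Suc n). bDs h \<mu> u x * leib (Qo h) h 2 \<mu> q u x)"
    unfolding leib_main_1[OF u, symmetric] sum_distrib_left[of 2] sum.distrib[symmetric]
    by (intro sum.cong refl) (simp add: algebra_simps)
  have B10: "0 \<le> B1" using B1[of 0] U_nonneg[of h n u 0] by linarith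
  show ?thesis
  proof (cases n)
    case 0
    have "(\<Sum>\<mu>\<in>pw (Suc n). bDs h \<mu> u x * leib (Qo h) h 2 \<mu> q u x) = 0"
      using 0 by (intro sum.neutral ballI) (auto simp: leib_zero dest!: pw_length)
    moreover have "Aform \<Lambda>\<^sub>1 \<l> \<tau>\<^sub>0 \<tau> q p h u x \<le> (1 - \<delta>) * (\<Sum>\<xi>\<in>LM. Qf h (bD h \<xi> u) x) + K * Qf h u x + 2 * (1 - \<delta>) * c x * B2"
      by (rule str1[OF h u]) (use B2 0 in \<open>simp add: U_eq\<close>)
    moreover have "0 \<le> K * B1" using K1 B10 by simp
    ultimately show ?thesis unfolding split using 0 by (simp add: pw_0 sum_pw_1)
  next
    case (Suc n')
    \<comment> \<open>From order 2 on, the second inequality is applied to the family of differences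
      of order \<open>n - 1\<close>; two further differences lead to order
      \<open>Suc n\<close>.\<close>
    define \<phi> where "\<phi> = (\<lambda>i. bDs h i u)"
    have ps: "smb (\<phi> i)" if "i \<in> pw n'" for i unfolding \<phi>_def by (intro bDs_smb pw_subset[OF that] u)
    have e1: "(\<Sum>i\<in>pw n'. \<Sum>\<nu>\<in>LM. F (bD h \<nu> (\<phi> i))) = (\<Sum>\<mu>\<in>pw n. F (bDs h \<mu> u))" for F :: "(real^'d \<Rightarrow> real) \<Rightarrow> real"
      unfolding Suc sum_pw_Suc by (subst sum.swap) (simp add: \<phi>_def)
    have e2: "(\<Sum>i\<in>pw n'. \<Sum>\<mu>\<in>pw 2. F (bDs h \<mu> (\<phi> i))) = (\<Sum>\<mu>\<in>pw (Suc n). F (bDs h \<mu> u))" for F :: "(real^'d \<Rightarrow> real) \<Rightarrow> real"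
    proof -
      have "(\<Sum>i\<in>pw n'. \<Sum>\<mu>\<in>pw 2. F (bDs h \<mu> (\<phi> i))) = (\<Sum>\<xi>\<in>LM. \<Sum>i\<in>pw n'. \<Sum>\<zeta>\<in>LM. F (bD h \<xi> (bD h \<zeta> (\<phi> i))))"
        unfolding sum_pw_2 by (subst sum.swap) simp
      also have "\<dots> = (\<Sum>\<xi>\<in>LM. \<Sum>\<zeta>\<in>LM. \<Sum>i\<in>pw n'. F (bD h \<xi> (bD h \<zeta> (\<phi> i))))"
        by (intro sum.cong refl sum.swap)
      finally show ?thesis unfolding Suc sum_pw_Suc by (simp add: \<phi>_def)
    qed
    have "2 * (\<Sum>\<mu>\<in>pw (Suc n). bDs h \<mu> u x * leib (Qo h) h 2 \<mu> q u x)
      = real (Suc n) * real n * (\<Sum>\<xi>\<in>LM. \<Sum>\<nu>\<in>LM. \<Sum>i\<in>pw n'. bD h \<nu> (bD h \<xi> (\<phi> i)) x * Qo h (\<lambda>\<zeta>. bD h \<nu> (bD h \<xi> (q \<zeta>))) (sh h \<nu> (sh h \<xi> (\<phi> i))) x)"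
      unfolding Suc leib_sum_2[OF q_smb u u]
      by (intro arg_cong2[of _ _ _ _ "(*)"] refl sum.cong)
        (use u in \<open>auto simp: \<phi>_def bD_bDs bD_smb bDs_sh dest!: pw_subset\<close>)
    also have "(\<Sum>\<xi>\<in>LM. \<Sum>\<nu>\<in>LM. \<Sum>i\<in>pw n'. bD h \<nu> (bD h \<xi> (\<phi> i)) x * Qo h (\<lambda>\<zeta>. bD h \<nu> (bD h \<xi> (q \<zeta>))) (sh h \<nu> (sh h \<xi> (\<phi> i))) x)
      = (\<Sum>i\<in>pw n'. \<Sum>\<mu>\<in>pw 2. bDs h \<mu> (\<phi> i) x * Qop \<Lambda>\<^sub>1 \<l> \<tau>\<^sub>0 \<tau> q h \<mu> (shifts \<Lambda>\<^sub>1 h \<mu> (\<phi> i)) x)"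
    proof -
      have sw: "(\<Sum>\<xi>\<in>LM. \<Sum>\<nu>\<in>LM. \<Sum>i\<in>pw n'. F \<xi> \<nu> i) = (\<Sum>i\<in>pw n'. \<Sum>\<nu>\<in>LM. \<Sum>\<xi>\<in>LM. F \<xi> \<nu> i)" for F :: "real^'d \<Rightarrow> real^'d \<Rightarrow> (real^'d) list \<Rightarrow> real"
      proof -
        have "(\<Sum>\<xi>\<in>LM. \<Sum>\<nu>\<in>LM. \<Sum>i\<in>pw n'. F \<xi> \<nu> i) = (\<Sum>\<nu>\<in>LM. \<Sum>\<xi>\<in>LM. \<Sum>i\<in>pw n'. F \<xi> \<nu> i)" by (rule sum.swap)
        also have "\<dots> = (\<Sum>\<nu>\<in>LM. \<Sum>i\<in>pw n'. \<Sum>\<xi>\<in>LM. F \<xi> \<nu> i)" by (intro sum.cong refl sum.swap)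
        also have "\<dots> = (\<Sum>i\<in>pw n'. \<Sum>\<nu>\<in>LM. \<Sum>\<xi>\<in>LM. F \<xi> \<nu> i)" by (rule sum.swap)
        finally show ?thesis .
      qed
      show ?thesis unfolding sw sum_pw_2 by (simp add: Qop_def Qo_def shifts_def)
    qed
    finally have e3: "2 * (\<Sum>\<mu>\<in>pw (Suc n). bDs h \<mu> u x * leib (Qo h) h 2 \<mu> q u x)
      = real (Suc n) * real n * (\<Sum>i\<in>pw n'. \<Sum>\<mu>\<in>pw 2. bDs h \<mu> (\<phi> i) x * Qop \<Lambda>\<^sub>1 \<l> \<tau>\<^sub>0 \<tau> q h \<mu> (shifts \<Lambda>\<^sub>1 h \<mu> (\<phi> i)) x)" .
    have u1: "(\<Sum>i\<in>pw n'. bdiff_sq \<Lambda>\<^sub>1 \<l> \<tau>\<^sub>0 \<tau> 1 h (\<phi> i) y) \<le> B1" for y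
      using B1[of y] e1[of "\<lambda>g. (g y)\<^sup>2"] by (simp add: U_eq U_def sum_pw_1)
    have u2: "(\<Sum>i\<in>pw n'. bdiff_sq \<Lambda>\<^sub>1 \<l> \<tau>\<^sub>0 \<tau> 2 h (\<phi> i) y) \<le> B2" for y
      using B2[of y] e2[of "\<lambda>g. (g y)\<^sup>2"] by (simp add: U_eq U_def)
    have n2: "2 \<le> Suc n" using Suc by simp
    have "real (Suc n) * (\<Sum>\<mu>\<in>pw n. Aform \<Lambda>\<^sub>1 \<l> \<tau>\<^sub>0 \<tau> q p h (bDs h \<mu> u) x)
        + 2 * (\<Sum>\<mu>\<in>pw (Suc n). bDs h \<mu> u x * leib (Qo h) h 2 \<mu> q u x)
      = (\<Sum>i\<in>pw n'. real (Suc n) * (\<Sum>\<nu>\<in>LM. Aform \<Lambda>\<^sub>1 \<l> \<tau>\<^sub>0 \<tau> q p h (bD h \<nu> (\<phi> i)) x)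
         + real (Suc n) * (real (Suc n) - 1) * (\<Sum>\<mu>\<in>pw 2. bDs h \<mu> (\<phi> i) x * Qop \<Lambda>\<^sub>1 \<l> \<tau>\<^sub>0 \<tau> q h \<mu> (shifts \<Lambda>\<^sub>1 h \<mu> (\<phi> i)) x))"
      unfolding e3 e1[of "\<lambda>g. Aform \<Lambda>\<^sub>1 \<l> \<tau>\<^sub>0 \<tau> q p h g x", symmetric]
      by (simp add: sum.distrib sum_distrib_left)
    also have "\<dots> \<le> (\<Sum>i\<in>pw n'. (1 - \<delta>) * (\<Sum>\<mu>\<in>pw 2. Qf h (bDs h \<mu> (\<phi> i)) x) + K * (\<Sum>\<xi>\<in>LM. Qf h (bD h \<xi> (\<phi> i)) x))
          + 2 * (1 - \<delta>) * c x * B2 + K * B1"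
      by (rule str2[OF h n2 n finite_pw ps u1 u2])
    also have "(\<Sum>i\<in>pw n'. (1 - \<delta>) * (\<Sum>\<mu>\<in>pw 2. Qf h (bDs h \<mu> (\<phi> i)) x) + K * (\<Sum>\<xi>\<in>LM. Qf h (bD h \<xi> (\<phi> i)) x))
      = (1 - \<delta>) * (\<Sum>\<mu>\<in>pw (Suc n). Qf h (bDs h \<mu> u) x) + K * (\<Sum>\<mu>\<in>pw n. Qf h (bDs h \<mu> u) x)"
      unfolding e1[of "\<lambda>g. Qf h g x", symmetric] e2[of "\<lambda>g. Qf h g x", symmetric]
      by (simp add: sum.distrib sum_distrib_left)
    finally show ?thesis unfolding split .
  qed
qed

text \<open>The remaining terms have at least three differences on \<open>q\<close>, two on
  \<open>p\<close> or one on \<open>c\<close>. Each then costs at most \<open>n\<close> derivatives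
  of \<open>u\<close>, which are already bounded when order \<open>Suc n\<close> is treated.\<close>

lemma leib_remainder:
  assumes h: "0 < h" and u: "smb u" and N: "Suc n \<le> m" and G: "bd n G u" and mu: "\<mu> \<in> pw (Suc n)"
  shows "\<bar>bDs h \<mu> (L h u) x - (L h (bDs h \<mu> u) x + (leib (Qo h) h 1 \<mu> q u x + leib (Po h) h 1 \<mu> p u x + leib (Qo h) h 2 \<mu> q u x))\<bar>
    \<le> 3 * real (Suc (Suc n)) * C0 * (2 * real CARD('d)) ^ Suc n * Mx * wl \<mu> * G"
proof -
  have ms: "set \<mu> \<subseteq> LM" and len: "length \<mu> = Suc n" using mu by (auto dest: pw_subset pw_length)
  \<comment> \<open>\<open>T\<close> bounds every single term; there are three operators with at
    most \<open>n + 2\<close> terms each.\<close>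
  define T where "T = C0 * (2 * real CARD('d)) ^ Suc n * wl \<mu> * Mx * G"
  have G0: "0 \<le> G" using bd_nonneg[OF G] .
  have T0: "0 \<le> T" unfolding T_def using C0_nonneg wl_nonneg[of \<mu>] Mx G0 by (intro mult_nonneg_nonneg) auto
  define aQ where "aQ = (\<lambda>j. leib (Qo h) h j \<mu> q u x)"
  define aP where "aP = (\<lambda>j. leib (Po h) h j \<mu> p u x)"
  define aC where "aC = (\<lambda>j. leib Co h j \<mu> (\<lambda>_. c) u x)"
  have cm: "cbd j Mx b" if "cbd m Mx b" "j \<le> m" for j b
    using that unfolding cbd_def by (meson bd_mono order_refl)
  have beta: "betaQ j Mx q" "betaP j Mx p" "betaC j Mx (\<lambda>_. c)" if "j \<le> m" for j
    by (simp_all add: betaQ_def betaP_def betaC_def cm[OF _ that] q_cbd p_cbd q_smb p_smb c_smb centered bd_mono[OF c_bd that])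
  have bQ: "\<bar>aQ j\<bar> \<le> T" if j: "3 \<le> j" "j \<le> Suc n" for j
  proof -
    have "bd (length \<mu> - j + 2) G u" by (rule bd_mono[OF G]) (use j len in simp_all)
    moreover have "betaQ j Mx q" by (rule beta) (use j N in simp)
    moreover have "j \<le> length \<mu>" using j len by simp
    ultimately have "\<bar>leib (Qo h) h j \<mu> q u x\<bar> \<le> C0 * (2 * real CARD('d)) ^ length \<mu> * wl \<mu> * Mx * G"
      by (intro leib_bounds(1) h ms u Mx)
    then show ?thesis by (simp only: aQ_def T_def len)
  qed
  have bP: "\<bar>aP j\<bar> \<le> T" if j: "2 \<le> j" "j \<le> Suc n" for j
  proof -
    have "bd (length \<mu> - j + 1) G u" by (rule bd_mono[OF G]) (use j len in simp_all)
    moreover have "betaP j Mx p" by (rule beta) (use j N in simp)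
    moreover have "j \<le> length \<mu>" using j len by simp
    ultimately have "\<bar>leib (Po h) h j \<mu> p u x\<bar> \<le> C0 * (2 * real CARD('d)) ^ length \<mu> * wl \<mu> * Mx * G"
      by (intro leib_bounds(2) h ms u Mx)
    then show ?thesis by (simp only: aP_def T_def len)
  qed
  have bC: "\<bar>aC j\<bar> \<le> T" if j: "1 \<le> j" "j \<le> Suc n" for j
  proof -
    have "bd (length \<mu> - j + 0) G u" by (rule bd_mono[OF G]) (use j len in simp_all)
    moreover have "betaC j Mx (\<lambda>_. c)" by (rule beta) (use j N in simp)
    moreover have "j \<le> length \<mu>" using j len by simp
    ultimately have "\<bar>leib Co h j \<mu> (\<lambda>_. c) u x\<bar> \<le> C0 * (2 * real CARD('d)) ^ length \<mu> * wl \<mu> * Mx * G"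
      by (intro leib_bounds(3) h ms u Mx)
    then show ?thesis by (simp only: aC_def T_def len)
  qed
  have sQ: "smb (Qo h q u)" by (rule leibniz_smb[OF leibniz_Qo q_smb u])
  have sP: "smb (Po h p u)" by (rule leibniz_smb[OF leibniz_Po p_smb u])
  have sC: "smb (Co (\<lambda>_. c) u)" by (rule leibniz_smb[OF leibniz_Co c_smb u])
  have "L h u = (\<lambda>x. (Qo h q u x + Po h p u x) + (-1) * Co (\<lambda>_. c) u x)" by (simp add: L_eq fun_eq_iff)
  then have "bDs h \<mu> (L h u) x = bDs h \<mu> (Qo h q u) x + bDs h \<mu> (Po h p u) x - bDs h \<mu> (Co (\<lambda>_. c) u) x"
    using bDs_add[OF ms smb_add[OF sQ sP] smb_mult[OF smb_const sC], of h "-1"] bDs_add[OF ms sQ sP, of h] bDs_cmult[OF ms sC, of h "-1"]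
    by simp
  also have "\<dots> = (\<Sum>j\<le>Suc n. aQ j) + (\<Sum>j\<le>Suc n. aP j) - (\<Sum>j\<le>Suc n. aC j)"
    unfolding aQ_def aP_def aC_def
    by (simp add: leibniz_formula[OF leibniz_Qo ms u q_smb] leibniz_formula[OF leibniz_Po ms u p_smb] leibniz_formula[OF leibniz_Co ms u c_smb] len)
  finally have 1: "bDs h \<mu> (L h u) x = (\<Sum>j\<le>Suc n. aQ j) + (\<Sum>j\<le>Suc n. aP j) - (\<Sum>j\<le>Suc n. aC j)" .
  have 2: "L h (bDs h \<mu> u) x = aQ 0 + aP 0 - aC 0"
    unfolding aQ_def aP_def aC_def leib_0[OF ms u] by (rule L_eq)
  have sum_bound: "\<bar>\<Sum>j\<in>J. a j\<bar> \<le> real (Suc (Suc n)) * T" if "J \<subseteq> {..Suc n}" "\<And>j. j \<in> J \<Longrightarrow> \<bar>a j\<bar> \<le> T" for a J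
  proof -
    have "\<bar>\<Sum>j\<in>J. a j\<bar> \<le> (\<Sum>j\<in>J. T)" by (rule order_trans[OF sum_abs sum_mono]) (use that in auto)
    also have "\<dots> = real (card J) * T" by simp
    also have "\<dots> \<le> real (Suc (Suc n)) * T"
      using card_mono[OF _ that(1)] T0 by (intro mult_right_mono) auto
    finally show ?thesis .
  qed
  have 3: "(\<Sum>j\<le>Suc n. aQ j) = aQ 0 + (aQ 1 + aQ 2) + (\<Sum>j\<in>{3..Suc n}. aQ j)"
  proof (cases n)
    case 0
    then have "aQ 2 = 0" using len by (simp add: aQ_def leib_zero)
    then show ?thesis using 0 by simp
  next
    case (Suc n')
    have "{..Suc n} = {0, 1, 2} \<union> {3..Suc n}" using Suc by auto
    then have "(\<Sum>j\<le>Suc n. aQ j) = (\<Sum>j\<in>{0, 1, 2}. aQ j) + (\<Sum>j\<in>{3..Suc n}. aQ j)"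
      by (simp only:) (rule sum.union_disjoint, auto)
    then show ?thesis by simp
  qed
  have 4: "(\<Sum>j\<le>Suc n. aP j) = aP 0 + aP 1 + (\<Sum>j\<in>{2..Suc n}. aP j)"
  proof -
    have "{..Suc n} = {0, 1} \<union> {2..Suc n}" by auto
    then have "(\<Sum>j\<le>Suc n. aP j) = (\<Sum>j\<in>{0, 1}. aP j) + (\<Sum>j\<in>{2..Suc n}. aP j)"
      by (simp only:) (rule sum.union_disjoint, auto)
    then show ?thesis by simp
  qed
  have 5: "(\<Sum>j\<le>Suc n. aC j) = aC 0 + (\<Sum>j\<in>{1..Suc n}. aC j)"
  proof -
    have "{..Suc n} = {0} \<union> {1..Suc n}" by auto
    then have "(\<Sum>j\<le>Suc n. aC j) = (\<Sum>j\<in>{0}. aC j) + (\<Sum>j\<in>{1..Suc n}. aC j)"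
      by (simp only:) (rule sum.union_disjoint, auto)
    then show ?thesis by simp
  qed
  have "\<bar>\<Sum>j\<in>{3..Suc n}. aQ j\<bar> \<le> real (Suc (Suc n)) * T" by (rule sum_bound) (use bQ in auto)
  moreover have "\<bar>\<Sum>j\<in>{2..Suc n}. aP j\<bar> \<le> real (Suc (Suc n)) * T" by (rule sum_bound) (use bP in auto)
  moreover have "\<bar>\<Sum>j\<in>{1..Suc n}. aC j\<bar> \<le> real (Suc (Suc n)) * T" by (rule sum_bound) (use bC in auto)
  ultimately have "\<bar>bDs h \<mu> (L h u) x - (L h (bDs h \<mu> u) x + (aQ 1 + aP 1 + aQ 2))\<bar> \<le> 3 * (real (Suc (Suc n)) * T)"
    using 1 2 3 4 5 by linarith
  moreover have "3 * (real (Suc (Suc n)) * T) = 3 * real (Suc (Suc n)) * C0 * (2 * real CARD('d)) ^ Suc n * Mx * wl \<mu> * G"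
    by (simp only: T_def mult_ac)
  ultimately show ?thesis by (simp only: aQ_def aP_def)
qed

end

text \<open>Constants of the a priori estimate; \<open>d\<close> is the dimension, \<open>L\<close> and \<open>T\<close> stand for
  \<open>|\<Lambda>\<^sub>1|\<close> and \<open>\<parallel>\<Lambda>\<^sub>1\<parallel>\<close>, and \<open>A\<close> bounds the derivatives of the coefficients.\<close>

definition cst_G :: "real \<Rightarrow> nat \<Rightarrow> real" where
  "cst_G \<tau>\<^sub>0 n = (max 1 (1 / \<tau>\<^sub>0)) ^ n"

definition cst_r :: "real \<Rightarrow> real \<Rightarrow> real \<Rightarrow> nat \<Rightarrow> real" where
  "cst_r d L A n = 3 * real (Suc n) * ((d * L)\<^sup>2 + d * L + 1) * (2 * d) ^ n * A"

text \<open>\<open>2 * K * C\<close> pays for two lower-order errors, that of the structural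
  inequality and that of the auxiliary function handed on by the previous order. The quotient comes
  from Young's inequality with parameter \<open>\<delta> * c0\<close>, summed over all words with
  the squares of \<open>wl\<close> as weights.\<close>

definition cst_R :: "real \<Rightarrow> real \<Rightarrow> real \<Rightarrow> real \<Rightarrow> real \<Rightarrow> real \<Rightarrow> real \<Rightarrow> real \<Rightarrow> nat \<Rightarrow> real \<Rightarrow> real" where
  "cst_R d \<delta> K \<tau>\<^sub>0 c0 L T A n C = 2 * K * C
     + (T\<^sup>2 + d * \<tau>\<^sub>0\<^sup>2) ^ n * (2 * ((d ^ n)\<^sup>2 + (cst_r d L A n * cst_G \<tau>\<^sub>0 n)\<^sup>2 * C)) / (\<delta> * c0)"

text \<open>Results from solving \<open>\<delta> * s \<le> (K * C + R / c0) * F\<^sup>2\<close> for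
  the supremum \<open>s\<close> of the sums of squares.\<close>

definition cst_B :: "real \<Rightarrow> real \<Rightarrow> real \<Rightarrow> real \<Rightarrow> real \<Rightarrow> real" where
  "cst_B \<delta> K c0 C R = (K * C + R / c0) / \<delta>"

text \<open>A step adds up four requirements: \<open>C\<close> keeps the lower orders,
  \<open>B\<close> bounds the new squares, \<open>(B + K * C) / \<delta>\<close> the new auxiliary
  function, and the last summand the defect in the inequality for its image under the difference
  operator.\<close>

primrec cst :: "real \<Rightarrow> real \<Rightarrow> real \<Rightarrow> real \<Rightarrow> real \<Rightarrow> real \<Rightarrow> real \<Rightarrow> real \<Rightarrow> nat \<Rightarrow> real" where
  "cst d \<delta> K \<tau>\<^sub>0 c0 L T A 0 = (1 / c0)\<^sup>2 + 2 / c0"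
| "cst d \<delta> K \<tau>\<^sub>0 c0 L T A (Suc n) = (let C = cst d \<delta> K \<tau>\<^sub>0 c0 L T A n;
      R = cst_R d \<delta> K \<tau>\<^sub>0 c0 L T A (Suc n) C; B = cst_B \<delta> K c0 C R
    in C + B + (B + K * C) / \<delta> + (2 * A * B + R) / \<delta>)"

definition cst_apriori :: "real \<Rightarrow> real \<Rightarrow> real \<Rightarrow> real \<Rightarrow> real \<Rightarrow> real \<Rightarrow> real \<Rightarrow> real \<Rightarrow> nat \<Rightarrow> real" where
  "cst_apriori d \<delta> K \<tau>\<^sub>0 c0 L T A n = cst_G \<tau>\<^sub>0 n * sqrt (cst d \<delta> K \<tau>\<^sub>0 c0 L T A n)"

section \<open>The a priori estimate by induction on the order\<close>

context smooth_scheme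
begin

definition TT where "TT = sqrt (\<Sum>\<xi>\<in>\<Lambda>\<^sub>1. (norm (\<tau> \<xi> *\<^sub>R \<xi>))\<^sup>2)"

abbreviation "CC \<equiv> cst (real CARD('d)) \<delta> K \<tau>\<^sub>0 c0 LL TT Mx"
abbreviation "RR \<equiv> cst_R (real CARD('d)) \<delta> K \<tau>\<^sub>0 c0 LL TT Mx"

lemma wl_sum_eq: "(\<Sum>\<mu>\<in>pw n. (wl \<mu>)\<^sup>2) = (TT\<^sup>2 + real CARD('d) * \<tau>\<^sub>0\<^sup>2) ^ n"
  unfolding wl_sum wt_sum TT_def by (simp add: sum_nonneg)

lemma RR_nonneg: "0 \<le> C \<Longrightarrow> 0 \<le> RR n C"
  unfolding cst_R_def using K1 delta c0 by (intro add_nonneg_nonneg divide_nonneg_nonneg mult_nonneg_nonneg) auto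

lemma CC_nonneg: "0 \<le> CC n"
proof (induction n)
  case (Suc n)
  then show ?case using RR_nonneg[OF Suc, of "Suc n"] K1 delta c0 Mx
    by (auto simp: Let_def cst_B_def intro!: add_nonneg_nonneg divide_nonneg_nonneg mult_nonneg_nonneg)
qed (use c0 in simp)

lemma bDs_map_l: "smb u \<Longrightarrow> bDs h (map \<l> is) u = (\<lambda>x. \<tau>\<^sub>0 ^ length is * foldr partial is u x)"
proof (induction "is")
  case (Cons i "is")
  then show ?case by (simp add: bD_dir partial_cmult smb_pderivs mult.assoc)
qed simp

text \<open>Words in the labels \<open>\<l>\<close> alone give powers of
  \<open>\<tau>\<^sub>0\<close> times pure derivatives, so the sums of squares control all
  derivatives; this is the purpose of the coordinate directions in \<open>Lam\<close>. The maximum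
  with 1 in \<open>cst_G\<close> makes the constant monotone in the order.\<close>

lemma U_bd:
  assumes "smb u" "0 \<le> C" "0 \<le> F" "\<And>j x. j \<le> n \<Longrightarrow> U h j u x \<le> C * F\<^sup>2" "n \<le> N"
  shows "bd n (cst_G \<tau>\<^sub>0 N * sqrt C * F) u"
  unfolding bd_def
proof (intro allI impI)
  fix "is" :: "'d list" and x assume l: "length is \<le> n"
  have "map \<l> is \<in> pw (length is)" by (auto simp: Lam_pow_def Lam_def)
  then have "(bDs h (map \<l> is) u x)\<^sup>2 \<le> U h (length is) u x"
    unfolding U_def by (intro member_le_sum finite_pw) auto
  also have "\<dots> \<le> C * F\<^sup>2" by (rule assms(4)[OF l])
  also have "\<dots> = (sqrt C * F)\<^sup>2" using assms(2) by (simp add: power_mult_distrib)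
  finally have "\<bar>bDs h (map \<l> is) u x\<bar> \<le> sqrt C * F"
    using assms(2,3) abs_le_square_iff[of "bDs h (map \<l> is) u x" "sqrt C * F"] by simp
  then have le: "\<tau>\<^sub>0 ^ length is * \<bar>foldr partial is u x\<bar> \<le> sqrt C * F"
    using tau0 by (simp add: bDs_map_l[OF assms(1)] abs_mult)
  have "\<bar>foldr partial is u x\<bar> = (1 / \<tau>\<^sub>0) ^ length is * (\<tau>\<^sub>0 ^ length is * \<bar>foldr partial is u x\<bar>)"
    using tau0 by (simp add: power_divide)
  also have "\<dots> \<le> (max 1 (1 / \<tau>\<^sub>0)) ^ length is * (sqrt C * F)"
    by (rule mult_mono[OF power_mono le]) (use tau0 in auto)
  also have "\<dots> \<le> (max 1 (1 / \<tau>\<^sub>0)) ^ N * (sqrt C * F)"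
    using l assms by (intro mult_right_mono power_increasing) auto
  finally show "\<bar>foldr partial is u x\<bar> \<le> cst_G \<tau>\<^sub>0 N * sqrt C * F" by (simp add: cst_G_def mult.assoc)
qed

text \<open>\<open>L_sq\<close> is summed over all words of length \<open>Suc n\<close>. The terms
  of top order are estimated by the structural inequality, the others by Young's inequality, and the
  sum of \<open>Qform\<close> one order lower that the structural inequality leaves behind is
  compensated by \<open>K * L h Z x\<close>.\<close>

lemma apriori_step_lower:
  assumes h: "0 < h" "h \<le> h0" and n: "Suc n \<le> m" and u: "smb u" and f: "smb f"
    and eq: "\<And>x. L h u x + f x = 0" and bf: "bd (Suc n) F f"
    and Uj: "\<And>j x. j \<le> n \<Longrightarrow> U h j u x \<le> C * F\<^sup>2" and C: "0 \<le> C"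
    and Z: "\<And>x. (\<Sum>\<mu>\<in>pw n. Qf h (bDs h \<mu> u) x) - C * F\<^sup>2 \<le> L h Z x"
    and B2: "\<And>y. U h (Suc n) u y \<le> B2"
  shows "c x * U h (Suc n) u x - \<delta> * c0 * U h (Suc n) u x + \<delta> * (\<Sum>\<mu>\<in>pw (Suc n). Qf h (bDs h \<mu> u) x)
      - 2 * (1 - \<delta>) * c x * B2 - RR (Suc n) C * F\<^sup>2 \<le> L h (\<lambda>x. U h (Suc n) u x + K * Z x) x"
proof -
  have F0: "0 \<le> F" using bd_nonneg[OF bf] .
  define N where "N = Suc n"
  define G where "G = cst_G \<tau>\<^sub>0 N * sqrt C * F"
  have G: "bd n G u" unfolding G_def by (rule U_bd[OF u C F0 Uj]) (auto simp: N_def)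
  define H where "H = real CARD('d) ^ N * F + cst_r (real CARD('d)) LL Mx N * G"
  \<comment> \<open>Young's inequality may spend only part of the gain
    \<open>2 * \<delta> * c x\<close> hidden in the factor \<open>1 - \<delta>\<close> of the
    structural inequality; \<open>\<delta> * c0\<close> is at most half of it.\<close>
  define e where "e = \<delta> * c0"
  have e: "0 < e" using delta c0 by (simp add: e_def)
  define l where "l = (\<lambda>\<mu>. leib (Qo h) h 1 \<mu> q u x + leib (Po h) h 1 \<mu> p u x + leib (Qo h) h 2 \<mu> q u x)"
  have trm: "L h (\<lambda>x. (bDs h \<mu> u x)\<^sup>2) x \<ge> c x * (bDs h \<mu> u x)\<^sup>2 - e * (bDs h \<mu> u x)\<^sup>2 - (wl \<mu>)\<^sup>2 * (H\<^sup>2 / e)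
      + Qf h (bDs h \<mu> u) x - 2 * bDs h \<mu> u x * l \<mu>" if mu: "\<mu> \<in> pw N" for \<mu>
  proof -
    have ms: "set \<mu> \<subseteq> LM" and len: "length \<mu> = N" using mu by (auto dest: pw_subset pw_length)
    define r where "r = bDs h \<mu> (L h u) x - (L h (bDs h \<mu> u) x + l \<mu>)"
    have rb: "\<bar>r\<bar> \<le> cst_r (real CARD('d)) LL Mx N * G * wl \<mu>"
      using leib_remainder[OF h(1) u n G, of \<mu> x] mu
      by (simp add: r_def l_def N_def cst_r_def C0_def mult_ac)
    have "L h u = (\<lambda>x. (-1) * f x)" using eq by (simp add: fun_eq_iff eq_neg_iff_add_eq_0)
    then have Lu: "bDs h \<mu> (L h u) x = - bDs h \<mu> f x" by (simp add: bDs_cmult[OF ms f, of h "-1", simplified])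
    have fb: "\<bar>bDs h \<mu> f x\<bar> \<le> real CARD('d) ^ N * F * wl \<mu>"
      using bd0[OF bd_bDs[OF ms h(1) f, of 0 F], of x] bf len by (simp add: N_def mult_ac)
    define a where "a = bDs h \<mu> u x"
    define s where "s = bDs h \<mu> f x + r"
    have sb: "\<bar>s\<bar> \<le> wl \<mu> * H" using rb fb unfolding s_def H_def by (simp add: algebra_simps)
    have "2 * a * s \<le> e * a\<^sup>2 + (wl \<mu>)\<^sup>2 * (H\<^sup>2 / e)"
    proof -
      have "0 \<le> (e * a - s)\<^sup>2 / e" using e by simp
      also have "\<dots> = e * a\<^sup>2 - 2 * a * s + s\<^sup>2 / e" using e by (simp add: field_simps power2_eq_square)
      finally have "2 * a * s \<le> e * a\<^sup>2 + s\<^sup>2 / e" by simp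
      moreover have "s\<^sup>2 \<le> (wl \<mu> * H)\<^sup>2"
        using sb abs_le_square_iff[of s "wl \<mu> * H"] by linarith
      then have "s\<^sup>2 / e \<le> (wl \<mu> * H)\<^sup>2 / e" using e by (simp add: divide_right_mono)
      ultimately show ?thesis by (simp add: power_mult_distrib)
    qed
    moreover have "L h (bDs h \<mu> u) x = - s - l \<mu>" using Lu by (simp add: s_def r_def)
    then have "2 * a * L h (bDs h \<mu> u) x = 2 * a * (- s - l \<mu>)" by (simp only:)
    then have "2 * a * L h (bDs h \<mu> u) x = - (2 * a * s) - 2 * a * l \<mu>" by (simp only: right_diff_distrib mult_minus_right)
    moreover have "L h (\<lambda>x. (bDs h \<mu> u x)\<^sup>2) x = 2 * a * L h (bDs h \<mu> u) x + c x * a\<^sup>2 + Qf h (bDs h \<mu> u) x"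
      unfolding a_def by (rule L_sq) (use h in simp)
    ultimately show ?thesis unfolding a_def by linarith
  qed
  have "c x * U h N u x - e * U h N u x - (\<Sum>\<mu>\<in>pw N. (wl \<mu>)\<^sup>2) * (H\<^sup>2 / e) + (\<Sum>\<mu>\<in>pw N. Qf h (bDs h \<mu> u) x)
      - (\<Sum>\<mu>\<in>pw N. 2 * bDs h \<mu> u x * l \<mu>)
    = (\<Sum>\<mu>\<in>pw N. c x * (bDs h \<mu> u x)\<^sup>2 - e * (bDs h \<mu> u x)\<^sup>2 - (wl \<mu>)\<^sup>2 * (H\<^sup>2 / e)
      + Qf h (bDs h \<mu> u) x - 2 * bDs h \<mu> u x * l \<mu>)"
    by (simp add: U_def sum.distrib sum_subtractf sum_distrib_left sum_distrib_right sum_divide_distrib)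
  also have "\<dots> \<le> (\<Sum>\<mu>\<in>pw N. L h (\<lambda>x. (bDs h \<mu> u x)\<^sup>2) x)" by (rule sum_mono[OF trm])
  also have "\<dots> = L h (U h N u) x" unfolding U_def[abs_def] by (rule L_sum[OF finite_pw, symmetric])
  finally have low: "c x * U h N u x - e * U h N u x - (TT\<^sup>2 + real CARD('d) * \<tau>\<^sub>0\<^sup>2) ^ N * (H\<^sup>2 / e) + (\<Sum>\<mu>\<in>pw N. Qf h (bDs h \<mu> u) x)
      - (\<Sum>\<mu>\<in>pw N. 2 * bDs h \<mu> u x * l \<mu>) \<le> L h (U h N u) x"
    unfolding wl_sum_eq .
  have main: "(\<Sum>\<mu>\<in>pw N. 2 * bDs h \<mu> u x * l \<mu>) \<le> (1 - \<delta>) * (\<Sum>\<mu>\<in>pw N. Qf h (bDs h \<mu> u) x)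
      + K * (\<Sum>\<mu>\<in>pw n. Qf h (bDs h \<mu> u) x) + 2 * (1 - \<delta>) * c x * B2 + K * (C * F\<^sup>2)"
    unfolding N_def l_def by (rule main_ineq[OF h u n B2 Uj]) simp
  have LW: "L h (\<lambda>x. U h N u x + K * Z x) x = L h (U h N u) x + K * L h Z x"
    using h by (simp add: L_add L_cmult)
  have "K * ((\<Sum>\<mu>\<in>pw n. Qf h (bDs h \<mu> u) x) - C * F\<^sup>2) \<le> K * L h Z x"
    using Z K1 by (intro mult_left_mono) auto
  then have KZ: "K * (\<Sum>\<mu>\<in>pw n. Qf h (bDs h \<mu> u) x) - K * (C * F\<^sup>2) \<le> K * L h Z x"
    by (simp add: right_diff_distrib)
  have Hle: "H\<^sup>2 \<le> 2 * ((real CARD('d) ^ N)\<^sup>2 + (cst_r (real CARD('d)) LL Mx N * cst_G \<tau>\<^sub>0 N)\<^sup>2 * C) * F\<^sup>2"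
  proof -
    have "H\<^sup>2 \<le> 2 * ((real CARD('d) ^ N * F)\<^sup>2 + (cst_r (real CARD('d)) LL Mx N * G)\<^sup>2)"
      unfolding H_def using sum_squares_bound[of "real CARD('d) ^ N * F" "cst_r (real CARD('d)) LL Mx N * G"] by (simp add: power2_sum)
    also have "(cst_r (real CARD('d)) LL Mx N * G)\<^sup>2 = (cst_r (real CARD('d)) LL Mx N * cst_G \<tau>\<^sub>0 N)\<^sup>2 * C * F\<^sup>2"
      unfolding G_def using C by (simp add: power_mult_distrib)
    finally show ?thesis by (simp add: power_mult_distrib algebra_simps)
  qed
  have "(TT\<^sup>2 + real CARD('d) * \<tau>\<^sub>0\<^sup>2) ^ N * (H\<^sup>2 / e) \<le> (TT\<^sup>2 + real CARD('d) * \<tau>\<^sub>0\<^sup>2) ^ N *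
      (2 * ((real CARD('d) ^ N)\<^sup>2 + (cst_r (real CARD('d)) LL Mx N * cst_G \<tau>\<^sub>0 N)\<^sup>2 * C) * F\<^sup>2 / e)"
    using Hle e by (intro mult_left_mono divide_right_mono) auto
  also have "\<dots> = (RR N C - 2 * K * C) * F\<^sup>2" unfolding cst_R_def e_def by simp
  also have "\<dots> = RR N C * F\<^sup>2 - 2 * (K * (C * F\<^sup>2))" by (simp add: left_diff_distrib)
  finally have RRle: "(TT\<^sup>2 + real CARD('d) * \<tau>\<^sub>0\<^sup>2) ^ N * (H\<^sup>2 / e) \<le> RR N C * F\<^sup>2 - 2 * (K * (C * F\<^sup>2))" .
  have dl: "(1 - \<delta>) * (\<Sum>\<mu>\<in>pw N. Qf h (bDs h \<mu> u) x) = (\<Sum>\<mu>\<in>pw N. Qf h (bDs h \<mu> u) x) - \<delta> * (\<Sum>\<mu>\<in>pw N. Qf h (bDs h \<mu> u) x)"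
    by (simp add: left_diff_distrib)
  show ?thesis using low main LW KZ RRle dl unfolding N_def[symmetric] e_def by linarith
qed

text \<open>The inequality for \<open>U\<close> contains the supremum of \<open>U\<close> on the
  right. The maximum principle yields a bound in which this supremum recurs with the factor
  \<open>1 - \<delta> / 2\<close>, so that it can be absorbed.\<close>

lemma apriori_step_max:
  assumes h: "0 < h" "h \<le> h0" and u: "smb u" and Zs: "smb Z"
    and C: "0 \<le> C" and R: "0 \<le> R" and F0: "0 \<le> F" and Z0: "\<And>x. 0 \<le> Z x" "\<And>x. Z x \<le> C * F\<^sup>2"
    and low: "\<And>x B2. (\<And>y. U h N u y \<le> B2) \<Longrightarrow>
      c x * U h N u x - \<delta> * c0 * U h N u x - 2 * (1 - \<delta>) * c x * B2 - R * F\<^sup>2 \<le> L h (\<lambda>x. U h N u x + K * Z x) x"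
  shows "U h N u x \<le> cst_B \<delta> K c0 C R * F\<^sup>2"
proof -
  define W where "W = (\<lambda>x. U h N u x + K * Z x)"
  have Ws: "smb W" unfolding W_def by (intro smb_intros U_smb u Zs)
  obtain W0 where W0: "\<And>x. \<bar>W x\<bar> \<le> W0" using smb_lipb[OF Ws] by (metis lipbE)
  obtain U0 where U0: "\<And>x. \<bar>U h N u x\<bar> \<le> U0" using smb_lipb[OF U_smb[OF u]] by (metis lipbE)
  define s where "s = (SUP x. U h N u x)"
  have bdd: "bdd_above (range (U h N u))" using U0 abs_le_D1 by (intro bdd_aboveI2) blast
  have Us: "U h N u x \<le> s" for x unfolding s_def by (rule cSUP_upper[OF _ bdd]) simp
  have s0: "0 \<le> s" using Us[of 0] U_nonneg[of h N u 0] by linarith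
  define B where "B = K * (C * F\<^sup>2) / 2 + (1 - \<delta> / 2) * s + R * F\<^sup>2 / (2 * c0)"
  define a where "a = (\<lambda>\<xi> x. (q \<xi> x + h * p \<xi> x) / h\<^sup>2)"
  have asm: "smb (a \<xi>)" for \<xi> unfolding a_def by (intro smb_intros q_smb p_smb)
  have "\<exists>A. \<forall>x. \<bar>a \<xi> x\<bar> \<le> A" for \<xi> using smb_lipb[OF asm[of \<xi>]] by (metis lipbE)
  then obtain A where A: "\<And>\<xi> x. \<bar>a \<xi> x\<bar> \<le> A \<xi>" by metis
  have WB: "W x \<le> B" for x
  \<comment> \<open>The zeroth-order coefficient is \<open>2 * c x\<close>: one half belongs to
    \<open>L\<close>, the other is the term with \<open>c\<close> produced by squaring.\<close>
  proof (rule max_principle[where a = a and W = W and \<sigma> = "\<lambda>\<xi> x. x + h *\<^sub>R \<xi>" and c = "\<lambda>x. 2 * c x" and ?c0.0 = "2 * c0" and A = "\<Sum>\<xi>\<in>\<Lambda>\<^sub>1. A \<xi>", OF fin])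
    show "0 \<le> a \<xi> x" if "\<xi> \<in> \<Lambda>\<^sub>1" for \<xi> x unfolding a_def using nn[OF h that] h by simp
    show "(\<Sum>\<xi>\<in>\<Lambda>\<^sub>1. a \<xi> x) \<le> (\<Sum>\<xi>\<in>\<Lambda>\<^sub>1. A \<xi>)" for x by (intro sum_mono) (use A abs_le_D1 in blast)
    show "0 < 2 * c0" "\<And>x. 2 * c0 \<le> 2 * c x" using c0 by auto
    show "W x \<le> W0" for x using W0[of x] by linarith
    fix x
    have LW: "L h W x = (\<Sum>\<xi>\<in>\<Lambda>\<^sub>1. a \<xi> x * (W (x + h *\<^sub>R \<xi>) - W x)) - c x * W x"
      using h by (simp add: Lh_alt a_def)
    have l: "c x * U h N u x - \<delta> * c0 * U h N u x - 2 * (1 - \<delta>) * c x * s - R * F\<^sup>2 \<le> L h W x"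
      unfolding W_def by (rule low[OF Us])
    have cx: "0 < c x" using c0(1) c0(2)[of x] by linarith
    have 1: "\<delta> * c0 * U h N u x \<le> \<delta> * c x * s"
      using Us[of x] s0 c0 delta cx U_nonneg[of h N u x] by (intro mult_mono) auto
    have 2: "R * F\<^sup>2 \<le> c x * (R * F\<^sup>2 / c0)"
    proof -
      have "c0 * (R * F\<^sup>2 / c0) \<le> c x * (R * F\<^sup>2 / c0)" using c0 R by (intro mult_right_mono) auto
      then show ?thesis using c0(1) by simp
    qed
    have 3: "c x * W x \<le> c x * U h N u x + c x * (K * (C * F\<^sup>2))"
      unfolding W_def distrib_left using Z0(2)[of x] cx K1 by (intro add_left_mono mult_left_mono) auto
    have 4: "2 * c x * B = c x * (K * (C * F\<^sup>2)) + 2 * c x * s - \<delta> * c x * s + c x * (R * F\<^sup>2 / c0)"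
      by (simp add: B_def algebra_simps)
    have 5: "2 * (1 - \<delta>) * c x * s = 2 * c x * s - 2 * (\<delta> * c x * s)" by (simp add: algebra_simps)
    show "2 * c x * W x \<le> (\<Sum>\<xi>\<in>\<Lambda>\<^sub>1. a \<xi> x * (W (x + h *\<^sub>R \<xi>) - W x)) + 2 * c x * B"
      using LW l 1 2 3 4 5 by linarith
  qed
  have "s \<le> B" unfolding s_def
  proof (rule cSUP_least)
    fix x show "U h N u x \<le> B" using WB[of x] Z0(1)[of x] K1 unfolding W_def
      by (smt (verit) mult_nonneg_nonneg)
  qed simp
  then have "\<delta> * s \<le> (K * C + R / c0) * F\<^sup>2" using c0(1) by (simp add: B_def field_simps)
  then have "s \<le> cst_B \<delta> K c0 C R * F\<^sup>2" using delta by (simp add: cst_B_def field_simps)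
  then show ?thesis using Us[of x] by linarith
qed

text \<open>A bound on the squares of order \<open>n\<close> does not control the sums of
  \<open>Qform\<close> of that order, which contain one more difference. \<open>Z\<close> is the
  substitute: it is bounded and \<open>L h Z\<close> dominates those sums up to a constant, which is
  all the maximum principle asks for at the next order.\<close>

lemma apriori_energy:
  assumes h: "0 < h" "h \<le> h0" and u: "smb u" and f: "smb f" and eq: "\<And>x. L h u x + f x = 0"
  shows "n \<le> m \<Longrightarrow> bd n F f \<Longrightarrow> (\<forall>j\<le>n. \<forall>x. U h j u x \<le> CC n * F\<^sup>2) \<and>
    (\<exists>Z. smb Z \<and> (\<forall>x. 0 \<le> Z x \<and> Z x \<le> CC n * F\<^sup>2) \<and>
      (\<forall>x. (\<Sum>\<mu>\<in>pw n. Qf h (bDs h \<mu> u) x) - CC n * F\<^sup>2 \<le> L h Z x))"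
proof (induction n)
  case 0
  have F0: "0 \<le> F" using bd_nonneg 0 by blast
  have fb: "\<bar>f x\<bar> \<le> F" for x using bd0 0 by blast
  have ub: "\<bar>u x\<bar> \<le> F / c0" for x
  proof (rule Lh_bound[OF fin h(1) _ _ nn[OF h] c0])
    show "bounded (range (q \<xi>))" "bounded (range (p \<xi>))" "bounded (range u)" for \<xi>
      using q_smb p_smb u by (auto intro: lipb_bounded smb_lipb)
    show "\<bar>L h u x\<bar> \<le> F" for x using eq[of x] fb[of x] by linarith
  qed
  have u2: "(u x)\<^sup>2 \<le> (1 / c0)\<^sup>2 * F\<^sup>2" for x
    using ub[of x] abs_le_square_iff[of "u x" "F / c0"] F0 c0(1) by (simp add: power_divide)
  have le: "(1 / c0)\<^sup>2 * F\<^sup>2 \<le> CC 0 * F\<^sup>2" "2 / c0 * F\<^sup>2 \<le> CC 0 * F\<^sup>2"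
    using c0(1) by (intro mult_right_mono; simp)+
  have "U h 0 u x \<le> CC 0 * F\<^sup>2" for x
    using u2[of x] le(1) by (simp add: U_def pw_0 del: cst.simps)
  moreover have "\<exists>Z. smb Z \<and> (\<forall>x. 0 \<le> Z x \<and> Z x \<le> CC 0 * F\<^sup>2) \<and>
      (\<forall>x. (\<Sum>\<mu>\<in>pw 0. Qf h (bDs h \<mu> u) x) - CC 0 * F\<^sup>2 \<le> L h Z x)"
  \<comment> \<open>At order 0 the square of \<open>u\<close> will do, by \<open>L_sq\<close>; the
    product of \<open>u\<close> and \<open>f\<close> is bounded by
    \<open>F\<^sup>2 / c0\<close>.\<close>
  proof (intro exI[of _ "\<lambda>x. (u x)\<^sup>2"] conjI allI)
    show "smb (\<lambda>x. (u x)\<^sup>2)" by (intro smb_intros u)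
    fix x
    show "0 \<le> (u x)\<^sup>2" by simp
    show "(u x)\<^sup>2 \<le> CC 0 * F\<^sup>2" using u2[of x] le(1) by linarith
    have "\<bar>u x\<bar> * \<bar>f x\<bar> \<le> (F / c0) * F" by (rule mult_mono[OF ub fb]) (use F0 c0(1) in auto)
    then have "2 * \<bar>u x * f x\<bar> \<le> 2 / c0 * F\<^sup>2" by (simp add: abs_mult power2_eq_square)
    moreover have "L h u x = - f x" using eq[of x] by linarith
    then have "L h (\<lambda>x. (u x)\<^sup>2) x = - 2 * (u x * f x) + c x * (u x)\<^sup>2 + Qf h u x" using h by (simp add: L_sq)
    moreover have "0 \<le> c x * (u x)\<^sup>2" using c0(1) c0(2)[of x] by simp
    ultimately show "(\<Sum>\<mu>\<in>pw 0. Qf h (bDs h \<mu> u) x) - CC 0 * F\<^sup>2 \<le> L h (\<lambda>x. (u x)\<^sup>2) x"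
      using le(2) by (simp add: pw_0 del: cst.simps)
  qed
  ultimately show ?case by blast
next
  case (Suc n)
  have F0: "0 \<le> F" using bd_nonneg Suc by blast
  define C where "C = CC n"
  define R where "R = RR (Suc n) C"
  define B where "B = cst_B \<delta> K c0 C R"
  have C: "0 \<le> C" unfolding C_def by (rule CC_nonneg)
  have R: "0 \<le> R" unfolding R_def by (rule RR_nonneg[OF C])
  have B: "0 \<le> B" unfolding B_def cst_B_def using C R K1 delta c0 by simp
  have CS: "CC (Suc n) = C + B + (B + K * C) / \<delta> + (2 * Mx * B + R) / \<delta>"
    by (simp add: C_def R_def B_def Let_def)
  have p1: "0 \<le> (B + K * C) / \<delta>" "0 \<le> (2 * Mx * B + R) / \<delta>" using B C R K1 delta Mx by auto
  have "n \<le> m" using Suc.prems by simp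
  moreover have "bd n F f" using Suc.prems bd_mono[of "Suc n" F f n F] by simp
  ultimately obtain Z where Uj: "\<And>j x. j \<le> n \<Longrightarrow> U h j u x \<le> C * F\<^sup>2"
    and Z: "smb Z" "\<And>x. 0 \<le> Z x" "\<And>x. Z x \<le> C * F\<^sup>2"
      "\<And>x. (\<Sum>\<mu>\<in>pw n. Qf h (bDs h \<mu> u) x) - C * F\<^sup>2 \<le> L h Z x"
    using Suc.IH unfolding C_def by blast
  have low: "c x * U h (Suc n) u x - \<delta> * c0 * U h (Suc n) u x + \<delta> * (\<Sum>\<mu>\<in>pw (Suc n). Qf h (bDs h \<mu> u) x)
      - 2 * (1 - \<delta>) * c x * B2 - RR (Suc n) C * F\<^sup>2 \<le> L h (\<lambda>x. U h (Suc n) u x + K * Z x) x"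
    if "\<And>y. U h (Suc n) u y \<le> B2" for x B2
    by (rule apriori_step_lower[OF h Suc.prems(1) u f eq Suc.prems(2) _ C Z(4) that]) (rule Uj)
  have Qs0: "0 \<le> \<delta> * (\<Sum>\<mu>\<in>pw (Suc n). Qf h (bDs h \<mu> u) x)" for x
    using delta by (intro mult_nonneg_nonneg sum_nonneg Qf_nonneg h) auto
  have UB: "U h (Suc n) u x \<le> B * F\<^sup>2" for x
    unfolding B_def
  proof (rule apriori_step_max[OF h u Z(1) C R F0 Z(2,3)])
    fix x B2 assume "\<And>y. U h (Suc n) u y \<le> B2"
    from low[OF this, of x] Qs0[of x]
    show "c x * U h (Suc n) u x - \<delta> * c0 * U h (Suc n) u x - 2 * (1 - \<delta>) * c x * B2 - R * F\<^sup>2 \<le> L h (\<lambda>x. U h (Suc n) u x + K * Z x) x"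
      unfolding R_def by linarith
  qed
  have "U h j u x \<le> CC (Suc n) * F\<^sup>2" if "j \<le> Suc n" for j x
  proof (cases "j \<le> n")
    case True
    have "C * F\<^sup>2 \<le> CC (Suc n) * F\<^sup>2" unfolding CS using B p1 by (intro mult_right_mono) auto
    then show ?thesis using Uj[OF True, of x] by linarith
  next
    case False
    then have j: "j = Suc n" using that by simp
    have "B * F\<^sup>2 \<le> CC (Suc n) * F\<^sup>2" unfolding CS using C p1 by (intro mult_right_mono) auto
    then show ?thesis using UB[of x] unfolding j by linarith
  qed
  moreover have "\<exists>Z. smb Z \<and> (\<forall>x. 0 \<le> Z x \<and> Z x \<le> CC (Suc n) * F\<^sup>2) \<and>
      (\<forall>x. (\<Sum>\<mu>\<in>pw (Suc n). Qf h (bDs h \<mu> u) x) - CC (Suc n) * F\<^sup>2 \<le> L h Z x)"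
  \<comment> \<open>The nonnegative term \<open>\<delta>\<close> times the sum of
    \<open>Qform\<close>, dropped in the maximum principle, is now kept and read as a lower bound
    for \<open>L\<close> of the function used there; the bound just found for \<open>U\<close> takes
    the place of \<open>B2\<close>.\<close>
  proof (intro exI[of _ "\<lambda>x. (1 / \<delta>) * (U h (Suc n) u x + K * Z x)"] conjI allI)
    show "smb (\<lambda>x. (1 / \<delta>) * (U h (Suc n) u x + K * Z x))" by (intro smb_intros U_smb u Z)
    fix x
    show "0 \<le> (1 / \<delta>) * (U h (Suc n) u x + K * Z x)"
      using delta K1 Z(2)[of x] U_nonneg[of h "Suc n" u x] by simp
    have "U h (Suc n) u x + K * Z x \<le> B * F\<^sup>2 + K * (C * F\<^sup>2)"
      using UB[of x] Z(3)[of x] K1 by (intro add_mono mult_left_mono) auto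
    then have "(1 / \<delta>) * (U h (Suc n) u x + K * Z x) \<le> (1 / \<delta>) * (B * F\<^sup>2 + K * (C * F\<^sup>2))"
      using delta by (intro mult_left_mono) auto
    also have "\<dots> = ((B + K * C) / \<delta>) * F\<^sup>2" by (simp add: field_simps)
    also have "\<dots> \<le> CC (Suc n) * F\<^sup>2" unfolding CS using B C p1 by (intro mult_right_mono) auto
    finally show "(1 / \<delta>) * (U h (Suc n) u x + K * Z x) \<le> CC (Suc n) * F\<^sup>2" .
    define Qs where "Qs = (\<Sum>\<mu>\<in>pw (Suc n). Qf h (bDs h \<mu> u) x)"
    have l: "c x * U h (Suc n) u x - \<delta> * c0 * U h (Suc n) u x + \<delta> * Qs
      - 2 * (1 - \<delta>) * c x * (B * F\<^sup>2) - R * F\<^sup>2 \<le> L h (\<lambda>x. U h (Suc n) u x + K * Z x) x"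
      using low[OF UB, of x] unfolding R_def Qs_def .
    have "\<delta> * c0 * U h (Suc n) u x \<le> 1 * c x * U h (Suc n) u x"
      using delta c0 U_nonneg[of h "Suc n" u x] by (intro mult_right_mono mult_mono) auto
    moreover have "2 * (1 - \<delta>) * c x * (B * F\<^sup>2) \<le> 2 * 1 * Mx * (B * F\<^sup>2)"
    proof -
      have "c x \<le> Mx" "0 \<le> c x" using bd0[OF c_bd, of x] c0(1) c0(2)[of x] by auto
      then show ?thesis using delta B by (intro mult_right_mono mult_mono) auto
    qed
    ultimately have "\<delta> * Qs - (2 * Mx * B + R) * F\<^sup>2 \<le> L h (\<lambda>x. U h (Suc n) u x + K * Z x) x"
      using l by (simp add: distrib_right)
    then have "(1 / \<delta>) * (\<delta> * Qs - (2 * Mx * B + R) * F\<^sup>2) \<le> (1 / \<delta>) * L h (\<lambda>x. U h (Suc n) u x + K * Z x) x"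
      using delta by (intro mult_left_mono) auto
    moreover have "(1 / \<delta>) * (\<delta> * Qs - (2 * Mx * B + R) * F\<^sup>2) = Qs - (2 * Mx * B + R) / \<delta> * F\<^sup>2"
      using delta by (simp add: field_simps)
    moreover have "(2 * Mx * B + R) / \<delta> * F\<^sup>2 \<le> CC (Suc n) * F\<^sup>2"
      unfolding CS using B C p1 by (intro mult_right_mono) auto
    moreover have "L h (\<lambda>x. (1 / \<delta>) * (U h (Suc n) u x + K * Z x)) x = (1 / \<delta>) * L h (\<lambda>x. U h (Suc n) u x + K * Z x) x"
      by (rule L_cmult) (use h in simp)
    ultimately show "(\<Sum>\<mu>\<in>pw (Suc n). Qf h (bDs h \<mu> u) x) - CC (Suc n) * F\<^sup>2 \<le> L h (\<lambda>x. (1 / \<delta>) * (U h (Suc n) u x + K * Z x)) x"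
      unfolding Qs_def by linarith
  qed
  ultimately show ?case by blast
qed

abbreviation "NA \<equiv> cst_apriori (real CARD('d)) \<delta> K \<tau>\<^sub>0 c0 LL TT Mx"

lemma NA_nonneg: "0 \<le> NA n"
  unfolding cst_apriori_def cst_G_def by (intro mult_nonneg_nonneg real_sqrt_ge_zero CC_nonneg) auto

text \<open>The constant depends neither on \<open>h\<close> nor on more of the coefficients than
  their bounds. From here on the structural inequalities act only through this estimate.\<close>

theorem apriori:
  assumes "0 < h" "h \<le> h0" "smb u" "smb f" "\<And>x. L h u x + f x = 0" "n \<le> m" "bd n F f"
  shows "bd n (NA n * F) u"
  unfolding cst_apriori_def
  by (rule U_bd[OF assms(3) CC_nonneg bd_nonneg[OF assms(7)]])
    (use apriori_energy[OF assms(1-7)] in auto)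

end

subsection \<open>Taylor expansion of the difference operators\<close>

lemma partial_dir: "smb \<phi> \<Longrightarrow> partial i (dir \<xi> \<phi>) = dir \<xi> (partial i \<phi>)"
  using pderivs_dir[OF smb_Cb, of \<phi> "[i]" 1 \<xi>]
  by (simp add: fun_eq_iff dir_def partial_commute[of \<phi> i])

lemma partial_dirpow: "smb \<phi> \<Longrightarrow> partial i ((dir \<xi> ^^ k) \<phi>) = (dir \<xi> ^^ k) (partial i \<phi>)"
  by (induction k) (auto simp: partial_dir smb_dirpow)

lemma dir_const: "dir \<xi> (\<lambda>x. a) = (\<lambda>x. 0)"
  by (simp add: dir_def fun_eq_iff partial_const)

lemma dirpow_zero: "(dir \<xi> ^^ k) (\<lambda>x. 0) = (\<lambda>x. 0)"
  by (induction k) (auto simp: dir_const)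

lemma dir_cmult: "smb \<phi> \<Longrightarrow> dir \<xi> (\<lambda>x. a * \<phi> x) = (\<lambda>x. a * dir \<xi> \<phi> x)"
  using pderivs_cmult[OF smb_Cb, of \<phi> "[_]" 1 a]
  by (simp add: dir_def fun_eq_iff sum_distrib_left mult_ac)

lemma dirpow_uminus: "smb \<phi> \<Longrightarrow> (dir (- \<xi>) ^^ k) \<phi> = (\<lambda>x. (-1) ^ k * (dir \<xi> ^^ k) \<phi> x)"
proof (induction k)
  case (Suc k)
  have "dir (- \<xi>) \<psi> = (\<lambda>x. - dir \<xi> \<psi> x)" for \<psi> :: "real^'a \<Rightarrow> real"
    by (simp add: dir_def fun_eq_iff sum_negf)
  then show ?case using Suc by (simp add: dir_cmult smb_dirpow)
qed simp

lemma bd_pderivs: "bd (n + k) G \<phi> \<Longrightarrow> length is \<le> n \<Longrightarrow> bd k G (foldr partial is \<phi>)"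
  unfolding bd_def
proof (intro allI impI)
  fix js :: "'a list" and x
  assume a: "\<forall>is x. length is \<le> n + k \<longrightarrow> \<bar>foldr partial is \<phi> x\<bar> \<le> G" "length is \<le> n" "length js \<le> k"
  then show "\<bar>foldr partial js (foldr partial is \<phi>) x\<bar> \<le> G"
    using a(1)[rule_format, of "js @ is" x] by simp
qed

context smooth_scheme
begin

lemma cbd_mono: "cbd n B b \<Longrightarrow> k \<le> n \<Longrightarrow> cbd k B b"
  unfolding cbd_def using bd_mono[OF _ _ order_refl] by blast

text \<open>Each derivative falls on the coefficient or on \<open>\<psi> \<xi>\<close>, which
  doubles the constant; both resulting families satisfy the same assumptions one order
  lower.\<close>

lemma cbd_nonneg_bd:
  assumes "cbd n B b" "0 \<le> B" "\<And>\<zeta>. smb (b \<zeta>)" "\<And>\<xi>. smb (\<psi> \<xi>)" "\<And>\<xi>. \<xi> \<in> \<Lambda>\<^sub>1 \<Longrightarrow> bd n (g \<xi>) (\<psi> \<xi>)"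
  shows "bd n (2 ^ n * (B * L2_set g \<Lambda>\<^sub>1)) (\<lambda>x. \<Sum>\<xi>\<in>\<Lambda>\<^sub>1. b \<xi> x * \<psi> \<xi> x)"
  using assms(1,3-)
proof (induction n arbitrary: b \<psi>)
  case 0
  then show ?case using cbd_apply[OF 0(1) assms(2)] by (auto simp: bd_0_iff)
next
  case (Suc n)
  have Y0: "0 \<le> B * L2_set g \<Lambda>\<^sub>1" using assms(2) by simp
  have v: "\<bar>\<Sum>\<xi>\<in>\<Lambda>\<^sub>1. b \<xi> x * \<psi> \<xi> x\<bar> \<le> 2 ^ Suc n * (B * L2_set g \<Lambda>\<^sub>1)" for x
  proof -
    have "cbd 0 B b" using Suc.prems(1) by (rule cbd_mono) simp
    then have "\<bar>\<Sum>\<xi>\<in>\<Lambda>\<^sub>1. b \<xi> x * \<psi> \<xi> x\<bar> \<le> B * L2_set g \<Lambda>\<^sub>1"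
      by (rule cbd_apply[OF _ assms(2)]) (use Suc.prems(4) bd0 in blast)
    also have "\<dots> \<le> 2 ^ Suc n * (B * L2_set g \<Lambda>\<^sub>1)"
      using mult_right_mono[OF one_le_power[of "2::real" "Suc n"], of "B * L2_set g \<Lambda>\<^sub>1"] Y0 by simp
    finally show ?thesis .
  qed
  have cb: "cbd n B (\<lambda>\<zeta>. partial i (b \<zeta>))" for i
    unfolding cbd_def
  proof
    fix e
    have "partial i (\<lambda>x. \<Sum>\<xi>\<in>\<Lambda>\<^sub>1. e \<xi> * b \<xi> x) = (\<lambda>x. \<Sum>\<xi>\<in>\<Lambda>\<^sub>1. e \<xi> * partial i (b \<xi>) x)"
      using Suc.prems(2) by (subst partial_sum) (auto simp: smb_intros partial_cmult)
    then show "bd n (B * L2_set e \<Lambda>\<^sub>1) (\<lambda>x. \<Sum>\<xi>\<in>\<Lambda>\<^sub>1. e \<xi> * partial i (b \<xi>) x)"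
      using Suc.prems(1) bd_partial unfolding cbd_def by metis
  qed
  have cb': "cbd n B b" using Suc.prems(1) by (rule cbd_mono) simp
  have dist: "partial i (\<lambda>x. \<Sum>\<xi>\<in>\<Lambda>\<^sub>1. b \<xi> x * \<psi> \<xi> x)
      = (\<lambda>x. (\<Sum>\<xi>\<in>\<Lambda>\<^sub>1. b \<xi> x * partial i (\<psi> \<xi>) x) + (\<Sum>\<xi>\<in>\<Lambda>\<^sub>1. partial i (b \<xi>) x * \<psi> \<xi> x))" for i
    using Suc.prems(2,3)
    by (subst partial_sum) (auto simp: smb_intros partial_mult smb_differentiable sum.distrib)
  have "bd n (2 ^ n * (B * L2_set g \<Lambda>\<^sub>1) + 2 ^ n * (B * L2_set g \<Lambda>\<^sub>1))
      (\<lambda>x. (\<Sum>\<xi>\<in>\<Lambda>\<^sub>1. b \<xi> x * partial i (\<psi> \<xi>) x) + (\<Sum>\<xi>\<in>\<Lambda>\<^sub>1. partial i (b \<xi>) x * \<psi> \<xi> x))" for i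
  proof (rule bd_add)
    show "Cb n (\<lambda>x. \<Sum>\<xi>\<in>\<Lambda>\<^sub>1. b \<xi> x * partial i (\<psi> \<xi>) x)" "Cb n (\<lambda>x. \<Sum>\<xi>\<in>\<Lambda>\<^sub>1. partial i (b \<xi>) x * \<psi> \<xi> x)"
      using Suc.prems by (auto intro!: smb_Cb smb_sum smb_mult smb_partial)
    show "bd n (2 ^ n * (B * L2_set g \<Lambda>\<^sub>1)) (\<lambda>x. \<Sum>\<xi>\<in>\<Lambda>\<^sub>1. b \<xi> x * partial i (\<psi> \<xi>) x)"
      by (rule Suc.IH[OF cb' Suc.prems(2)]) (use Suc.prems in \<open>auto intro: smb_partial bd_partial\<close>)
    show "bd n (2 ^ n * (B * L2_set g \<Lambda>\<^sub>1)) (\<lambda>x. \<Sum>\<xi>\<in>\<Lambda>\<^sub>1. partial i (b \<xi>) x * \<psi> \<xi> x)"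
    proof (rule Suc.IH[OF cb])
      show "bd n (g \<xi>) (\<psi> \<xi>)" if "\<xi> \<in> \<Lambda>\<^sub>1" for \<xi>
        by (rule bd_mono[OF Suc.prems(4)[OF that]]) auto
    qed (use Suc.prems in \<open>auto intro: smb_partial\<close>)
  qed
  moreover have "2 ^ n * (B * L2_set g \<Lambda>\<^sub>1) + 2 ^ n * (B * L2_set g \<Lambda>\<^sub>1) = 2 ^ Suc n * (B * L2_set g \<Lambda>\<^sub>1)" by simp
  ultimately have "bd n (2 ^ Suc n * (B * L2_set g \<Lambda>\<^sub>1)) (partial i (\<lambda>x. \<Sum>\<xi>\<in>\<Lambda>\<^sub>1. b \<xi> x * \<psi> \<xi> x))" for i
    by (simp only: dist)
  then show ?case using v unfolding bd_Suc_iff by blast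
qed

text \<open>The coefficient of \<open>h ^ i\<close> in the formal Taylor expansion of
  \<open>L h\<close>. The terms of order 1/h are absent because \<open>q\<close> is centered, and
  \<open>EL 0\<close> is the limiting differential operator.\<close>

definition EL :: "nat \<Rightarrow> (real^'d \<Rightarrow> real) \<Rightarrow> real^'d \<Rightarrow> real" where
  "EL i \<phi> x = (\<Sum>\<xi>\<in>\<Lambda>\<^sub>1. q \<xi> x * ((dir \<xi> ^^ (i + 2)) \<phi> x / fact (i + 2)))
     + (\<Sum>\<xi>\<in>\<Lambda>\<^sub>1. p \<xi> x * ((dir \<xi> ^^ (i + 1)) \<phi> x / fact (i + 1))) - (if i = 0 then c x * \<phi> x else 0)"

definition rem :: "nat \<Rightarrow> real \<Rightarrow> (real^'d \<Rightarrow> real) \<Rightarrow> real^'d \<Rightarrow> real" where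
  "rem r h \<phi> x = L h \<phi> x - (\<Sum>i\<le>r. h ^ i * EL i \<phi> x)"

lemma EL_smb: "smb \<phi> \<Longrightarrow> smb (EL i \<phi>)"
  unfolding EL_def[abs_def]
  by (cases "i = 0") (auto intro!: smb_add smb_diff smb_sum smb_mult smb_divide smb_dirpow smb_dir q_smb p_smb c_smb smb_const)

lemma rem_smb: "smb \<phi> \<Longrightarrow> smb (rem r h \<phi>)"
  unfolding rem_def[abs_def] by (intro smb_diff smb_sum smb_mult smb_const L_smb EL_smb)

lemma EL_zero: "EL i (\<lambda>x. 0) = (\<lambda>x. 0)"
  unfolding EL_def[abs_def] dirpow_zero by (cases "i = 0") simp_all

lemma L_zero: "L h (\<lambda>x. 0) x = 0"
  by (simp add: Lh_def fdiff_def)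

lemma rem_zero: "rem r h (\<lambda>x. 0) = (\<lambda>x. 0)"
  by (simp add: rem_def EL_zero L_zero fun_eq_iff)

definition rho :: "nat \<Rightarrow> real \<Rightarrow> real^'d \<Rightarrow> (real^'d \<Rightarrow> real) \<Rightarrow> real^'d \<Rightarrow> real" where
  "rho N h \<xi> \<phi> x = \<phi> (x + h *\<^sub>R \<xi>) - (\<Sum>i<N. h ^ i / fact i * (dir \<xi> ^^ i) \<phi> x)"

lemma rho_smb: "smb \<phi> \<Longrightarrow> smb (rho N h \<xi> \<phi>)"
  unfolding rho_def[abs_def] by (intro smb_diff smb_sum smb_mult smb_const smb_shift smb_dirpow)

lemma rho_partial: "smb \<phi> \<Longrightarrow> partial i (rho N h \<xi> \<phi>) = rho N h \<xi> (partial i \<phi>)"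
  unfolding rho_def[abs_def]
  by (subst partial_sub)
    (auto simp: smb_intros smb_dirpow partial_shift partial_sum partial_cmult partial_cdivide partial_dirpow)

lemma rho_pderivs: "smb \<phi> \<Longrightarrow> foldr partial is (rho N h \<xi> \<phi>) = rho N h \<xi> (foldr partial is \<phi>)"
  by (induction "is") (auto simp: rho_partial smb_pderivs)

lemma rho_bd:
  assumes "smb \<phi>" "bd (n + N) G \<phi>" "0 < h"
  shows "bd n ((real CARD('d) * norm \<xi>) ^ N * G * h ^ N) (rho N h \<xi> \<phi>)"
  unfolding bd_def rho_pderivs[OF assms(1)]
proof (intro allI impI)
  fix "is" :: "'d list" and x assume l: "length is \<le> n"
  show "\<bar>rho N h \<xi> (foldr partial is \<phi>) x\<bar> \<le> (real CARD('d) * norm \<xi>) ^ N * G * h ^ N"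
    using taylor_line[OF smb_pderivs[OF assms(1)] bd_pderivs[OF assms(2) l], of x h \<xi>] assms(3)
    by (simp add: rho_def mult_ac)
qed

text \<open>The diffusion part carries the factor 1/h^2 and the drift part 1/h, so the Taylor
  polynomial of \<open>\<phi>\<close> is taken one order further in the former to reach the same
  power of \<open>h\<close>.\<close>

lemma rem_eq:
  assumes "0 < h"
  shows "rem r h \<phi> x = (\<Sum>\<xi>\<in>\<Lambda>\<^sub>1. q \<xi> x * (rho (r + 3) h \<xi> \<phi> x / h\<^sup>2)) + (\<Sum>\<xi>\<in>\<Lambda>\<^sub>1. p \<xi> x * (rho (r + 2) h \<xi> \<phi> x / h))"
proof -
  have gen2: "(\<Sum>i<Suc (Suc n). F i) = F 0 + (F (Suc 0) + (\<Sum>i<n. F (Suc (Suc i))))" for F :: "nat \<Rightarrow> real" and n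
    by (simp add: sum.lessThan_Suc_shift del: sum.lessThan_Suc)
  have gen1: "(\<Sum>i<Suc n. F i) = F 0 + (\<Sum>i<n. F (Suc i))" for F :: "nat \<Rightarrow> real" and n
    by (simp add: sum.lessThan_Suc_shift del: sum.lessThan_Suc)
  have q: "(\<phi> (x + h *\<^sub>R \<xi>) - \<phi> x) / h\<^sup>2 - (\<Sum>i\<le>r. h ^ i * ((dir \<xi> ^^ (i + 2)) \<phi> x / fact (i + 2)))
      = rho (r + 3) h \<xi> \<phi> x / h\<^sup>2 + dir \<xi> \<phi> x / h" for \<xi>
  proof -
    have "(\<Sum>i<r + 3. h ^ i / fact i * (dir \<xi> ^^ i) \<phi> x)
        = \<phi> x + h * dir \<xi> \<phi> x + (\<Sum>i\<le>r. h ^ (i + 2) / fact (i + 2) * (dir \<xi> ^^ (i + 2)) \<phi> x)"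
    proof -
      have e: "r + 3 = Suc (Suc (Suc r))" by simp
      show ?thesis unfolding e gen2[of _ "Suc r"] unfolding lessThan_Suc_atMost by (simp del: sum.atMost_Suc)
    qed
    also have "(\<Sum>i\<le>r. h ^ (i + 2) / fact (i + 2) * (dir \<xi> ^^ (i + 2)) \<phi> x)
        = h\<^sup>2 * (\<Sum>i\<le>r. h ^ i * ((dir \<xi> ^^ (i + 2)) \<phi> x / fact (i + 2)))"
      unfolding sum_distrib_left by (rule sum.cong) (auto simp: power_add power2_eq_square)
    finally show ?thesis using assms by (simp add: rho_def field_simps power2_eq_square)
  qed
  have p: "(\<phi> (x + h *\<^sub>R \<xi>) - \<phi> x) / h - (\<Sum>i\<le>r. h ^ i * ((dir \<xi> ^^ (i + 1)) \<phi> x / fact (i + 1)))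
      = rho (r + 2) h \<xi> \<phi> x / h" for \<xi>
  proof -
    have "(\<Sum>i<r + 2. h ^ i / fact i * (dir \<xi> ^^ i) \<phi> x)
        = \<phi> x + (\<Sum>i\<le>r. h ^ (i + 1) / fact (i + 1) * (dir \<xi> ^^ (i + 1)) \<phi> x)"
    proof -
      have e: "r + 2 = Suc (Suc r)" by simp
      show ?thesis unfolding e gen1[of _ "Suc r"] unfolding lessThan_Suc_atMost by (simp del: sum.atMost_Suc)
    qed
    also have "(\<Sum>i\<le>r. h ^ (i + 1) / fact (i + 1) * (dir \<xi> ^^ (i + 1)) \<phi> x)
        = h * (\<Sum>i\<le>r. h ^ i * ((dir \<xi> ^^ (i + 1)) \<phi> x / fact (i + 1)))"
      unfolding sum_distrib_left by (rule sum.cong) auto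
    finally show ?thesis using assms by (simp add: rho_def field_simps)
  qed
  have "(\<Sum>i\<le>r. h ^ i * EL i \<phi> x) = (\<Sum>i\<le>r. (\<Sum>\<xi>\<in>\<Lambda>\<^sub>1. q \<xi> x * (h ^ i * ((dir \<xi> ^^ (i + 2)) \<phi> x / fact (i + 2))))
     + (\<Sum>\<xi>\<in>\<Lambda>\<^sub>1. p \<xi> x * (h ^ i * ((dir \<xi> ^^ (i + 1)) \<phi> x / fact (i + 1)))) - (if i = 0 then c x * \<phi> x else 0))"
    unfolding EL_def by (intro sum.cong refl) (auto simp: right_diff_distrib distrib_left sum_distrib_left mult_ac)
  also have "\<dots> = (\<Sum>i\<le>r. \<Sum>\<xi>\<in>\<Lambda>\<^sub>1. q \<xi> x * (h ^ i * ((dir \<xi> ^^ (i + 2)) \<phi> x / fact (i + 2))))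
     + (\<Sum>i\<le>r. \<Sum>\<xi>\<in>\<Lambda>\<^sub>1. p \<xi> x * (h ^ i * ((dir \<xi> ^^ (i + 1)) \<phi> x / fact (i + 1)))) - c x * \<phi> x"
    by (simp add: sum.distrib sum_subtractf)
  also have "(\<Sum>i\<le>r. \<Sum>\<xi>\<in>\<Lambda>\<^sub>1. q \<xi> x * (h ^ i * ((dir \<xi> ^^ (i + 2)) \<phi> x / fact (i + 2))))
      = (\<Sum>\<xi>\<in>\<Lambda>\<^sub>1. q \<xi> x * (\<Sum>i\<le>r. h ^ i * ((dir \<xi> ^^ (i + 2)) \<phi> x / fact (i + 2))))"
    by (subst sum.swap) (simp only: sum_distrib_left)
  also have "(\<Sum>i\<le>r. \<Sum>\<xi>\<in>\<Lambda>\<^sub>1. p \<xi> x * (h ^ i * ((dir \<xi> ^^ (i + 1)) \<phi> x / fact (i + 1))))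
      = (\<Sum>\<xi>\<in>\<Lambda>\<^sub>1. p \<xi> x * (\<Sum>i\<le>r. h ^ i * ((dir \<xi> ^^ (i + 1)) \<phi> x / fact (i + 1))))"
    by (subst sum.swap) (simp only: sum_distrib_left)
  finally have E: "(\<Sum>i\<le>r. h ^ i * EL i \<phi> x) = (\<Sum>\<xi>\<in>\<Lambda>\<^sub>1. q \<xi> x * (\<Sum>i\<le>r. h ^ i * ((dir \<xi> ^^ (i + 2)) \<phi> x / fact (i + 2))))
    + (\<Sum>\<xi>\<in>\<Lambda>\<^sub>1. p \<xi> x * (\<Sum>i\<le>r. h ^ i * ((dir \<xi> ^^ (i + 1)) \<phi> x / fact (i + 1)))) - c x * \<phi> x" .
  have Lx: "L h \<phi> x = (\<Sum>\<xi>\<in>\<Lambda>\<^sub>1. q \<xi> x * ((\<phi> (x + h *\<^sub>R \<xi>) - \<phi> x) / h\<^sup>2)) + (\<Sum>\<xi>\<in>\<Lambda>\<^sub>1. p \<xi> x * ((\<phi> (x + h *\<^sub>R \<xi>) - \<phi> x) / h)) - c x * \<phi> x"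
    unfolding Lh_def fdiff_def sum_distrib_left by (simp add: power2_eq_square)
  have z: "(\<Sum>\<xi>\<in>\<Lambda>\<^sub>1. q \<xi> x * (dir \<xi> \<phi> x / h)) = 0"
  proof -
    have "(\<Sum>\<xi>\<in>\<Lambda>\<^sub>1. q \<xi> x * (dir \<xi> \<phi> x / h)) = (\<Sum>k\<in>UNIV. \<Sum>\<xi>\<in>\<Lambda>\<^sub>1. q \<xi> x * (\<xi> $ k * partial k \<phi> x / h))"
      unfolding dir_def sum_divide_distrib sum_distrib_left by (rule sum.swap)
    also have "\<dots> = (\<Sum>k\<in>UNIV. (\<Sum>\<xi>\<in>\<Lambda>\<^sub>1. q \<xi> x * \<xi> $ k) * (partial k \<phi> x / h))"
      by (simp add: sum_distrib_right sum_divide_distrib mult.assoc)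
    finally show ?thesis by (simp add: centered)
  qed
  have "rem r h \<phi> x = (\<Sum>\<xi>\<in>\<Lambda>\<^sub>1. q \<xi> x * ((\<phi> (x + h *\<^sub>R \<xi>) - \<phi> x) / h\<^sup>2 - (\<Sum>i\<le>r. h ^ i * ((dir \<xi> ^^ (i + 2)) \<phi> x / fact (i + 2)))))
    + (\<Sum>\<xi>\<in>\<Lambda>\<^sub>1. p \<xi> x * ((\<phi> (x + h *\<^sub>R \<xi>) - \<phi> x) / h - (\<Sum>i\<le>r. h ^ i * ((dir \<xi> ^^ (i + 1)) \<phi> x / fact (i + 1)))))"
    unfolding rem_def E Lx right_diff_distrib sum_subtractf by linarith
  also have "\<dots> = (\<Sum>\<xi>\<in>\<Lambda>\<^sub>1. q \<xi> x * (rho (r + 3) h \<xi> \<phi> x / h\<^sup>2)) + (\<Sum>\<xi>\<in>\<Lambda>\<^sub>1. q \<xi> x * (dir \<xi> \<phi> x / h))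
      + (\<Sum>\<xi>\<in>\<Lambda>\<^sub>1. p \<xi> x * (rho (r + 2) h \<xi> \<phi> x / h))"
    unfolding q p by (simp only: distrib_left sum.distrib)
  finally show ?thesis using z by simp
qed

text \<open>The power of 2 comes from the product rule, the exponent \<open>m + 3\<close> covers
  every Taylor order that occurs, and the factor 3 lets each sum over
  \<open>\<Lambda>\<^sub>1\<close> use up a third of the constant.\<close>

definition CX :: real where
  "CX = 2 ^ m * (3 * Mx) * (1 + real CARD('d) * LL) ^ (m + 3)"

lemma CX_nonneg: "0 \<le> CX"
  unfolding CX_def using Mx LL_nonneg by (intro mult_nonneg_nonneg zero_le_power add_nonneg_nonneg) auto

lemma cbd_sum_bd:
  assumes b: "cbd m Mx b" "\<And>\<zeta>. smb (b \<zeta>)" and n: "n \<le> m" and k: "Suc k \<le> m + 3" and Y: "0 \<le> Y"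
    and sm: "\<And>\<xi>. smb (\<psi> \<xi>)" and bd: "\<And>\<xi>. bd n ((real CARD('d) * norm \<xi>) ^ Suc k * Y) (\<psi> \<xi>)"
  shows "bd n (CX / 3 * Y) (\<lambda>x. \<Sum>\<xi>\<in>\<Lambda>\<^sub>1. b \<xi> x * \<psi> \<xi> x)"
proof -
  define g where "g = (\<lambda>\<xi>::real^'d. (real CARD('d) * norm \<xi>) ^ Suc k * Y)"
  have "cbd n Mx b" by (rule cbd_mono[OF b(1) n])
  then have 1: "bd n (2 ^ n * (Mx * L2_set g \<Lambda>\<^sub>1)) (\<lambda>x. \<Sum>\<xi>\<in>\<Lambda>\<^sub>1. b \<xi> x * \<psi> \<xi> x)"
    by (rule cbd_nonneg_bd[OF _ Mx b(2) sm]) (use bd in \<open>simp add: g_def\<close>)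
  have "L2_set g \<Lambda>\<^sub>1 = L2_set (\<lambda>\<xi>. (real CARD('d) ^ Suc k * Y) * norm \<xi> ^ Suc k) \<Lambda>\<^sub>1"
    unfolding g_def by (simp add: power_mult_distrib mult_ac)
  also have "\<dots> = (real CARD('d) ^ Suc k * Y) * L2_set (\<lambda>\<xi>. norm \<xi> ^ Suc k) \<Lambda>\<^sub>1"
    using Y by (intro L2_set_right_distrib[symmetric]) simp
  also have "\<dots> \<le> (real CARD('d) ^ Suc k * Y) * LL ^ Suc k"
    using Y by (intro mult_left_mono L2_norm_power) simp
  also have "\<dots> = (real CARD('d) * LL) ^ Suc k * Y" by (simp only: power_mult_distrib mult_ac)
  also have "\<dots> \<le> (1 + real CARD('d) * LL) ^ (m + 3) * Y"
  proof (intro mult_right_mono Y)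
    have "(real CARD('d) * LL) ^ Suc k \<le> (1 + real CARD('d) * LL) ^ Suc k"
      using LL_nonneg by (intro power_mono) auto
    also have "\<dots> \<le> (1 + real CARD('d) * LL) ^ (m + 3)"
      using k LL_nonneg by (intro power_increasing) auto
    finally show "(real CARD('d) * LL) ^ Suc k \<le> (1 + real CARD('d) * LL) ^ (m + 3)" .
  qed
  finally have "2 ^ n * (Mx * L2_set g \<Lambda>\<^sub>1) \<le> 2 ^ m * (Mx * ((1 + real CARD('d) * LL) ^ (m + 3) * Y))"
    using n Mx by (intro mult_mono power_increasing mult_left_mono) auto
  also have "\<dots> = CX / 3 * Y" by (simp add: CX_def)
  finally show ?thesis using 1 bd_mono by blast
qed

text \<open>Expanding up to \<open>h ^ r\<close> costs \<open>r + 3\<close> derivatives beyond those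
  estimated: two for the diffusion operator, \<open>r\<close> for the powers of \<open>h\<close> and
  one for the remainder.\<close>

lemma rem_bd:
  assumes h: "0 < h" and sm: "smb \<phi>" and n: "n + r + 3 \<le> m" and b: "bd (n + r + 3) G \<phi>"
  shows "bd n (CX * G * h ^ Suc r) (rem r h \<phi>)"
proof -
  have G: "0 \<le> G" using bd_nonneg[OF b] .
  have 1: "bd n (CX / 3 * (G * h ^ Suc r)) (\<lambda>x. \<Sum>\<xi>\<in>\<Lambda>\<^sub>1. q \<xi> x * (rho (r + 3) h \<xi> \<phi> x / h\<^sup>2))"
  proof (rule cbd_sum_bd[OF q_cbd q_smb, where k = "r + 2"])
    show "smb (\<lambda>x. rho (r + 3) h \<xi> \<phi> x / h\<^sup>2)" for \<xi> by (intro smb_divide rho_smb sm)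
    fix \<xi>
    have "bd n (\<bar>1 / h\<^sup>2\<bar> * ((real CARD('d) * norm \<xi>) ^ (r + 3) * G * h ^ (r + 3))) (\<lambda>x. 1 / h\<^sup>2 * rho (r + 3) h \<xi> \<phi> x)"
      by (intro bd_cmult smb_Cb rho_smb sm rho_bd h) (use b in \<open>simp add: add.assoc\<close>)
    moreover have "\<bar>1 / h\<^sup>2\<bar> * ((real CARD('d) * norm \<xi>) ^ (r + 3) * G * h ^ (r + 3)) = (real CARD('d) * norm \<xi>) ^ Suc (r + 2) * (G * h ^ Suc r)"
    proof -
      have e: "r + 3 = Suc (Suc (Suc r))" "Suc (r + 2) = Suc (Suc (Suc r))" by simp_all
      show ?thesis unfolding e using h by (simp add: power2_eq_square)
    qed
    ultimately show "bd n ((real CARD('d) * norm \<xi>) ^ Suc (r + 2) * (G * h ^ Suc r)) (\<lambda>x. rho (r + 3) h \<xi> \<phi> x / h\<^sup>2)"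
      by simp
  qed (use n G h in auto)
  have 2: "bd n (CX / 3 * (G * h ^ Suc r)) (\<lambda>x. \<Sum>\<xi>\<in>\<Lambda>\<^sub>1. p \<xi> x * (rho (r + 2) h \<xi> \<phi> x / h))"
  proof (rule cbd_sum_bd[OF p_cbd p_smb, where k = "r + 1"])
    show "smb (\<lambda>x. rho (r + 2) h \<xi> \<phi> x / h)" for \<xi> by (intro smb_divide rho_smb sm)
    fix \<xi>
    have "bd n (\<bar>1 / h\<bar> * ((real CARD('d) * norm \<xi>) ^ (r + 2) * G * h ^ (r + 2))) (\<lambda>x. 1 / h * rho (r + 2) h \<xi> \<phi> x)"
      by (intro bd_cmult smb_Cb rho_smb sm rho_bd h) (rule bd_mono[OF b], auto)
    moreover have "\<bar>1 / h\<bar> * ((real CARD('d) * norm \<xi>) ^ (r + 2) * G * h ^ (r + 2)) = (real CARD('d) * norm \<xi>) ^ Suc (r + 1) * (G * h ^ Suc r)"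
    proof -
      have e: "r + 2 = Suc (Suc r)" "Suc (r + 1) = Suc (Suc r)" by simp_all
      show ?thesis unfolding e using h by simp
    qed
    ultimately show "bd n ((real CARD('d) * norm \<xi>) ^ Suc (r + 1) * (G * h ^ Suc r)) (\<lambda>x. rho (r + 2) h \<xi> \<phi> x / h)"
      by simp
  qed (use n G h in auto)
  have "bd n (CX / 3 * (G * h ^ Suc r) + CX / 3 * (G * h ^ Suc r)) (rem r h \<phi>)"
    unfolding rem_eq[OF h, abs_def]
    by (intro bd_add 1 2 smb_Cb smb_sum smb_mult smb_divide rho_smb sm q_smb p_smb)
  then show ?thesis
    by (rule bd_mono) (use CX_nonneg G h in auto)
qed

text \<open>The diffusion part of \<open>EL i\<close> consumes \<open>i + 2\<close> derivatives, the
  drift part \<open>i + 1\<close>. The alternative in the last assumption anticipates the symmetric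
  case, where the diffusion part vanishes for odd \<open>i\<close>.\<close>

lemma EL_bd_gen:
  assumes sm: "smb \<phi>" and n: "n \<le> m" and i: "1 \<le> i" "i \<le> m"
    and b: "bd (n + i + 1) G \<phi>"
    and q: "bd (n + i + 2) G \<phi> \<or> (\<forall>x. (\<Sum>\<xi>\<in>\<Lambda>\<^sub>1. q \<xi> x * ((dir \<xi> ^^ (i + 2)) \<phi> x / fact (i + 2))) = 0)"
  shows "bd n (CX * G) (EL i \<phi>)"
proof -
  have G: "0 \<le> G" using bd_nonneg[OF b] .
  have dp: "bd n ((real CARD('d) * norm \<xi>) ^ Suc k * G) (\<lambda>x. (dir \<xi> ^^ Suc k) \<phi> x / fact (Suc k))"
    if "bd (n + Suc k) G \<phi>" for k \<xi>
  proof -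
    have "bd n (\<bar>1 / fact (Suc k)\<bar> * ((real CARD('d) * norm \<xi>) ^ Suc k * G)) (\<lambda>x. 1 / fact (Suc k) * (dir \<xi> ^^ Suc k) \<phi> x)"
      by (intro bd_cmult smb_Cb smb_dirpow sm bd_dirpow that)
    moreover have "\<bar>1 / fact (Suc k)\<bar> * ((real CARD('d) * norm \<xi>) ^ Suc k * G) \<le> (real CARD('d) * norm \<xi>) ^ Suc k * G"
    proof -
      have "\<bar>1 / (fact (Suc k) :: real)\<bar> \<le> 1" by (simp del: fact_Suc)
      then show ?thesis using G by (intro mult_left_le_one_le) auto
    qed
    ultimately show ?thesis using bd_mono by fastforce
  qed
  have 2: "bd n (CX / 3 * G) (\<lambda>x. \<Sum>\<xi>\<in>\<Lambda>\<^sub>1. p \<xi> x * ((dir \<xi> ^^ (i + 1)) \<phi> x / fact (i + 1)))"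
    by (rule cbd_sum_bd[OF p_cbd p_smb, where k = i])
      (use n i G b dp[of i] in \<open>auto intro!: smb_divide smb_dir smb_dirpow sm\<close>)
  have 1: "bd n (CX / 3 * G) (\<lambda>x. \<Sum>\<xi>\<in>\<Lambda>\<^sub>1. q \<xi> x * ((dir \<xi> ^^ (i + 2)) \<phi> x / fact (i + 2)))"
    using q
  proof
    assume q: "bd (n + i + 2) G \<phi>"
    show ?thesis
      by (rule cbd_sum_bd[OF q_cbd q_smb, where k = "i + 1"])
        (use n i G q dp[of "i + 1"] in \<open>auto intro!: smb_divide smb_dir smb_dirpow sm\<close>)
  next
    assume "\<forall>x. (\<Sum>\<xi>\<in>\<Lambda>\<^sub>1. q \<xi> x * ((dir \<xi> ^^ (i + 2)) \<phi> x / fact (i + 2))) = 0"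
    then have "(\<lambda>x. \<Sum>\<xi>\<in>\<Lambda>\<^sub>1. q \<xi> x * ((dir \<xi> ^^ (i + 2)) \<phi> x / fact (i + 2))) = (\<lambda>x. 0)" by auto
    then show ?thesis using CX_nonneg G by (simp only:) (auto simp: bd_def pderivs_const)
  qed
  have "bd n (CX / 3 * G + CX / 3 * G) (\<lambda>x. (\<Sum>\<xi>\<in>\<Lambda>\<^sub>1. q \<xi> x * ((dir \<xi> ^^ (i + 2)) \<phi> x / fact (i + 2)))
     + (\<Sum>\<xi>\<in>\<Lambda>\<^sub>1. p \<xi> x * ((dir \<xi> ^^ (i + 1)) \<phi> x / fact (i + 1))))"
    by (intro bd_add 1 2 smb_Cb smb_sum smb_mult smb_divide smb_dirpow sm q_smb p_smb)
  moreover have "EL i \<phi> = (\<lambda>x. (\<Sum>\<xi>\<in>\<Lambda>\<^sub>1. q \<xi> x * ((dir \<xi> ^^ (i + 2)) \<phi> x / fact (i + 2)))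
     + (\<Sum>\<xi>\<in>\<Lambda>\<^sub>1. p \<xi> x * ((dir \<xi> ^^ (i + 1)) \<phi> x / fact (i + 1))))"
    using i by (auto simp: EL_def fun_eq_iff)
  ultimately have "bd n (CX / 3 * G + CX / 3 * G) (EL i \<phi>)" by simp
  then show ?thesis by (rule bd_mono) (use CX_nonneg G in auto)
qed

text \<open>The terms of \<open>\<xi>\<close> and \<open>- \<xi>\<close> cancel, \<open>b\<close>
  and \<open>g\<close> having opposite parities; \<open>s\<close> is the parity of
  \<open>b\<close>.\<close>

lemma odd_symmetric_sum:
  assumes "\<Lambda>\<^sub>1 = uminus ` \<Lambda>\<^sub>1" "\<And>\<xi>. \<xi> \<in> \<Lambda>\<^sub>1 \<Longrightarrow> b (- \<xi>) = s * b \<xi>" "\<And>\<xi>. g (- \<xi>) = - s * g \<xi>" "s\<^sup>2 = (1::real)"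
  shows "(\<Sum>\<xi>\<in>\<Lambda>\<^sub>1. b \<xi> * g \<xi>) = 0"
proof -
  have "(\<Sum>\<xi>\<in>\<Lambda>\<^sub>1. b \<xi> * g \<xi>) = (\<Sum>\<xi>\<in>uminus ` \<Lambda>\<^sub>1. b \<xi> * g \<xi>)" using assms(1) by simp
  also have "\<dots> = (\<Sum>\<xi>\<in>\<Lambda>\<^sub>1. b (- \<xi>) * g (- \<xi>))" by (subst sum.reindex) auto
  also have "\<dots> = (\<Sum>\<xi>\<in>\<Lambda>\<^sub>1. - (s\<^sup>2 * (b \<xi> * g \<xi>)))"
    by (intro sum.cong refl) (simp add: assms(2,3) power2_eq_square)
  finally show ?thesis by (simp add: assms(4) sum_negf)
qed

lemma q_odd_zero:
  assumes "\<Lambda>\<^sub>1 = uminus ` \<Lambda>\<^sub>1" "\<And>\<xi>. \<xi> \<in> \<Lambda>\<^sub>1 \<Longrightarrow> q (- \<xi>) = q \<xi>" "odd i" "smb \<phi>"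
  shows "(\<Sum>\<xi>\<in>\<Lambda>\<^sub>1. q \<xi> x * ((dir \<xi> ^^ (i + 2)) \<phi> x / fact (i + 2))) = 0"
  by (rule odd_symmetric_sum[where s = 1])
    (use assms dirpow_uminus[OF assms(4), where k = "i + 2"] in \<open>auto simp del: funpow.simps fact_Suc\<close>)

lemma EL_odd_zero:
  assumes "\<Lambda>\<^sub>1 = uminus ` \<Lambda>\<^sub>1" "\<And>\<xi>. \<xi> \<in> \<Lambda>\<^sub>1 \<Longrightarrow> q (- \<xi>) = q \<xi>"
    "\<And>\<xi> x. \<xi> \<in> \<Lambda>\<^sub>1 \<Longrightarrow> p (- \<xi>) x = - p \<xi> x" "odd i" "smb \<phi>"
  shows "EL i \<phi> = (\<lambda>x. 0)"
proof
  fix x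
  have "(\<Sum>\<xi>\<in>\<Lambda>\<^sub>1. p \<xi> x * ((dir \<xi> ^^ (i + 1)) \<phi> x / fact (i + 1))) = 0"
    by (rule odd_symmetric_sum[where s = "-1"])
      (use assms dirpow_uminus[OF assms(5), where k = "i + 1"] in \<open>auto simp del: funpow.simps fact_Suc\<close>)
  then show "EL i \<phi> x = 0" using q_odd_zero[OF assms(1,2,4,5), of x] assms(4) unfolding EL_def
    by (auto simp del: funpow.simps fact_Suc)
qed

end

subsection \<open>Expansion in powers of the mesh size\<close>

lemma sum_triangle:
  fixes F :: "nat \<Rightarrow> nat \<Rightarrow> 'a::comm_monoid_add"
  shows "(\<Sum>j\<le>k. \<Sum>i\<le>k - j. F i j) = (\<Sum>t\<le>k. \<Sum>i\<le>t. F i (t - i))"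
proof -
  have "(\<Sum>(j, i)\<in>Sigma {..k} (\<lambda>j. {..k - j}). F i j) = (\<Sum>(t, i)\<in>Sigma {..k} (\<lambda>t. {..t}). F i (t - i))"
    by (rule sum.reindex_bij_witness[of _ "\<lambda>(t, i). (t - i, i)" "\<lambda>(j, i). (j + i, i)"]) auto
  then show ?thesis by (simp add: sum.Sigma)
qed

lemma bd_zero: "0 \<le> B \<Longrightarrow> bd n B (\<lambda>x. 0)"
  by (simp add: bd_def pderivs_const)

context smooth_scheme
begin

definition Sol :: "real \<Rightarrow> (real^'d \<Rightarrow> real) \<Rightarrow> real^'d \<Rightarrow> real" where
  "Sol h g = (SOME v. smb v \<and> (\<forall>x. L h v x + g x = 0))"

lemma Sol:
  assumes "0 < h" "h \<le> h0" "smb g"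
  shows "smb (Sol h g)" "L h (Sol h g) x + g x = 0"
proof -
  have "\<exists>v. smb v \<and> (\<forall>x. L h v x + g x = 0)"
    by (rule Lh_ex_solution[OF fin zero_notin assms(1) q_smb p_smb c_smb assms(3) nn[OF assms(1,2)] c0])
  then have "smb (Sol h g) \<and> (\<forall>x. L h (Sol h g) x + g x = 0)" unfolding Sol_def by (rule someI_ex)
  then show "smb (Sol h g)" "L h (Sol h g) x + g x = 0" by blast+
qed

lemma L_bound:
  assumes "0 < h" "h \<le> h0" "bounded (range w)" "\<And>x. \<bar>L h w x\<bar> \<le> G"
  shows "\<bar>w x\<bar> \<le> G / c0"
  by (rule Lh_bound[OF fin assms(1) _ _ nn[OF assms(1,2)] c0 assms(3,4)])
    (auto intro: lipb_bounded smb_lipb q_smb p_smb)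

lemma Sol_zero:
  assumes "0 < h" "h \<le> h0"
  shows "Sol h (\<lambda>x. 0) = (\<lambda>x. 0)"
proof
  fix x
  note S = Sol[OF assms smb_const[of 0]]
  have "\<bar>Sol h (\<lambda>x. 0) x\<bar> \<le> 0 / c0"
    by (rule L_bound[OF assms lipb_bounded[OF smb_lipb[OF S(1)]]]) (use S(2) in simp)
  then show "Sol h (\<lambda>x. 0) x = 0" by simp
qed

text \<open>The coefficients of the expansion. They solve the difference equations with a fixed small
  step \<open>\<eta>\<close> instead of the limiting differential equations, so that they are smooth and the a
  priori estimate applies to them.\<close>

fun V :: "real \<Rightarrow> (real^'d \<Rightarrow> real) \<Rightarrow> nat \<Rightarrow> real^'d \<Rightarrow> real" where
  "V \<eta> f 0 = Sol \<eta> f"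
| "V \<eta> f (Suc j) = Sol \<eta> (\<lambda>x. \<Sum>i\<le>j. EL (Suc i) (V \<eta> f (j - i)) x)"

lemma V_smb:
  assumes "0 < \<eta>" "\<eta> \<le> h0" "smb f"
  shows "smb (V \<eta> f j)"
proof (induction j rule: less_induct)
  case (less j)
  show ?case
  proof (cases j)
    case 0
    then show ?thesis using Sol[OF assms] by simp
  next
    case (Suc j')
    have "smb (\<lambda>x. \<Sum>i\<le>j'. EL (Suc i) (V \<eta> f (j' - i)) x)"
      using less Suc by (intro smb_sum EL_smb) auto
    then show ?thesis using Sol[OF assms(1,2)] Suc by simp
  qed
qed

text \<open>The equations of the formal power series solution, one for each power of
  \<open>h\<close>, perturbed by the consistency error \<open>rem 0 \<eta>\<close>, which arises
  because the recursion inverts \<open>L \<eta>\<close> instead of \<open>EL 0\<close>.\<close>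

lemma V_eq:
  assumes "0 < \<eta>" "\<eta> \<le> h0" "smb f"
  shows "(\<Sum>i\<le>t. EL i (V \<eta> f (t - i)) x) = - (if t = 0 then f x else 0) - rem 0 \<eta> (V \<eta> f t) x"
proof (cases t)
  case 0
  then show ?thesis using Sol(2)[OF assms, of x] by (simp add: rem_def)
next
  case (Suc t')
  have "smb (\<lambda>x. \<Sum>i\<le>t'. EL (Suc i) (V \<eta> f (t' - i)) x)" by (intro smb_sum EL_smb V_smb assms)
  from Sol(2)[OF assms(1,2) this, of x]
  have "L \<eta> (V \<eta> f t) x = - (\<Sum>i\<le>t'. EL (Suc i) (V \<eta> f (t' - i)) x)" using Suc by simp
  moreover have "(\<Sum>i\<le>t. EL i (V \<eta> f (t - i)) x) = EL 0 (V \<eta> f t) x + (\<Sum>i\<le>t'. EL (Suc i) (V \<eta> f (t' - i)) x)"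
    unfolding Suc sum.atMost_Suc_shift by simp
  ultimately show ?thesis using Suc by (simp add: rem_def del: V.simps)
qed

text \<open>One a priori constant for all orders up to \<open>m\<close>. On it are built
  \<open>aX\<close>, the growth per index in the recursion for \<open>V\<close>, \<open>vX\<close>,
  a bound for all coefficients of the expansion, and \<open>NE\<close>, which bounds the error of
  the truncated expansion.\<close>

definition NX :: real where "NX = (\<Sum>n\<le>m. NA n)"
definition aX :: real where "aX = real (m + 1) * (NX * CX)"
definition vX :: real where "vX = NX * (1 + aX) ^ m"
definition NE :: real where "NE = NX * (real (m + 1) * (CX * vX))"

lemma NA_le_NX: "n \<le> m \<Longrightarrow> NA n \<le> NX"
  unfolding NX_def by (rule member_le_sum) (auto intro: NA_nonneg)

lemma NX_nonneg: "0 \<le> NX" unfolding NX_def by (intro sum_nonneg NA_nonneg)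
lemma aX_nonneg: "0 \<le> aX" unfolding aX_def by (intro mult_nonneg_nonneg NX_nonneg CX_nonneg) auto
lemma vX_nonneg: "0 \<le> vX" unfolding vX_def using aX_nonneg by (intro mult_nonneg_nonneg NX_nonneg) auto
lemma NE_nonneg: "0 \<le> NE" unfolding NE_def by (intro mult_nonneg_nonneg NX_nonneg CX_nonneg vX_nonneg) auto

lemma apriori_NX:
  assumes "0 < h" "h \<le> h0" "smb u" "smb f" "\<And>x. L h u x + f x = 0" "n \<le> m" "bd n F f"
  shows "bd n (NX * F) u"
  by (rule bd_mono[OF apriori[OF assms]])
    (use NA_le_NX[OF assms(6)] bd_nonneg[OF assms(7)] in \<open>auto intro: mult_right_mono\<close>)

text \<open>\<open>s\<close> is the number of derivatives spent per power of \<open>h\<close>. In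
  general \<open>s = 3\<close>, as i + 2 \<le> 3 i for i \<ge> 1; the value of \<open>s\<close> is
  what separates conditions (i) and (ii).\<close>

definition EL_cost :: "nat \<Rightarrow> bool" where
  "EL_cost s \<longleftrightarrow> (\<forall>i n G \<phi>. 1 \<le> i \<longrightarrow> n + s * i \<le> m \<longrightarrow> smb \<phi> \<longrightarrow> bd (n + s * i) G \<phi> \<longrightarrow> bd n (CX * G) (EL i \<phi>))"

lemma EL_cost_3: "EL_cost 3"
  unfolding EL_cost_def
proof (intro allI impI)
  fix i n :: nat and G and \<phi> :: "real^'d \<Rightarrow> real"
  assume a: "1 \<le> i" "n + 3 * i \<le> m" "smb \<phi>" "bd (n + 3 * i) G \<phi>"
  have "bd (n + i + 1) G \<phi>" "bd (n + i + 2) G \<phi>" by (rule bd_mono[OF a(4)]; use a in simp)+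
  then show "bd n (CX * G) (EL i \<phi>)" using a by (intro EL_bd_gen) auto
qed

text \<open>For even \<open>i\<close>, which is at least 2, one has i + 2 \<le> 2 i. For odd
  \<open>i\<close> the diffusion part vanishes and the drift part needs only i + 1 \<le> 2 i
  derivatives.\<close>

lemma EL_cost_2:
  assumes "\<Lambda>\<^sub>1 = uminus ` \<Lambda>\<^sub>1" "\<And>\<xi>. \<xi> \<in> \<Lambda>\<^sub>1 \<Longrightarrow> q (- \<xi>) = q \<xi>"
  shows "EL_cost 2"
  unfolding EL_cost_def
proof (intro allI impI)
  fix i n :: nat and G and \<phi> :: "real^'d \<Rightarrow> real"
  assume a: "1 \<le> i" "n + 2 * i \<le> m" "smb \<phi>" "bd (n + 2 * i) G \<phi>"
  have 1: "bd (n + i + 1) G \<phi>" by (rule bd_mono[OF a(4)]) (use a in simp_all)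
  have 2: "bd (n + i + 2) G \<phi> \<or> (\<forall>x. (\<Sum>\<xi>\<in>\<Lambda>\<^sub>1. q \<xi> x * ((dir \<xi> ^^ (i + 2)) \<phi> x / fact (i + 2))) = 0)"
  proof (cases "even i")
    case True
    then have "2 \<le> i" using a(1) by (cases "i = 1") auto
    then show ?thesis using bd_mono[OF a(4), of "n + i + 2" G] by simp
  next
    case False
    then show ?thesis using q_odd_zero[OF assms False a(3)] by blast
  qed
  show "bd n (CX * G) (EL i \<phi>)" by (rule EL_bd_gen[OF a(3) _ a(1) _ 1 2]) (use a in auto)
qed

text \<open>The right-hand side for index \<open>j\<close> combines \<open>EL (Suc i)\<close> with
  an earlier coefficient, and the total cost is \<open>s * j\<close> however it is split; the a
  priori estimate itself loses no derivatives.\<close>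

lemma V_bd:
  assumes eta: "0 < \<eta>" "\<eta> \<le> h0" and f: "smb f" "bd m F f" and s: "EL_cost s" "1 \<le> s"
  shows "s * j \<le> m \<Longrightarrow> bd (m - s * j) (NX * (1 + aX) ^ j * F) (V \<eta> f j)"
proof (induction j rule: less_induct)
  case (less j)
  have F0: "0 \<le> F" using bd_nonneg f(2) .
  show ?case
  proof (cases j)
    case 0
    have "bd m (NX * F) (V \<eta> f 0)"
      by (rule apriori_NX[OF eta V_smb[OF eta f(1)] f(1) _ _ f(2)]) (use Sol[OF eta f(1)] in auto)
    then show ?thesis using 0 by simp
  next
    case (Suc j')
    define n where "n = m - s * j"
    define Y where "Y = NX * (1 + aX) ^ j' * F"
    have Y0: "0 \<le> Y" unfolding Y_def using NX_nonneg aX_nonneg F0 by simp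
    have n: "n + s * Suc j' = m" using less.prems Suc by (simp add: n_def)
    have g: "bd n (\<Sum>i\<le>j'. CX * Y) (\<lambda>x. \<Sum>i\<le>j'. EL (Suc i) (V \<eta> f (j' - i)) x)"
    proof (rule bd_sum)
      fix i assume i: "i \<in> {..j'}"
      show "Cb n (EL (Suc i) (V \<eta> f (j' - i)))" by (intro smb_Cb EL_smb V_smb eta f)
      have e: "s * Suc j' = s * Suc i + s * (j' - i)"
        using i by (simp flip: distrib_left)
      have le: "s * (j' - i) \<le> m" using n e by linarith
      have "bd (m - s * (j' - i)) (NX * (1 + aX) ^ (j' - i) * F) (V \<eta> f (j' - i))"
        by (rule less.IH[OF _ le]) (use Suc in simp)
      moreover have "m - s * (j' - i) = n + s * Suc i" using n e by linarith
      moreover have "NX * (1 + aX) ^ (j' - i) * F \<le> Y"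
        unfolding Y_def using NX_nonneg aX_nonneg F0
        by (intro mult_right_mono mult_left_mono power_increasing) auto
      ultimately have "bd (n + s * Suc i) Y (V \<eta> f (j' - i))" using bd_mono by (metis order_refl)
      then show "bd n (CX * Y) (EL (Suc i) (V \<eta> f (j' - i)))"
        using s(1) V_smb[OF eta f(1), of "j' - i"] n e unfolding EL_cost_def by auto
    qed
    have sm: "smb (\<lambda>x. \<Sum>i\<le>j'. EL (Suc i) (V \<eta> f (j' - i)) x)" by (intro smb_sum EL_smb V_smb eta f)
    have "bd n (NX * (\<Sum>i\<le>j'. CX * Y)) (V \<eta> f j)"
      by (rule apriori_NX[OF eta V_smb[OF eta f(1)] sm _ _ g]) (use Sol(2)[OF eta sm] Suc n in auto)
    moreover have "NX * (\<Sum>i\<le>j'. CX * Y) \<le> NX * (1 + aX) ^ j * F"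
    proof -
      have "j' + 1 \<le> m + 1"
      proof -
        have "1 * Suc j' \<le> s * Suc j'" using s(2) by (rule mult_right_mono) simp
        then have "Suc j' \<le> m" using n by (metis le_add2 mult_1 order_trans)
        then show ?thesis by simp
      qed
      have "NX * (\<Sum>i\<le>j'. CX * Y) = real (j' + 1) * (NX * CX) * Y" by (simp add: algebra_simps)
      also have "\<dots> \<le> aX * Y"
        unfolding aX_def using NX_nonneg CX_nonneg Y0 \<open>j' + 1 \<le> m + 1\<close> by (intro mult_right_mono) auto
      also have "\<dots> \<le> (1 + aX) * Y" using Y0 by (intro mult_right_mono) auto
      also have "\<dots> = NX * (1 + aX) ^ j * F" by (simp add: Y_def Suc)
      finally show ?thesis .
    qed
    ultimately show ?thesis unfolding n_def using bd_mono by blast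
  qed
qed

text \<open>The error solves the difference equation with a right-hand side made up of remainders
  only, of size \<open>h ^ Suc k\<close> or \<open>\<eta>\<close>, so the a priori estimate applies.
  In \<open>dead\<close>, coefficients that vanish identically are exempt from the count of
  derivatives; condition (iii) profits from this.\<close>

lemma expansion:
  assumes eta: "0 < \<eta>" "\<eta> \<le> h0" and f: "smb f" "bd m F f" and s: "EL_cost s" "1 \<le> s" and l: "l \<le> m" "k \<le> m"
    and dead: "\<And>j. j \<le> k \<Longrightarrow> V \<eta> f j = (\<lambda>x. 0) \<or> l + (k - j) + 3 + s * j \<le> m"
    and h: "0 < h" "h \<le> h0" and v: "smb v" "\<And>x. L h v x + f x = 0"
  shows "bd l (NE * F * (h ^ Suc k + \<eta> * (\<Sum>t\<le>k. h ^ t))) (\<lambda>x. v x - (\<Sum>j\<le>k. h ^ j * V \<eta> f j x))"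
proof -
  have F0: "0 \<le> F" using bd_nonneg f(2) .
  have Vs: "smb (V \<eta> f j)" for j by (rule V_smb[OF eta f(1)])
  define Y where "Y = CX * (vX * F)"
  have Y0: "0 \<le> Y" unfolding Y_def using CX_nonneg vX_nonneg F0 by simp
  have Vb: "bd n (vX * F) (V \<eta> f j)" if "n + s * j \<le> m" for n j
  proof -
    have "1 * j \<le> s * j" using s(2) by (rule mult_right_mono) simp
    then have jm: "j \<le> m" "s * j \<le> m" "n \<le> m - s * j" using that by linarith+
    have "NX * (1 + aX) ^ j * F \<le> vX * F"
      unfolding vX_def using NX_nonneg aX_nonneg F0 jm(1)
      by (intro mult_right_mono mult_left_mono power_increasing) auto
    then show ?thesis using bd_mono[OF V_bd[OF eta f s jm(2)] jm(3)] by blast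
  qed
  have b1: "bd l (h ^ j * (Y * h ^ Suc (k - j))) (\<lambda>x. h ^ j * rem (k - j) h (V \<eta> f j) x)" if j: "j \<in> {..k}" for j
  proof -
    have "bd l (Y * h ^ Suc (k - j)) (rem (k - j) h (V \<eta> f j))"
    proof (cases "V \<eta> f j = (\<lambda>x. 0)")
      case True
      then show ?thesis using Y0 h by (simp only: rem_zero) (intro bd_zero, simp)
    next
      case False
      then have le: "l + (k - j) + 3 + s * j \<le> m" using dead j by blast
      show ?thesis unfolding Y_def by (rule rem_bd[OF h(1) Vs _ Vb]) (use le in auto)
    qed
    from bd_cmult[OF smb_Cb[OF rem_smb[OF Vs]] this, of "h ^ j"] show ?thesis using h by simp
  qed
  have b2: "bd l (h ^ t * (Y * \<eta>)) (\<lambda>x. h ^ t * rem 0 \<eta> (V \<eta> f t) x)" if t: "t \<in> {..k}" for t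
  proof -
    have "bd l (Y * \<eta>) (rem 0 \<eta> (V \<eta> f t))"
    proof (cases "V \<eta> f t = (\<lambda>x. 0)")
      case True
      then show ?thesis using Y0 eta by (simp only: rem_zero) (intro bd_zero, simp)
    next
      case False
      then have le: "l + (k - t) + 3 + s * t \<le> m" using dead t by blast
      have "bd l (CX * (vX * F) * \<eta> ^ Suc 0) (rem 0 \<eta> (V \<eta> f t))"
        by (rule rem_bd[OF eta(1) Vs _ Vb]) (use le in auto)
      then show ?thesis by (simp add: Y_def)
    qed
    from bd_cmult[OF smb_Cb[OF rem_smb[OF Vs]] this, of "h ^ t"] show ?thesis using h by simp
  qed
  define g where "g = (\<lambda>x. (\<Sum>j\<le>k. h ^ j * rem (k - j) h (V \<eta> f j) x) - (\<Sum>t\<le>k. h ^ t * rem 0 \<eta> (V \<eta> f t) x))"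
  have sm1: "smb (\<lambda>x. h ^ j * rem r h' (V \<eta> f j) x)" for j r h' by (intro smb_mult smb_const rem_smb Vs)
  have gs: "smb g" unfolding g_def by (intro smb_diff smb_sum sm1)
  have gb: "bd l ((\<Sum>j\<le>k. h ^ j * (Y * h ^ Suc (k - j))) + (\<Sum>t\<le>k. h ^ t * (Y * \<eta>))) g"
    unfolding g_def
    by (intro bd_diff smb_Cb smb_sum sm1 bd_sum b1 b2)
  have hh: "h \<noteq> 0" using h by simp
  have Lr: "L h (\<lambda>x. v x - (\<Sum>j\<le>k. h ^ j * V \<eta> f j x)) x + g x = 0" for x
  proof -
    have "L h (\<lambda>x. v x - (\<Sum>j\<le>k. h ^ j * V \<eta> f j x)) x = L h (\<lambda>x. v x + (-1) * (\<Sum>j\<le>k. h ^ j * V \<eta> f j x)) x" by simp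
    also have "\<dots> = L h v x + (-1) * L h (\<lambda>x. \<Sum>j\<le>k. h ^ j * V \<eta> f j x) x"
      by (simp only: L_add L_cmult[OF hh])
    also have "L h (\<lambda>x. \<Sum>j\<le>k. h ^ j * V \<eta> f j x) x = (\<Sum>j\<le>k. h ^ j * L h (V \<eta> f j) x)"
      by (simp only: L_sum[OF finite_atMost] L_cmult[OF hh])
    also have "\<dots> = (\<Sum>j\<le>k. h ^ j * rem (k - j) h (V \<eta> f j) x) + (\<Sum>j\<le>k. h ^ j * (\<Sum>i\<le>k - j. h ^ i * EL i (V \<eta> f j) x))"
      by (simp add: rem_def sum.distrib[symmetric] algebra_simps)
    also have "(\<Sum>j\<le>k. h ^ j * (\<Sum>i\<le>k - j. h ^ i * EL i (V \<eta> f j) x)) = (\<Sum>j\<le>k. \<Sum>i\<le>k - j. h ^ (j + i) * EL i (V \<eta> f j) x)"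
      by (simp add: sum_distrib_left power_add mult.assoc)
    \<comment> \<open>Regrouping by the total power of \<open>h\<close> produces exactly the sums
      that \<open>V_eq\<close> evaluates.\<close>
    also have "\<dots> = (\<Sum>t\<le>k. \<Sum>i\<le>t. h ^ ((t - i) + i) * EL i (V \<eta> f (t - i)) x)"
      by (rule sum_triangle)
    also have "\<dots> = (\<Sum>t\<le>k. h ^ t * (\<Sum>i\<le>t. EL i (V \<eta> f (t - i)) x))"
      unfolding sum_distrib_left by (intro sum.cong refl) auto
    also have "\<dots> = (\<Sum>t\<le>k. h ^ t * (- (if t = 0 then f x else 0)) - h ^ t * rem 0 \<eta> (V \<eta> f t) x)"
      by (simp only: V_eq[OF eta f(1)] right_diff_distrib)
    also have "\<dots> = - f x - (\<Sum>t\<le>k. h ^ t * rem 0 \<eta> (V \<eta> f t) x)"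
    proof -
      have "(\<Sum>t\<le>k. h ^ t * (- (if t = 0 then f x else 0))) = (\<Sum>t\<le>k. if t = 0 then - f x else 0)"
        by (intro sum.cong refl) auto
      also have "\<dots> = - f x" by simp
      finally show ?thesis by (simp only: sum_subtractf)
    qed
    finally have e: "L h (\<lambda>x. v x - (\<Sum>j\<le>k. h ^ j * V \<eta> f j x)) x = L h v x + (-1) *
      ((\<Sum>j\<le>k. h ^ j * rem (k - j) h (V \<eta> f j) x) + (- f x - (\<Sum>t\<le>k. h ^ t * rem 0 \<eta> (V \<eta> f t) x)))" .
    have "L h v x = - f x" using v(2)[of x] by linarith
    then show ?thesis unfolding e g_def by simp
  qed
  have rs: "smb (\<lambda>x. v x - (\<Sum>j\<le>k. h ^ j * V \<eta> f j x))" by (intro smb_diff smb_sum smb_mult smb_const Vs v)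
  have "bd l (NX * ((\<Sum>j\<le>k. h ^ j * (Y * h ^ Suc (k - j))) + (\<Sum>t\<le>k. h ^ t * (Y * \<eta>)))) (\<lambda>x. v x - (\<Sum>j\<le>k. h ^ j * V \<eta> f j x))"
    by (rule apriori_NX[OF h rs gs Lr l(1) gb])
  moreover have "NX * ((\<Sum>j\<le>k. h ^ j * (Y * h ^ Suc (k - j))) + (\<Sum>t\<le>k. h ^ t * (Y * \<eta>))) \<le> NE * F * (h ^ Suc k + \<eta> * (\<Sum>t\<le>k. h ^ t))"
  proof -
    have "(\<Sum>j\<le>k. h ^ j * (Y * h ^ Suc (k - j))) = (\<Sum>j\<le>k. Y * h ^ Suc k)"
    proof (rule sum.cong[OF refl])
      fix j assume "j \<in> {..k}"
      then have "h ^ j * h ^ Suc (k - j) = h ^ Suc k" by (simp only: power_add[symmetric]) simp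
      then show "h ^ j * (Y * h ^ Suc (k - j)) = Y * h ^ Suc k" by (metis mult.left_commute)
    qed
    also have "\<dots> = real (k + 1) * (Y * h ^ Suc k)" by simp
    also have "\<dots> \<le> real (m + 1) * (Y * h ^ Suc k)" using l Y0 h by (intro mult_right_mono) auto
    finally have 1: "(\<Sum>j\<le>k. h ^ j * (Y * h ^ Suc (k - j))) \<le> real (m + 1) * (Y * h ^ Suc k)" .
    have sn: "0 \<le> \<eta> * (\<Sum>t\<le>k. h ^ t)" using eta h by (intro mult_nonneg_nonneg sum_nonneg) auto
    have "(\<Sum>t\<le>k. h ^ t * (Y * \<eta>)) = 1 * (Y * (\<eta> * (\<Sum>t\<le>k. h ^ t)))"
      by (simp add: sum_distrib_left mult_ac)
    also have "\<dots> \<le> real (m + 1) * (Y * (\<eta> * (\<Sum>t\<le>k. h ^ t)))" using sn Y0 by (intro mult_right_mono) auto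
    finally have 2: "(\<Sum>t\<le>k. h ^ t * (Y * \<eta>)) \<le> real (m + 1) * (Y * (\<eta> * (\<Sum>t\<le>k. h ^ t)))" .
    have "NX * ((\<Sum>j\<le>k. h ^ j * (Y * h ^ Suc (k - j))) + (\<Sum>t\<le>k. h ^ t * (Y * \<eta>)))
      \<le> NX * (real (m + 1) * (Y * h ^ Suc k) + real (m + 1) * (Y * (\<eta> * (\<Sum>t\<le>k. h ^ t))))"
      using 1 2 NX_nonneg by (intro mult_left_mono add_mono) auto
    also have "\<dots> = NE * F * (h ^ Suc k + \<eta> * (\<Sum>t\<le>k. h ^ t))"
      by (simp only: NE_def Y_def distrib_left mult_ac)
    finally show ?thesis .
  qed
  ultimately show ?thesis using bd_mono by blast
qed

text \<open>The weights have to cancel only those powers of \<open>h\<close> whose coefficient is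
  not identically zero. All steps involved are at most \<open>h\<close>, so the error of each single
  expansion is bounded by the one at \<open>h\<close>.\<close>

lemma extrapolation:
  assumes eta: "0 < \<eta>" "\<eta> \<le> h0" and f: "smb f" "bd m F f" and s: "EL_cost s" "1 \<le> s" and l: "l \<le> m" "k \<le> m"
    and dead: "\<And>j. j \<le> k \<Longrightarrow> V \<eta> f j = (\<lambda>x. 0) \<or> l + (k - j) + 3 + s * j \<le> m"
    and h: "0 < h" "h \<le> h0" and v: "\<And>h. 0 < h \<Longrightarrow> h \<le> h0 \<Longrightarrow> smb (v h)" "\<And>h x. 0 < h \<Longrightarrow> h \<le> h0 \<Longrightarrow> L h (v h) x + f x = 0"
    and w: "\<And>t. t \<le> k \<Longrightarrow> V \<eta> f t = (\<lambda>x. 0) \<or> (\<Sum>j\<le>J. w j * ((1 / 2) ^ j) ^ t) = (if t = 0 then 1 else 0)"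
  shows "bd l ((\<Sum>j\<le>J. \<bar>w j\<bar>) * (NE * F * (h ^ Suc k + \<eta> * (\<Sum>t\<le>k. h ^ t))))
    (\<lambda>x. (\<Sum>j\<le>J. w j * v ((1 / 2) ^ j * h) x) - V \<eta> f 0 x)"
proof -
  have F0: "0 \<le> F" using bd_nonneg f(2) .
  have hj: "0 < (1 / 2) ^ j * h" "(1 / 2) ^ j * h \<le> h" for j :: nat
    using h by (auto simp: power_le_one mult_left_le_one_le)
  have hj0: "(1 / 2) ^ j * h \<le> h0" for j :: nat using hj(2)[of j] h by linarith
  define r where "r = (\<lambda>j x. v ((1 / 2) ^ j * h) x - (\<Sum>t\<le>k. ((1 / 2) ^ j * h) ^ t * V \<eta> f t x))"
  have Vs: "smb (V \<eta> f j)" for j by (rule V_smb[OF eta f(1)])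
  have vs: "smb (v ((1 / 2) ^ j * h))" for j by (rule v(1)[OF hj(1) hj0])
  have rs: "smb (r j)" for j unfolding r_def by (intro smb_diff smb_sum smb_mult smb_const Vs vs)
  define E where "E = NE * F * (h ^ Suc k + \<eta> * (\<Sum>t\<le>k. h ^ t))"
  have rb: "bd l E (r j)" for j
  proof -
    let ?h = "(1 / 2) ^ j * h"
    have "bd l (NE * F * (?h ^ Suc k + \<eta> * (\<Sum>t\<le>k. ?h ^ t))) (r j)"
      unfolding r_def
      by (rule expansion[OF eta f s l dead hj(1) hj0 vs v(2)[OF hj(1) hj0]])
    moreover have "NE * F * (?h ^ Suc k + \<eta> * (\<Sum>t\<le>k. ?h ^ t)) \<le> E"
      unfolding E_def using NE_nonneg F0 hj[of j] h eta
      by (intro mult_left_mono add_mono sum_mono power_mono) auto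
    ultimately show ?thesis using bd_mono by blast
  qed
  have "bd l (\<Sum>j\<le>J. \<bar>w j\<bar> * E) (\<lambda>x. \<Sum>j\<le>J. w j * r j x)"
    by (intro bd_sum bd_cmult Cb_cmult smb_Cb rs rb)
  moreover have "(\<Sum>j\<le>J. w j * r j x) = (\<Sum>j\<le>J. w j * v ((1 / 2) ^ j * h) x) - V \<eta> f 0 x" for x
  proof -
    have "(\<Sum>j\<le>J. w j * (\<Sum>t\<le>k. ((1 / 2) ^ j * h) ^ t * V \<eta> f t x))
        = (\<Sum>t\<le>k. (\<Sum>j\<le>J. w j * ((1 / 2) ^ j) ^ t) * (h ^ t * V \<eta> f t x))"
      unfolding sum_distrib_left sum_distrib_right
      by (subst sum.swap) (simp only: power_mult_distrib mult_ac)
    also have "\<dots> = (\<Sum>t\<le>k. if t = 0 then V \<eta> f 0 x else 0)"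
    proof (rule sum.cong[OF refl])
      fix t assume t: "t \<in> {..k}"
      show "(\<Sum>j\<le>J. w j * ((1 / 2) ^ j) ^ t) * (h ^ t * V \<eta> f t x) = (if t = 0 then V \<eta> f 0 x else 0)"
      proof (cases "V \<eta> f t = (\<lambda>x. 0)")
        case True
        then show ?thesis by (cases "t = 0") (auto simp del: V.simps)
      next
        case False
        then have "(\<Sum>j\<le>J. w j * ((1 / 2) ^ j) ^ t) = (if t = 0 then 1 else 0)" using w t by blast
        then show ?thesis by (simp only:) simp
      qed
    qed
    also have "\<dots> = V \<eta> f 0 x" by simp
    finally show ?thesis by (simp add: r_def right_diff_distrib sum_subtractf)
  qed
  ultimately show ?thesis unfolding E_def by (simp add: sum_distrib_right)
qed

text \<open>In the recursion the indices \<open>Suc i\<close> and \<open>j' - i\<close> add up to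
  \<open>j\<close>. If \<open>j\<close> is odd, one of them is odd, and either the operator or the
  coefficient it acts on vanishes.\<close>

lemma V_odd_zero:
  assumes "\<Lambda>\<^sub>1 = uminus ` \<Lambda>\<^sub>1" "\<And>\<xi>. \<xi> \<in> \<Lambda>\<^sub>1 \<Longrightarrow> q (- \<xi>) = q \<xi>" "\<And>\<xi> x. \<xi> \<in> \<Lambda>\<^sub>1 \<Longrightarrow> p (- \<xi>) x = - p \<xi> x"
    and eta: "0 < \<eta>" "\<eta> \<le> h0" and f: "smb f"
  shows "odd j \<Longrightarrow> V \<eta> f j = (\<lambda>x. 0)"
proof (induction j rule: less_induct)
  case (less j)
  then obtain j' where j: "j = Suc j'" by (cases j) auto
  have "EL (Suc i) (V \<eta> f (j' - i)) x = 0" if "i \<le> j'" for i x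
  proof (cases "odd (Suc i)")
    case True
    then show ?thesis using EL_odd_zero[OF assms(1-3) True V_smb[OF eta f]] by simp
  next
    case False
    then have "odd (j' - i)" "j' - i < j" using less.prems j that by auto
    then show ?thesis using less.IH EL_zero by (simp del: V.simps)
  qed
  then have "(\<lambda>x. \<Sum>i\<le>j'. EL (Suc i) (V \<eta> f (j' - i)) x) = (\<lambda>x. 0)" by (auto simp del: V.simps)
  then show ?case unfolding j by (simp add: Sol_zero[OF eta])
qed

end

subsection \<open>Mollified coefficients\<close>

lemma li_add: "locally_integrable f \<Longrightarrow> locally_integrable g \<Longrightarrow> locally_integrable (\<lambda>x. f x + g x)"
  unfolding locally_integrable_def by (blast intro: set_integral_add)

lemma li_cmult: "locally_integrable f \<Longrightarrow> locally_integrable (\<lambda>x. a * f x)"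
  unfolding locally_integrable_def by simp

lemma li_const: "locally_integrable (\<lambda>x::real^'d::finite. a)"
  by (intro continuous_locally_integrable) simp

text \<open>Local integrability is bundled with the value so that linear combinations can be
  mollified by introduction rules alone.\<close>

definition has_conv :: "nat \<Rightarrow> real^'d::finite \<Rightarrow> (real^'d \<Rightarrow> real) \<Rightarrow> real \<Rightarrow> bool" where
  "has_conv n x g r \<longleftrightarrow> locally_integrable g \<and> conv g (bump n) x = r"

lemma has_conv_self: "locally_integrable g \<Longrightarrow> has_conv n x g (conv g (bump n) x)"
  by (simp add: has_conv_def)

lemma has_conv_add: "has_conv n x f a \<Longrightarrow> has_conv n x g b \<Longrightarrow> has_conv n x (\<lambda>z. f z + g z) (a + b)"
  unfolding has_conv_def
proof (intro conjI li_add; elim conjE; assumption?)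
  assume f: "locally_integrable f" "conv f (bump n) x = a" and g: "locally_integrable g" "conv g (bump n) x = b"
  show "conv (\<lambda>z. f z + g z) (bump n) x = a + b"
    using conv_integrable[OF f(1) bump_test[of n], of x] conv_integrable[OF g(1) bump_test[of n], of x] f(2) g(2)
    by (simp add: conv_def distrib_right)
qed

lemma has_conv_cmult: "has_conv n x f a \<Longrightarrow> has_conv n x (\<lambda>z. k * f z) (k * a)"
  unfolding has_conv_def by (auto simp: conv_def mult.assoc intro!: li_cmult)

lemma has_conv_multc: "has_conv n x f a \<Longrightarrow> has_conv n x (\<lambda>z. f z * k) (a * k)"
  using has_conv_cmult[of n x f a k] by (simp add: mult.commute)

lemma conv_bump_const: "conv (\<lambda>z. k) (bump n) x = k"
proof -
  have "\<bar>conv (\<lambda>z. k) (bump n) x - k\<bar> \<le> 0" by (rule conv_bump_minus) auto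
  then show ?thesis by simp
qed

lemma has_conv_const: "has_conv n x (\<lambda>z. k) k"
  by (simp add: has_conv_def conv_bump_const li_const)

lemma has_conv_sum: "(\<And>i. i \<in> I \<Longrightarrow> has_conv n x (f i) (a i)) \<Longrightarrow> has_conv n x (\<lambda>z. \<Sum>i\<in>I. f i z) (\<Sum>i\<in>I. a i)"
  by (induction I rule: infinite_finite_induct) (auto intro: has_conv_const has_conv_add)

lemma has_conv_mono:
  assumes "has_conv n x f a" "has_conv n x g b" "\<forall>z. f z \<le> g z"
  shows "a \<le> b"
proof -
  have f: "locally_integrable f" "conv f (bump n) x = a" and g: "locally_integrable g" "conv g (bump n) x = b"
    using assms(1,2) by (auto simp: has_conv_def)
  have "conv f (bump n) x \<le> conv g (bump n) x"
    unfolding conv_def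
    by (intro integral_mono conv_integrable f g bump_test mult_right_mono bump_nonneg) (use assms(3) in auto)
  then show ?thesis using f g by simp
qed

lemma conv_shift:
  fixes g :: "real^'d::finite \<Rightarrow> real"
  assumes "locally_integrable g"
  shows "conv g (bump n) (x + a) = conv (\<lambda>z. g (z + a)) (bump n) x"
proof -
  have [measurable]: "g \<in> borel_measurable borel" by (rule locally_integrable_measurable[OF assms])
  have [measurable]: "(\<lambda>z. bump n (x + a - z)) \<in> borel_measurable borel"
    by (rule test_measurable[OF test_reflect[OF bump_test]])
  have "(LINT z|lborel. g (z + a) * bump n (x + a - (z + a))) = (LINT z|lborel. g z * bump n (x + a - z))"
    by (rule integral_translate_lborel[of "\<lambda>z. g z * bump n (x + a - z)"]) measurable
  then show ?thesis by (simp add: conv_def)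
qed

lemma Cb_li: "Cb n g \<Longrightarrow> locally_integrable g"
  by (intro continuous_locally_integrable lipb_continuous Cb_lipb)

lemma conv_partial:
  assumes "Cb (Suc 0) g"
  shows "partial i (conv g (bump n)) = conv (partial i g) (bump n)"
proof -
  have c: "\<forall>j. count_list [i] j = (\<lambda>j. count_list [i] j) j" by simp
  have "has_gen_deriv (\<lambda>j. count_list [i] j) g (foldr partial [i] g)"
    by (rule Cb_has_gen_deriv[OF assms _ c]) simp
  from conv_gen_deriv[OF this c bump_test, of n]
  show ?thesis
    using conv_differentiable(2)[OF lipb_bmeas[OF Cb_lipb[OF assms]] bump_test] by (simp add: fun_eq_iff)
qed

context scheme_data
begin

lemma bDs_Cb: "set \<mu> \<subseteq> LM \<Longrightarrow> Cb (n + length \<mu>) g \<Longrightarrow> Cb n (bDs h \<mu> g)"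
proof (induction \<mu> arbitrary: n)
  case (Cons \<xi> \<mu>)
  have "Cb (Suc n) (bDs h \<mu> g)" by (rule Cons.IH) (use Cons.prems in \<open>simp_all del: Cb.simps\<close>)
  then show ?case using Cons.prems(1) by (simp add: bD_Cb del: Cb.simps)
qed simp

lemma bD_conv:
  assumes "\<xi> \<in> LM" "Cb (Suc 0) g"
  shows "bD h \<xi> (conv g (bump n)) = conv (bD h \<xi> g) (bump n)"
  using assms(1)
proof (cases rule: LM_cases)
  case 1
  show ?thesis
  proof
    fix x
    have s: "has_conv n x (\<lambda>z. g (z + h *\<^sub>R \<xi>)) (conv g (bump n) (x + h *\<^sub>R \<xi>))"
      using Cb_li[OF Cb_shift[OF assms(2)]] by (simp add: has_conv_def conv_shift[OF Cb_li[OF assms(2)]])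
    have "has_conv n x (\<lambda>z. (\<tau> \<xi> / h) * (g (z + h *\<^sub>R \<xi>) + (-1) * g z)) ((\<tau> \<xi> / h) * (conv g (bump n) (x + h *\<^sub>R \<xi>) + (-1) * conv g (bump n) x))"
      by (intro has_conv_cmult has_conv_add s has_conv_self Cb_li[OF assms(2)])
    then show "bD h \<xi> (conv g (bump n)) x = conv (bD h \<xi> g) (bump n) x"
      by (simp add: has_conv_def bD_in[OF 1])
  qed
next
  case (2 i)
  show ?thesis
  proof
    fix x
    have "has_conv n x (partial i g) (conv (partial i g) (bump n) x)"
      by (rule has_conv_self[OF Cb_li[OF Cb_partial[OF assms(2)]]])
    from has_conv_cmult[OF this, of \<tau>\<^sub>0]
    show "bD h \<xi> (conv g (bump n)) x = conv (bD h \<xi> g) (bump n) x"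
      by (simp add: has_conv_def 2(1) bD_dir conv_partial[OF assms(2)])
  qed
qed

lemma bDs_conv:
  "set \<mu> \<subseteq> LM \<Longrightarrow> Cb (length \<mu>) g \<Longrightarrow> bDs h \<mu> (conv g (bump n)) = conv (bDs h \<mu> g) (bump n)"
proof (induction \<mu>)
  case (Cons \<xi> \<mu>)
  have "Cb (Suc 0) (bDs h \<mu> g)" by (rule bDs_Cb) (use Cons.prems in \<open>simp_all del: Cb.simps\<close>)
  moreover have "Cb (length \<mu>) g" using Cons.prems(2) by (simp add: Cb_Suc del: Cb.simps)
  ultimately show ?case using Cons by (simp add: bD_conv del: Cb.simps)
qed simp

text \<open>The forms entering the structural inequalities, with the values of the coefficients and of
  their differences at a point treated as independent parameters. They are linear in these values.\<close>

definition AF :: "(real^'d \<Rightarrow> real^'d \<Rightarrow> real) \<Rightarrow> (real^'d \<Rightarrow> real^'d \<Rightarrow> real) \<Rightarrow> real \<Rightarrow> (real^'d \<Rightarrow> real) \<Rightarrow> real^'d \<Rightarrow> real" where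
  "AF Q P h \<phi> x = 2 * (\<Sum>\<xi>\<in>LM. bD h \<xi> \<phi> x *
     ((1 / h) * (\<Sum>\<zeta>\<in>\<Lambda>\<^sub>1. Q \<xi> \<zeta> * fdiff h \<zeta> (sh h \<xi> \<phi>) x) + (\<Sum>\<zeta>\<in>\<Lambda>\<^sub>1. P \<xi> \<zeta> * fdiff h \<zeta> (sh h \<xi> \<phi>) x)))"

definition QF :: "(real^'d \<Rightarrow> real) \<Rightarrow> (real^'d \<Rightarrow> real) \<Rightarrow> real \<Rightarrow> (real^'d \<Rightarrow> real) \<Rightarrow> real^'d \<Rightarrow> real" where
  "QF Q P h \<phi> x = (\<Sum>\<zeta>\<in>\<Lambda>\<^sub>1. (Q \<zeta> + h * P \<zeta>) * (fdiff h \<zeta> \<phi> x)\<^sup>2)"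

definition Q2 :: "((real^'d) list \<Rightarrow> real^'d \<Rightarrow> real) \<Rightarrow> real \<Rightarrow> (real^'d) list \<Rightarrow> (real^'d \<Rightarrow> real) \<Rightarrow> real^'d \<Rightarrow> real" where
  "Q2 Q h \<mu> \<phi> x = (1 / h) * (\<Sum>\<zeta>\<in>\<Lambda>\<^sub>1. Q \<mu> \<zeta> * fdiff h \<zeta> \<phi> x)"

lemma Aform_AF: "Aform \<Lambda>\<^sub>1 \<l> \<tau>\<^sub>0 \<tau> q p h \<phi> x = AF (\<lambda>\<xi> \<zeta>. bD h \<xi> (q \<zeta>) x) (\<lambda>\<xi> \<zeta>. bD h \<xi> (p \<zeta>) x) h \<phi> x"
  by (simp add: Aform_def AF_def L0op_def Qop_def)

lemma Qform_QF: "Qform \<Lambda>\<^sub>1 q p h \<phi> x = QF (\<lambda>\<zeta>. q \<zeta> x) (\<lambda>\<zeta>. p \<zeta> x) h \<phi> x"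
  by (simp add: Qform_def QF_def)

lemma Qop_Q2: "Qop \<Lambda>\<^sub>1 \<l> \<tau>\<^sub>0 \<tau> q h \<mu> \<phi> x = Q2 (\<lambda>\<mu> \<zeta>. bDs h \<mu> (q \<zeta>) x) h \<mu> \<phi> x"
  by (simp add: Qop_def Q2_def)

lemma bD_translate: "\<xi> \<in> LM \<Longrightarrow> bD h \<xi> (\<lambda>y. \<phi> (y + a)) = (\<lambda>y. bD h \<xi> \<phi> (y + a))"
  by (erule LM_cases) (auto simp: bD_in bD_dir partial_shift add_ac)

lemma bDs_translate: "set \<mu> \<subseteq> LM \<Longrightarrow> bDs h \<mu> (\<lambda>y. \<phi> (y + a)) = (\<lambda>y. bDs h \<mu> \<phi> (y + a))"
  by (induction \<mu>) (auto simp: bD_translate)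

lemma sh_translate: "sh h \<xi> (\<lambda>y. \<phi> (y + a)) = (\<lambda>y. sh h \<xi> \<phi> (y + a))"
  by (auto simp: shift_def add_ac)

lemma shifts_translate: "shifts \<Lambda>\<^sub>1 h \<mu> (\<lambda>y. \<phi> (y + a)) = (\<lambda>y. shifts \<Lambda>\<^sub>1 h \<mu> \<phi> (y + a))"
  unfolding shifts_def by (induction \<mu>) (auto simp: sh_translate)

lemma fdiff_translate: "fdiff h \<zeta> (\<lambda>y. \<phi> (y + a)) x = fdiff h \<zeta> \<phi> (x + a)"
  by (simp add: fdiff_def add_ac)

lemma AF_translate: "AF Q P h (\<lambda>y. \<phi> (y + a)) x = AF Q P h \<phi> (x + a)"
  unfolding AF_def by (simp add: bD_translate sh_translate fdiff_translate)

lemma QF_translate: "QF Q P h (\<lambda>y. \<phi> (y + a)) x = QF Q P h \<phi> (x + a)"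
  unfolding QF_def by (simp add: fdiff_translate)

lemma Q2_translate: "Q2 Q h \<mu> (\<lambda>y. \<phi> (y + a)) x = Q2 Q h \<mu> \<phi> (x + a)"
  unfolding Q2_def by (simp add: fdiff_translate)

lemma bdiff_sq_translate: "bdiff_sq \<Lambda>\<^sub>1 \<l> \<tau>\<^sub>0 \<tau> k h (\<lambda>y. \<phi> (y + a)) x = bdiff_sq \<Lambda>\<^sub>1 \<l> \<tau>\<^sub>0 \<tau> k h \<phi> (x + a)"
  unfolding bdiff_sq_def by (intro sum.cong refl) (simp add: bDs_translate pw_subset)

lemma AF_has_conv:
  assumes "\<And>\<xi> \<zeta>. \<xi> \<in> LM \<Longrightarrow> \<zeta> \<in> \<Lambda>\<^sub>1 \<Longrightarrow> has_conv n x (\<lambda>z. Q z \<xi> \<zeta>) (Q' \<xi> \<zeta>)"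
    "\<And>\<xi> \<zeta>. \<xi> \<in> LM \<Longrightarrow> \<zeta> \<in> \<Lambda>\<^sub>1 \<Longrightarrow> has_conv n x (\<lambda>z. P z \<xi> \<zeta>) (P' \<xi> \<zeta>)"
  shows "has_conv n x (\<lambda>z. AF (Q z) (P z) h \<phi> y) (AF Q' P' h \<phi> y)"
  unfolding AF_def
  by (intro has_conv_cmult has_conv_sum has_conv_add has_conv_multc assms)

lemma QF_has_conv:
  assumes "\<And>\<zeta>. \<zeta> \<in> \<Lambda>\<^sub>1 \<Longrightarrow> has_conv n x (\<lambda>z. Q z \<zeta>) (Q' \<zeta>)" "\<And>\<zeta>. \<zeta> \<in> \<Lambda>\<^sub>1 \<Longrightarrow> has_conv n x (\<lambda>z. P z \<zeta>) (P' \<zeta>)"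
  shows "has_conv n x (\<lambda>z. QF (Q z) (P z) h \<phi> y) (QF Q' P' h \<phi> y)"
  unfolding QF_def by (intro has_conv_sum has_conv_multc has_conv_add has_conv_cmult assms)

lemma Q2_has_conv:
  assumes "\<And>\<zeta>. \<zeta> \<in> \<Lambda>\<^sub>1 \<Longrightarrow> has_conv n x (\<lambda>z. Q z \<mu> \<zeta>) (Q' \<mu> \<zeta>)"
  shows "has_conv n x (\<lambda>z. Q2 (Q z) h \<mu> \<phi> y) (Q2 Q' h \<mu> \<phi> y)"
  unfolding Q2_def by (intro has_conv_cmult has_conv_sum has_conv_multc assms)

end

section \<open>Structural inequalities for the mollified coefficients\<close>

lemma smb_bounded_borel: "smb g \<Longrightarrow> g \<in> bounded_borel"
  using lipb_bmeas[OF smb_lipb] by (simp add: bounded_borel_def bmeas_def)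

text \<open>Positivity applied to B - g, together with \<K> 1 \<le> 1. The bound \<open>B\<close> is
  taken nonnegative because \<K> 1 may be smaller than 1.\<close>

lemma Kops_le:
  assumes "\<K> \<in> Kops" "g \<in> bounded_borel" "\<And>x. g x \<le> B" "0 \<le> B"
  shows "\<K> g x \<le> B"
proof -
  have one: "(\<lambda>_. 1) \<in> bounded_borel" by (rule smb_bounded_borel[OF smb_const])
  have lin: "\<K> (\<lambda>x. a * g x + b * g' x) = (\<lambda>x. a * \<K> g x + b * \<K> g' x)"
    if "g \<in> bounded_borel" "g' \<in> bounded_borel" for g g' a b
    using assms(1) that unfolding Kops_def by blast
  have bb: "(\<lambda>x. B * 1 + (-1) * g x) \<in> bounded_borel"
  proof -
    obtain A where A: "\<And>x. \<bar>g x\<bar> \<le> A" using assms(2) unfolding bounded_borel_def bounded_iff by auto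
    have "\<bar>B * 1 + (-1) * g x\<bar> \<le> \<bar>B\<bar> + A" for x using A[of x] by linarith
    then have "bounded (range (\<lambda>x. B * 1 + (-1) * g x))" unfolding bounded_iff by auto
    then show ?thesis using assms(2) by (auto simp: bounded_borel_def intro!: borel_measurable_diff)
  qed
  have "0 \<le> \<K> (\<lambda>x. B * 1 + (-1) * g x) x"
    using assms(1,3) bb unfolding Kops_def by auto
  then have "\<K> g x \<le> B * \<K> (\<lambda>_. 1) x" unfolding lin[OF one assms(2)] by simp
  also have "\<dots> \<le> B * 1"
    using assms(1,4) unfolding Kops_def by (intro mult_left_mono) auto
  finally show ?thesis by simp
qed

lemma Kops_sum:
  assumes "\<K> \<in> Kops" "finite I" "\<And>i. i \<in> I \<Longrightarrow> smb (g i)"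
  shows "\<K> (\<lambda>x. \<Sum>i\<in>I. g i x) = (\<lambda>x. \<Sum>i\<in>I. \<K> (g i) x)"
proof -
  have lin: "\<K> (\<lambda>x. a * g x + b * g' x) = (\<lambda>x. a * \<K> g x + b * \<K> g' x)"
    if "g \<in> bounded_borel" "g' \<in> bounded_borel" for g g' a b
    using assms(1) that unfolding Kops_def by blast
  show ?thesis using assms(2,3)
  proof (induction I rule: finite_induct)
    case empty
    have "(\<lambda>_. 0) \<in> bounded_borel" by (rule smb_bounded_borel[OF smb_const])
    from lin[OF this this, of 0 0] show ?case by simp
  next
    case (insert i I)
    have "g i \<in> bounded_borel" "(\<lambda>x. \<Sum>i\<in>I. g i x) \<in> bounded_borel"
      using insert.prems by (auto intro!: smb_bounded_borel smb_sum)
    from lin[OF this, of 1 1] show ?case using insert by simp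
  qed
qed

locale rough_scheme = scheme_data \<Lambda>\<^sub>1 \<l> \<tau>\<^sub>0 \<tau>
  for \<Lambda>\<^sub>1 :: "(real^'d::finite) set" and \<l> :: "'d \<Rightarrow> real^'d" and \<tau>\<^sub>0 :: real and \<tau> :: "real^'d \<Rightarrow> real" +
  fixes q p :: "real^'d \<Rightarrow> real^'d \<Rightarrow> real" and c f :: "real^'d \<Rightarrow> real"
    and h0 \<delta> K c0 :: real and M :: "nat \<Rightarrow> real" and m :: nat
  assumes h0: "0 < h0" and delta: "0 < \<delta>" "\<delta> \<le> 1" and K1: "1 \<le> K" and c0: "0 < c0" "\<And>x. c0 \<le> c x" and m3: "3 \<le> m"
    and reg: "regularity_condition \<Lambda>\<^sub>1 q p c f m M"
    and nn: "\<And>h \<xi> x. 0 < h \<Longrightarrow> h \<le> h0 \<Longrightarrow> \<xi> \<in> \<Lambda>\<^sub>1 \<Longrightarrow> 0 \<le> q \<xi> x + h * p \<xi> x"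
    and centered: "\<And>x. (\<Sum>\<xi>\<in>\<Lambda>\<^sub>1. q \<xi> x *\<^sub>R \<xi>) = 0"
    and str1: "first_structural \<Lambda>\<^sub>1 \<l> \<tau>\<^sub>0 \<tau> q p c h0 \<delta> K m"
    and str2: "second_structural \<Lambda>\<^sub>1 \<l> \<tau>\<^sub>0 \<tau> q p c h0 \<delta> K m"
begin

text \<open>Extension by zero: \<open>smooth_scheme\<close> asks for smoothness at every index, and
  nothing is known about \<open>q\<close> and \<open>p\<close> off
  \<open>\<Lambda>\<^sub>1\<close>.\<close>

definition on\<Lambda> :: "(real^'d \<Rightarrow> real^'d \<Rightarrow> real) \<Rightarrow> real^'d \<Rightarrow> real^'d \<Rightarrow> real" where
  "on\<Lambda> b \<xi> = (if \<xi> \<in> \<Lambda>\<^sub>1 then b \<xi> else (\<lambda>x. 0))"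

definition moll :: "nat \<Rightarrow> (real^'d \<Rightarrow> real^'d \<Rightarrow> real) \<Rightarrow> real^'d \<Rightarrow> real^'d \<Rightarrow> real" where
  "moll n b \<xi> = conv (on\<Lambda> b \<xi>) (bump n)"

text \<open>A single constant above all of M_0, ..., M_m, so that only one bound is carried through
  the recursions.\<close>

definition Mx :: real where "Mx = (\<Sum>k\<le>m. \<bar>M k\<bar>)"

lemma regD: "\<xi> \<in> \<Lambda>\<^sub>1 \<Longrightarrow> q \<xi> \<in> Bspace m" "\<xi> \<in> \<Lambda>\<^sub>1 \<Longrightarrow> p \<xi> \<in> Bspace m" "c \<in> Bspace m" "f \<in> Bspace m"
  "k \<le> m \<Longrightarrow> AE x in lborel. (\<Sum>\<xi>\<in>\<Lambda>\<^sub>1. deriv_sq k (q \<xi>) x + deriv_sq k (p \<xi>) x) + deriv_sq k c x \<le> (M k)\<^sup>2"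
  using reg unfolding regularity_condition_def by auto

lemma zero_Bspace: "(\<lambda>x::real^'d. 0) \<in> Bspace m"
  by (rule Cb_Bspace[OF Cb_const])

lemma on_Bspace: "on\<Lambda> q \<xi> \<in> Bspace m" "on\<Lambda> p \<xi> \<in> Bspace m"
  using regD zero_Bspace by (auto simp: on\<Lambda>_def)

lemma Bspace_Cb': "g \<in> Bspace m \<Longrightarrow> k < m \<Longrightarrow> Cb k g"
  by (metis Bspace_Cb(1) Cb_mono less_Suc_eq_le not0_implies_Suc not_less0)

lemma Bspace_li: "g \<in> Bspace m \<Longrightarrow> locally_integrable g"
  using Bspace_Cb'[of g 0] m3 by (intro Cb_li[of 0]) auto

lemma moll_smb: "smb (moll n q \<xi>)" "smb (moll n p \<xi>)" "smb (conv c (bump n))" "smb (conv f (bump n))"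
  unfolding moll_def by (intro conv_smb Bspace_bmeas[OF on_Bspace(1)] Bspace_bmeas[OF on_Bspace(2)] Bspace_bmeas[OF regD(3)] Bspace_bmeas[OF regD(4)] bump_test)+

lemma has_conv_moll:
  assumes "\<xi> \<in> \<Lambda>\<^sub>1"
  shows "has_conv n x (q \<xi>) (moll n q \<xi> x)" "has_conv n x (p \<xi>) (moll n p \<xi> x)"
  using assms Bspace_li regD by (auto simp: moll_def on\<Lambda>_def intro: has_conv_self)

lemma has_conv_c: "has_conv n x c (conv c (bump n) x)"
  using Bspace_li regD by (auto intro: has_conv_self)

lemma has_conv_bDs:
  assumes "\<xi> \<in> \<Lambda>\<^sub>1" "set \<mu> \<subseteq> LM" "length \<mu> \<le> 2"
  shows "has_conv n x (bDs h \<mu> (q \<xi>)) (bDs h \<mu> (moll n q \<xi>) x)" "has_conv n x (bDs h \<mu> (p \<xi>)) (bDs h \<mu> (moll n p \<xi>) x)"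
proof -
  have "Cb (length \<mu>) (q \<xi>)" "Cb (length \<mu>) (p \<xi>)" using assms m3 regD by (auto intro!: Bspace_Cb' simp del: Cb.simps)
  then show "has_conv n x (bDs h \<mu> (q \<xi>)) (bDs h \<mu> (moll n q \<xi>) x)" "has_conv n x (bDs h \<mu> (p \<xi>)) (bDs h \<mu> (moll n p \<xi>) x)"
    using assms bDs_Cb[of \<mu> 0 "q \<xi>"] bDs_Cb[of \<mu> 0 "p \<xi>"]
    by (auto simp: has_conv_def moll_def on\<Lambda>_def bDs_conv simp del: Cb.simps intro!: Cb_li)
qed

lemma conv_nn: "0 < h \<Longrightarrow> h \<le> h0 \<Longrightarrow> \<xi> \<in> \<Lambda>\<^sub>1 \<Longrightarrow> 0 \<le> moll n q \<xi> x + h * moll n p \<xi> x"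
  by (rule has_conv_mono[OF has_conv_const has_conv_add[OF has_conv_moll(1) has_conv_cmult[OF has_conv_moll(2)]]])
    (auto intro: nn)

lemma conv_c0: "c0 \<le> conv c (bump n) x"
  by (rule has_conv_mono[OF has_conv_const has_conv_c]) (simp add: c0(2))

lemma conv_centered: "(\<Sum>\<xi>\<in>\<Lambda>\<^sub>1. moll n q \<xi> x * \<xi> $ k) = 0"
proof -
  have "has_conv n x (\<lambda>z. \<Sum>\<xi>\<in>\<Lambda>\<^sub>1. q \<xi> z * \<xi> $ k) (\<Sum>\<xi>\<in>\<Lambda>\<^sub>1. moll n q \<xi> x * \<xi> $ k)"
    by (intro has_conv_sum has_conv_multc has_conv_moll)
  moreover have "(\<Sum>\<xi>\<in>\<Lambda>\<^sub>1. q \<xi> z * \<xi> $ k) = 0" for z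
    using arg_cong[OF centered[of z], of "\<lambda>y. y $ k"] by simp
  ultimately show ?thesis using conv_bump_const[of 0 n x] by (simp add: has_conv_def)
qed

lemma Mx_ge: "k \<le> m \<Longrightarrow> \<bar>M k\<bar> \<le> Mx"
  unfolding Mx_def by (rule member_le_sum) auto

lemma Mx_nonneg: "0 \<le> Mx" unfolding Mx_def by (intro sum_nonneg) auto

lemma deriv_sq_nonneg: "0 \<le> deriv_sq k g x" unfolding deriv_sq_def by (intro sum_nonneg) auto

lemma finite_mi_order_eq: "finite {\<alpha> :: 'd \<Rightarrow> nat. mi_order \<alpha> = k}"
  by (rule finite_subset[OF _ finite_mi_order[of k]]) auto

lemma gen_deriv_sq_le: "mi_order \<alpha> = k \<Longrightarrow> (gen_deriv \<alpha> g x)\<^sup>2 \<le> deriv_sq k g x" for g :: "real^'d \<Rightarrow> real"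
  unfolding deriv_sq_def by (rule member_le_sum) (auto simp: finite_mi_order_eq)

text \<open>The Cauchy-Schwarz inequality over \<open>\<Lambda>\<^sub>1\<close> is applied to the
  generalized derivatives almost everywhere, before the convolution; averaging then preserves the
  bound of the linear combination.\<close>

lemma moll_cbd_gen:
  assumes b: "\<And>\<xi>. \<xi> \<in> \<Lambda>\<^sub>1 \<Longrightarrow> b \<xi> \<in> Bspace m"
    and ae: "\<And>k. k \<le> m \<Longrightarrow> AE x in lborel. (\<Sum>\<xi>\<in>\<Lambda>\<^sub>1. deriv_sq k (b \<xi>) x) \<le> (M k)\<^sup>2"
  shows "cbd m Mx (moll n b)"
  unfolding cbd_def bd_def
proof (intro allI impI)
  fix e :: "real^'d \<Rightarrow> real" and "is" :: "'d list" and x :: "real^'d" assume l: "length is \<le> m"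
  define \<alpha> where "\<alpha> = (\<lambda>i. count_list is i)"
  have c: "\<forall>i. count_list is i = \<alpha> i" by (simp add: \<alpha>_def)
  have mo: "mi_order \<alpha> = length is" by (rule mi_order_count[OF c])
  have h: "has_gen_deriv \<alpha> (b \<xi>) (gen_deriv \<alpha> (b \<xi>))" if "\<xi> \<in> \<Lambda>\<^sub>1" for \<xi>
    by (rule Bspace_has_gen_deriv[OF b[OF that]]) (use mo l in simp)
  have sm: "smb (moll n b \<xi>)" if "\<xi> \<in> \<Lambda>\<^sub>1" for \<xi>
    unfolding moll_def on\<Lambda>_def using that by (simp add: conv_smb Bspace_bmeas[OF b] bump_test)
  have pd: "foldr partial is (moll n b \<xi>) x = conv (gen_deriv \<alpha> (b \<xi>)) (bump n) x" if "\<xi> \<in> \<Lambda>\<^sub>1" for \<xi>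
    unfolding moll_def on\<Lambda>_def using that
    by (simp add: conv_pderivs[OF Bspace_bmeas[OF b] bump_test] conv_gen_deriv[OF h c bump_test])
  have hc: "has_conv n x (\<lambda>z. \<Sum>\<xi>\<in>\<Lambda>\<^sub>1. e \<xi> * gen_deriv \<alpha> (b \<xi>) z) (\<Sum>\<xi>\<in>\<Lambda>\<^sub>1. e \<xi> * foldr partial is (moll n b \<xi>) x)"
    by (intro has_conv_sum has_conv_cmult) (use h pd in \<open>auto simp: has_conv_def has_gen_deriv_def\<close>)
  have "foldr partial is (\<lambda>x. \<Sum>\<xi>\<in>\<Lambda>\<^sub>1. e \<xi> * moll n b \<xi> x) x = (\<Sum>\<xi>\<in>\<Lambda>\<^sub>1. e \<xi> * foldr partial is (moll n b \<xi>) x)"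
  proof -
    have "foldr partial is (\<lambda>x. \<Sum>\<xi>\<in>\<Lambda>\<^sub>1. e \<xi> * moll n b \<xi> x) = (\<lambda>x. \<Sum>\<xi>\<in>\<Lambda>\<^sub>1. foldr partial is (\<lambda>x. e \<xi> * moll n b \<xi> x) x)"
      by (rule pderivs_sum[OF _ order_refl]) (rule smb_Cb[OF smb_mult[OF smb_const sm]])
    also have "\<dots> = (\<lambda>x. \<Sum>\<xi>\<in>\<Lambda>\<^sub>1. e \<xi> * foldr partial is (moll n b \<xi>) x)"
      by (intro ext sum.cong refl) (simp add: pderivs_cmult[OF smb_Cb[OF sm] order_refl])
    finally show ?thesis by simp
  qed
  also have "\<dots> = conv (\<lambda>z. \<Sum>\<xi>\<in>\<Lambda>\<^sub>1. e \<xi> * gen_deriv \<alpha> (b \<xi>) z) (bump n) x"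
    using hc by (simp add: has_conv_def)
  also have "\<bar>\<dots>\<bar> \<le> Mx * L2_set e \<Lambda>\<^sub>1"
  proof (rule conv_bump_abs_le)
    show "locally_integrable (\<lambda>z. \<Sum>\<xi>\<in>\<Lambda>\<^sub>1. e \<xi> * gen_deriv \<alpha> (b \<xi>) z)" using hc by (simp add: has_conv_def)
    show "AE z in lborel. \<bar>\<Sum>\<xi>\<in>\<Lambda>\<^sub>1. e \<xi> * gen_deriv \<alpha> (b \<xi>) z\<bar> \<le> Mx * L2_set e \<Lambda>\<^sub>1"
      using ae[OF l]
    proof eventually_elim
      case (elim z)
      have "(\<Sum>\<xi>\<in>\<Lambda>\<^sub>1. (gen_deriv \<alpha> (b \<xi>) z)\<^sup>2) \<le> (\<Sum>\<xi>\<in>\<Lambda>\<^sub>1. deriv_sq (length is) (b \<xi>) z)"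
        by (intro sum_mono gen_deriv_sq_le mo)
      then have "L2_set (\<lambda>\<xi>. gen_deriv \<alpha> (b \<xi>) z) \<Lambda>\<^sub>1 \<le> \<bar>M (length is)\<bar>"
        using elim unfolding L2_set_def by (intro real_le_lsqrt) (auto intro: sum_nonneg)
      then have L: "L2_set (\<lambda>\<xi>. gen_deriv \<alpha> (b \<xi>) z) \<Lambda>\<^sub>1 \<le> Mx" using Mx_ge[OF l] by linarith
      have "\<bar>\<Sum>\<xi>\<in>\<Lambda>\<^sub>1. e \<xi> * gen_deriv \<alpha> (b \<xi>) z\<bar> \<le> (\<Sum>\<xi>\<in>\<Lambda>\<^sub>1. \<bar>e \<xi>\<bar> * \<bar>gen_deriv \<alpha> (b \<xi>) z\<bar>)"
        by (rule order_trans[OF sum_abs]) (simp add: abs_mult)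
      also have "\<dots> \<le> L2_set e \<Lambda>\<^sub>1 * L2_set (\<lambda>\<xi>. gen_deriv \<alpha> (b \<xi>) z) \<Lambda>\<^sub>1" by (rule L2_set_mult_ineq)
      also have "\<dots> \<le> L2_set e \<Lambda>\<^sub>1 * Mx" using L by (intro mult_left_mono) auto
      finally show ?case by (simp add: mult.commute)
    qed
  qed
  finally show "\<bar>foldr partial is (\<lambda>x. \<Sum>\<xi>\<in>\<Lambda>\<^sub>1. e \<xi> * moll n b \<xi> x) x\<bar> \<le> Mx * L2_set e \<Lambda>\<^sub>1" .
qed

lemma reg_q: "k \<le> m \<Longrightarrow> AE x in lborel. (\<Sum>\<xi>\<in>\<Lambda>\<^sub>1. deriv_sq k (q \<xi>) x) \<le> (M k)\<^sup>2"
  and reg_p: "k \<le> m \<Longrightarrow> AE x in lborel. (\<Sum>\<xi>\<in>\<Lambda>\<^sub>1. deriv_sq k (p \<xi>) x) \<le> (M k)\<^sup>2"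
  and reg_c: "k \<le> m \<Longrightarrow> AE x in lborel. deriv_sq k c x \<le> (M k)\<^sup>2"
proof -
  assume k: "k \<le> m"
  have nn: "0 \<le> (\<Sum>\<xi>\<in>\<Lambda>\<^sub>1. deriv_sq k (q \<xi>) x)" "0 \<le> (\<Sum>\<xi>\<in>\<Lambda>\<^sub>1. deriv_sq k (p \<xi>) x)" "0 \<le> deriv_sq k c x" for x
    by (intro sum_nonneg deriv_sq_nonneg)+
  show "AE x in lborel. (\<Sum>\<xi>\<in>\<Lambda>\<^sub>1. deriv_sq k (q \<xi>) x) \<le> (M k)\<^sup>2"
    using regD(5)[OF k]
  proof eventually_elim
    case (elim x)
    then show ?case using nn[of x] unfolding sum.distrib by linarith
  qed
  show "AE x in lborel. (\<Sum>\<xi>\<in>\<Lambda>\<^sub>1. deriv_sq k (p \<xi>) x) \<le> (M k)\<^sup>2"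
    using regD(5)[OF k]
  proof eventually_elim
    case (elim x)
    then show ?case using nn[of x] unfolding sum.distrib by linarith
  qed
  show "AE x in lborel. deriv_sq k c x \<le> (M k)\<^sup>2"
    using regD(5)[OF k]
  proof eventually_elim
    case (elim x)
    then show ?case using nn[of x] unfolding sum.distrib by linarith
  qed
qed

lemma conv_c_bd: "bd m Mx (conv c (bump n))"
  unfolding bd_def
proof (intro allI impI)
  fix "is" :: "'d list" and x :: "real^'d" assume l: "length is \<le> m"
  define \<alpha> where "\<alpha> = (\<lambda>i. count_list is i)"
  have cc: "\<forall>i. count_list is i = \<alpha> i" by (simp add: \<alpha>_def)
  have mo: "mi_order \<alpha> = length is" by (rule mi_order_count[OF cc])
  have h: "has_gen_deriv \<alpha> c (gen_deriv \<alpha> c)" by (rule Bspace_has_gen_deriv[OF regD(3)]) (use mo l in simp)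
  have "\<bar>conv (gen_deriv \<alpha> c) (bump n) x\<bar> \<le> Mx"
  proof (rule conv_bump_abs_le)
    show "locally_integrable (gen_deriv \<alpha> c)" using h by (simp add: has_gen_deriv_def)
    show "AE z in lborel. \<bar>gen_deriv \<alpha> c z\<bar> \<le> Mx" using reg_c[OF l]
    proof eventually_elim
      case (elim z)
      then have "(gen_deriv \<alpha> c z)\<^sup>2 \<le> (M (length is))\<^sup>2" using gen_deriv_sq_le[OF mo, of c z] by linarith
      then have "\<bar>gen_deriv \<alpha> c z\<bar> \<le> \<bar>M (length is)\<bar>" by (simp only: abs_le_square_iff)
      then show ?case using Mx_ge[OF l] by linarith
    qed
  qed
  then show "\<bar>foldr partial is (conv c (bump n)) x\<bar> \<le> Mx"
    by (simp add: conv_pderivs[OF Bspace_bmeas[OF regD(3)] bump_test] conv_gen_deriv[OF h cc bump_test])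
qed

lemma bdiff_sq_smb: "smb \<phi> \<Longrightarrow> smb (bdiff_sq \<Lambda>\<^sub>1 \<l> \<tau>\<^sub>0 \<tau> k h \<phi>)"
  unfolding bdiff_sq_def[abs_def] power2_abs by (intro smb_sum smb_power bDs_smb pw_subset)

lemma bdiff_sq_nonneg: "0 \<le> bdiff_sq \<Lambda>\<^sub>1 \<l> \<tau>\<^sub>0 \<tau> k h \<phi> x"
  unfolding bdiff_sq_def by (intro sum_nonneg) auto

text \<open>At the point \<open>z\<close> the inequality is applied to the translate of
  \<open>\<phi>\<close> that takes at \<open>z\<close> the value of \<open>\<phi>\<close> at
  \<open>x\<close>. The differences of \<open>\<phi>\<close> are thus evaluated at the fixed point
  \<open>x\<close> and the coefficients at \<open>z\<close>, and both sides, being linear in the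
  coefficients, can be averaged over \<open>z\<close>. The term with \<K> depends on
  \<open>z\<close> also through the translate and is therefore replaced by its bound
  beforehand.\<close>

lemma conv_str1:
  assumes h: "0 < h" "h \<le> h0" and phi: "smb \<phi>" and B: "\<And>y. bdiff_sq \<Lambda>\<^sub>1 \<l> \<tau>\<^sub>0 \<tau> 1 h \<phi> y \<le> B"
  shows "Aform \<Lambda>\<^sub>1 \<l> \<tau>\<^sub>0 \<tau> (moll n q) (moll n p) h \<phi> x
      \<le> (1 - \<delta>) * (\<Sum>\<xi>\<in>LM. Qform \<Lambda>\<^sub>1 (moll n q) (moll n p) h (bD h \<xi> \<phi>) x) + K * Qform \<Lambda>\<^sub>1 (moll n q) (moll n p) h \<phi> x
        + 2 * (1 - \<delta>) * conv c (bump n) x * B"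
proof -
  obtain \<K> where KK: "\<K> \<in> Kops" and ineq: "\<And>\<phi> x. smooth \<phi> \<Longrightarrow> bounded (range (bdiff_sq \<Lambda>\<^sub>1 \<l> \<tau>\<^sub>0 \<tau> 1 h \<phi>)) \<Longrightarrow>
      real m * Aform \<Lambda>\<^sub>1 \<l> \<tau>\<^sub>0 \<tau> q p h \<phi> x
       \<le> (1 - \<delta>) * (\<Sum>\<xi>\<in>LM. Qform \<Lambda>\<^sub>1 q p h (bD h \<xi> \<phi>) x) + K * Qform \<Lambda>\<^sub>1 q p h \<phi> x
          + 2 * (1 - \<delta>) * c x * \<K> (bdiff_sq \<Lambda>\<^sub>1 \<l> \<tau>\<^sub>0 \<tau> 1 h \<phi>) x"
    using str1 h unfolding first_structural_def by blast
  have B0: "0 \<le> B" using order_trans[OF bdiff_sq_nonneg B] .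
  have pt: "\<forall>z. real m * AF (\<lambda>\<xi> \<zeta>. bD h \<xi> (q \<zeta>) z) (\<lambda>\<xi> \<zeta>. bD h \<xi> (p \<zeta>) z) h \<phi> x
     \<le> (1 - \<delta>) * (\<Sum>\<xi>\<in>LM. QF (\<lambda>\<zeta>. q \<zeta> z) (\<lambda>\<zeta>. p \<zeta> z) h (bD h \<xi> \<phi>) x)
      + K * QF (\<lambda>\<zeta>. q \<zeta> z) (\<lambda>\<zeta>. p \<zeta> z) h \<phi> x + 2 * (1 - \<delta>) * c z * B"
  proof (rule allI, goal_cases)
    case (1 z)
    define \<psi> where "\<psi> = (\<lambda>y. \<phi> (y + (x - z)))"
    have ps: "smb \<psi>" unfolding \<psi>_def by (rule smb_shift[OF phi])
    have "\<K> (bdiff_sq \<Lambda>\<^sub>1 \<l> \<tau>\<^sub>0 \<tau> 1 h \<psi>) z \<le> B"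
      by (rule Kops_le[OF KK smb_bounded_borel[OF bdiff_sq_smb[OF ps]] _ B0]) (unfold \<psi>_def bdiff_sq_translate, rule B)
    then have Kle: "2 * (1 - \<delta>) * c z * \<K> (bdiff_sq \<Lambda>\<^sub>1 \<l> \<tau>\<^sub>0 \<tau> 1 h \<psi>) z \<le> 2 * (1 - \<delta>) * c z * B"
      using delta c0(1) c0(2)[of z] by (intro mult_left_mono) auto
    have "Aform \<Lambda>\<^sub>1 \<l> \<tau>\<^sub>0 \<tau> q p h \<psi> z = AF (\<lambda>\<xi> \<zeta>. bD h \<xi> (q \<zeta>) z) (\<lambda>\<xi> \<zeta>. bD h \<xi> (p \<zeta>) z) h \<phi> x"
      unfolding Aform_AF \<psi>_def AF_translate by simp
    moreover have "(\<Sum>\<xi>\<in>LM. Qform \<Lambda>\<^sub>1 q p h (bD h \<xi> \<psi>) z) = (\<Sum>\<xi>\<in>LM. QF (\<lambda>\<zeta>. q \<zeta> z) (\<lambda>\<zeta>. p \<zeta> z) h (bD h \<xi> \<phi>) x)"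
      unfolding Qform_QF \<psi>_def by (intro sum.cong refl) (simp add: bD_translate QF_translate)
    moreover have "Qform \<Lambda>\<^sub>1 q p h \<psi> z = QF (\<lambda>\<zeta>. q \<zeta> z) (\<lambda>\<zeta>. p \<zeta> z) h \<phi> x"
      unfolding Qform_QF \<psi>_def QF_translate by simp
    ultimately have "real m * AF (\<lambda>\<xi> \<zeta>. bD h \<xi> (q \<zeta>) z) (\<lambda>\<xi> \<zeta>. bD h \<xi> (p \<zeta>) z) h \<phi> x
     \<le> (1 - \<delta>) * (\<Sum>\<xi>\<in>LM. QF (\<lambda>\<zeta>. q \<zeta> z) (\<lambda>\<zeta>. p \<zeta> z) h (bD h \<xi> \<phi>) x)
      + K * QF (\<lambda>\<zeta>. q \<zeta> z) (\<lambda>\<zeta>. p \<zeta> z) h \<phi> x + 2 * (1 - \<delta>) * c z * \<K> (bdiff_sq \<Lambda>\<^sub>1 \<l> \<tau>\<^sub>0 \<tau> 1 h \<psi>) z"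
      using ineq[OF smb_smooth[OF ps] lipb_bounded[OF smb_lipb[OF bdiff_sq_smb[OF ps]]], of z] by simp
    then show ?case using Kle by linarith
  qed
  have hcb: "has_conv n x (\<lambda>z. bD h \<xi> (q \<zeta>) z) (bD h \<xi> (moll n q \<zeta>) x)" "has_conv n x (\<lambda>z. bD h \<xi> (p \<zeta>) z) (bD h \<xi> (moll n p \<zeta>) x)"
    if "\<xi> \<in> LM" "\<zeta> \<in> \<Lambda>\<^sub>1" for \<xi> \<zeta>
    using has_conv_bDs[of \<zeta> "[\<xi>]" n x h] that by auto
  have "real m * AF (\<lambda>\<xi> \<zeta>. bD h \<xi> (moll n q \<zeta>) x) (\<lambda>\<xi> \<zeta>. bD h \<xi> (moll n p \<zeta>) x) h \<phi> x
     \<le> (1 - \<delta>) * (\<Sum>\<xi>\<in>LM. QF (\<lambda>\<zeta>. moll n q \<zeta> x) (\<lambda>\<zeta>. moll n p \<zeta> x) h (bD h \<xi> \<phi>) x)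
      + K * QF (\<lambda>\<zeta>. moll n q \<zeta> x) (\<lambda>\<zeta>. moll n p \<zeta> x) h \<phi> x + 2 * (1 - \<delta>) * conv c (bump n) x * B"
    by (rule has_conv_mono[where n = n and x = x, OF _ _ pt])
      (intro has_conv_cmult has_conv_sum has_conv_add has_conv_multc AF_has_conv QF_has_conv hcb has_conv_moll has_conv_c; assumption)+
  then have mA: "real m * Aform \<Lambda>\<^sub>1 \<l> \<tau>\<^sub>0 \<tau> (moll n q) (moll n p) h \<phi> x
      \<le> (1 - \<delta>) * (\<Sum>\<xi>\<in>LM. Qform \<Lambda>\<^sub>1 (moll n q) (moll n p) h (bD h \<xi> \<phi>) x) + K * Qform \<Lambda>\<^sub>1 (moll n q) (moll n p) h \<phi> x
        + 2 * (1 - \<delta>) * conv c (bump n) x * B" (is "_ \<le> ?R")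
    unfolding Aform_AF Qform_QF .
  have Qnn: "0 \<le> Qform \<Lambda>\<^sub>1 (moll n q) (moll n p) h \<psi> x" for \<psi>
    unfolding Qform_def by (intro sum_nonneg mult_nonneg_nonneg conv_nn h) auto
  have "0 \<le> conv c (bump n) x" using conv_c0[of n x] c0(1) by linarith
  then have R0: "0 \<le> ?R" using Qnn delta K1 B0 by (intro add_nonneg_nonneg mult_nonneg_nonneg sum_nonneg) auto
  show ?thesis
  proof (cases "Aform \<Lambda>\<^sub>1 \<l> \<tau>\<^sub>0 \<tau> (moll n q) (moll n p) h \<phi> x \<le> 0")
    case True
    then show ?thesis using R0 by linarith
  next
    case False
    then have "1 * Aform \<Lambda>\<^sub>1 \<l> \<tau>\<^sub>0 \<tau> (moll n q) (moll n p) h \<phi> x \<le> real m * Aform \<Lambda>\<^sub>1 \<l> \<tau>\<^sub>0 \<tau> (moll n q) (moll n p) h \<phi> x"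
      using m3 by (intro mult_right_mono) auto
    then show ?thesis using mA by linarith
  qed
qed

text \<open>The translation argument is that of the first inequality. By linearity of \<K> the
  family is summed before \<K> is estimated, so that only suprema of the summed squares
  appear.\<close>

lemma conv_str2:
  fixes \<phi> :: "(real^'d) list \<Rightarrow> real^'d \<Rightarrow> real"
  assumes h: "0 < h" "h \<le> h0" and N: "2 \<le> N" "N \<le> m" and I: "finite I" and phi: "\<And>i. i \<in> I \<Longrightarrow> smb (\<phi> i)"
    and B1: "\<And>y. (\<Sum>i\<in>I. bdiff_sq \<Lambda>\<^sub>1 \<l> \<tau>\<^sub>0 \<tau> 1 h (\<phi> i) y) \<le> B1" and B2: "\<And>y. (\<Sum>i\<in>I. bdiff_sq \<Lambda>\<^sub>1 \<l> \<tau>\<^sub>0 \<tau> 2 h (\<phi> i) y) \<le> B2"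
  shows "(\<Sum>i\<in>I. real N * (\<Sum>\<nu>\<in>LM. Aform \<Lambda>\<^sub>1 \<l> \<tau>\<^sub>0 \<tau> (moll n q) (moll n p) h (bD h \<nu> (\<phi> i)) x)
         + real N * (real N - 1) * (\<Sum>\<mu>\<in>pw 2. bDs h \<mu> (\<phi> i) x * Qop \<Lambda>\<^sub>1 \<l> \<tau>\<^sub>0 \<tau> (moll n q) h \<mu> (shifts \<Lambda>\<^sub>1 h \<mu> (\<phi> i)) x))
      \<le> (\<Sum>i\<in>I. (1 - \<delta>) * (\<Sum>\<mu>\<in>pw 2. Qform \<Lambda>\<^sub>1 (moll n q) (moll n p) h (bDs h \<mu> (\<phi> i)) x)
          + K * (\<Sum>\<xi>\<in>LM. Qform \<Lambda>\<^sub>1 (moll n q) (moll n p) h (bD h \<xi> (\<phi> i)) x))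
          + 2 * (1 - \<delta>) * conv c (bump n) x * B2 + K * B1"
proof -
  obtain \<K> where KK: "\<K> \<in> Kops" and ineq: "\<And>\<phi> x. smooth \<phi> \<Longrightarrow> bounded (range (bdiff_sq \<Lambda>\<^sub>1 \<l> \<tau>\<^sub>0 \<tau> 1 h \<phi>)) \<Longrightarrow>
      bounded (range (bdiff_sq \<Lambda>\<^sub>1 \<l> \<tau>\<^sub>0 \<tau> 2 h \<phi>)) \<Longrightarrow>
       real N * (\<Sum>\<nu>\<in>LM. Aform \<Lambda>\<^sub>1 \<l> \<tau>\<^sub>0 \<tau> q p h (bD h \<nu> \<phi>) x)
         + real N * (real N - 1) * (\<Sum>\<mu>\<in>pw 2. bDs h \<mu> \<phi> x * Qop \<Lambda>\<^sub>1 \<l> \<tau>\<^sub>0 \<tau> q h \<mu> (shifts \<Lambda>\<^sub>1 h \<mu> \<phi>) x)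
       \<le> (1 - \<delta>) * (\<Sum>\<mu>\<in>pw 2. Qform \<Lambda>\<^sub>1 q p h (bDs h \<mu> \<phi>) x)
          + K * (\<Sum>\<xi>\<in>LM. Qform \<Lambda>\<^sub>1 q p h (bD h \<xi> \<phi>) x)
          + 2 * (1 - \<delta>) * c x * \<K> (bdiff_sq \<Lambda>\<^sub>1 \<l> \<tau>\<^sub>0 \<tau> 2 h \<phi>) x + K * \<K> (bdiff_sq \<Lambda>\<^sub>1 \<l> \<tau>\<^sub>0 \<tau> 1 h \<phi>) x"
  proof -
    have "N \<in> {1..m}" using N by auto
    then show thesis using that str2 h unfolding second_structural_def by blast
  qed
  have B10: "0 \<le> B1" using order_trans[OF sum_nonneg B1] bdiff_sq_nonneg by blast
  have B20: "0 \<le> B2" using order_trans[OF sum_nonneg B2] bdiff_sq_nonneg by blast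
  have pt: "\<forall>z. (\<Sum>i\<in>I. real N * (\<Sum>\<nu>\<in>LM. AF (\<lambda>\<xi> \<zeta>. bD h \<xi> (q \<zeta>) z) (\<lambda>\<xi> \<zeta>. bD h \<xi> (p \<zeta>) z) h (bD h \<nu> (\<phi> i)) x)
         + real N * (real N - 1) * (\<Sum>\<mu>\<in>pw 2. bDs h \<mu> (\<phi> i) x * Q2 (\<lambda>\<mu> \<zeta>. bDs h \<mu> (q \<zeta>) z) h \<mu> (shifts \<Lambda>\<^sub>1 h \<mu> (\<phi> i)) x))
      \<le> (\<Sum>i\<in>I. (1 - \<delta>) * (\<Sum>\<mu>\<in>pw 2. QF (\<lambda>\<zeta>. q \<zeta> z) (\<lambda>\<zeta>. p \<zeta> z) h (bDs h \<mu> (\<phi> i)) x)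
          + K * (\<Sum>\<xi>\<in>LM. QF (\<lambda>\<zeta>. q \<zeta> z) (\<lambda>\<zeta>. p \<zeta> z) h (bD h \<xi> (\<phi> i)) x))
          + 2 * (1 - \<delta>) * c z * B2 + K * B1"
  proof (rule allI, goal_cases)
    case (1 z)
    define \<psi> where "\<psi> = (\<lambda>i y. \<phi> i (y + (x - z)))"
    have ps: "smb (\<psi> i)" if "i \<in> I" for i unfolding \<psi>_def by (rule smb_shift[OF phi[OF that]])
    define k1 where "k1 = (\<lambda>i. \<K> (bdiff_sq \<Lambda>\<^sub>1 \<l> \<tau>\<^sub>0 \<tau> 1 h (\<psi> i)) z)"
    define k2 where "k2 = (\<lambda>i. \<K> (bdiff_sq \<Lambda>\<^sub>1 \<l> \<tau>\<^sub>0 \<tau> 2 h (\<psi> i)) z)"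
    have Ks: "(\<Sum>i\<in>I. \<K> (bdiff_sq \<Lambda>\<^sub>1 \<l> \<tau>\<^sub>0 \<tau> k h (\<psi> i)) z) \<le> B"
      if "\<And>y. (\<Sum>i\<in>I. bdiff_sq \<Lambda>\<^sub>1 \<l> \<tau>\<^sub>0 \<tau> k h (\<phi> i) y) \<le> B" "0 \<le> B" for k B
    proof -
      have "\<K> (\<lambda>y. \<Sum>i\<in>I. bdiff_sq \<Lambda>\<^sub>1 \<l> \<tau>\<^sub>0 \<tau> k h (\<psi> i) y) z \<le> B"
        by (rule Kops_le[OF KK smb_bounded_borel[OF smb_sum[OF bdiff_sq_smb[OF ps]]] _ that(2)])
          (unfold \<psi>_def bdiff_sq_translate, assumption, rule that(1))
      then show ?thesis using Kops_sum[OF KK I, of "\<lambda>i. bdiff_sq \<Lambda>\<^sub>1 \<l> \<tau>\<^sub>0 \<tau> k h (\<psi> i)"] bdiff_sq_smb[OF ps] by (simp only: fun_eq_iff)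
    qed
    have k1: "(\<Sum>i\<in>I. k1 i) \<le> B1" unfolding k1_def by (rule Ks[OF B1 B10])
    have k2: "(\<Sum>i\<in>I. k2 i) \<le> B2" unfolding k2_def by (rule Ks[OF B2 B20])
    have "(\<Sum>i\<in>I. real N * (\<Sum>\<nu>\<in>LM. AF (\<lambda>\<xi> \<zeta>. bD h \<xi> (q \<zeta>) z) (\<lambda>\<xi> \<zeta>. bD h \<xi> (p \<zeta>) z) h (bD h \<nu> (\<phi> i)) x)
         + real N * (real N - 1) * (\<Sum>\<mu>\<in>pw 2. bDs h \<mu> (\<phi> i) x * Q2 (\<lambda>\<mu> \<zeta>. bDs h \<mu> (q \<zeta>) z) h \<mu> (shifts \<Lambda>\<^sub>1 h \<mu> (\<phi> i)) x))
      \<le> (\<Sum>i\<in>I. ((1 - \<delta>) * (\<Sum>\<mu>\<in>pw 2. QF (\<lambda>\<zeta>. q \<zeta> z) (\<lambda>\<zeta>. p \<zeta> z) h (bDs h \<mu> (\<phi> i)) x)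
          + K * (\<Sum>\<xi>\<in>LM. QF (\<lambda>\<zeta>. q \<zeta> z) (\<lambda>\<zeta>. p \<zeta> z) h (bD h \<xi> (\<phi> i)) x))
          + 2 * (1 - \<delta>) * c z * k2 i + K * k1 i)"
    proof (rule sum_mono)
      fix i assume i: "i \<in> I"
      have zx: "z + (x - z) = x" by simp
      have 1: "(\<Sum>\<nu>\<in>LM. Aform \<Lambda>\<^sub>1 \<l> \<tau>\<^sub>0 \<tau> q p h (bD h \<nu> (\<psi> i)) z) = (\<Sum>\<nu>\<in>LM. AF (\<lambda>\<xi> \<zeta>. bD h \<xi> (q \<zeta>) z) (\<lambda>\<xi> \<zeta>. bD h \<xi> (p \<zeta>) z) h (bD h \<nu> (\<phi> i)) x)"
        unfolding Aform_AF \<psi>_def by (intro sum.cong refl) (simp add: bD_translate AF_translate)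
      have 2: "(\<Sum>\<mu>\<in>pw 2. bDs h \<mu> (\<psi> i) z * Qop \<Lambda>\<^sub>1 \<l> \<tau>\<^sub>0 \<tau> q h \<mu> (shifts \<Lambda>\<^sub>1 h \<mu> (\<psi> i)) z)
        = (\<Sum>\<mu>\<in>pw 2. bDs h \<mu> (\<phi> i) x * Q2 (\<lambda>\<mu> \<zeta>. bDs h \<mu> (q \<zeta>) z) h \<mu> (shifts \<Lambda>\<^sub>1 h \<mu> (\<phi> i)) x)"
        unfolding Qop_Q2 \<psi>_def by (intro sum.cong refl) (simp add: bDs_translate pw_subset shifts_translate Q2_translate)
      have 3: "(\<Sum>\<mu>\<in>pw 2. Qform \<Lambda>\<^sub>1 q p h (bDs h \<mu> (\<psi> i)) z) = (\<Sum>\<mu>\<in>pw 2. QF (\<lambda>\<zeta>. q \<zeta> z) (\<lambda>\<zeta>. p \<zeta> z) h (bDs h \<mu> (\<phi> i)) x)"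
        unfolding Qform_QF \<psi>_def by (intro sum.cong refl) (simp add: bDs_translate pw_subset QF_translate)
      have 4: "(\<Sum>\<xi>\<in>LM. Qform \<Lambda>\<^sub>1 q p h (bD h \<xi> (\<psi> i)) z) = (\<Sum>\<xi>\<in>LM. QF (\<lambda>\<zeta>. q \<zeta> z) (\<lambda>\<zeta>. p \<zeta> z) h (bD h \<xi> (\<phi> i)) x)"
        unfolding Qform_QF \<psi>_def by (intro sum.cong refl) (simp add: bD_translate QF_translate)
      show "real N * (\<Sum>\<nu>\<in>LM. AF (\<lambda>\<xi> \<zeta>. bD h \<xi> (q \<zeta>) z) (\<lambda>\<xi> \<zeta>. bD h \<xi> (p \<zeta>) z) h (bD h \<nu> (\<phi> i)) x)
         + real N * (real N - 1) * (\<Sum>\<mu>\<in>pw 2. bDs h \<mu> (\<phi> i) x * Q2 (\<lambda>\<mu> \<zeta>. bDs h \<mu> (q \<zeta>) z) h \<mu> (shifts \<Lambda>\<^sub>1 h \<mu> (\<phi> i)) x)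
        \<le> ((1 - \<delta>) * (\<Sum>\<mu>\<in>pw 2. QF (\<lambda>\<zeta>. q \<zeta> z) (\<lambda>\<zeta>. p \<zeta> z) h (bDs h \<mu> (\<phi> i)) x)
          + K * (\<Sum>\<xi>\<in>LM. QF (\<lambda>\<zeta>. q \<zeta> z) (\<lambda>\<zeta>. p \<zeta> z) h (bD h \<xi> (\<phi> i)) x))
          + 2 * (1 - \<delta>) * c z * k2 i + K * k1 i"
        using ineq[OF smb_smooth[OF ps[OF i]] lipb_bounded[OF smb_lipb[OF bdiff_sq_smb[OF ps[OF i]]]]
            lipb_bounded[OF smb_lipb[OF bdiff_sq_smb[OF ps[OF i]]]], of z]
        unfolding 1 2 3 4 k1_def k2_def .
    qed
    also have "\<dots> = (\<Sum>i\<in>I. (1 - \<delta>) * (\<Sum>\<mu>\<in>pw 2. QF (\<lambda>\<zeta>. q \<zeta> z) (\<lambda>\<zeta>. p \<zeta> z) h (bDs h \<mu> (\<phi> i)) x)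
          + K * (\<Sum>\<xi>\<in>LM. QF (\<lambda>\<zeta>. q \<zeta> z) (\<lambda>\<zeta>. p \<zeta> z) h (bD h \<xi> (\<phi> i)) x))
          + 2 * (1 - \<delta>) * c z * (\<Sum>i\<in>I. k2 i) + K * (\<Sum>i\<in>I. k1 i)"
      by (simp only: sum.distrib sum_distrib_left)
    also have "\<dots> \<le> (\<Sum>i\<in>I. (1 - \<delta>) * (\<Sum>\<mu>\<in>pw 2. QF (\<lambda>\<zeta>. q \<zeta> z) (\<lambda>\<zeta>. p \<zeta> z) h (bDs h \<mu> (\<phi> i)) x)
          + K * (\<Sum>\<xi>\<in>LM. QF (\<lambda>\<zeta>. q \<zeta> z) (\<lambda>\<zeta>. p \<zeta> z) h (bD h \<xi> (\<phi> i)) x))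
          + 2 * (1 - \<delta>) * c z * B2 + K * B1"
      using k1 k2 delta c0(1) c0(2)[of z] K1 by (intro add_mono order_refl mult_left_mono) auto
    finally show ?case .
  qed
  have hcb: "has_conv n x (\<lambda>z. bD h \<xi> (q \<zeta>) z) (bD h \<xi> (moll n q \<zeta>) x)" "has_conv n x (\<lambda>z. bD h \<xi> (p \<zeta>) z) (bD h \<xi> (moll n p \<zeta>) x)"
    if "\<xi> \<in> LM" "\<zeta> \<in> \<Lambda>\<^sub>1" for \<xi> \<zeta>
    using has_conv_bDs[of \<zeta> "[\<xi>]" n x h] that by auto
  have hcq: "has_conv n x (\<lambda>z. bDs h \<mu> (q \<zeta>) z) (bDs h \<mu> (moll n q \<zeta>) x)" if "\<mu> \<in> pw 2" "\<zeta> \<in> \<Lambda>\<^sub>1" for \<mu> \<zeta>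
    using has_conv_bDs(1)[OF that(2) pw_subset[OF that(1)], of n x h] pw_length[OF that(1)] by simp
  show ?thesis
    unfolding Aform_AF Qform_QF Qop_Q2
    by (rule has_conv_mono[where n = n and x = x, OF _ _ pt])
      (intro has_conv_sum has_conv_add has_conv_cmult has_conv_multc has_conv_const AF_has_conv QF_has_conv Q2_has_conv hcb hcq has_conv_moll has_conv_c; assumption)+
qed

lemma smooth: "smooth_scheme \<Lambda>\<^sub>1 \<l> \<tau>\<^sub>0 \<tau> (moll n q) (moll n p) (conv c (bump n)) h0 \<delta> K c0 Mx m"
proof unfold_locales
  show "cbd m Mx (moll n q)" by (rule moll_cbd_gen[OF regD(1) reg_q])
  show "cbd m Mx (moll n p)" by (rule moll_cbd_gen[OF regD(2) reg_p])
qed (rule delta K1 c0 conv_c0 moll_smb conv_nn conv_centered Mx_nonneg conv_c_bd conv_str1 conv_str2; assumption)+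

end

subsection \<open>Extrapolation weights\<close>

text \<open>The columns of a right inverse are the coefficients of the Lagrange polynomials for the
  nodes \<open>b ^ k\<close>. The matrix is symmetric, so its right inverse is symmetric too and
  hence also a left inverse.\<close>

lemma vandermonde_inverse:
  fixes b :: real
  assumes b: "0 < b" "b < 1"
  shows "\<exists>W. \<forall>i<n. \<forall>j<n. (\<Sum>r<n. b ^ (i * r) * W r j) = (if i = j then 1 else 0)
    \<and> (\<Sum>r<n. W i r * b ^ (r * j)) = (if i = j then 1 else 0)"
proof -
  define V where "V = (\<lambda>i r. b ^ (i * r))"
  define P where "P = (\<lambda>j. \<Prod>k\<in>{..<n} - {j}. smult (1 / (b ^ j - b ^ k)) [:- (b ^ k), 1:])"
  define W where "W = (\<lambda>r j. coeff (P j) r)"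
  have ne: "b ^ j \<noteq> b ^ k" if "j \<noteq> k" for j k :: nat
    using that b power_inject_exp'[of b j k] by auto
  have deg: "degree (P j) < n" if "j < n" for j
  proof -
    have "degree (P j) \<le> (\<Sum>k\<in>{..<n} - {j}. degree (smult (1 / (b ^ j - b ^ k)) [:- (b ^ k), 1:]))"
      unfolding P_def by (rule degree_prod_sum_le[unfolded o_def]) simp
    also have "\<dots> \<le> (\<Sum>k\<in>{..<n} - {j}. 1)"
      by (intro sum_mono order_trans[OF degree_smult_le]) simp
    also have "\<dots> = n - 1" using that by simp
    finally show ?thesis using that by simp
  qed
  have right: "(\<Sum>r<n. V i r * W r j) = (if i = j then 1 else 0)" if "i < n" "j < n" for i j
  proof -
    have "(\<Sum>r<n. V i r * W r j) = (\<Sum>r\<le>degree (P j). coeff (P j) r * (b ^ i) ^ r)"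
      unfolding V_def W_def using deg[OF that(2)]
      by (intro sum.mono_neutral_cong_right) (auto simp: mult.commute coeff_eq_0 simp flip: power_mult)
    also have "\<dots> = poly (P j) (b ^ i)" by (simp add: poly_altdef)
    also have "\<dots> = (\<Prod>k\<in>{..<n} - {j}. (b ^ i - b ^ k) / (b ^ j - b ^ k))"
      unfolding P_def by (simp add: poly_prod diff_divide_distrib)
    also have "\<dots> = (if i = j then 1 else 0)"
    proof (cases "i = j")
      case True
      have "(b ^ i - b ^ k) / (b ^ j - b ^ k) = 1" if "k \<in> {..<n} - {j}" for k using ne[of j k] that True by auto
      then show ?thesis using True by simp
    next
      case False
      then have "\<exists>k\<in>{..<n} - {j}. (b ^ i - b ^ k) / (b ^ j - b ^ k) = 0" using that by (intro bexI[of _ i]) auto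
      then show ?thesis using False by (subst prod_zero) auto
    qed
    finally show ?thesis .
  qed
  have sym: "W i j = W j i" if ij: "i < n" "j < n" for i j
  proof -
    have "W i j = (\<Sum>s<n. (if i = s then 1 else 0) * W s j)"
      using ij by (simp add: if_distrib[of "\<lambda>t. t * _"] cong: if_cong)
    also have "\<dots> = (\<Sum>s<n. (\<Sum>r<n. V s r * W r i) * W s j)"
      using ij by (intro sum.cong refl) (simp add: right)
    also have "\<dots> = (\<Sum>r<n. (\<Sum>s<n. V r s * W s j) * W r i)"
      unfolding sum_distrib_right by (subst sum.swap) (simp add: V_def mult_ac)
    also have "\<dots> = (\<Sum>r<n. (if r = j then 1 else 0) * W r i)"
      using ij by (intro sum.cong refl) (simp add: right)
    also have "\<dots> = W j i" using ij by (simp add: if_distrib[of "\<lambda>t. t * _"] cong: if_cong)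
    finally show ?thesis .
  qed
  have left: "(\<Sum>r<n. W i r * V r j) = (if i = j then 1 else 0)" if "i < n" "j < n" for i j
  proof -
    have "(\<Sum>r<n. W i r * V r j) = (\<Sum>r<n. V j r * W r i)"
      using that by (intro sum.cong refl) (simp add: V_def mult.commute sym)
    then show ?thesis using right[OF that(2,1)] by simp
  qed
  show ?thesis using left right unfolding V_def by blast
qed

text \<open>The first row of the inverse times the matrix is the first unit vector. These moment
  conditions make the combination exact for constants and cancel the powers of the step.\<close>

lemma first_row_inverse_vandermonde:
  fixes b :: real
  assumes "0 < b" "b < 1" "t < n"
  shows "(\<Sum>j<n. first_row_inverse n (\<lambda>i j. b ^ (i * j)) j * (b ^ j) ^ t) = (if t = 0 then 1 else 0)"
proof -
  define W where "W = mat_inverse n (\<lambda>i j. b ^ (i * j))"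
  have W: "\<forall>i<n. \<forall>j<n. (\<Sum>r<n. b ^ (i * r) * W r j) = (if i = j then 1 else 0)
    \<and> (\<Sum>r<n. W i r * b ^ (r * j)) = (if i = j then 1 else 0)"
    unfolding W_def mat_inverse_def by (rule someI_ex[OF vandermonde_inverse[OF assms(1,2)]])
  have n: "0 < n" using assms(3) by simp
  have "first_row_inverse n (\<lambda>i j. b ^ (i * j)) j = W 0 j" for j
    unfolding first_row_inverse_def W_def[symmetric] using n
    by (simp add: if_distrib[of "\<lambda>t. t * _"] cong: if_cong)
  then have "(\<Sum>j<n. first_row_inverse n (\<lambda>i j. b ^ (i * j)) j * (b ^ j) ^ t) = (\<Sum>j<n. W 0 j * b ^ (j * t))"
    by (simp add: power_mult)
  then show ?thesis using W n assms(3) by auto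
qed

text \<open>\<open>NE\<close> unfolded to a function of numbers alone, since the constant of the
  theorem has to be chosen before any of the data.\<close>

definition cst_error :: "real \<Rightarrow> real \<Rightarrow> real \<Rightarrow> real \<Rightarrow> real \<Rightarrow> real \<Rightarrow> real \<Rightarrow> real \<Rightarrow> nat \<Rightarrow> real" where
  "cst_error d \<delta> K \<tau>\<^sub>0 c0 L T A m = (let X = (\<Sum>n\<le>m. cst_apriori d \<delta> K \<tau>\<^sub>0 c0 L T A n);
      C = 2 ^ m * (3 * A) * (1 + d * L) ^ (m + 3)
    in X * (real (m + 1) * (C * (X * (1 + real (m + 1) * (X * C)) ^ m))))"

lemma (in smooth_scheme) NE_eq: "NE = cst_error (real CARD('d)) \<delta> K \<tau>\<^sub>0 c0 LL TT Mx m"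
  by (simp add: NE_def vX_def aX_def NX_def CX_def cst_error_def Let_def)

subsection \<open>Passage to the limit\<close>

lemma lipb_conv_bump:
  fixes g :: "real^'d::finite \<Rightarrow> real"
  assumes "lipb g"
  shows "\<exists>C\<ge>0. \<forall>n x. \<bar>conv g (bump n) x - g x\<bar> \<le> C / real (Suc n)"
proof -
  obtain C where C: "C > 0" "\<And>x y. \<bar>g x - g y\<bar> \<le> C * dist x y" using assms by (metis lipbE)
  have "\<bar>conv g (bump n) x - g x\<bar> \<le> (C * real CARD('d)) / real (Suc n)" for n x
    using conv_bump_lipschitz[OF lipb_continuous[OF assms] _ C(2), of n x] C(1) by simp
  then show ?thesis using C(1) by (intro exI[of _ "C * real CARD('d)"]) auto
qed

lemma Lh_minus:
  assumes "h \<noteq> 0"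
  shows "Lh \<Lambda> q p c h (\<lambda>x. u x - w x) x = Lh \<Lambda> q p c h u x - Lh \<Lambda> q p c h w x"
proof -
  have dist: "a * (U - W - (u - w)) = a * (U - u) - a * (W - w)" for a U W u w :: real
    by (simp add: algebra_simps)
  have "(\<Sum>\<xi>\<in>\<Lambda>. (q \<xi> x + h * p \<xi> x) / h\<^sup>2 * (u (x + h *\<^sub>R \<xi>) - w (x + h *\<^sub>R \<xi>) - (u x - w x)))
    = (\<Sum>\<xi>\<in>\<Lambda>. (q \<xi> x + h * p \<xi> x) / h\<^sup>2 * (u (x + h *\<^sub>R \<xi>) - u x) - (q \<xi> x + h * p \<xi> x) / h\<^sup>2 * (w (x + h *\<^sub>R \<xi>) - w x))"
    by (intro sum.cong refl) (rule dist)
  then show ?thesis unfolding Lh_alt[OF assms] by (simp add: sum_subtractf right_diff_distrib)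
qed

text \<open>\<open>Lcal\<close> with classical derivatives, so that the equation and its
  discretisation can be compared at every point.\<close>

definition Lp :: "(real^'d::finite) set \<Rightarrow> (real^'d \<Rightarrow> real^'d \<Rightarrow> real) \<Rightarrow> (real^'d \<Rightarrow> real^'d \<Rightarrow> real) \<Rightarrow>
     (real^'d \<Rightarrow> real) \<Rightarrow> (real^'d \<Rightarrow> real) \<Rightarrow> real^'d \<Rightarrow> real" where
  "Lp \<Lambda> q p c \<phi> x = (1 / 2) * (\<Sum>\<xi>\<in>\<Lambda>. \<Sum>i\<in>UNIV. \<Sum>j\<in>UNIV. q \<xi> x * \<xi> $ i * \<xi> $ j * foldr partial [i, j] \<phi> x)
     + (\<Sum>\<xi>\<in>\<Lambda>. \<Sum>i\<in>UNIV. p \<xi> x * \<xi> $ i * foldr partial [i] \<phi> x) - c x * \<phi> x"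

lemma Lcal_Lp:
  assumes "Cb 2 \<phi>"
  shows "Lcal \<Lambda> q p c \<phi> x = Lp \<Lambda> q p c \<phi> x"
proof -
  have "gen_deriv (\<lambda>r. mi_unit i r + mi_unit j r) \<phi> = foldr partial [i, j] \<phi>" for i j
    by (rule gen_deriv_eq[OF assms]) (auto simp: mi_unit_def)
  moreover have "gen_deriv (mi_unit i) \<phi> = foldr partial [i] \<phi>" for i
    by (rule gen_deriv_eq[OF assms]) (auto simp: mi_unit_def)
  ultimately show ?thesis by (simp only: Lcal_def Lp_def)
qed

lemma dir_dir:
  assumes "smb \<phi>"
  shows "(dir \<xi> ^^ 2) \<phi> x = (\<Sum>i\<in>UNIV. \<Sum>j\<in>UNIV. \<xi> $ i * \<xi> $ j * foldr partial [i, j] \<phi> x)"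
proof -
  have c: "Cb (length [i]) (partial j \<phi>)" for i j by (rule smb_Cb[OF smb_partial[OF assms]])
  have "partial i (dir \<xi> \<phi>) x = (\<Sum>j\<in>UNIV. \<xi> $ j * partial i (partial j \<phi>) x)" for i
  proof -
    have "foldr partial [i] (\<lambda>x. \<Sum>j\<in>UNIV. \<xi> $ j * partial j \<phi> x) = (\<lambda>x. \<Sum>j\<in>UNIV. foldr partial [i] (\<lambda>x. \<xi> $ j * partial j \<phi> x) x)"
      by (rule pderivs_sum[OF _ order_refl]) (rule Cb_cmult[OF c])
    then show ?thesis using pderivs_cmult[OF c order_refl] by (simp add: dir_def[abs_def])
  qed
  then show ?thesis by (simp add: numeral_2_eq_2 dir_def[of \<xi> "dir \<xi> \<phi>"] sum_distrib_left mult.assoc)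
qed

text \<open>Only the values of the coefficients at \<open>x\<close> enter, so that the estimate can
  be used with the original coefficients and a mollified solution.\<close>

lemma consistency_smooth:
  fixes \<Lambda> :: "(real^'d::finite) set"
  assumes eta: "0 < \<eta>" and phi: "smb \<phi>" "bd 3 B \<phi>" and cen: "(\<Sum>\<xi>\<in>\<Lambda>. q \<xi> x *\<^sub>R \<xi>) = 0"
    and q: "\<And>\<xi>. \<xi> \<in> \<Lambda> \<Longrightarrow> \<bar>q \<xi> x\<bar> \<le> Q" "\<And>\<xi>. \<xi> \<in> \<Lambda> \<Longrightarrow> \<bar>p \<xi> x\<bar> \<le> Q"
  shows "\<bar>Lh \<Lambda> q p c \<eta> \<phi> x - Lp \<Lambda> q p c \<phi> x\<bar>
    \<le> (\<Sum>\<xi>\<in>\<Lambda>. Q * ((real CARD('d) * norm \<xi>) ^ 3 * B) + Q * ((real CARD('d) * norm \<xi>) ^ 2 * B)) * \<eta>"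
proof -
  define r3 where "r3 = (\<lambda>\<xi>. \<phi> (x + \<eta> *\<^sub>R \<xi>) - \<phi> x - \<eta> * dir \<xi> \<phi> x - \<eta>\<^sup>2 / 2 * (dir \<xi> ^^ 2) \<phi> x)"
  define r2 where "r2 = (\<lambda>\<xi>. \<phi> (x + \<eta> *\<^sub>R \<xi>) - \<phi> x - \<eta> * dir \<xi> \<phi> x)"
  have r3: "\<bar>r3 \<xi>\<bar> \<le> (real CARD('d) * norm \<xi>) ^ 3 * B * \<eta> ^ 3" for \<xi>
    using taylor_line[OF phi, of x \<eta> \<xi>] eta unfolding r3_def
    by (simp add: numeral_3_eq_3 numeral_2_eq_2 algebra_simps)
  have r2: "\<bar>r2 \<xi>\<bar> \<le> (real CARD('d) * norm \<xi>) ^ 2 * B * \<eta> ^ 2" for \<xi>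
    using taylor_line[OF phi(1) bd_mono[OF phi(2), of 2 B], of x \<eta> \<xi>] eta unfolding r2_def
    by (simp add: numeral_2_eq_2 algebra_simps)
  have cen': "(\<Sum>\<xi>\<in>\<Lambda>. q \<xi> x * dir \<xi> \<phi> x) = 0"
  proof -
    have "(\<Sum>\<xi>\<in>\<Lambda>. q \<xi> x * dir \<xi> \<phi> x) = (\<Sum>i\<in>UNIV. (\<Sum>\<xi>\<in>\<Lambda>. q \<xi> x *\<^sub>R \<xi>) $ i * partial i \<phi> x)"
      unfolding dir_def sum_distrib_left sum_component sum_distrib_right
      by (subst sum.swap) (simp add: mult.assoc)
    then show ?thesis using cen by simp
  qed
  have "Lp \<Lambda> q p c \<phi> x = (\<Sum>\<xi>\<in>\<Lambda>. q \<xi> x * ((dir \<xi> ^^ 2) \<phi> x / 2)) + (\<Sum>\<xi>\<in>\<Lambda>. p \<xi> x * dir \<xi> \<phi> x) - c x * \<phi> x"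
    unfolding Lp_def dir_dir[OF phi(1)]
    by (simp add: dir_def sum_distrib_left sum_divide_distrib mult_ac)
  moreover have pw: "(1 / \<eta>) * (q \<xi> x * fdiff \<eta> \<xi> \<phi> x) = (1 / \<eta>) * (q \<xi> x * dir \<xi> \<phi> x) + q \<xi> x * ((dir \<xi> ^^ 2) \<phi> x / 2) + q \<xi> x * (r3 \<xi> / \<eta>\<^sup>2)" for \<xi>
    using eta unfolding fdiff_def r3_def by (simp add: field_simps power2_eq_square)
  moreover have "(1 / \<eta>) * (\<Sum>\<xi>\<in>\<Lambda>. q \<xi> x * fdiff \<eta> \<xi> \<phi> x) = (\<Sum>\<xi>\<in>\<Lambda>. q \<xi> x * ((dir \<xi> ^^ 2) \<phi> x / 2)) + (\<Sum>\<xi>\<in>\<Lambda>. q \<xi> x * (r3 \<xi> / \<eta>\<^sup>2))"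
  proof -
    have "(1 / \<eta>) * (\<Sum>\<xi>\<in>\<Lambda>. q \<xi> x * fdiff \<eta> \<xi> \<phi> x) = (1 / \<eta>) * (\<Sum>\<xi>\<in>\<Lambda>. q \<xi> x * dir \<xi> \<phi> x)
        + (\<Sum>\<xi>\<in>\<Lambda>. q \<xi> x * ((dir \<xi> ^^ 2) \<phi> x / 2)) + (\<Sum>\<xi>\<in>\<Lambda>. q \<xi> x * (r3 \<xi> / \<eta>\<^sup>2))"
      unfolding sum_distrib_left pw by (simp only: sum.distrib)
    then show "(1 / \<eta>) * (\<Sum>\<xi>\<in>\<Lambda>. q \<xi> x * fdiff \<eta> \<xi> \<phi> x) = (\<Sum>\<xi>\<in>\<Lambda>. q \<xi> x * ((dir \<xi> ^^ 2) \<phi> x / 2)) + (\<Sum>\<xi>\<in>\<Lambda>. q \<xi> x * (r3 \<xi> / \<eta>\<^sup>2))"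
      using cen' by simp
  qed
  moreover have "p \<xi> x * fdiff \<eta> \<xi> \<phi> x = p \<xi> x * dir \<xi> \<phi> x + p \<xi> x * (r2 \<xi> / \<eta>)" for \<xi>
    using eta unfolding fdiff_def r2_def by (simp add: field_simps)
  then have "(\<Sum>\<xi>\<in>\<Lambda>. p \<xi> x * fdiff \<eta> \<xi> \<phi> x) = (\<Sum>\<xi>\<in>\<Lambda>. p \<xi> x * dir \<xi> \<phi> x) + (\<Sum>\<xi>\<in>\<Lambda>. p \<xi> x * (r2 \<xi> / \<eta>))"
    by (simp add: sum.distrib)
  ultimately have "Lh \<Lambda> q p c \<eta> \<phi> x - Lp \<Lambda> q p c \<phi> x = (\<Sum>\<xi>\<in>\<Lambda>. q \<xi> x * (r3 \<xi> / \<eta>\<^sup>2) + p \<xi> x * (r2 \<xi> / \<eta>))"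
    unfolding Lh_def by (simp add: sum.distrib)
  also have "\<bar>\<dots>\<bar> \<le> (\<Sum>\<xi>\<in>\<Lambda>. (Q * ((real CARD('d) * norm \<xi>) ^ 3 * B) + Q * ((real CARD('d) * norm \<xi>) ^ 2 * B)) * \<eta>)"
  proof (rule order_trans[OF sum_abs sum_mono])
    fix \<xi> assume xi: "\<xi> \<in> \<Lambda>"
    have Q0: "0 \<le> Q" using q(1)[OF xi] by linarith
    have "\<bar>r3 \<xi> / \<eta>\<^sup>2\<bar> \<le> (real CARD('d) * norm \<xi>) ^ 3 * B * \<eta>"
      using r3[of \<xi>] eta by (simp add: divide_le_eq power3_eq_cube power2_eq_square mult.assoc)
    then have 1: "\<bar>q \<xi> x * (r3 \<xi> / \<eta>\<^sup>2)\<bar> \<le> Q * ((real CARD('d) * norm \<xi>) ^ 3 * B * \<eta>)"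
      unfolding abs_mult using q(1)[OF xi] Q0 by (intro mult_mono) auto
    have "\<bar>r2 \<xi> / \<eta>\<bar> \<le> (real CARD('d) * norm \<xi>) ^ 2 * B * \<eta>"
      using r2[of \<xi>] eta by (simp add: divide_le_eq power2_eq_square mult.assoc)
    then have 2: "\<bar>p \<xi> x * (r2 \<xi> / \<eta>)\<bar> \<le> Q * ((real CARD('d) * norm \<xi>) ^ 2 * B * \<eta>)"
      unfolding abs_mult using q(2)[OF xi] Q0 by (intro mult_mono) auto
    show "\<bar>q \<xi> x * (r3 \<xi> / \<eta>\<^sup>2) + p \<xi> x * (r2 \<xi> / \<eta>)\<bar> \<le> (Q * ((real CARD('d) * norm \<xi>) ^ 3 * B) + Q * ((real CARD('d) * norm \<xi>) ^ 2 * B)) * \<eta>"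
      using order_trans[OF abs_triangle_ineq add_mono[OF 1 2]] by (simp add: algebra_simps)
  qed
  finally show ?thesis by (simp add: sum_distrib_right)
qed

context rough_scheme
begin

sublocale S: smooth_scheme \<Lambda>\<^sub>1 \<l> \<tau>\<^sub>0 \<tau> "moll n q" "moll n p" "conv c (bump n)" h0 \<delta> K c0 Mx m for n
  by (rule smooth)

lemma coeff_lipb: "\<xi> \<in> \<Lambda>\<^sub>1 \<Longrightarrow> lipb (q \<xi>)" "\<xi> \<in> \<Lambda>\<^sub>1 \<Longrightarrow> lipb (p \<xi>)" "lipb c" "lipb f"
  using regD(1-4) Bspace_Cb'[of _ 0] m3 by auto

lemma coeff_bounded: "\<xi> \<in> \<Lambda>\<^sub>1 \<Longrightarrow> bounded (range (q \<xi>))" "\<xi> \<in> \<Lambda>\<^sub>1 \<Longrightarrow> bounded (range (p \<xi>))"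
  using coeff_lipb lipb_bounded by auto

lemma moll_lipschitz:
  shows "\<exists>C\<ge>0. \<forall>\<xi>\<in>\<Lambda>\<^sub>1. \<forall>n x. \<bar>moll n q \<xi> x - q \<xi> x\<bar> \<le> C / real (Suc n) \<and> \<bar>moll n p \<xi> x - p \<xi> x\<bar> \<le> C / real (Suc n)"
proof -
  have "\<forall>\<xi>. \<exists>C. \<xi> \<in> \<Lambda>\<^sub>1 \<longrightarrow> 0 \<le> C \<and> (\<forall>n x. \<bar>moll n q \<xi> x - q \<xi> x\<bar> \<le> C / real (Suc n))"
    using lipb_conv_bump[OF coeff_lipb(1)] by (auto simp: moll_def on\<Lambda>_def; metis)
  then obtain a where a: "\<And>\<xi>. \<xi> \<in> \<Lambda>\<^sub>1 \<Longrightarrow> 0 \<le> a \<xi>" "\<And>\<xi> n x. \<xi> \<in> \<Lambda>\<^sub>1 \<Longrightarrow> \<bar>moll n q \<xi> x - q \<xi> x\<bar> \<le> a \<xi> / real (Suc n)" by metis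
  have "\<forall>\<xi>. \<exists>C. \<xi> \<in> \<Lambda>\<^sub>1 \<longrightarrow> 0 \<le> C \<and> (\<forall>n x. \<bar>moll n p \<xi> x - p \<xi> x\<bar> \<le> C / real (Suc n))"
    using lipb_conv_bump[OF coeff_lipb(2)] by (auto simp: moll_def on\<Lambda>_def; metis)
  then obtain b where b: "\<And>\<xi>. \<xi> \<in> \<Lambda>\<^sub>1 \<Longrightarrow> 0 \<le> b \<xi>" "\<And>\<xi> n x. \<xi> \<in> \<Lambda>\<^sub>1 \<Longrightarrow> \<bar>moll n p \<xi> x - p \<xi> x\<bar> \<le> b \<xi> / real (Suc n)" by metis
  define C where "C = (\<Sum>\<xi>\<in>\<Lambda>\<^sub>1. a \<xi> + b \<xi>)"
  have C: "a \<xi> \<le> C" "b \<xi> \<le> C" if "\<xi> \<in> \<Lambda>\<^sub>1" for \<xi>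
  proof -
    have "a \<xi> + b \<xi> \<le> C" unfolding C_def by (rule member_le_sum[OF that _ fin]) (use a b in auto)
    then show "a \<xi> \<le> C" "b \<xi> \<le> C" using a(1)[OF that] b(1)[OF that] by linarith+
  qed
  have "\<bar>moll n q \<xi> x - q \<xi> x\<bar> \<le> C / real (Suc n) \<and> \<bar>moll n p \<xi> x - p \<xi> x\<bar> \<le> C / real (Suc n)" if "\<xi> \<in> \<Lambda>\<^sub>1" for \<xi> n x
    using order_trans[OF a(2)[OF that] divide_right_mono[OF C(1)[OF that]]] order_trans[OF b(2)[OF that] divide_right_mono[OF C(2)[OF that]]] by simp
  moreover have "0 \<le> C" unfolding C_def by (intro sum_nonneg add_nonneg_nonneg a b)
  ultimately show ?thesis by blast
qed

text \<open>The difference of the two solutions solves the mollified equation with a right-hand side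
  made up of the errors of the data, of order 1/(n+1). The constant contains the factor 1/h^2, so
  for a sequence of steps tending to 0 the mollification must be chosen depending on the
  step.\<close>

lemma solution_stability:
  assumes h: "0 < h" "h \<le> h0" and w: "bounded_solution_h \<Lambda>\<^sub>1 q p c f h w"
  shows "\<exists>C\<ge>0. \<forall>n x. \<bar>S.Sol n h (conv f (bump n)) x - w x\<bar> \<le> C / real (Suc n)"
proof -
  obtain B where B: "\<And>x. \<bar>w x\<bar> \<le> B" using w unfolding bounded_solution_h_def bounded_iff by auto
  have B0: "0 \<le> B" using order_trans[OF abs_ge_zero B] .
  obtain C where C: "0 \<le> C" "\<And>\<xi> n x. \<xi> \<in> \<Lambda>\<^sub>1 \<Longrightarrow> \<bar>moll n q \<xi> x - q \<xi> x\<bar> \<le> C / real (Suc n)"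
    "\<And>\<xi> n x. \<xi> \<in> \<Lambda>\<^sub>1 \<Longrightarrow> \<bar>moll n p \<xi> x - p \<xi> x\<bar> \<le> C / real (Suc n)" using moll_lipschitz by blast
  obtain D where D: "0 \<le> D" "\<And>n x. \<bar>conv c (bump n) x - c x\<bar> \<le> D / real (Suc n)" using lipb_conv_bump[OF coeff_lipb(3)] by blast
  obtain E where E: "0 \<le> E" "\<And>n x. \<bar>conv f (bump n) x - f x\<bar> \<le> E / real (Suc n)" using lipb_conv_bump[OF coeff_lipb(4)] by blast
  define G where "G = E + (\<Sum>\<xi>\<in>\<Lambda>\<^sub>1. (C + h * C) / h\<^sup>2 * (2 * B)) + D * B"
  have G0: "0 \<le> G" unfolding G_def using B0 C(1) D(1) E(1) h by (intro add_nonneg_nonneg sum_nonneg mult_nonneg_nonneg divide_nonneg_nonneg) auto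
  have "\<bar>S.Sol n h (conv f (bump n)) x - w x\<bar> \<le> (G / real (Suc n)) / c0" for n x
  proof (rule S.L_bound[where n = n and w = "\<lambda>x. S.Sol n h (conv f (bump n)) x - w x", OF h])
    note So = S.Sol[where n = n and g = "conv f (bump n)", OF h moll_smb(4)]
    show "bounded (range (\<lambda>x. S.Sol n h (conv f (bump n)) x - w x))"
      using lipb_bounded[OF smb_lipb[OF So(1)]] w unfolding bounded_solution_h_def by (intro bounded_minus_comp) auto
    fix x
    have h0': "h \<noteq> 0" using h by simp
    let ?L' = "Lh \<Lambda>\<^sub>1 (moll n q) (moll n p) (conv c (bump n)) h"
    have e: "?L' (\<lambda>x. S.Sol n h (conv f (bump n)) x - w x) x
      = (f x - conv f (bump n) x) + (Lh \<Lambda>\<^sub>1 q p c h w x - ?L' w x)"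
    proof -
      have "Lh \<Lambda>\<^sub>1 q p c h w x + f x = 0" using w unfolding bounded_solution_h_def by blast
      then show ?thesis unfolding Lh_minus[OF h0'] using So(2)[of x] by linarith
    qed
    have "Lh \<Lambda>\<^sub>1 q p c h w x - ?L' w x = (\<Sum>\<xi>\<in>\<Lambda>\<^sub>1. ((q \<xi> x - moll n q \<xi> x) + h * (p \<xi> x - moll n p \<xi> x)) / h\<^sup>2 * (w (x + h *\<^sub>R \<xi>) - w x))
      + (conv c (bump n) x - c x) * w x"
    proof -
      have "(\<Sum>\<xi>\<in>\<Lambda>\<^sub>1. (q \<xi> x + h * p \<xi> x) / h\<^sup>2 * (w (x + h *\<^sub>R \<xi>) - w x) - (moll n q \<xi> x + h * moll n p \<xi> x) / h\<^sup>2 * (w (x + h *\<^sub>R \<xi>) - w x))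
        = (\<Sum>\<xi>\<in>\<Lambda>\<^sub>1. ((q \<xi> x - moll n q \<xi> x) + h * (p \<xi> x - moll n p \<xi> x)) / h\<^sup>2 * (w (x + h *\<^sub>R \<xi>) - w x))"
        using h by (intro sum.cong refl) (simp add: field_simps)
      moreover have "A - a * W - (A' - a' * W) = D + (a' - a) * W" if "A - A' = D" for A A' D a a' W :: real
        using that by (simp add: algebra_simps)
      ultimately show ?thesis unfolding Lh_alt[OF h0'] sum_subtractf by blast
    qed
    also have "\<bar>\<dots>\<bar> \<le> (\<Sum>\<xi>\<in>\<Lambda>\<^sub>1. (C + h * C) / h\<^sup>2 * (2 * B)) / real (Suc n) + D * B / real (Suc n)"
    proof (rule order_trans[OF abs_triangle_ineq add_mono])
      show "\<bar>\<Sum>\<xi>\<in>\<Lambda>\<^sub>1. ((q \<xi> x - moll n q \<xi> x) + h * (p \<xi> x - moll n p \<xi> x)) / h\<^sup>2 * (w (x + h *\<^sub>R \<xi>) - w x)\<bar>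
        \<le> (\<Sum>\<xi>\<in>\<Lambda>\<^sub>1. (C + h * C) / h\<^sup>2 * (2 * B)) / real (Suc n)"
        unfolding sum_divide_distrib
      proof (rule order_trans[OF sum_abs sum_mono])
        fix \<xi> assume xi: "\<xi> \<in> \<Lambda>\<^sub>1"
        have "\<bar>q \<xi> x - moll n q \<xi> x\<bar> \<le> C / real (Suc n)" using C(2)[OF xi] by (simp add: abs_minus_commute)
        moreover have "\<bar>h * (p \<xi> x - moll n p \<xi> x)\<bar> \<le> h * (C / real (Suc n))"
          unfolding abs_mult using C(3)[OF xi, of n x] h by (intro mult_mono) (auto simp: abs_minus_commute)
        ultimately have 1: "\<bar>(q \<xi> x - moll n q \<xi> x) + h * (p \<xi> x - moll n p \<xi> x)\<bar> \<le> (C + h * C) / real (Suc n)"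
          unfolding add_divide_distrib using abs_triangle_ineq[of "q \<xi> x - moll n q \<xi> x" "h * (p \<xi> x - moll n p \<xi> x)"] by simp
        have 2: "\<bar>w (x + h *\<^sub>R \<xi>) - w x\<bar> \<le> 2 * B" using B[of "x + h *\<^sub>R \<xi>"] B[of x] by linarith
        have "\<bar>((q \<xi> x - moll n q \<xi> x) + h * (p \<xi> x - moll n p \<xi> x)) / h\<^sup>2 * (w (x + h *\<^sub>R \<xi>) - w x)\<bar>
          = \<bar>(q \<xi> x - moll n q \<xi> x) + h * (p \<xi> x - moll n p \<xi> x)\<bar> / h\<^sup>2 * \<bar>w (x + h *\<^sub>R \<xi>) - w x\<bar>"
          by (simp add: abs_mult)
        also have "\<dots> \<le> ((C + h * C) / real (Suc n)) / h\<^sup>2 * (2 * B)"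
          using 1 2 C(1) h by (intro mult_mono divide_right_mono divide_nonneg_nonneg) auto
        finally show "\<bar>((q \<xi> x - moll n q \<xi> x) + h * (p \<xi> x - moll n p \<xi> x)) / h\<^sup>2 * (w (x + h *\<^sub>R \<xi>) - w x)\<bar>
          \<le> (C + h * C) / h\<^sup>2 * (2 * B) / real (Suc n)" by (simp add: mult_ac)
      qed
      have "\<bar>conv c (bump n) x - c x\<bar> * \<bar>w x\<bar> \<le> (D / real (Suc n)) * B"
        by (intro mult_mono D(2) B divide_nonneg_nonneg D(1)) auto
      then show "\<bar>(conv c (bump n) x - c x) * w x\<bar> \<le> D * B / real (Suc n)" by (simp add: abs_mult)
    qed
    finally have "\<bar>Lh \<Lambda>\<^sub>1 q p c h w x - ?L' w x\<bar> \<le> (\<Sum>\<xi>\<in>\<Lambda>\<^sub>1. (C + h * C) / h\<^sup>2 * (2 * B)) / real (Suc n) + D * B / real (Suc n)" .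
    then show "\<bar>?L' (\<lambda>x. S.Sol n h (conv f (bump n)) x - w x) x\<bar> \<le> G / real (Suc n)"
      unfolding e G_def add_divide_distrib
      using E(2)[of n x] abs_triangle_ineq[of "f x - conv f (bump n) x" "Lh \<Lambda>\<^sub>1 q p c h w x - ?L' w x"] by linarith
  qed
  then have "\<bar>S.Sol n h (conv f (bump n)) x - w x\<bar> \<le> (G / c0) / real (Suc n)" for n x
    by (simp add: mult.commute)
  moreover have "0 \<le> G / c0" using G0 c0(1) by simp
  ultimately show ?thesis by blast
qed

text \<open>For \<open>m = 3\<close> the third derivatives of \<open>u\<close> are only generalized
  ones. The Taylor estimate is therefore made for the mollifications of \<open>u\<close>, whose
  third derivatives are uniformly bounded, and passed to the limit, for which convergence of the
  derivatives up to order 2 suffices.\<close>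

lemma consistency:
  assumes u: "u \<in> Bspace m" "solution_Lcal \<Lambda>\<^sub>1 q p c f u"
  shows "\<exists>C\<ge>0. \<forall>\<eta> x. 0 < \<eta> \<longrightarrow> \<eta> \<le> h0 \<longrightarrow> \<bar>Lh \<Lambda>\<^sub>1 q p c \<eta> u x + f x\<bar> \<le> C * \<eta>"
proof -
  obtain m' where m': "m = Suc m'" "2 \<le> m'" using m3 by (cases m) auto
  have Cu: "Cb m' u" using Bspace_Cb(1) u(1) m'(1) by blast
  have Cu2: "Cb 2 u" by (rule Cb_mono[OF m'(2) Cu])
  have lim: "(\<lambda>j. foldr partial is (conv u (bump j)) x) \<longlonglongrightarrow> foldr partial is u x" if "length is \<le> 2" for "is" x
    using Bspace_Cb(2)[of u m' "is"] u(1) m' that by (intro tendsto_uniform_limitI[where S = UNIV]) auto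
  obtain B where B: "\<And>j. bd m B (conv u (bump j))" using Bspace_conv_bd[OF u(1)] by blast
  have B3: "bd 3 B (conv u (bump j))" for j by (rule bd_mono[OF B m3 order_refl])
  have sm: "smb (conv u (bump j))" for j by (intro conv_smb Bspace_bmeas[OF u(1)] bump_test)
  have "\<exists>Q. \<forall>\<xi>\<in>\<Lambda>\<^sub>1. \<forall>x. \<bar>q \<xi> x\<bar> \<le> Q \<and> \<bar>p \<xi> x\<bar> \<le> Q"
  proof -
    have "\<forall>\<xi>. \<exists>a. \<xi> \<in> \<Lambda>\<^sub>1 \<longrightarrow> (\<forall>x. \<bar>q \<xi> x\<bar> \<le> a \<and> \<bar>p \<xi> x\<bar> \<le> a)"
    proof
      fix \<xi>
      show "\<exists>a. \<xi> \<in> \<Lambda>\<^sub>1 \<longrightarrow> (\<forall>x. \<bar>q \<xi> x\<bar> \<le> a \<and> \<bar>p \<xi> x\<bar> \<le> a)"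
      proof (cases "\<xi> \<in> \<Lambda>\<^sub>1")
        case True
        obtain a b where "\<And>x. \<bar>q \<xi> x\<bar> \<le> a" "\<And>x. \<bar>p \<xi> x\<bar> \<le> b"
          using coeff_bounded[OF True] unfolding bounded_iff by auto
        then have "\<forall>x. \<bar>q \<xi> x\<bar> \<le> max a b \<and> \<bar>p \<xi> x\<bar> \<le> max a b" by (simp add: le_max_iff_disj)
        then show ?thesis by blast
      qed auto
    qed
    then obtain a where a: "\<And>\<xi> x. \<xi> \<in> \<Lambda>\<^sub>1 \<Longrightarrow> \<bar>q \<xi> x\<bar> \<le> a \<xi> \<and> \<bar>p \<xi> x\<bar> \<le> a \<xi>" by metis
    have "a \<xi> \<le> (\<Sum>\<xi>\<in>\<Lambda>\<^sub>1. \<bar>a \<xi>\<bar>)" if "\<xi> \<in> \<Lambda>\<^sub>1" for \<xi>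
      using member_le_sum[OF that, of "\<lambda>\<xi>. \<bar>a \<xi>\<bar>"] fin by simp
    then show ?thesis using a by (intro exI[of _ "\<Sum>\<xi>\<in>\<Lambda>\<^sub>1. \<bar>a \<xi>\<bar>"]) (meson order_trans)
  qed
  then obtain Q where Q: "\<And>\<xi> x. \<xi> \<in> \<Lambda>\<^sub>1 \<Longrightarrow> \<bar>q \<xi> x\<bar> \<le> Q" "\<And>\<xi> x. \<xi> \<in> \<Lambda>\<^sub>1 \<Longrightarrow> \<bar>p \<xi> x\<bar> \<le> Q" by blast
  define C where "C = (\<Sum>\<xi>\<in>\<Lambda>\<^sub>1. Q * ((real CARD('d) * norm \<xi>) ^ 3 * B) + Q * ((real CARD('d) * norm \<xi>) ^ 2 * B))"
  have le: "\<bar>Lh \<Lambda>\<^sub>1 q p c \<eta> u x - Lp \<Lambda>\<^sub>1 q p c u x\<bar> \<le> C * \<eta>" if "0 < \<eta>" for \<eta> x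
  proof (rule tendsto_upperbound)
    show "(\<lambda>j. \<bar>Lh \<Lambda>\<^sub>1 q p c \<eta> (conv u (bump j)) x - Lp \<Lambda>\<^sub>1 q p c (conv u (bump j)) x\<bar>) \<longlonglongrightarrow> \<bar>Lh \<Lambda>\<^sub>1 q p c \<eta> u x - Lp \<Lambda>\<^sub>1 q p c u x\<bar>"
      unfolding Lh_def Lp_def fdiff_def
      using that lim[of "[]"] by (intro tendsto_intros lim) auto
    show "\<forall>\<^sub>F j in sequentially. \<bar>Lh \<Lambda>\<^sub>1 q p c \<eta> (conv u (bump j)) x - Lp \<Lambda>\<^sub>1 q p c (conv u (bump j)) x\<bar> \<le> C * \<eta>"
      unfolding C_def by (intro always_eventually allI consistency_smooth[OF that sm B3 centered] Q)
  qed simp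
  \<comment> \<open>The equation is assumed almost everywhere; the left-hand side is continuous, so
    it holds at every point.\<close>
  have Lp0: "Lp \<Lambda>\<^sub>1 q p c u x + f x = 0" for x
  proof (rule continuous_AE_eq_0[where f = "\<lambda>x. Lp \<Lambda>\<^sub>1 q p c u x + f x"])
    have c2: "Cb 0 (foldr partial [i, j] u)" for i j by (rule Cb_pderivs) (use Cu2 in \<open>simp add: numeral_2_eq_2\<close>)
    have c1: "Cb 0 (foldr partial [i] u)" for i by (rule Cb_pderivs) (rule Cb_mono[OF _ Cu2], simp)
    have cc: "Cb 0 c" "Cb 0 f" "\<And>\<xi>. \<xi> \<in> \<Lambda>\<^sub>1 \<Longrightarrow> Cb 0 (q \<xi>)" "\<And>\<xi>. \<xi> \<in> \<Lambda>\<^sub>1 \<Longrightarrow> Cb 0 (p \<xi>)" "Cb 0 u"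
      using coeff_lipb Cb_lipb[OF Cu] by auto
    have "Cb 0 (\<lambda>x. Lp \<Lambda>\<^sub>1 q p c u x + f x)"
      unfolding Lp_def by (intro Cb_add Cb_diff2 Cb_cmult Cb_sum Cb_mult Cb_const c1 c2 cc)
    then show "continuous_on UNIV (\<lambda>x. Lp \<Lambda>\<^sub>1 q p c u x + f x)" by (intro lipb_continuous) simp
    show "AE x in lborel. Lp \<Lambda>\<^sub>1 q p c u x + f x = 0"
      using u(2) unfolding solution_Lcal_def Lcal_Lp[OF Cu2] by blast
  qed
  have "\<bar>Lh \<Lambda>\<^sub>1 q p c \<eta> u x + f x\<bar> \<le> \<bar>C\<bar> * \<eta>" if "0 < \<eta>" for \<eta> x
  proof -
    have "C * \<eta> \<le> \<bar>C\<bar> * \<eta>" using that by (intro mult_right_mono) auto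
    moreover have "Lh \<Lambda>\<^sub>1 q p c \<eta> u x + f x = Lh \<Lambda>\<^sub>1 q p c \<eta> u x - Lp \<Lambda>\<^sub>1 q p c u x" using Lp0[of x] by linarith
    ultimately show ?thesis using le[OF that, of x] by linarith
  qed
  then show ?thesis by (intro exI[of _ "\<bar>C\<bar>"]) auto
qed

text \<open>Consistency and the maximum principle for the original coefficients. The result
  identifies the limit of the surrogate solutions with step \<open>\<eta>\<close>.\<close>

lemma convergence:
  assumes u: "u \<in> Bspace m" "solution_Lcal \<Lambda>\<^sub>1 q p c f u"
    and v: "\<And>h. 0 < h \<Longrightarrow> h \<le> h0 \<Longrightarrow> bounded_solution_h \<Lambda>\<^sub>1 q p c f h (v h)"
  shows "\<exists>C\<ge>0. \<forall>\<eta> x. 0 < \<eta> \<longrightarrow> \<eta> \<le> h0 \<longrightarrow> \<bar>v \<eta> x - u x\<bar> \<le> C * \<eta>"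
proof -
  obtain C where C: "0 \<le> C" "\<And>\<eta> x. 0 < \<eta> \<Longrightarrow> \<eta> \<le> h0 \<Longrightarrow> \<bar>Lh \<Lambda>\<^sub>1 q p c \<eta> u x + f x\<bar> \<le> C * \<eta>"
    using consistency[OF u] by blast
  have "\<bar>v \<eta> x - u x\<bar> \<le> C * \<eta> / c0" if e: "0 < \<eta>" "\<eta> \<le> h0" for \<eta> x
  proof (rule Lh_bound[where W = "\<lambda>x. v \<eta> x - u x", OF fin e(1) coeff_bounded nn[OF e] c0])
    note V = v[OF e, unfolded bounded_solution_h_def]
    show "bounded (range (\<lambda>x. v \<eta> x - u x))" using V u(1) by (intro bounded_minus_comp) (auto simp: Bspace_def)
    fix x
    have "Lh \<Lambda>\<^sub>1 q p c \<eta> (v \<eta>) x + f x = 0" using V by blast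
    moreover have "Lh \<Lambda>\<^sub>1 q p c \<eta> (\<lambda>x. v \<eta> x - u x) x = Lh \<Lambda>\<^sub>1 q p c \<eta> (v \<eta>) x - Lh \<Lambda>\<^sub>1 q p c \<eta> u x"
      using e by (intro Lh_minus) simp
    ultimately show "\<bar>Lh \<Lambda>\<^sub>1 q p c \<eta> (\<lambda>x. v \<eta> x - u x) x\<bar> \<le> C * \<eta>" using C(2)[OF e, of x] by linarith
  qed
  then show ?thesis using C(1) c0(1) by (intro exI[of _ "C / c0"]) auto
qed

end

section \<open>The diagonal limit and the final estimate\<close>

lemma ex_small:
  assumes "0 \<le> C" "0 \<le> D"
  shows "\<exists>n. C / real (Suc n) \<le> 1 / real (Suc i) \<and> D / real (Suc n) \<le> 1 / real (Suc i)"
proof -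
  obtain n where n: "(C + D) * real (Suc i) < real n" using reals_Archimedean2 by blast
  have "X / real (Suc n) \<le> 1 / real (Suc i)" if "0 \<le> X" "X \<le> C + D" for X
  proof -
    have "X * real (Suc i) \<le> (C + D) * real (Suc i)" using that by (intro mult_right_mono) auto
    then have "X * real (Suc i) \<le> real (Suc n)" using n by linarith
    then show ?thesis by (simp add: divide_le_eq le_divide_eq del: of_nat_Suc)
  qed
  then show ?thesis using assms by (intro exI[of _ n]) auto
qed

lemma half_power_le: "0 < h \<Longrightarrow> (1 / 2) ^ j * h \<le> (h::real)"
  by (auto simp: power_le_one mult_left_le_one_le)

context rough_scheme
begin

lemma smooth_combination_stability:
  assumes v: "\<And>h. 0 < h \<Longrightarrow> h \<le> h0 \<Longrightarrow> bounded_solution_h \<Lambda>\<^sub>1 q p c f h (v h)" and h: "0 < h" "h \<le> h0"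
  shows "\<exists>D\<ge>0. \<forall>n x. \<bar>(\<Sum>j\<le>J. w j * S.Sol n ((1 / 2) ^ j * h) (conv f (bump n)) x)
    - (\<Sum>j\<le>J. w j * v ((1 / 2) ^ j * h) x)\<bar> \<le> D / real (Suc n)"
proof -
  have hj: "0 < (1 / 2) ^ j * h" "(1 / 2) ^ j * h \<le> h0" for j :: nat
    using order_trans[OF half_power_le[OF h(1)] h(2), of j] h by auto
  have "\<forall>j. \<exists>C\<ge>0. \<forall>n x. \<bar>S.Sol n ((1 / 2) ^ j * h) (conv f (bump n)) x - v ((1 / 2) ^ j * h) x\<bar> \<le> C / real (Suc n)"
    using solution_stability[OF hj v[OF hj]] by blast
  then obtain C where C: "\<And>j. 0 \<le> C j"
    "\<And>j n x. \<bar>S.Sol n ((1 / 2) ^ j * h) (conv f (bump n)) x - v ((1 / 2) ^ j * h) x\<bar> \<le> C j / real (Suc n)" by metis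
  have "\<bar>(\<Sum>j\<le>J. w j * S.Sol n ((1 / 2) ^ j * h) (conv f (bump n)) x)
    - (\<Sum>j\<le>J. w j * v ((1 / 2) ^ j * h) x)\<bar> \<le> (\<Sum>j\<le>J. \<bar>w j\<bar> * C j) / real (Suc n)" for n x
  proof -
    have "(\<Sum>j\<le>J. w j * S.Sol n ((1 / 2) ^ j * h) (conv f (bump n)) x) - (\<Sum>j\<le>J. w j * v ((1 / 2) ^ j * h) x)
      = (\<Sum>j\<le>J. w j * (S.Sol n ((1 / 2) ^ j * h) (conv f (bump n)) x - v ((1 / 2) ^ j * h) x))"
      by (simp only: right_diff_distrib sum_subtractf)
    also have "\<bar>\<dots>\<bar> \<le> (\<Sum>j\<le>J. \<bar>w j\<bar> * C j / real (Suc n))"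
    proof (rule order_trans[OF sum_abs sum_mono])
      fix j
      show "\<bar>w j * (S.Sol n ((1 / 2) ^ j * h) (conv f (bump n)) x - v ((1 / 2) ^ j * h) x)\<bar> \<le> \<bar>w j\<bar> * C j / real (Suc n)"
        unfolding abs_mult times_divide_eq_right[symmetric] by (intro mult_left_mono C(2)) auto
    qed
    finally show ?thesis by (simp only: sum_divide_distrib)
  qed
  moreover have "0 \<le> (\<Sum>j\<le>J. \<bar>w j\<bar> * C j)" by (intro sum_nonneg mult_nonneg_nonneg C) auto
  ultimately show ?thesis by blast
qed

text \<open>A diagonal argument: the smoothing parameter of the coefficients is tied to the small step
  \<open>\<eta>\<close> of the surrogate for the limit equation, with \<open>\<eta> \<rightarrow> 0\<close>.\<close>

lemma limit_estimate:
  assumes u: "u \<in> Bspace m" "solution_Lcal \<Lambda>\<^sub>1 q p c f u"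
    and v: "\<And>h. 0 < h \<Longrightarrow> h \<le> h0 \<Longrightarrow> bounded_solution_h \<Lambda>\<^sub>1 q p c f h (v h)" and h: "0 < h" "h \<le> h0" and l: "l < m"
    and ext: "\<And>n \<eta>. 0 < \<eta> \<Longrightarrow> \<eta> \<le> h0 \<Longrightarrow> bd l (A * (B + \<eta> * G))
      (\<lambda>x. (\<Sum>j\<le>J. w j * S.Sol n ((1 / 2) ^ j * h) (conv f (bump n)) x) - S.Sol n \<eta> (conv f (bump n)) x)"
  shows "derivs_within l (\<lambda>x. \<Sum>j\<le>J. w j * v ((1 / 2) ^ j * h) x) u (A * B)"
proof -
  have hj: "0 < (1 / 2) ^ j * h" "(1 / 2) ^ j * h \<le> h0" for j :: nat
    using order_trans[OF half_power_le[OF h(1)] h(2), of j] h by auto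
  define vb where "vb = (\<lambda>x. \<Sum>j\<le>J. w j * v ((1 / 2) ^ j * h) x)"
  define \<eta> where "\<eta> = (\<lambda>i. h0 / real (Suc i))"
  have eta: "0 < \<eta> i" "\<eta> i \<le> h0" for i using h0 by (auto simp: \<eta>_def divide_le_eq)
  obtain D where D: "0 \<le> D" "\<And>n x. \<bar>(\<Sum>j\<le>J. w j * S.Sol n ((1 / 2) ^ j * h) (conv f (bump n)) x) - vb x\<bar> \<le> D / real (Suc n)"
    using smooth_combination_stability[OF v h, of w J] unfolding vb_def by blast
  \<comment> \<open>The constant in \<open>solution_stability\<close> depends on the step, so
    \<open>n\<close> is chosen separately for each \<open>\<eta> i\<close>.\<close>
  have "\<forall>i. \<exists>n. \<forall>x. \<bar>(\<Sum>j\<le>J. w j * S.Sol n ((1 / 2) ^ j * h) (conv f (bump n)) x) - vb x\<bar> \<le> 1 / real (Suc i)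
    \<and> \<bar>S.Sol n (\<eta> i) (conv f (bump n)) x - v (\<eta> i) x\<bar> \<le> 1 / real (Suc i)"
  proof
    fix i
    obtain C where C: "0 \<le> C" "\<And>n x. \<bar>S.Sol n (\<eta> i) (conv f (bump n)) x - v (\<eta> i) x\<bar> \<le> C / real (Suc n)"
      using solution_stability[OF eta v[OF eta], of i] by blast
    obtain n where "C / real (Suc n) \<le> 1 / real (Suc i)" "D / real (Suc n) \<le> 1 / real (Suc i)" using ex_small[OF C(1) D(1)] by blast
    then show "\<exists>n. \<forall>x. \<bar>(\<Sum>j\<le>J. w j * S.Sol n ((1 / 2) ^ j * h) (conv f (bump n)) x) - vb x\<bar> \<le> 1 / real (Suc i)
      \<and> \<bar>S.Sol n (\<eta> i) (conv f (bump n)) x - v (\<eta> i) x\<bar> \<le> 1 / real (Suc i)"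
      using order_trans[OF C(2)] order_trans[OF D(2)] by blast
  qed
  from choice[OF this] obtain N where NN: "\<forall>i. \<forall>x. \<bar>(\<Sum>j\<le>J. w j * S.Sol (N i) ((1 / 2) ^ j * h) (conv f (bump (N i))) x) - vb x\<bar> \<le> 1 / real (Suc i)
    \<and> \<bar>S.Sol (N i) (\<eta> i) (conv f (bump (N i))) x - v (\<eta> i) x\<bar> \<le> 1 / real (Suc i)" ..
  have N: "\<bar>(\<Sum>j\<le>J. w j * S.Sol (N i) ((1 / 2) ^ j * h) (conv f (bump (N i))) x) - vb x\<bar> \<le> 1 / real (Suc i)"
    "\<bar>S.Sol (N i) (\<eta> i) (conv f (bump (N i))) x - v (\<eta> i) x\<bar> \<le> 1 / real (Suc i)" for i x
    using NN by blast+
  define W where "W = (\<lambda>i x. (\<Sum>j\<le>J. w j * S.Sol (N i) ((1 / 2) ^ j * h) (conv f (bump (N i))) x) - S.Sol (N i) (\<eta> i) (conv f (bump (N i))) x)"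
  have Ss: "smb (S.Sol n h' (conv f (bump n)))" if "0 < h'" "h' \<le> h0" for n h'
    by (rule S.Sol(1)[OF that moll_smb(4)])
  \<comment> \<open>\<open>S.NX\<close> carries no index \<open>n\<close>: the a priori constant
    involves only bounds shared by all mollifications.\<close>
  have Sb: "bd m (S.NX * Bnorm m f) (S.Sol n h' (conv f (bump n)))" if "0 < h'" "h' \<le> h0" for n h'
    by (rule S.apriori_NX[where n = m and na = n, OF that Ss[OF that] moll_smb(4) S.Sol(2)[OF that moll_smb(4)] order_refl Bspace_conv_bd_Bnorm[OF regD(4)]])
  have Ws: "smb (W i)" for i
    unfolding W_def by (intro smb_diff smb_sum smb_mult smb_const Ss hj eta)
  \<comment> \<open>These bounds reach one order above the derivatives that are to converge, as
    \<open>smooth_limit\<close> requires.\<close>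
  have Wb: "bd m ((\<Sum>j\<le>J. \<bar>w j\<bar> * (S.NX * Bnorm m f)) + S.NX * Bnorm m f) (W i)" for i
    unfolding W_def
  proof (rule bd_diff[OF _ smb_Cb[OF Ss[OF eta]] bd_sum Sb[OF eta]])
    show "Cb m (\<lambda>x. \<Sum>j\<le>J. w j * S.Sol (N i) ((1 / 2) ^ j * h) (conv f (bump (N i))) x)"
      by (intro Cb_sum Cb_cmult smb_Cb[OF Ss[OF hj]])
    fix j
    show "Cb m (\<lambda>x. w j * S.Sol (N i) ((1 / 2) ^ j * h) (conv f (bump (N i))) x)"
      by (rule Cb_cmult[OF smb_Cb[OF Ss[OF hj]]])
    show "bd m (\<bar>w j\<bar> * (S.NX * Bnorm m f)) (\<lambda>x. w j * S.Sol (N i) ((1 / 2) ^ j * h) (conv f (bump (N i))) x)"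
      by (rule bd_cmult[OF smb_Cb[OF Ss[OF hj]] Sb[OF hj]])
  qed
  have "\<exists>C\<ge>0. \<forall>\<eta> x. 0 < \<eta> \<longrightarrow> \<eta> \<le> h0 \<longrightarrow> \<bar>v \<eta> x - u x\<bar> \<le> C * \<eta>" by (rule convergence[OF u v])
  then obtain E where E: "0 \<le> E" "\<And>\<eta> x. 0 < \<eta> \<Longrightarrow> \<eta> \<le> h0 \<Longrightarrow> \<bar>v \<eta> x - u x\<bar> \<le> E * \<eta>" by blast
  have close: "\<bar>W i x - (vb x - u x)\<bar> \<le> (2 + E * h0) / real (Suc i)" for i x
  proof -
    have "\<bar>W i x - (vb x - u x)\<bar> \<le> 1 / real (Suc i) + 1 / real (Suc i) + E * \<eta> i"
      unfolding W_def using N[of i x] E(2)[OF eta, of i x] by linarith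
    then show ?thesis by (simp add: \<eta>_def add_divide_distrib)
  qed
  have lim0: "(\<lambda>i. a / real (Suc i)) \<longlonglongrightarrow> 0" for a :: real
    using tendsto_mult[OF tendsto_const[of a] LIMSEQ_inverse_real_of_nat] by (simp add: divide_inverse)
  have ul: "uniform_limit UNIV W (\<lambda>x. vb x - u x) sequentially"
    unfolding uniform_limit_seq_iff
  proof (intro allI impI)
    fix e :: real assume "0 < e"
    with lim0[of "2 + E * h0"] obtain M0 where M0: "\<And>i. i \<ge> M0 \<Longrightarrow> \<bar>(2 + E * h0) / real (Suc i)\<bar> < e"
      unfolding LIMSEQ_iff by (auto simp del: of_nat_Suc)
    have "\<bar>W i x - (vb x - u x)\<bar> < e" if "i \<ge> M0" for i x
      using close[of i x] M0[OF that] by linarith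
    then show "\<exists>N. \<forall>n\<ge>N. \<forall>x. \<bar>W n x - (vb x - u x)\<bar> < e" by blast
  qed
  obtain m' where m': "m = Suc m'" "l \<le> m'" using l by (cases m) auto
  have SL: "Cb m' (\<lambda>x. vb x - u x)"
    "\<And>is. length is \<le> m' \<Longrightarrow> uniform_limit UNIV (\<lambda>j. foldr partial is (W j)) (foldr partial is (\<lambda>x. vb x - u x)) sequentially"
    using smooth_limit[of W m', OF Ws Wb[unfolded m'] ul] by blast+
  have Cu: "Cb m' u" using Bspace_Cb(1) u(1) m'(1) by blast
  \<comment> \<open>The regularity of the extrapolated solution itself is recovered from that of its
    difference to \<open>u\<close>.\<close>
  have Cv: "Cb m' vb" using Cb_add[OF SL(1) Cu] by (simp del: Cb.simps)
  have bound: "\<bar>foldr partial is (\<lambda>x. vb x - u x) x\<bar> \<le> A * B" if "length is \<le> l" for "is" x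
  proof (rule LIMSEQ_le)
    show "(\<lambda>i. \<bar>foldr partial is (W i) x\<bar>) \<longlonglongrightarrow> \<bar>foldr partial is (\<lambda>x. vb x - u x) x\<bar>"
      using SL(2)[of "is"] that m'(2) by (intro tendsto_rabs tendsto_uniform_limitI[where S = UNIV]) auto
    \<comment> \<open>The error of the artificial step disappears together with \<open>G\<close>,
      whose size depends on \<open>h\<close>.\<close>
    have "(\<lambda>i. A * (B + \<eta> i * G)) \<longlonglongrightarrow> A * (B + 0 * G)"
      unfolding \<eta>_def by (intro tendsto_intros lim0)
    then show "(\<lambda>i. A * (B + \<eta> i * G)) \<longlonglongrightarrow> A * B" by simp
    show "\<exists>N. \<forall>i\<ge>N. \<bar>foldr partial is (W i) x\<bar> \<le> A * (B + \<eta> i * G)"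
      using bdD[OF ext[OF eta] that] unfolding W_def by blast
  qed
  show ?thesis
    unfolding derivs_within_def vb_def[symmetric]
  proof (intro conjI allI impI)
    show "vb \<in> Bspace l" by (rule Cb_Bspace[OF Cb_mono[OF m'(2) Cv]])
    fix \<alpha> :: "'d \<Rightarrow> nat" and x assume a: "mi_order \<alpha> \<le> l"
    obtain "is" where is': "\<forall>i. count_list is i = \<alpha> i" using ex_list_count by blast
    have len: "length is \<le> l" using mi_order_count[OF is'] a by simp
    then have len': "length is \<le> m'" using m'(2) by simp
    show "\<bar>gen_deriv \<alpha> vb x - gen_deriv \<alpha> u x\<bar> \<le> A * B"
      using bound[OF len, of x] unfolding gen_deriv_eq[OF Cv len' is'] gen_deriv_eq[OF Cu len' is'] pderivs_diff[OF Cv Cu len'] .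
  qed
qed

lemma moll_reflect:
  assumes L: "\<Lambda>\<^sub>1 = uminus ` \<Lambda>\<^sub>1" and xi: "\<xi> \<in> \<Lambda>\<^sub>1"
  shows "(\<And>x. q \<xi> x = q (- \<xi>) x) \<Longrightarrow> moll n q (- \<xi>) = moll n q \<xi>"
    "(\<And>x. p (- \<xi>) x = - p \<xi> x) \<Longrightarrow> moll n p (- \<xi>) x = - moll n p \<xi> x"
proof -
  have mi: "- \<xi> \<in> \<Lambda>\<^sub>1" using L xi by blast
  show "moll n q (- \<xi>) = moll n q \<xi>" if "\<And>x. q \<xi> x = q (- \<xi>) x"
  proof -
    have "q (- \<xi>) = q \<xi>" using that by auto
    then show ?thesis using xi mi by (simp add: moll_def on\<Lambda>_def)
  qed
  show "moll n p (- \<xi>) x = - moll n p \<xi> x" if "\<And>x. p (- \<xi>) x = - p \<xi> x"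
    using xi mi that by (simp add: moll_def on\<Lambda>_def conv_def)
qed

lemma extrapolated_estimate:
  assumes u: "u \<in> Bspace m" "solution_Lcal \<Lambda>\<^sub>1 q p c f u"
    and v: "\<And>h. 0 < h \<Longrightarrow> h \<le> h0 \<Longrightarrow> bounded_solution_h \<Lambda>\<^sub>1 q p c f h (v h)" and h: "0 < h" "h \<le> h0" and l: "l + 3 \<le> m" "k \<le> m"
    and s: "\<And>n. S.EL_cost n s" "1 \<le> s"
    and dead: "\<And>n \<eta> j. 0 < \<eta> \<Longrightarrow> \<eta> \<le> h0 \<Longrightarrow> j \<le> k \<Longrightarrow> S.V n \<eta> (conv f (bump n)) j = (\<lambda>x. 0) \<or> l + (k - j) + 3 + s * j \<le> m"
    and w: "\<And>n \<eta> t. 0 < \<eta> \<Longrightarrow> \<eta> \<le> h0 \<Longrightarrow> t \<le> k \<Longrightarrow> S.V n \<eta> (conv f (bump n)) t = (\<lambda>x. 0) \<or> (\<Sum>j\<le>J. w j * ((1 / 2) ^ j) ^ t) = (if t = 0 then 1 else 0)"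
  shows "derivs_within l (\<lambda>x. \<Sum>j\<le>J. w j * v ((1 / 2) ^ j * h) x) u ((\<Sum>j\<le>J. \<bar>w j\<bar>) * S.NE * Bnorm m f * h ^ (k + 1))"
proof (rule limit_estimate[OF u v h, where G = "\<Sum>t\<le>k. h ^ t"])
  show "l < m" using l by simp
  fix n :: nat and \<eta> :: real assume e: "0 < \<eta>" "\<eta> \<le> h0"
  have "bd l ((\<Sum>j\<le>J. \<bar>w j\<bar>) * (S.NE * Bnorm m f * (h ^ Suc k + \<eta> * (\<Sum>t\<le>k. h ^ t))))
    (\<lambda>x. (\<Sum>j\<le>J. w j * S.Sol n ((1 / 2) ^ j * h) (conv f (bump n)) x) - S.V n \<eta> (conv f (bump n)) 0 x)"
    by (rule S.extrapolation[where n = n and v = "\<lambda>h. S.Sol n h (conv f (bump n))", OF e moll_smb(4) Bspace_conv_bd_Bnorm[OF regD(4)] s _ l(2) dead[OF e] h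
          S.Sol(1)[OF _ _ moll_smb(4)] S.Sol(2)[OF _ _ moll_smb(4)] w[OF e]]) (use l in auto)
  then show "bd l ((\<Sum>j\<le>J. \<bar>w j\<bar>) * S.NE * Bnorm m f * (h ^ (k + 1) + \<eta> * (\<Sum>t\<le>k. h ^ t)))
    (\<lambda>x. (\<Sum>j\<le>J. w j * S.Sol n ((1 / 2) ^ j * h) (conv f (bump n)) x) - S.Sol n \<eta> (conv f (bump n)) x)"
    by (simp add: mult.assoc)
qed

lemma conclusion:
  assumes u: "u \<in> Bspace m" "solution_Lcal \<Lambda>\<^sub>1 q p c f u"
    and v: "\<And>h. 0 < h \<Longrightarrow> h \<le> h0 \<Longrightarrow> bounded_solution_h \<Lambda>\<^sub>1 q p c f h (v h)" and h: "0 < h" "h \<le> h0" and l: "l \<le> m"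
    and cond: "condition_i m k l \<or> condition_ii \<Lambda>\<^sub>1 q m k l \<or> condition_iii \<Lambda>\<^sub>1 q p m k l"
  shows "derivs_within l (vbar k v h) u ((\<Sum>j\<le>k. \<bar>first_row_inverse (k + 1) (\<lambda>i j. (1 / 2) ^ (i * j)) j\<bar>) * S.NE * Bnorm m f * h ^ (k + 1))"
    and "condition_iii \<Lambda>\<^sub>1 q p m k l \<Longrightarrow> derivs_within l (vtilde k v h) u
      ((\<Sum>j\<le>(k - 1) div 2. \<bar>first_row_inverse ((k - 1) div 2 + 1) (\<lambda>i j. (1 / 4) ^ (i * j)) j\<bar>) * S.NE * Bnorm m f * h ^ (k + 1))"
proof -
  let ?w = "first_row_inverse (k + 1) (\<lambda>i j. (1 / 2) ^ (i * j))"
  have w: "(\<Sum>j\<le>k. ?w j * ((1 / 2) ^ j) ^ t) = (if t = 0 then 1 else 0)" if "t \<le> k" for t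
    using first_row_inverse_vandermonde[of "1 / 2" t "k + 1"] that by (simp add: lessThan_Suc_atMost)
  have cost2: "S.EL_cost n 2" if "\<Lambda>\<^sub>1 = uminus ` \<Lambda>\<^sub>1" "\<forall>\<xi>\<in>\<Lambda>\<^sub>1. \<forall>x. q \<xi> x = q (- \<xi>) x" for n
    by (rule S.EL_cost_2[OF that(1)]) (use that moll_reflect(1)[OF that(1)] in blast)
  have odd0: "S.V n \<eta> (conv f (bump n)) j = (\<lambda>x. 0)" if iii: "condition_iii \<Lambda>\<^sub>1 q p m k l" and "odd j" "0 < \<eta>" "\<eta> \<le> h0" for n \<eta> j
  proof -
    have L: "\<Lambda>\<^sub>1 = uminus ` \<Lambda>\<^sub>1" and qp: "\<forall>\<xi>\<in>\<Lambda>\<^sub>1. \<forall>x. q \<xi> x = q (- \<xi>) x \<and> p (- \<xi>) x = - p \<xi> x" using iii by (auto simp: condition_iii_def)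
    show ?thesis
      by (rule S.V_odd_zero[where n = n, OF L _ _ that(3,4) moll_smb(4) that(2)])
        (use moll_reflect[OF L] qp in blast)+
  qed
  \<comment> \<open>Only even \<open>j\<close> survive and \<open>k\<close> is odd, so j \<le> k - 1
    and the count is at most \<open>l + 2 * k + 2\<close>; this is the derivative saved by condition
    (iii).\<close>
  have iii_dead: "S.V n \<eta> (conv f (bump n)) j = (\<lambda>x. 0) \<or> l + (k - j) + 3 + 2 * j \<le> m"
    if iii: "condition_iii \<Lambda>\<^sub>1 q p m k l" and "0 < \<eta>" "\<eta> \<le> h0" "j \<le> k" for n \<eta> j
  proof (cases "odd j")
    case False
    have "odd k" "2 * k + 2 \<le> m - l" using iii by (auto simp: condition_iii_def)
    moreover have "j \<noteq> k" using False \<open>odd k\<close> by auto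
    ultimately show ?thesis using that(4) l by linarith
  qed (use odd0[OF iii _ that(2,3)] in blast)
  note est = extrapolated_estimate[OF u v h, of l k]
  have "derivs_within l (\<lambda>x. \<Sum>j\<le>k. ?w j * v ((1 / 2) ^ j * h) x) u ((\<Sum>j\<le>k. \<bar>?w j\<bar>) * S.NE * Bnorm m f * h ^ (k + 1))"
    using cond
  proof (elim disjE)
    assume c: "condition_i m k l"
    then have m: "3 * k + 3 \<le> m - l" by (simp add: condition_i_def)
    show ?thesis
      by (rule est[of 3]) (use m l w S.EL_cost_3 in auto)
  next
    assume c: "condition_ii \<Lambda>\<^sub>1 q m k l"
    then have m: "2 * k + 3 \<le> m - l" by (simp add: condition_ii_def)
    have e2: "S.EL_cost n 2" for n using c cost2 by (simp add: condition_ii_def)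
    show ?thesis
      by (rule est[of 2]) (use m l w e2 in auto)
  next
    assume c: "condition_iii \<Lambda>\<^sub>1 q p m k l"
    then have m: "2 * k + 2 \<le> m - l" "0 < k" by (auto simp: condition_iii_def intro: odd_pos)
    have e2: "S.EL_cost n 2" for n using c cost2 by (simp add: condition_iii_def)
    show ?thesis
      by (rule est[of 2, OF _ _ _ _ e2 _ iii_dead[OF c]]) (use m l w in auto)
  qed
  then show "derivs_within l (vbar k v h) u ((\<Sum>j\<le>k. \<bar>?w j\<bar>) * S.NE * Bnorm m f * h ^ (k + 1))"
    by (simp only: vbar_def[abs_def])
  assume c: "condition_iii \<Lambda>\<^sub>1 q p m k l"
  define J where "J = (k - 1) div 2"
  let ?z = "first_row_inverse (J + 1) (\<lambda>i j. (1 / 4) ^ (i * j))"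
  have m: "2 * k + 2 \<le> m - l" "0 < k" and k: "odd k" using c by (auto simp: condition_iii_def intro: odd_pos)
  have e2: "S.EL_cost n 2" for n using c cost2 by (simp add: condition_iii_def)
  have z: "S.V n \<eta> (conv f (bump n)) t = (\<lambda>x. 0) \<or> (\<Sum>j\<le>J. ?z j * ((1 / 2) ^ j) ^ t) = (if t = 0 then 1 else 0)"
    if "0 < \<eta>" "\<eta> \<le> h0" "t \<le> k" for n \<eta> t
  proof (cases "odd t")
    case False
    then obtain i where i: "t = 2 * i" by (auto elim: evenE)
    \<comment> \<open>The even powers from 0 to k - 1 number \<open>J + 1\<close>, as many as there
      are weights.\<close>
    have "i \<le> J" using k that(3) i unfolding J_def by (auto elim!: oddE)
    have "((1 / 2 :: real) ^ j) ^ t = ((1 / 4) ^ j) ^ i" for j :: nat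
    proof -
      have "((1 / 2 :: real) ^ j) ^ t = (((1 / 2)\<^sup>2) ^ j) ^ i" unfolding i by (simp only: power_mult[symmetric] mult_ac)
      then show ?thesis by (simp add: power2_eq_square)
    qed
    then have "(\<Sum>j\<le>J. ?z j * ((1 / 2) ^ j) ^ t) = (if t = 0 then 1 else 0)"
      using first_row_inverse_vandermonde[of "1 / 4" i "J + 1"] \<open>i \<le> J\<close> i by (simp add: lessThan_Suc_atMost)
    then show ?thesis by blast
  qed (use odd0[OF c _ that(1,2)] in blast)
  have "derivs_within l (\<lambda>x. \<Sum>j\<le>J. ?z j * v ((1 / 2) ^ j * h) x) u ((\<Sum>j\<le>J. \<bar>?z j\<bar>) * S.NE * Bnorm m f * h ^ (k + 1))"
    by (rule est[of 2, OF _ _ _ _ e2 _ iii_dead[OF c] z]) (use m l in auto)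
  then show "derivs_within l (vtilde k v h) u
      ((\<Sum>j\<le>(k - 1) div 2. \<bar>first_row_inverse ((k - 1) div 2 + 1) (\<lambda>i j. (1 / 4) ^ (i * j)) j\<bar>) * S.NE * Bnorm m f * h ^ (k + 1))"
    by (simp only: vtilde_def[abs_def] J_def)
qed

end

text \<open>The constant may depend on \<open>m\<close> but not on \<open>k\<close>, so the weights
  for all \<open>k \<le> m\<close> are added up.\<close>

definition cst_weights :: "nat \<Rightarrow> real" where
  "cst_weights m = (\<Sum>k\<le>m. \<Sum>j\<le>k. \<bar>first_row_inverse (k + 1) (\<lambda>i j. (1 / 2) ^ (i * j)) j\<bar>)
     + (\<Sum>k\<le>m. \<Sum>j\<le>(k - 1) div 2. \<bar>first_row_inverse ((k - 1) div 2 + 1) (\<lambda>i j. (1 / 4) ^ (i * j)) j\<bar>)"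

lemma cst_weights_ge:
  assumes "k \<le> m"
  shows "(\<Sum>j\<le>k. \<bar>first_row_inverse (k + 1) (\<lambda>i j. (1 / 2) ^ (i * j)) j\<bar>) \<le> cst_weights m"
    "(\<Sum>j\<le>(k - 1) div 2. \<bar>first_row_inverse ((k - 1) div 2 + 1) (\<lambda>i j. (1 / 4) ^ (i * j)) j\<bar>) \<le> cst_weights m"
proof -
  let ?a = "\<lambda>k. \<Sum>j\<le>k. \<bar>first_row_inverse (k + 1) (\<lambda>i j. (1 / 2) ^ (i * j)) j\<bar>"
  let ?b = "\<lambda>k. \<Sum>j\<le>(k - 1) div 2. \<bar>first_row_inverse ((k - 1) div 2 + 1) (\<lambda>i j. (1 / 4) ^ (i * j)) j\<bar>"
  have nn: "0 \<le> ?a k" "0 \<le> ?b k" for k by (intro sum_nonneg; simp)+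
  have "?a k \<le> (\<Sum>k\<le>m. ?a k)" "?b k \<le> (\<Sum>k\<le>m. ?b k)"
    by (rule member_le_sum; use assms nn in auto)+
  moreover have "0 \<le> (\<Sum>k\<le>m. ?a k)" "0 \<le> (\<Sum>k\<le>m. ?b k)" by (intro sum_nonneg nn)+
  ultimately show "?a k \<le> cst_weights m" "?b k \<le> cst_weights m" unfolding cst_weights_def by linarith+
qed

lemma derivs_within_mono: "derivs_within l w u A \<Longrightarrow> A \<le> B \<Longrightarrow> derivs_within l w u B"
  unfolding derivs_within_def by (meson order_trans)

text \<open>\<open>N\<close> is quantified before all data and receives only the listed numbers,
  which expresses the claimed dependence; the dimension enters through the type.\<close>

theorem corollary3p7:
  shows "\<exists>N :: nat \<Rightarrow> real \<Rightarrow> real \<Rightarrow> real \<Rightarrow> real \<Rightarrow> real \<Rightarrow> real \<Rightarrow> real list \<Rightarrow> real.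
    \<forall>(\<Lambda>\<^sub>1 :: (real^'d::finite) set) (\<l> :: 'd \<Rightarrow> real^'d) (\<tau>\<^sub>0 :: real) (\<tau> :: real^'d \<Rightarrow> real)
      (q :: real^'d \<Rightarrow> real^'d \<Rightarrow> real) (p :: real^'d \<Rightarrow> real^'d \<Rightarrow> real)
      (c :: real^'d \<Rightarrow> real) (f :: real^'d \<Rightarrow> real)
      (h0 :: real) (\<delta> :: real) (K :: real) (c0 :: real) (M :: nat \<Rightarrow> real)
      (m :: nat) (k :: nat) (l :: nat)
      (v :: real \<Rightarrow> real^'d \<Rightarrow> real) (v0 :: real^'d \<Rightarrow> real).
      finite \<Lambda>\<^sub>1 \<and> 0 \<notin> \<Lambda>\<^sub>1 \<and> inj \<l> \<and> range \<l> \<inter> \<Lambda>\<^sub>1 = {} \<and>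
      0 < h0 \<and> 0 < \<tau>\<^sub>0 \<and> (\<forall>\<xi>\<in>\<Lambda>\<^sub>1. 0 \<le> \<tau> \<xi>) \<and> 0 < \<delta> \<and> \<delta> \<le> 1 \<and> 1 \<le> K \<and>
      (\<forall>\<xi>\<in>\<Lambda>\<^sub>1. \<forall>x. 0 \<le> q \<xi> x) \<and>
      3 \<le> m \<and>
      regularity_condition \<Lambda>\<^sub>1 q p c f m M \<and>
      (\<forall>h \<xi> x. 0 < h \<and> h \<le> h0 \<and> \<xi> \<in> \<Lambda>\<^sub>1 \<longrightarrow> 0 \<le> q \<xi> x + h * p \<xi> x) \<and>
      (\<forall>x. (\<Sum>\<xi>\<in>\<Lambda>\<^sub>1. q \<xi> x *\<^sub>R \<xi>) = 0) \<and>
      0 < c0 \<and> (\<forall>x. c0 \<le> c x) \<and>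
      first_structural \<Lambda>\<^sub>1 \<l> \<tau>\<^sub>0 \<tau> q p c h0 \<delta> K m \<and>
      second_structural \<Lambda>\<^sub>1 \<l> \<tau>\<^sub>0 \<tau> q p c h0 \<delta> K m \<and>
      l \<le> m \<and>
      (condition_i m k l \<or> condition_ii \<Lambda>\<^sub>1 q m k l \<or> condition_iii \<Lambda>\<^sub>1 q p m k l) \<and>
      (\<forall>h. 0 < h \<and> h \<le> h0 \<longrightarrow> bounded_solution_h \<Lambda>\<^sub>1 q p c f h (v h)) \<and>
      v0 \<in> Bspace m \<and> solution_Lcal \<Lambda>\<^sub>1 q p c f v0
      \<longrightarrow>
      (\<forall>h. 0 < h \<and> h \<le> h0 \<longrightarrow>
        (let B = N m \<delta> K \<tau>\<^sub>0 c0 (sqrt (\<Sum>\<xi>\<in>\<Lambda>\<^sub>1. (norm \<xi>)\<^sup>2))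
                   (sqrt (\<Sum>\<xi>\<in>\<Lambda>\<^sub>1. (norm (\<tau> \<xi> *\<^sub>R \<xi>))\<^sup>2)) (map M [0..<m + 1])
                 * Bnorm m f * h ^ (k + 1)
         in derivs_within l (vbar k v h) v0 B \<and>
            (condition_iii \<Lambda>\<^sub>1 q p m k l \<longrightarrow> derivs_within l (vtilde k v h) v0 B)))"
proof (rule exI[where x = "\<lambda>m \<delta> K \<tau>\<^sub>0 c0 L T Ms. cst_weights m * cst_error (real CARD('d)) \<delta> K \<tau>\<^sub>0 c0 L T (\<Sum>i\<le>m. \<bar>Ms ! i\<bar>) m"],
    intro allI impI, elim conjE)
  fix \<Lambda>\<^sub>1 :: "(real^'d) set" and \<l> :: "'d \<Rightarrow> real^'d" and \<tau>\<^sub>0 :: real and \<tau> :: "real^'d \<Rightarrow> real"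
    and q p :: "real^'d \<Rightarrow> real^'d \<Rightarrow> real" and c f :: "real^'d \<Rightarrow> real" and h0 \<delta> K c0 :: real and M :: "nat \<Rightarrow> real"
    and m k l :: nat and v :: "real \<Rightarrow> real^'d \<Rightarrow> real" and v0 :: "real^'d \<Rightarrow> real" and h :: real
  assume 1: "finite \<Lambda>\<^sub>1" "0 \<notin> \<Lambda>\<^sub>1" "inj \<l>" "range \<l> \<inter> \<Lambda>\<^sub>1 = {}" "0 < h0" "0 < \<tau>\<^sub>0" "\<forall>\<xi>\<in>\<Lambda>\<^sub>1. 0 \<le> \<tau> \<xi>"
    "0 < \<delta>" "\<delta> \<le> 1" "1 \<le> K" "3 \<le> m" "regularity_condition \<Lambda>\<^sub>1 q p c f m M"
    and 2: "\<forall>h \<xi> x. 0 < h \<and> h \<le> h0 \<and> \<xi> \<in> \<Lambda>\<^sub>1 \<longrightarrow> 0 \<le> q \<xi> x + h * p \<xi> x" "\<forall>x. (\<Sum>\<xi>\<in>\<Lambda>\<^sub>1. q \<xi> x *\<^sub>R \<xi>) = 0"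
    "0 < c0" "\<forall>x. c0 \<le> c x" "first_structural \<Lambda>\<^sub>1 \<l> \<tau>\<^sub>0 \<tau> q p c h0 \<delta> K m" "second_structural \<Lambda>\<^sub>1 \<l> \<tau>\<^sub>0 \<tau> q p c h0 \<delta> K m"
    and l: "l \<le> m" and cond: "condition_i m k l \<or> condition_ii \<Lambda>\<^sub>1 q m k l \<or> condition_iii \<Lambda>\<^sub>1 q p m k l"
    and v: "\<forall>h. 0 < h \<and> h \<le> h0 \<longrightarrow> bounded_solution_h \<Lambda>\<^sub>1 q p c f h (v h)"
    and v0: "v0 \<in> Bspace m" "solution_Lcal \<Lambda>\<^sub>1 q p c f v0" and h: "0 < h" "h \<le> h0"
  interpret rough_scheme \<Lambda>\<^sub>1 \<l> \<tau>\<^sub>0 \<tau> q p c f h0 \<delta> K c0 M m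
    by unfold_locales (use 1 2 in auto)
  have v': "bounded_solution_h \<Lambda>\<^sub>1 q p c f h (v h)" if "0 < h" "h \<le> h0" for h using v that by blast
  have A: "(\<Sum>i\<le>m. \<bar>map M [0..<m + 1] ! i\<bar>) = Mx"
    unfolding Mx_def by (intro sum.cong refl) (simp add: nth_append del: upt_Suc)
  have L: "sqrt (\<Sum>\<xi>\<in>\<Lambda>\<^sub>1. (norm \<xi>)\<^sup>2) = LL" by (simp add: LL_def L2_set_def)
  have NE: "cst_error (real CARD('d)) \<delta> K \<tau>\<^sub>0 c0 (sqrt (\<Sum>\<xi>\<in>\<Lambda>\<^sub>1. (norm \<xi>)\<^sup>2)) (sqrt (\<Sum>\<xi>\<in>\<Lambda>\<^sub>1. (norm (\<tau> \<xi> *\<^sub>R \<xi>))\<^sup>2))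
      (\<Sum>i\<le>m. \<bar>map M [0..<m + 1] ! i\<bar>) m = S.NE"
    unfolding A L S.TT_def[symmetric] S.NE_eq ..
  \<comment> \<open>Each of the three conditions forces this, so the sums in
    \<open>cst_weights m\<close> include the weights for \<open>k\<close>.\<close>
  have km: "k \<le> m" using cond l by (auto simp: condition_i_def condition_ii_def condition_iii_def)
  have le: "X * S.NE * Bnorm m f * h ^ (k + 1) \<le> cst_weights m * S.NE * Bnorm m f * h ^ (k + 1)" if "X \<le> cst_weights m" for X
    using that S.NE_nonneg Bnorm_bound(1)[OF regD(4)] h by (intro mult_right_mono) auto
  show "let B = cst_weights m * cst_error (real CARD('d)) \<delta> K \<tau>\<^sub>0 c0 (sqrt (\<Sum>\<xi>\<in>\<Lambda>\<^sub>1. (norm \<xi>)\<^sup>2))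
           (sqrt (\<Sum>\<xi>\<in>\<Lambda>\<^sub>1. (norm (\<tau> \<xi> *\<^sub>R \<xi>))\<^sup>2)) (\<Sum>i\<le>m. \<bar>map M [0..<m + 1] ! i\<bar>) m * Bnorm m f * h ^ (k + 1)
        in derivs_within l (vbar k v h) v0 B \<and> (condition_iii \<Lambda>\<^sub>1 q p m k l \<longrightarrow> derivs_within l (vtilde k v h) v0 B)"
    unfolding Let_def NE
    using derivs_within_mono[OF conclusion(1)[OF v0 v' h l cond] le[OF cst_weights_ge(1)[OF km]]]
      derivs_within_mono[OF conclusion(2)[OF v0 v' h l cond] le[OF cst_weights_ge(2)[OF km]]] by blast
qed

end
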